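(* For any $\beta > 1$ and $r \in (0, 1/\beta)$, there exists a constant $C = C(\beta, r) \in (0, \infty)$ such that $$\sup_{n \ge 1} \mathbb{E} \left[ 1 - \exp\left\{-q\,\widetilde{V}_n^\beta(Q)\right\}\right] \le C q^{r} \qquad \forall q \in [0,1/2].$$
   Context: Let $d\ge 1$, $\gamma_c := \sqrt{2d}$, $Q := (0,1)^d$. Let $\rho:\mathbb{R}^d\to[0,\infty)$ be a positive definite, rotationally symmetric function with $\rho(0)=1$, $\rho\in C_c^\infty(\mathbb{R}^d)$ and $\mathrm{supp}(\rho)\subset B(0,R/2)$ for some $R>0$. Let $X$ be the associated $\star$-scale invariant field, i.e. the centred Gaussian field on $\mathbb{R}^d$ with covariance $\int_0^\infty \rho(e^u(x-y))\,du$, and let $(X_t)_{t\ge 0}$ be its martingale decomposition: a jointly Gaussian family of centred continuous random fields on $\mathbb{R}^d$ with $\mathbb{E}[X_s(x)X_t(y)] = \int_0^{\min(s,t)}\rho(e^u(x-y))\,du$ (so that $X_t-X_s$ is independent of $\mathcal{F}_s := \sigma(X_u(x): u\le s, x\in\mathbb{R}^d)$ for $s<t$). The critical Gaussian multiplicative chaos $M$ is the random measure $$M(dx) := \lim_{t\to\infty} \sqrt{t}\, e^{\gamma_c X_t(x) - dt}\,dx,$$ where the limit holds in probability with respect to the weak$^*$ topology. For $n\in\mathbb{N}$ put $\mathcal{J}_n := \{0,\dots,n-1\}^d$ and, for $\mathbf{j}\in\mathcal{J}_n$, $Q_{n,\mathbf{j}} := n^{-1}(\mathbf{j}+(0,1)^d)$.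 Write $\ell(n) := \log n$ and $$\widetilde V_n^\beta(Q) := \ell(n)^{\beta/2}\sum_{\mathbf{j}\in\mathcal{J}_n} M(Q_{n,\mathbf{j}})^\beta .$$ *)

theory Defs
  imports "HOL-Probability.Probability"
begin

text \<open>
  The dimension \<open>d \<ge> 1\<close> is \<open>CARD('d)\<close> for a finite index type \<open>'d\<close>.
\<close>

fun Ck :: "nat \<Rightarrow> ('a::euclidean_space \<Rightarrow> real) \<Rightarrow> bool" where
  "Ck 0 f \<longleftrightarrow> continuous_on UNIV f"
| "Ck (Suc k) f \<longleftrightarrow>
     f differentiable_on UNIV \<and> (\<forall>v. Ck k (\<lambda>x. frechet_derivative f (at x) v))"

definition smooth :: "('a::euclidean_space \<Rightarrow> real) \<Rightarrow> bool" where
  "smooth f \<longleftrightarrow> (\<forall>k. Ck k f)"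

definition supp :: "('a::topological_space \<Rightarrow> real) \<Rightarrow> 'a set" where
  "supp f = closure (support_on UNIV f)"

text \<open>
  Real coefficients suffice, since the functions considered are real and even (being
  rotationally symmetric).
\<close>

definition positive_definite_fun :: "('a::ab_group_add \<Rightarrow> real) \<Rightarrow> bool" where
  "positive_definite_fun f \<longleftrightarrow>
     (\<forall>A c. finite A \<longrightarrow> (\<Sum>x\<in>A. \<Sum>y\<in>A. c x * c y * f (x - y)) \<ge> 0)"

text \<open>
  Symmetry under the full orthogonal group, so that \<open>f\<close> is even also for \<open>d = 1\<close>.
\<close>

definition rotationally_symmetric :: "('a::euclidean_space \<Rightarrow> real) \<Rightarrow> bool" where
  "rotationally_symmetric f \<longleftrightarrow> (\<forall>T x. orthogonal_transformation T \<longrightarrow> f (T x) = f x)"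

definition seed_covariance :: "(real ^ 'd \<Rightarrow> real) \<Rightarrow> bool" where
  "seed_covariance \<rho> \<longleftrightarrow>
     (\<forall>x. \<rho> x \<ge> 0) \<and> positive_definite_fun \<rho> \<and> rotationally_symmetric \<rho> \<and> \<rho> 0 = 1 \<and>
     smooth \<rho> \<and> compact (supp \<rho>) \<and> (\<exists>R>0. supp \<rho> \<subseteq> ball 0 (R / 2))"

text \<open>
  The first disjunct is the degenerate Gaussian law of variance zero.
\<close>

definition centred_gaussian_rv :: "'w measure \<Rightarrow> ('w \<Rightarrow> real) \<Rightarrow> bool" where
  "centred_gaussian_rv P Y \<longleftrightarrow> Y \<in> borel_measurable P \<and>
     ((AE \<omega> in P. Y \<omega> = 0) \<or> (\<exists>\<sigma>>0. distributed P lborel Y (normal_density 0 \<sigma>)))"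

definition centred_jointly_gaussian ::
    "'w measure \<Rightarrow> 'i set \<Rightarrow> ('i \<Rightarrow> 'w \<Rightarrow> real) \<Rightarrow> bool" where
  "centred_jointly_gaussian P I Y \<longleftrightarrow>
     (\<forall>A c. finite A \<and> A \<subseteq> I \<longrightarrow> centred_gaussian_rv P (\<lambda>\<omega>. \<Sum>i\<in>A. c i * Y i \<omega>))"

text \<open>
  The martingale decomposition \<open>(X\<^sub>t)\<close>, \<open>t \<ge> 0\<close>, of the star-scale invariant field with
  seed covariance \<open>\<rho>\<close>. Values of \<open>X\<close> at negative times are irrelevant.
\<close>

definition martingale_decomposition ::
    "'w measure \<Rightarrow> (real ^ 'd \<Rightarrow> real) \<Rightarrow> (real \<Rightarrow> real ^ 'd \<Rightarrow> 'w \<Rightarrow> real) \<Rightarrow> bool" where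
  "martingale_decomposition P \<rho> X \<longleftrightarrow>
     centred_jointly_gaussian P ({0..} \<times> UNIV) (\<lambda>(t, x). X t x) \<and>
     (\<forall>t\<ge>0. \<forall>\<omega>\<in>space P. continuous_on UNIV (\<lambda>x. X t x \<omega>)) \<and>
     (\<forall>s\<ge>0. \<forall>t\<ge>0. \<forall>x y.
        prob_space.expectation P (\<lambda>\<omega>. X s x \<omega> * X t y \<omega>) =
        (LINT u:{0..min s t}|lborel. \<rho> (exp u *\<^sub>R (x - y))))"

definition locally_finite_random_measure ::
    "'w measure \<Rightarrow> ('w \<Rightarrow> 'a::topological_space measure) \<Rightarrow> bool" where
  "locally_finite_random_measure P M \<longleftrightarrow>
     (\<forall>\<omega>\<in>space P. sets (M \<omega>) = sets borel \<and> (\<forall>K. compact K \<longrightarrow> emeasure (M \<omega>) K < \<infinity>)) \<and>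
     (\<forall>A\<in>sets borel. (\<lambda>\<omega>. emeasure (M \<omega>) A) \<in> borel_measurable P)"

text \<open>
  Convergence in probability in the weak* topology of the dual of \<open>C\<^sub>c\<close>: the basic
  neighbourhoods of \<open>M \<omega>\<close> are given by finitely many test functions and some \<open>\<epsilon> > 0\<close>.
\<close>

definition tendsto_in_prob_weak_star ::
    "'w measure \<Rightarrow> 't filter \<Rightarrow> ('t \<Rightarrow> 'w \<Rightarrow> 'a::topological_space measure) \<Rightarrow>
     ('w \<Rightarrow> 'a measure) \<Rightarrow> bool" where
  "tendsto_in_prob_weak_star P F N M \<longleftrightarrow>
     (\<forall>\<Phi> \<epsilon>. finite \<Phi> \<and> (\<forall>f\<in>\<Phi>. continuous_on UNIV f \<and> compact (supp f)) \<and> \<epsilon> > 0 \<longrightarrow>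
        ((\<lambda>t. measure P {\<omega>\<in>space P. \<exists>f\<in>\<Phi>.
            \<bar>(LINT x|N t \<omega>. f x) - (LINT x|M \<omega>. f x)\<bar> \<ge> \<epsilon>}) \<longlongrightarrow> 0) F)"

definition critical_gamma :: "'d::finite itself \<Rightarrow> real" where
  "critical_gamma _ = sqrt (2 * real CARD('d))"

definition critical_approx ::
    "(real \<Rightarrow> real ^ 'd \<Rightarrow> 'w \<Rightarrow> real) \<Rightarrow> real \<Rightarrow> 'w \<Rightarrow> (real ^ 'd) measure" where
  "critical_approx X t \<omega> =
     density lborel (\<lambda>x. ennreal
       (sqrt t * exp (critical_gamma TYPE('d) * X t x \<omega> - real CARD('d) * t)))"

definition critical_gmc ::
    "'w measure \<Rightarrow> (real \<Rightarrow> real ^ 'd \<Rightarrow> 'w \<Rightarrow> real) \<Rightarrow> ('w \<Rightarrow> (real ^ 'd) measure) \<Rightarrow> bool" where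
  "critical_gmc P X M \<longleftrightarrow>
     locally_finite_random_measure P M \<and>
     tendsto_in_prob_weak_star P at_top (critical_approx X) M"

definition grid_index :: "nat \<Rightarrow> (nat ^ 'd) set" where
  "grid_index n = {j. \<forall>i. j $ i < n}"

definition grid_cube :: "nat \<Rightarrow> nat ^ 'd \<Rightarrow> (real ^ 'd) set" where
  "grid_cube n j = (\<lambda>y. (1 / real n) *\<^sub>R ((\<chi> i. real (j $ i)) + y)) ` box 0 1"

text \<open>
  For \<open>n = 1\<close> the prefactor is \<open>0 powr (\<beta> / 2) = 0\<close>.
\<close>

definition V_tilde :: "real \<Rightarrow> (real ^ 'd) measure \<Rightarrow> nat \<Rightarrow> real" where
  "V_tilde \<beta> m n =
     ln (real n) powr (\<beta> / 2) * (\<Sum>j\<in>grid_index n. measure m (grid_cube n j) powr \<beta>)"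

end

theory Submission
  imports Defs
begin

text \<open>
  By a Gronwall argument along Kahane's interpolation, the expectation of \<open>1 - exp (- E)\<close>, where \<open>E\<close> is a
  sum of \<open>\<beta>\<close>-th powers of exponential sums over blocks, increases at most by a constant factor when
  the covariance moves by a bounded amount within the blocks and falls by at most a bounded amount
  across them. This is so although the functional is not concave: the second
  derivatives of the wrong sign are dominated by the functional itself. Hence the field can be replaced by
  a Gaussian branching random walk on the dyadic tree. For the latter, the union over the children and a
  change of measure turn the recursion for the expectation into a centred Gaussian walk killed on the
  negative half-line, whose survival probability over \<open>k\<close> steps is of order \<open>1 / sqrt k\<close>; this
  compensates the normalisation \<open>sqrt t\<close>. Used once inside the cubes of side \<open>1 / n\<close> and once across them, it
  gives the bound \<open>exp (- L) * C * (1 + L)\<close> with \<open>exp (- L) = 2 * q powr (1 / \<beta>)\<close>, uniformly in the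
  cutoff, and any exponent \<open>r < 1 / \<beta>\<close> absorbs the factor \<open>1 + L\<close>.
\<close>

subsection \<open>Weighted characteristic functions\<close>

text \<open>Neighbouring points on two sides of a dyadic boundary share few ancestors, so the tree
  may see far less correlation than the field, and across blocks only one inequality between the
  covariances is available. It is the favourable one: mixed second derivatives of
  \<open>1 - exp (- G)\<close> across blocks are negative. Inside a block the power
  \<open>\<beta> > 1\<close> produces positive second derivatives, so there the covariances must
  agree up to a constant in both directions, which a tree cannot achieve. Hence the comparison field
  of the second step is a tree only down to the scale of the cubes and has an independent copy of
  the field itself in every cube; exact scale invariance makes the fine parts of the covariances
  equal. The leaves of this tree carry the mass of the unit cube, which is why that mass is
  estimated first, with one-point blocks and exponent 1. For it the bound
  \<open>exp (- L) * C * (1 + L)\<close> controls no mean, only a mean truncated at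
  \<open>exp L\<close>, of order \<open>1 + L\<close>. The killed walk is therefore set up to ask of
  a leaf function \<open>H\<close> no more than an integral of \<open>exp y * H y\<close> up to
  \<open>L\<close> that is linear in \<open>L\<close>.\<close>

lemma weighted_char_unique:
  fixes U W :: "'a \<Rightarrow> real" and U' W' :: "'b \<Rightarrow> real"
  assumes M: "prob_space M" and N: "prob_space N"
    and [measurable]: "U \<in> borel_measurable M" "W \<in> borel_measurable M"
      "U' \<in> borel_measurable N" "W' \<in> borel_measurable N"
    and W: "\<And>\<omega>. 0 \<le> W \<omega>" "\<And>\<omega>. W \<omega> \<le> B" and W': "\<And>\<omega>. 0 \<le> W' \<omega>" "\<And>\<omega>. W' \<omega> \<le> B"
    and eq: "\<And>u. (CLINT \<omega>|M. W \<omega> * iexp (u * U \<omega>)) = (CLINT \<omega>|N. W' \<omega> * iexp (u * U' \<omega>))"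
    and A: "A \<in> sets borel"
  shows "(LINT \<omega>|M. W \<omega> * indicator A (U \<omega>)) = (LINT \<omega>|N. W' \<omega> * indicator A (U' \<omega>))"
proof -
  interpret M: prob_space M by fact
  interpret N: prob_space N by fact
  note [measurable] = A
  have B: "0 \<le> B" using order_trans[OF W(1) W(2)] .
  have iW: "integrable M W" by (rule M.integrable_const_bound[of _ B]) (use W in auto)
  have iW': "integrable N W'" by (rule N.integrable_const_bound[of _ B]) (use W' in auto)
  define e where "e = (LINT \<omega>|M. W \<omega>)"
  have "complex_of_real e = complex_of_real (LINT \<omega>|N. W' \<omega>)"
    using eq[of 0] by (simp add: e_def)
  then have e': "e = (LINT \<omega>|N. W' \<omega>)" by simp
  have e0: "0 \<le> e" unfolding e_def by (rule integral_nonneg_AE) (use W in auto)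
  show ?thesis
  \<comment> \<open>A total weight of zero cannot be normalised; both sides are then squeezed
    between 0 and \<open>e\<close>.\<close>
  proof (cases "e = 0")
    case True
    have "(LINT \<omega>|M. W \<omega> * indicator A (U \<omega>)) \<le> (LINT \<omega>|M. W \<omega>)"
      by (rule integral_mono_AE[OF _ iW])
         (auto intro!: M.integrable_const_bound[of _ B] simp: W B indicator_def split: if_splits)
    moreover have "0 \<le> (LINT \<omega>|M. W \<omega> * indicator A (U \<omega>))"
      by (rule integral_nonneg_AE) (use W in auto)
    moreover have "(LINT \<omega>|N. W' \<omega> * indicator A (U' \<omega>)) \<le> (LINT \<omega>|N. W' \<omega>)"
      by (rule integral_mono_AE[OF _ iW'])
         (auto intro!: N.integrable_const_bound[of _ B] simp: W' B indicator_def split: if_splits)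
    moreover have "0 \<le> (LINT \<omega>|N. W' \<omega> * indicator A (U' \<omega>))"
      by (rule integral_nonneg_AE) (use W' in auto)
    ultimately show ?thesis using True e' by (simp add: e_def)
  next
    case False
    then have e: "0 < e" using e0 by simp
    \<comment> \<open>Stated for an arbitrary probability space, since it is applied to
      \<open>M\<close> and to \<open>N\<close>, whose types differ. Dividing the weight by
      \<open>e\<close> gives a probability measure whose characteristic function is the weighted one
      divided by \<open>e\<close>, so that Levy uniqueness on the line applies.\<close>
    have law: "real_distribution (distr (density K (\<lambda>\<omega>. ennreal (V \<omega> / e))) borel Y) \<and>
       char (distr (density K (\<lambda>\<omega>. ennreal (V \<omega> / e))) borel Y) u = (CLINT \<omega>|K. V \<omega> * iexp (u * Y \<omega>)) / e \<and>
       measure (distr (density K (\<lambda>\<omega>. ennreal (V \<omega> / e))) borel Y) A = (LINT \<omega>|K. V \<omega> * indicator A (Y \<omega>)) / e"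
      if K: "prob_space K" and [measurable]: "Y \<in> borel_measurable K" "V \<in> borel_measurable K"
        and V: "\<And>\<omega>. 0 \<le> V \<omega>" and iV: "integrable K V" and eV: "e = (LINT \<omega>|K. V \<omega>)"
      for K :: "'c measure" and V Y u
    proof -
      interpret K: prob_space K by fact
      let ?D = "density K (\<lambda>\<omega>. ennreal (V \<omega> / e))"
      have "emeasure ?D (space ?D) = (\<integral>\<^sup>+\<omega>. ennreal (V \<omega> / e) \<partial>K)"
        by (simp add: emeasure_density cong: nn_integral_cong)
      also have "\<dots> = ennreal (LINT \<omega>|K. V \<omega> / e)"
        by (rule nn_integral_eq_integral) (use iV V e in auto)
      also have "\<dots> = 1" using e eV by simp
      finally have D: "prob_space ?D" by (rule prob_spaceI)
      interpret D: prob_space ?D by fact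
      have 1: "real_distribution (distr ?D borel Y)"
        by (rule D.real_distribution_distr) simp
      have 2: "char (distr ?D borel Y) u = (CLINT \<omega>|K. V \<omega> * iexp (u * Y \<omega>)) / e"
      proof -
        have "char (distr ?D borel Y) u = (CLINT \<omega>|?D. iexp (u * Y \<omega>))"
          unfolding char_def by (subst integral_distr) auto
        also have "\<dots> = (CLINT \<omega>|K. (V \<omega> / e) *\<^sub>R iexp (u * Y \<omega>))"
          by (rule integral_density) (use V e in auto)
        also have "\<dots> = (CLINT \<omega>|K. (V \<omega> * iexp (u * Y \<omega>)) / e)"
          by (intro Bochner_Integration.integral_cong) (auto simp: scaleR_conv_of_real)
        finally show ?thesis by simp
      qed
      have 3: "measure (distr ?D borel Y) A = (LINT \<omega>|K. V \<omega> * indicator A (Y \<omega>)) / e"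
      proof -
        have "measure (distr ?D borel Y) A = (LINT x|distr ?D borel Y. indicator A x)"
          by simp
        also have "\<dots> = (LINT \<omega>|?D. indicator A (Y \<omega>))"
          by (subst integral_distr) auto
        also have "\<dots> = (LINT \<omega>|K. (V \<omega> / e) *\<^sub>R indicator A (Y \<omega>))"
          by (rule integral_density) (use V e in auto)
        finally show ?thesis by simp
      qed
      from 1 2 3 show ?thesis by blast
    qed
    note a = law[OF M assms(3,4) W(1) iW e_def] and b = law[OF N assms(5,6) W'(1) iW' e']
    have "distr (density M (\<lambda>\<omega>. ennreal (W \<omega> / e))) borel U
        = distr (density N (\<lambda>\<omega>. ennreal (W' \<omega> / e))) borel U'"
      by (rule Levy_uniqueness) (use a b eq in auto)
    then have "(LINT \<omega>|M. W \<omega> * indicator A (U \<omega>)) / e = (LINT \<omega>|N. W' \<omega> * indicator A (U' \<omega>)) / e"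
      by (simp only: a[of 0, THEN conjunct2, THEN conjunct2, symmetric] b[of 0, THEN conjunct2, THEN conjunct2, symmetric])
    then show ?thesis using e by simp
  qed
qed

text \<open>Reduction to one dimension: coordinate after coordinate, the exponential is exchanged
  for the indicator of a Borel set. In each exchange, the coordinates already treated and those
  still to come together form the weight of \<open>weighted_char_unique\<close>.\<close>

lemma joint_char_unique:
  fixes Z :: "'i \<Rightarrow> 'a \<Rightarrow> real" and Z' :: "'i \<Rightarrow> 'b \<Rightarrow> real"
  assumes M: "prob_space M" and N: "prob_space N" and I: "finite I"
    and mZ: "\<And>i. i \<in> I \<Longrightarrow> Z i \<in> borel_measurable M"
    and mZ': "\<And>i. i \<in> I \<Longrightarrow> Z' i \<in> borel_measurable N"
    and eq: "\<And>c. (CLINT \<omega>|M. iexp (\<Sum>i\<in>I. c i * Z i \<omega>)) = (CLINT \<omega>|N. iexp (\<Sum>i\<in>I. c i * Z' i \<omega>))"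
  shows "distr M (PiM I (\<lambda>_. borel)) (\<lambda>\<omega>. \<lambda>i\<in>I. Z i \<omega>) = distr N (PiM I (\<lambda>_. borel)) (\<lambda>\<omega>. \<lambda>i\<in>I. Z' i \<omega>)"
proof -
  interpret M: prob_space M by fact
  interpret N: prob_space N by fact
  have *: "\<And>c. (CLINT \<omega>|M. (\<Prod>i\<in>K. indicator (A i) (Z i \<omega>)) * iexp (\<Sum>i\<in>I-K. c i * Z i \<omega>))
       = (CLINT \<omega>|N. (\<Prod>i\<in>K. indicator (A i) (Z' i \<omega>)) * iexp (\<Sum>i\<in>I-K. c i * Z' i \<omega>))"
    if "finite K" "K \<subseteq> I" and A: "\<And>i. A i \<in> sets borel" for K and A :: "'i \<Rightarrow> real set"
    using that(1,2)
  proof (induction K)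
    case empty
    then show ?case using eq by simp
  next
    case (insert k K)
    have k: "k \<in> I" "k \<notin> K" "finite (I - insert k K)" using insert I by auto
    have IK: "I - K = insert k (I - insert k K)" "k \<notin> I - insert k K" using k by auto
    \<comment> \<open>The coefficient of \<open>k\<close> is singled out as \<open>u\<close>; the
      scale \<open>s\<close> of the remaining coefficients will take the values 0, 1 and -1.\<close>
    have IH: "(CLINT \<omega>|M. (\<Prod>i\<in>K. indicator (A i) (Z i \<omega>)) * iexp (u * Z k \<omega> + s * (\<Sum>i\<in>I-insert k K. c i * Z i \<omega>)))
       = (CLINT \<omega>|N. (\<Prod>i\<in>K. indicator (A i) (Z' i \<omega>)) * iexp (u * Z' k \<omega> + s * (\<Sum>i\<in>I-insert k K. c i * Z' i \<omega>)))" for u s c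
    proof -
      have e: "(\<Sum>i\<in>I-K. (if i = k then u else s * c i) * Y i \<omega>) = u * Y k \<omega> + s * (\<Sum>i\<in>I-insert k K. c i * Y i \<omega>)"
        for Y :: "'i \<Rightarrow> 'c \<Rightarrow> real" and \<omega>
        unfolding IK(1) using IK(2) k(3) by (auto simp: sum_distrib_left mult.assoc intro!: sum.cong)
      have "K \<subseteq> I" using insert.prems by simp
      from insert.IH[OF this, of "\<lambda>i. if i = k then u else s * c i"] show ?thesis by (simp only: e)
    qed
    fix c
    define SM where "SM = (\<lambda>\<omega>. \<Sum>i\<in>I-insert k K. c i * Z i \<omega>)"
    define SN where "SN = (\<lambda>\<omega>. \<Sum>i\<in>I-insert k K. c i * Z' i \<omega>)"
    define PM where "PM = (\<lambda>\<omega>. \<Prod>i\<in>K. indicator (A i) (Z i \<omega>) :: real)"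
    define PN where "PN = (\<lambda>\<omega>. \<Prod>i\<in>K. indicator (A i) (Z' i \<omega>) :: real)"
    have PM: "0 \<le> PM \<omega>" "PM \<omega> \<le> 1" for \<omega>
      unfolding PM_def by (auto intro!: prod_nonneg prod_le_1 simp: indicator_def)
    have PN: "0 \<le> PN \<omega>" "PN \<omega> \<le> 1" for \<omega>
      unfolding PN_def by (auto intro!: prod_nonneg prod_le_1 simp: indicator_def)
    have [measurable]: "SM \<in> borel_measurable M" "Z k \<in> borel_measurable M" "A k \<in> sets borel"
      "SN \<in> borel_measurable N" "Z' k \<in> borel_measurable N"
      unfolding SM_def SN_def using mZ mZ' k A by (auto intro!: borel_measurable_sum borel_measurable_times)
    have [measurable]: "PM \<in> borel_measurable M" "PN \<in> borel_measurable N"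
      unfolding PM_def PN_def
      by (auto intro!: borel_measurable_prod measurable_compose[OF mZ borel_measurable_indicator] measurable_compose[OF mZ' borel_measurable_indicator] A subsetD[OF insert.prems])
    have IH1: "(CLINT \<omega>|M. PM \<omega> * iexp (u * Z k \<omega> + s * SM \<omega>)) = (CLINT \<omega>|N. PN \<omega> * iexp (u * Z' k \<omega> + s * SN \<omega>))" for u s
      using IH[of u s c] unfolding PM_def PN_def SM_def SN_def by (simp add: of_real_prod of_real_indicator)
    have intM: "integrable M (\<lambda>\<omega>. PM \<omega> * iexp (u * Z k \<omega> + s * SM \<omega>))" for u s
      by (rule M.integrable_const_bound[of _ 1]) (use PM in \<open>auto simp: norm_mult\<close>)
    have intN: "integrable N (\<lambda>\<omega>. PN \<omega> * iexp (u * Z' k \<omega> + s * SN \<omega>))" for u s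
      by (rule N.integrable_const_bound[of _ 1]) (use PN in \<open>auto simp: norm_mult\<close>)
    \<comment> \<open>A weight has to be real and non-negative, which the exponential of the
      remaining coordinates is not. Its real and imaginary parts are therefore hidden in
      \<open>2 + a * cos y + b * sin y\<close>, which lies between 0 and 4 if \<open>a\<close> and
      \<open>b\<close> have modulus at most 1. Expanded into exponentials, this is covered by the
      induction hypothesis with \<open>s\<close> equal to 0, 1 and -1.\<close>
    have trig: "complex_of_real (p * (2 + a * cos y + b * sin y)) * iexp x
       = 2 * (p * iexp (x + 0 * y)) + (a - \<i> * b) / 2 * (p * iexp (x + 1 * y)) + (a + \<i> * b) / 2 * (p * iexp (x + (-1) * y))"
      for p a b x y :: real
    proof -
      have c: "iexp z = complex_of_real (cos z) + \<i> * complex_of_real (sin z)" for z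
        by (simp only: cis_conv_exp[symmetric] cis.code Complex_eq)
      have 1: "iexp (x + z) = iexp x * (complex_of_real (cos z) + \<i> * complex_of_real (sin z))" for z
        by (simp only: c[of z, symmetric] of_real_add distrib_left exp_add)
      have alg: "p * (2 + a * C + b * S) * e = 2 * (p * (e * (1 + i * 0))) + (a - i * b) / 2 * (p * (e * (C + i * S))) + (a + i * b) / 2 * (p * (e * (C + i * (- S))))"
        if "i * i = -1" for p a b C S e i :: complex
      proof -
        have "(a - i * b) * (C + i * S) + (a + i * b) * (C + i * (- S)) = 2 * a * C - 2 * (i * i) * b * S"
          by (simp add: algebra_simps)
        then have *: "(a - i * b) * (C + i * S) + (a + i * b) * (C + i * (- S)) = 2 * (a * C + b * S)" using that by (simp add: algebra_simps)
        have "2 * (p * (e * (1 + i * 0))) + (a - i * b) / 2 * (p * (e * (C + i * S))) + (a + i * b) / 2 * (p * (e * (C + i * (- S))))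
          = p * e * (2 + ((a - i * b) * (C + i * S) + (a + i * b) * (C + i * (- S))) / 2)"
          by (simp add: algebra_simps add_divide_distrib diff_divide_distrib)
        also have "\<dots> = p * (2 + a * C + b * S) * e" unfolding * by (simp add: algebra_simps)
        finally show ?thesis by simp
      qed
      show ?thesis
        unfolding 1[of "0 * y"] 1[of "1 * y"] 1[of "-1 * y"]
        using alg[of \<i> "complex_of_real p" "complex_of_real a" "complex_of_real (cos y)" "complex_of_real b" "complex_of_real (sin y)" "iexp x"]
        by simp
    qed
    have W: "(LINT \<omega>|M. PM \<omega> * (2 + a * cos (SM \<omega>) + b * sin (SM \<omega>)) * indicator (A k) (Z k \<omega>))
        = (LINT \<omega>|N. PN \<omega> * (2 + a * cos (SN \<omega>) + b * sin (SN \<omega>)) * indicator (A k) (Z' k \<omega>))"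
      if ab: "\<bar>a\<bar> \<le> 1" "\<bar>b\<bar> \<le> 1" for a b :: real
    proof (rule weighted_char_unique[OF M N, of _ _ _ _ 4])
      have l: "\<bar>a * cos x\<bar> \<le> 1" "\<bar>b * sin x\<bar> \<le> 1" for x
        using mult_mono[OF ab(1) abs_cos_le_one[of x]] mult_mono[OF ab(2) abs_sin_le_one[of x]] by (auto simp: abs_mult)
      have l: "0 \<le> 2 + a * cos x + b * sin x" "2 + a * cos x + b * sin x \<le> 4" for x
        using l[of x] by linarith+
      show "0 \<le> PM \<omega> * (2 + a * cos (SM \<omega>) + b * sin (SM \<omega>))" for \<omega> using PM l by simp
      show "0 \<le> PN \<omega> * (2 + a * cos (SN \<omega>) + b * sin (SN \<omega>))" for \<omega> using PN l by simp
      show "PM \<omega> * (2 + a * cos (SM \<omega>) + b * sin (SM \<omega>)) \<le> 4" for \<omega>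
        using mult_mono[OF PM(2) l(2) _ l(1)] by simp
      show "PN \<omega> * (2 + a * cos (SN \<omega>) + b * sin (SN \<omega>)) \<le> 4" for \<omega>
        using mult_mono[OF PN(2) l(2) _ l(1)] by simp
      show "(CLINT \<omega>|M. complex_of_real (PM \<omega> * (2 + a * cos (SM \<omega>) + b * sin (SM \<omega>))) * iexp (u * Z k \<omega>))
         = (CLINT \<omega>|N. complex_of_real (PN \<omega> * (2 + a * cos (SN \<omega>) + b * sin (SN \<omega>))) * iexp (u * Z' k \<omega>))" for u
        unfolding trig
        apply (subst Bochner_Integration.integral_add, intro Bochner_Integration.integrable_add integrable_mult_right intM, intro integrable_mult_right intM)
        apply (subst Bochner_Integration.integral_add, intro integrable_mult_right intM, intro integrable_mult_right intM)
        apply (subst Bochner_Integration.integral_add, intro Bochner_Integration.integrable_add integrable_mult_right intN, intro integrable_mult_right intN)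
        apply (subst Bochner_Integration.integral_add, intro integrable_mult_right intN, intro integrable_mult_right intN)
        apply (simp only: integral_mult_right_zero IH1)
        done
    qed (auto simp: A)
    define qM where "qM = (\<lambda>\<omega>. PM \<omega> * indicator (A k) (Z k \<omega>))"
    define qN where "qN = (\<lambda>\<omega>. PN \<omega> * indicator (A k) (Z' k \<omega>))"
    have [measurable]: "qM \<in> borel_measurable M" "qN \<in> borel_measurable N"
      unfolding qM_def qN_def by measurable
    have q: "\<bar>qM \<omega>\<bar> \<le> 1" "\<bar>qN \<omega>'\<bar> \<le> 1" for \<omega> \<omega>'
      using PM PN by (auto simp: qM_def qN_def indicator_def)
    have iM: "integrable M (\<lambda>\<omega>. qM \<omega> * h (SM \<omega>))" if [measurable]: "h \<in> borel_measurable borel" and "\<And>x. \<bar>h x\<bar> \<le> 1" for h :: "real \<Rightarrow> real"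
      by (rule M.integrable_const_bound[of _ 1]) (use q that mult_mono[OF q(1) that(2)] in \<open>auto simp: abs_mult\<close>)
    have iN: "integrable N (\<lambda>\<omega>. qN \<omega> * h (SN \<omega>))" if [measurable]: "h \<in> borel_measurable borel" and "\<And>x. \<bar>h x\<bar> \<le> 1" for h :: "real \<Rightarrow> real"
      by (rule N.integrable_const_bound[of _ 1]) (use q that mult_mono[OF q(2) that(2)] in \<open>auto simp: abs_mult\<close>)
    have W2: "2 * (LINT \<omega>|M. qM \<omega>) + a * (LINT \<omega>|M. qM \<omega> * cos (SM \<omega>)) + b * (LINT \<omega>|M. qM \<omega> * sin (SM \<omega>))
       = 2 * (LINT \<omega>|N. qN \<omega>) + a * (LINT \<omega>|N. qN \<omega> * cos (SN \<omega>)) + b * (LINT \<omega>|N. qN \<omega> * sin (SN \<omega>))"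
      if ab: "\<bar>a\<bar> \<le> 1" "\<bar>b\<bar> \<le> 1" for a b :: real
    proof -
      have m: "(LINT \<omega>|M. PM \<omega> * (2 + a * cos (SM \<omega>) + b * sin (SM \<omega>)) * indicator (A k) (Z k \<omega>))
         = (LINT \<omega>|M. 2 * (qM \<omega> * 1) + a * (qM \<omega> * cos (SM \<omega>)) + b * (qM \<omega> * sin (SM \<omega>)))"
        by (intro Bochner_Integration.integral_cong) (auto simp: qM_def algebra_simps)
      have n: "(LINT \<omega>|N. PN \<omega> * (2 + a * cos (SN \<omega>) + b * sin (SN \<omega>)) * indicator (A k) (Z' k \<omega>))
         = (LINT \<omega>|N. 2 * (qN \<omega> * 1) + a * (qN \<omega> * cos (SN \<omega>)) + b * (qN \<omega> * sin (SN \<omega>)))"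
        by (intro Bochner_Integration.integral_cong) (auto simp: qN_def algebra_simps)
      show ?thesis using W[OF ab] unfolding m n
        using iM[of "\<lambda>_. 1"] iM[of cos] iM[of sin] iN[of "\<lambda>_. 1"] iN[of cos] iN[of sin]
        by simp
    qed
    \<comment> \<open>The choice \<open>a = b = 0\<close> yields the constant part; subtracting it
      leaves the cosine part here and the sine part below.\<close>
    have c0: "(LINT \<omega>|M. qM \<omega> * cos (SM \<omega>)) = (LINT \<omega>|N. qN \<omega> * cos (SN \<omega>))"
      using W2[of 0 0] W2[of 1 0] by simp
    have s0: "(LINT \<omega>|M. qM \<omega> * sin (SM \<omega>)) = (LINT \<omega>|N. qN \<omega> * sin (SN \<omega>))"
      using W2[of 0 0] W2[of 0 1] by simp
    have fin: "(CLINT \<omega>|K. q \<omega> * iexp (S \<omega>)) = (LINT \<omega>|K. q \<omega> * cos (S \<omega>)) + \<i> * (LINT \<omega>|K. q \<omega> * sin (S \<omega>))"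
      if "integrable K (\<lambda>\<omega>. q \<omega> * cos (S \<omega>))" "integrable K (\<lambda>\<omega>. q \<omega> * sin (S \<omega>))" for K :: "'c measure" and q S :: "'c \<Rightarrow> real"
    proof -
      have "(CLINT \<omega>|K. q \<omega> * iexp (S \<omega>)) = (CLINT \<omega>|K. complex_of_real (q \<omega> * cos (S \<omega>)) + \<i> * complex_of_real (q \<omega> * sin (S \<omega>)))"
        by (intro Bochner_Integration.integral_cong refl) (simp add: complex_eq_iff Re_exp Im_exp)
      also have "\<dots> = (CLINT \<omega>|K. complex_of_real (q \<omega> * cos (S \<omega>))) + (CLINT \<omega>|K. \<i> * complex_of_real (q \<omega> * sin (S \<omega>)))"
        by (rule Bochner_Integration.integral_add) (use that in \<open>auto intro!: integrable_of_real simp del: of_real_mult\<close>)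
      finally show ?thesis by (simp del: of_real_mult)
    qed
    have "(CLINT \<omega>|M. qM \<omega> * iexp (SM \<omega>)) = (CLINT \<omega>|N. qN \<omega> * iexp (SN \<omega>))"
      using fin[of M qM SM] fin[of N qN SN] iM[of cos] iM[of sin] iN[of cos] iN[of sin] c0 s0 by simp
    then show "(CLINT \<omega>|M. (\<Prod>i\<in>insert k K. indicator (A i) (Z i \<omega>)) * iexp (\<Sum>i\<in>I-insert k K. c i * Z i \<omega>))
       = (CLINT \<omega>|N. (\<Prod>i\<in>insert k K. indicator (A i) (Z' i \<omega>)) * iexp (\<Sum>i\<in>I-insert k K. c i * Z' i \<omega>))"
      using k insert.hyps by (simp add: qM_def qN_def PM_def PN_def SM_def SN_def of_real_prod of_real_indicator mult.commute mult.left_commute)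
  qed
  have mM [measurable]: "(\<lambda>\<omega>. \<lambda>i\<in>I. Z i \<omega>) \<in> measurable M (PiM I (\<lambda>_. borel))"
    by (intro measurable_restrict mZ)
  have mN [measurable]: "(\<lambda>\<omega>. \<lambda>i\<in>I. Z' i \<omega>) \<in> measurable N (PiM I (\<lambda>_. borel))"
    by (intro measurable_restrict mZ')
  have cyl: "emeasure (distr K (PiM I (\<lambda>_. borel)) (\<lambda>\<omega>. \<lambda>i\<in>I. Y i \<omega>)) (Pi\<^sub>E I A)
       = ennreal (Re (CLINT \<omega>|K. (\<Prod>i\<in>I. indicator (A i) (Y i \<omega>))))"
    if K: "prob_space K" and Y: "\<And>i. i \<in> I \<Longrightarrow> Y i \<in> borel_measurable K" and A: "\<And>i. i \<in> I \<Longrightarrow> A i \<in> sets borel"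
    for K :: "'c measure" and Y :: "'i \<Rightarrow> 'c \<Rightarrow> real" and A :: "'i \<Rightarrow> real set"
  proof -
    interpret K: prob_space K by fact
    have [measurable]: "(\<lambda>\<omega>. \<lambda>i\<in>I. Y i \<omega>) \<in> measurable K (PiM I (\<lambda>_. borel))"
      by (intro measurable_restrict Y)
    have [measurable]: "Pi\<^sub>E I A \<in> sets (PiM I (\<lambda>_. borel))" by (intro sets_PiM_I_finite I A)
    have p: "complex_of_real (indicat_real (Pi\<^sub>E I A) (\<lambda>i\<in>I. Y i \<omega>)) = (\<Prod>i\<in>I. indicator (A i) (Y i \<omega>))" for \<omega>
    proof (cases "\<forall>i\<in>I. Y i \<omega> \<in> A i")
      case False
      then have "(\<Prod>i\<in>I. indicator (A i) (Y i \<omega>)) = (0::complex)"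
        by (intro prod_zero I) (auto simp: indicator_def)
      then show ?thesis using False by (auto simp: indicator_def restrict_PiE_iff)
    qed (simp add: restrict_PiE_iff)
    have "(CLINT \<omega>|K. (\<Prod>i\<in>I. indicator (A i) (Y i \<omega>))) = complex_of_real (LINT \<omega>|K. indicat_real (Pi\<^sub>E I A) (\<lambda>i\<in>I. Y i \<omega>))"
      unfolding p[symmetric] by simp
    also have "(LINT \<omega>|K. indicat_real (Pi\<^sub>E I A) (\<lambda>i\<in>I. Y i \<omega>)) = (LINT x|distr K (PiM I (\<lambda>_. borel)) (\<lambda>\<omega>. \<lambda>i\<in>I. Y i \<omega>). indicat_real (Pi\<^sub>E I A) x)"
      by (rule integral_distr[symmetric]) measurable
    also have "\<dots> = measure (distr K (PiM I (\<lambda>_. borel)) (\<lambda>\<omega>. \<lambda>i\<in>I. Y i \<omega>)) (Pi\<^sub>E I A)"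
      by (simp add: sets.Int_space_eq1)
    finally show ?thesis
      using K.prob_space_distr[of "\<lambda>\<omega>. \<lambda>i\<in>I. Y i \<omega>" "PiM I (\<lambda>_. borel)"]
      by (simp add: finite_measure.emeasure_eq_measure prob_space_def)
  qed
  show ?thesis
  proof (rule measure_eqI_PiM_finite[OF I, where A = "\<lambda>_. Pi\<^sub>E I (\<lambda>_. UNIV)"])
    fix A assume "\<And>i. i \<in> I \<Longrightarrow> A i \<in> sets (borel :: real measure)"
    then show "emeasure (distr M (PiM I (\<lambda>_. borel)) (\<lambda>\<omega>. \<lambda>i\<in>I. Z i \<omega>)) (Pi\<^sub>E I A)
        = emeasure (distr N (PiM I (\<lambda>_. borel)) (\<lambda>\<omega>. \<lambda>i\<in>I. Z' i \<omega>)) (Pi\<^sub>E I A)"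
      \<comment> \<open>For \<open>K = I\<close> all coordinates have been exchanged and the empty
        exponential equals 1. Outside \<open>I\<close> the sets are filled up with
        \<open>UNIV\<close>, because \<open>*\<close> asks for a Borel set at every index.\<close>
      using *[OF I order_refl, of "\<lambda>i. if i \<in> I then A i else UNIV" "\<lambda>_. 0"]
      by (simp add: cyl[OF M mZ] cyl[OF N mZ'] cong: prod.cong)
  next
    show "emeasure (distr M (PiM I (\<lambda>_. borel)) (\<lambda>\<omega>. \<lambda>i\<in>I. Z i \<omega>)) (Pi\<^sub>E I (\<lambda>_. UNIV)) \<noteq> \<infinity>"
      using M.prob_space_distr[OF mM] by (simp add: finite_measure.emeasure_eq_measure prob_space_def)
  qed (auto simp: space_PiM intro!: prod_algebraI_finite I)
qed

subsection \<open>Gaussian integration by parts\<close>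

abbreviation "stdN \<equiv> std_normal_distribution"

lemma prob_space_stdN: "prob_space stdN"
  using real_dist_normal_dist by (simp add: real_distribution_def)

lemma sets_stdN [measurable_cong, simp]: "sets stdN = sets borel" by simp

lemma space_stdN [simp]: "space stdN = UNIV" by simp

lemma iexp_stdN: "(CLINT x|stdN. iexp (u * x)) = complex_of_real (exp (- (u\<^sup>2) / 2))"
  using char_std_normal_distribution by (simp add: char_def fun_eq_iff)

lemma integral_stdN: "f \<in> borel_measurable borel \<Longrightarrow> (LINT x|stdN. f x) = (LINT x|lborel. std_normal_density x * f x)"
  for f :: "real \<Rightarrow> real"
  by (subst integral_density) auto

lemma integrable_stdN: "f \<in> borel_measurable borel \<Longrightarrow> integrable stdN f \<longleftrightarrow> integrable lborel (\<lambda>x. std_normal_density x * f x)"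
  for f :: "real \<Rightarrow> real"
  by (subst integrable_density) auto

lemma integrable_stdN_abs: "integrable stdN (\<lambda>x. \<bar>x\<bar>)"
  using integrable_std_normal_moment_abs[of 1] by (simp add: integrable_stdN)

text \<open>The function \<open>std_normal_density x * h x\<close> vanishes at both ends of the
  line, and its derivative is the density times \<open>h' x - x * h x\<close>.\<close>

lemma stdN_ibp:
  fixes h h' :: "real \<Rightarrow> real"
  assumes d: "\<And>x. (h has_real_derivative h' x) (at x)" and c: "continuous_on UNIV h'"
    and B: "\<And>x. \<bar>h x\<bar> \<le> B" "\<And>x. \<bar>h' x\<bar> \<le> B"
  shows "(LINT x|stdN. x * h x) = (LINT x|stdN. h' x)"
proof -
  interpret prob_space stdN by (rule prob_space_stdN)
  have ch: "continuous_on UNIV h" using d by (meson DERIV_continuous_on has_field_derivative_at_within)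
  have [measurable]: "h \<in> borel_measurable borel" "h' \<in> borel_measurable borel"
    using ch c by (auto intro: borel_measurable_continuous_onI)
  have i1: "integrable stdN (\<lambda>x. x * h x)"
    by (rule Bochner_Integration.integrable_bound[OF integrable_mult_right[OF integrable_stdN_abs, of B]])
       (auto intro!: AE_I2 simp: abs_mult mult.commute[of "\<bar>B\<bar>"] intro!: mult_left_mono order_trans[OF B(1)])
  have i2: "integrable stdN h'" by (rule integrable_const_bound[of _ B]) (use B in auto)
  let ?f = "\<lambda>x. std_normal_density x * (h' x - x * h x)"
  let ?F = "\<lambda>x. std_normal_density x * h x"
  have i3: "integrable lborel ?f"
    using Bochner_Integration.integrable_diff[OF i2 i1] by (subst (asm) integrable_stdN) auto
  have dens: "(std_normal_density has_real_derivative (- x * std_normal_density x)) (at x)" for x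
    unfolding std_normal_density_def[abs_def]
    by (auto intro!: derivative_eq_intros simp: field_simps)
  have cd: "isCont std_normal_density x" for x using dens DERIV_isCont by blast
  have "(LBINT x=-\<infinity>..\<infinity>. ?f x) = 0 - 0"
  proof (rule interval_integral_FTC_integrable[where F = ?F])
    show "(?F has_vector_derivative ?f x) (at x)" for x
      unfolding has_real_derivative_iff_has_vector_derivative[symmetric]
      by (auto intro!: derivative_eq_intros dens d simp: algebra_simps)
    show "isCont ?f x" for x
      using ch c cd by (auto intro!: continuous_intros simp: continuous_on_eq_continuous_at)
    show "set_integrable lborel (einterval (- \<infinity>) \<infinity>) ?f"
      using i3 by (simp add: set_integrable_def einterval_def)
    have z: "((\<lambda>x. std_normal_density x) \<longlongrightarrow> 0) F" if "filterlim (\<lambda>x. x\<^sup>2) at_top F" for F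
    proof -
      have "((\<lambda>x. exp (- x)) \<longlongrightarrow> (0::real)) at_top"
        by (rule filterlim_compose[OF exp_at_bot filterlim_uminus_at_bot_at_top])
      moreover have "filterlim (\<lambda>x. x\<^sup>2 / 2) at_top F"
        using filterlim_tendsto_pos_mult_at_top[OF tendsto_const[of "1/2"] _ that] by simp
      ultimately have "((\<lambda>x. exp (- (x\<^sup>2 / 2))) \<longlongrightarrow> (0::real)) F" by (rule filterlim_compose)
      from tendsto_mult[OF tendsto_const[of "1 / sqrt (2 * pi)"] this] show ?thesis
        by (simp add: std_normal_density_def[abs_def])
    qed
    have z2: "(?F \<longlongrightarrow> 0) F" if "filterlim (\<lambda>x. x\<^sup>2) at_top F" for F
    proof (rule Lim_null_comparison)
      show "\<forall>\<^sub>F x in F. norm (?F x) \<le> std_normal_density x * B"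
        using B by (auto intro!: always_eventually simp: abs_mult mult_left_mono)
      show "((\<lambda>x. std_normal_density x * B) \<longlongrightarrow> 0) F"
        using tendsto_mult_left_zero[OF z[OF that], of B] by simp
    qed
    have "filterlim (\<lambda>x::real. x\<^sup>2) at_top at_bot" "filterlim (\<lambda>x::real. x\<^sup>2) at_top at_top"
      using filterlim_pow_at_bot_even[of 2 "\<lambda>x::real. x" at_bot] filterlim_pow_at_top[of 2 "\<lambda>x::real. x" at_top]
      by (auto simp: filterlim_ident)
    then show "((?F \<circ> real_of_ereal) \<longlongrightarrow> 0) (at_right (- \<infinity>))" "((?F \<circ> real_of_ereal) \<longlongrightarrow> 0) (at_left \<infinity>)"
      by (auto simp: ereal_tendsto_simps intro: z2)
  qed auto
  then have "(LINT x|lborel. ?f x) = 0"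
    by (simp add: interval_lebesgue_integral_def set_lebesgue_integral_def einterval_def)
  then have "(LINT x|stdN. h' x - x * h x) = 0" by (subst integral_stdN) auto
  then show ?thesis using i1 i2 by simp
qed

text \<open>Prescribing the characteristic function instead of a density includes degenerate
  covariances, for instance those of repeated points, and is the form in which
  \<open>joint_char_unique\<close> compares laws.\<close>

definition gaussian_family :: "'w measure \<Rightarrow> 'i set \<Rightarrow> ('i \<Rightarrow> 'w \<Rightarrow> real) \<Rightarrow> ('i \<Rightarrow> 'i \<Rightarrow> real) \<Rightarrow> bool" where
  "gaussian_family M I Z K \<longleftrightarrow> (\<forall>i\<in>I. Z i \<in> borel_measurable M) \<and>
     (\<forall>c. (CLINT \<omega>|M. iexp (\<Sum>i\<in>I. c i * Z i \<omega>)) =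
        complex_of_real (exp (- (\<Sum>i\<in>I. \<Sum>k\<in>I. c i * c k * K i k) / 2)))"

text \<open>Subtracting from every \<open>Z k\<close> its regression \<open>(r k / v) * U\<close>
  leaves a family independent of \<open>U\<close>. Given that family, \<open>U\<close> is
  \<open>sqrt v\<close> times a standard normal variable, and the claim is \<open>stdN_ibp\<close>
  in this variable. In the hypothesis on the characteristic function, \<open>v\<close> is the
  variance of \<open>U\<close>, \<open>r\<close> the vector of its covariances with
  \<open>Z\<close>, and \<open>Q\<close> the quadratic form of \<open>Z\<close>.\<close>

lemma gaussian_ibp:
  fixes U :: "'w \<Rightarrow> real" and Z :: "'i \<Rightarrow> 'w \<Rightarrow> real" and D :: "('i \<Rightarrow> real) \<Rightarrow> real"
  assumes M: "prob_space M" and I: "finite I"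
    and U [measurable]: "U \<in> borel_measurable M" and Z: "\<And>i. i \<in> I \<Longrightarrow> Z i \<in> borel_measurable M"
    and v: "0 < v"
    and char: "\<And>a c. (CLINT \<omega>|M. iexp (a * U \<omega> + (\<Sum>i\<in>I. c i * Z i \<omega>))) =
       complex_of_real (exp (- (a\<^sup>2 * v + 2 * a * (\<Sum>i\<in>I. c i * r i) + Q c) / 2))"
    and D [measurable]: "D \<in> borel_measurable (PiM I (\<lambda>_. borel))"
    and D' [measurable]: "\<And>i. i \<in> I \<Longrightarrow> D' i \<in> borel_measurable (PiM I (\<lambda>_. borel))"
    and deriv: "\<And>z b s. ((\<lambda>s. D (\<lambda>i\<in>I. z i + s * b i)) has_real_derivative
        (\<Sum>i\<in>I. D' i (\<lambda>i\<in>I. z i + s * b i) * b i)) (at s)"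
    and cont: "\<And>z b i. i \<in> I \<Longrightarrow> continuous_on UNIV (\<lambda>s. D' i (\<lambda>i\<in>I. z i + s * b i))"
    and B: "\<And>z. \<bar>D z\<bar> \<le> B" "\<And>i z. i \<in> I \<Longrightarrow> \<bar>D' i z\<bar> \<le> B"
  shows "(LINT \<omega>|M. U \<omega> * D (\<lambda>i\<in>I. Z i \<omega>)) = (\<Sum>i\<in>I. r i * (LINT \<omega>|M. D' i (\<lambda>i\<in>I. Z i \<omega>)))"
proof -
  interpret M: prob_space M by fact
  interpret N: prob_space stdN by (rule prob_space_stdN)
  interpret P: pair_sigma_finite M stdN ..
  interpret PP: pair_prob_space M stdN ..
  note [measurable] = Z
  define W where "W = (\<lambda>k \<omega>. Z k \<omega> - (r k / v) * U \<omega>)"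
  have W [measurable]: "\<And>i. i \<in> I \<Longrightarrow> W i \<in> borel_measurable M" unfolding W_def by measurable
  \<comment> \<open>\<open>None\<close> stands for \<open>U\<close> and \<open>Some k\<close> for
    \<open>W k\<close>, so that one finite index set carries the whole family. In \<open>F'\<close>
    the variable \<open>U\<close> lives on an independent second factor.\<close>
  define F where "F = (\<lambda>j \<omega>. case j of None \<Rightarrow> U \<omega> | Some k \<Rightarrow> W k \<omega>)"
  define F' where "F' = (\<lambda>j x. case j of None \<Rightarrow> sqrt v * snd x | Some k \<Rightarrow> W k (fst x))"
  let ?J = "insert None (Some ` I)"
  have charW: "(CLINT \<omega>|M. iexp (a * U \<omega> + (\<Sum>i\<in>I. c i * W i \<omega>))) =
     complex_of_real (exp (- (a\<^sup>2 * v + (Q c - (\<Sum>i\<in>I. c i * r i)\<^sup>2 / v)) / 2))" for a c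
  proof -
    define R where "R = (\<Sum>i\<in>I. c i * r i)"
    have e: "a * U \<omega> + (\<Sum>i\<in>I. c i * W i \<omega>) = (a - R / v) * U \<omega> + (\<Sum>i\<in>I. c i * Z i \<omega>)" for \<omega>
      unfolding W_def R_def by (simp add: algebra_simps sum_subtractf sum_distrib_left sum_divide_distrib sum.distrib)
    have q: "(a - R / v)\<^sup>2 * v + 2 * (a - R / v) * R + Q c = a\<^sup>2 * v + (Q c - R\<^sup>2 / v)"
      using v by (simp add: power2_eq_square field_simps)
    show ?thesis unfolding e char unfolding R_def[symmetric] q ..
  qed
  have law: "distr M (PiM ?J (\<lambda>_. borel)) (\<lambda>\<omega>. \<lambda>j\<in>?J. F j \<omega>) = distr (M \<Otimes>\<^sub>M stdN) (PiM ?J (\<lambda>_. borel)) (\<lambda>\<omega>. \<lambda>j\<in>?J. F' j \<omega>)"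
  proof (rule joint_char_unique[OF M PP.prob_space_axioms])
    show "finite ?J" using I by simp
    show "j \<in> ?J \<Longrightarrow> F j \<in> borel_measurable M" for j by (auto simp: F_def)
    show "j \<in> ?J \<Longrightarrow> F' j \<in> borel_measurable (M \<Otimes>\<^sub>M stdN)" for j by (auto simp: F'_def)
    fix c :: "'i option \<Rightarrow> real"
    have s1: "(\<Sum>j\<in>?J. c j * F j \<omega>) = c None * U \<omega> + (\<Sum>i\<in>I. c (Some i) * W i \<omega>)" for \<omega>
      using I by (subst sum.insert) (auto simp: F_def sum.reindex)
    have s2: "(\<Sum>j\<in>?J. c j * F' j x) = c None * (sqrt v * snd x) + (\<Sum>i\<in>I. c (Some i) * W i (fst x))" for x
      using I by (subst sum.insert) (auto simp: F'_def sum.reindex)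
    have "(CLINT x|(M \<Otimes>\<^sub>M stdN). iexp (\<Sum>j\<in>?J. c j * F' j x)) =
       (CLINT \<omega>|M. CLINT x|stdN. iexp (\<Sum>j\<in>?J. c j * F' j (\<omega>, x)))"
    proof (rule P.integral_fst'[symmetric])
      show "integrable (M \<Otimes>\<^sub>M stdN) (\<lambda>x. iexp (\<Sum>j\<in>?J. c j * F' j x))"
        unfolding s2 by (rule PP.integrable_iexp) simp_all
    qed
    also have "\<dots> = (CLINT \<omega>|M. CLINT x|stdN. iexp (\<Sum>i\<in>I. c (Some i) * W i \<omega>) * iexp ((c None * sqrt v) * x))"
      unfolding s2 by (simp add: exp_add[symmetric] algebra_simps)
    also have "\<dots> = (CLINT \<omega>|M. iexp (\<Sum>i\<in>I. c (Some i) * W i \<omega>)) * complex_of_real (exp (- ((c None * sqrt v)\<^sup>2) / 2))"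
      by (simp only: integral_mult_right_zero integral_mult_left_zero iexp_stdN)
    also have "\<dots> = (CLINT \<omega>|M. iexp (\<Sum>j\<in>?J. c j * F j \<omega>))"
      unfolding s1 charW using charW[of 0 "\<lambda>i. c (Some i)"] v
      by (simp add: power_mult_distrib exp_add[symmetric] of_real_mult[symmetric] field_simps del: of_real_mult)
    finally show "(CLINT \<omega>|M. iexp (\<Sum>j\<in>?J. c j * F j \<omega>)) = (CLINT x|(M \<Otimes>\<^sub>M stdN). iexp (\<Sum>j\<in>?J. c j * F' j x))" by simp
  qed
  \<comment> \<open>Undoes the regression: \<open>Z i = W i + (r i / v) * U\<close>, and for
    \<open>U = sqrt v * x\<close> the added term is \<open>x * (r i / sqrt v)\<close>, the direction
    of differentiation below.\<close>
  have transfer: "(LINT \<omega>|M. H (U \<omega>) (\<lambda>i\<in>I. Z i \<omega>)) = (LINT x|(M \<Otimes>\<^sub>M stdN). H (sqrt v * snd x) (\<lambda>i\<in>I. W i (fst x) + snd x * (r i / sqrt v)))"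
    if H [measurable]: "(\<lambda>(u, z). H u z) \<in> borel_measurable (borel \<Otimes>\<^sub>M PiM I (\<lambda>_. borel))" for H :: "real \<Rightarrow> ('i \<Rightarrow> real) \<Rightarrow> real"
  proof -
    define G where "G = (\<lambda>f :: 'i option \<Rightarrow> real. H (f None) (\<lambda>i\<in>I. f (Some i) + (r i / v) * f None))"
    have [measurable]: "(\<lambda>f. f None) \<in> borel_measurable (PiM ?J (\<lambda>_. borel))"
      by (rule measurable_component_singleton) simp
    have [measurable]: "i \<in> I \<Longrightarrow> (\<lambda>f. f (Some i)) \<in> borel_measurable (PiM ?J (\<lambda>_. borel))" for i
      by (rule measurable_component_singleton) simp
    have G [measurable]: "G \<in> borel_measurable (PiM ?J (\<lambda>_. borel))"
    proof -
      have "(\<lambda>f. (f None, \<lambda>i\<in>I. f (Some i) + (r i / v) * f None)) \<in> measurable (PiM ?J (\<lambda>_. borel)) (borel \<Otimes>\<^sub>M PiM I (\<lambda>_. borel))"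
        by measurable
      from measurable_compose[OF this H] show ?thesis by (simp add: G_def)
    qed
    have m1: "(\<lambda>\<omega>. \<lambda>j\<in>?J. F j \<omega>) \<in> measurable M (PiM ?J (\<lambda>_. borel))"
      by (intro measurable_restrict) (auto simp: F_def)
    have m2: "(\<lambda>\<omega>. \<lambda>j\<in>?J. F' j \<omega>) \<in> measurable (M \<Otimes>\<^sub>M stdN) (PiM ?J (\<lambda>_. borel))"
      by (intro measurable_restrict) (auto simp: F'_def)
    have a: "(LINT \<omega>|M. H (U \<omega>) (\<lambda>i\<in>I. Z i \<omega>)) = (LINT \<omega>|M. G (\<lambda>j\<in>?J. F j \<omega>))"
      by (auto intro!: Bochner_Integration.integral_cong arg_cong2[where f = H] simp: G_def F_def W_def restrict_def)
    have b: "(LINT x|(M \<Otimes>\<^sub>M stdN). H (sqrt v * snd x) (\<lambda>i\<in>I. W i (fst x) + snd x * (r i / sqrt v))) = (LINT x|(M \<Otimes>\<^sub>M stdN). G (\<lambda>j\<in>?J. F' j x))"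
      using v by (auto intro!: Bochner_Integration.integral_cong arg_cong2[where f = H] simp: G_def F'_def restrict_def real_div_sqrt fun_eq_iff field_simps)
    show ?thesis unfolding a b
      using integral_distr[OF m1 G] integral_distr[OF m2 G] law by metis
  qed
  have zW [measurable]: "(\<lambda>x. \<lambda>i\<in>I. W i (fst x) + snd x * (r i / sqrt v)) \<in> measurable (M \<Otimes>\<^sub>M stdN) (PiM I (\<lambda>_. borel))"
    by measurable
  have int1: "integrable (M \<Otimes>\<^sub>M stdN) (\<lambda>x. sqrt v * snd x * D (\<lambda>i\<in>I. W i (fst x) + snd x * (r i / sqrt v)))"
  proof (rule Bochner_Integration.integrable_bound[where f = "\<lambda>x. (sqrt v * B) * \<bar>snd x\<bar>"])
    show "integrable (M \<Otimes>\<^sub>M stdN) (\<lambda>x. (sqrt v * B) * \<bar>snd x\<bar>)"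
      by (intro integrable_mult_right P.Fubini_integrable) (auto simp: integrable_stdN_abs)
    show "AE x in M \<Otimes>\<^sub>M stdN. norm (sqrt v * snd x * D (\<lambda>i\<in>I. W i (fst x) + snd x * (r i / sqrt v))) \<le> norm ((sqrt v * B) * \<bar>snd x\<bar>)"
    proof (intro AE_I2)
      fix x :: "'w \<times> real"
      have "\<bar>D (\<lambda>i\<in>I. W i (fst x) + snd x * (r i / sqrt v))\<bar> \<le> \<bar>B\<bar>" using B(1)[of "\<lambda>i\<in>I. W i (fst x) + snd x * (r i / sqrt v)"] by linarith
      then show "norm (sqrt v * snd x * D (\<lambda>i\<in>I. W i (fst x) + snd x * (r i / sqrt v))) \<le> norm ((sqrt v * B) * \<bar>snd x\<bar>)"
        using v mult_left_mono[of "\<bar>D (\<lambda>i\<in>I. W i (fst x) + snd x * (r i / sqrt v))\<bar>" "\<bar>B\<bar>" "\<bar>snd x\<bar>"]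
        by (simp add: abs_mult mult.commute mult.left_commute)
    qed
  qed measurable
  have int2: "integrable (M \<Otimes>\<^sub>M stdN) (\<lambda>x. D' i (\<lambda>i\<in>I. W i (fst x) + snd x * (r i / sqrt v)))" if "i \<in> I" for i
    by (rule PP.integrable_const_bound[of _ B]) (use B(2)[OF that] that in auto)
  have "(LINT \<omega>|M. U \<omega> * D (\<lambda>i\<in>I. Z i \<omega>)) = (LINT x|(M \<Otimes>\<^sub>M stdN). sqrt v * snd x * D (\<lambda>i\<in>I. W i (fst x) + snd x * (r i / sqrt v)))"
    by (rule transfer[of "\<lambda>u z. u * D z"]) measurable
  also have "\<dots> = (LINT \<omega>|M. LINT x|stdN. sqrt v * x * D (\<lambda>i\<in>I. W i \<omega> + x * (r i / sqrt v)))"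
    using P.integral_fst'[OF int1] by simp
  also have "\<dots> = (LINT \<omega>|M. LINT x|stdN. (\<Sum>i\<in>I. r i * D' i (\<lambda>i\<in>I. W i \<omega> + x * (r i / sqrt v))))"
  proof (rule Bochner_Integration.integral_cong[OF refl])
    fix \<omega>
    let ?z = "\<lambda>i. W i \<omega>" and ?b = "\<lambda>i. r i / sqrt v"
    let ?h' = "\<lambda>x. \<Sum>i\<in>I. D' i (\<lambda>i\<in>I. ?z i + x * ?b i) * ?b i"
    have hb: "\<bar>?h' x\<bar> \<le> (\<Sum>i\<in>I. B * \<bar>?b i\<bar>)" for x
      by (rule order_trans[OF sum_abs sum_mono]) (unfold abs_mult, rule mult_right_mono[OF B(2)], auto)
    have "(LINT x|stdN. x * D (\<lambda>i\<in>I. ?z i + x * ?b i)) = (LINT x|stdN. ?h' x)"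
    proof (rule stdN_ibp[where B = "max B (\<Sum>i\<in>I. B * \<bar>?b i\<bar>)"])
      show "continuous_on UNIV ?h'" by (intro continuous_intros cont)
      show "((\<lambda>x. D (\<lambda>i\<in>I. ?z i + x * ?b i)) has_real_derivative ?h' x) (at x)" for x by (rule deriv)
      show "\<bar>D (\<lambda>i\<in>I. ?z i + x * ?b i)\<bar> \<le> max B (\<Sum>i\<in>I. B * \<bar>?b i\<bar>)" for x
        by (rule order_trans[OF B(1)]) simp
      show "\<bar>?h' x\<bar> \<le> max B (\<Sum>i\<in>I. B * \<bar>?b i\<bar>)" for x
        by (rule order_trans[OF hb]) (rule max.cobounded2)
    qed
    then have "sqrt v * (LINT x|stdN. x * D (\<lambda>i\<in>I. ?z i + x * ?b i)) = sqrt v * (LINT x|stdN. ?h' x)" by simp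
    then have "(LINT x|stdN. sqrt v * x * D (\<lambda>i\<in>I. ?z i + x * ?b i)) = (LINT x|stdN. sqrt v * ?h' x)"
      by (simp only: mult.assoc integral_mult_right_zero)
    also have "(\<lambda>x. sqrt v * ?h' x) = (\<lambda>x. \<Sum>i\<in>I. r i * D' i (\<lambda>i\<in>I. ?z i + x * ?b i))"
      using v by (simp add: fun_eq_iff sum_distrib_left mult.commute)
    finally show "(LINT x|stdN. sqrt v * x * D (\<lambda>i\<in>I. ?z i + x * ?b i)) = (LINT x|stdN. (\<Sum>i\<in>I. r i * D' i (\<lambda>i\<in>I. ?z i + x * ?b i)))" .
  qed
  also have "\<dots> = (LINT x|(M \<Otimes>\<^sub>M stdN). (\<Sum>i\<in>I. r i * D' i (\<lambda>i\<in>I. W i (fst x) + snd x * (r i / sqrt v))))"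
    using P.integral_fst'[of "\<lambda>x. \<Sum>i\<in>I. r i * D' i (\<lambda>i\<in>I. W i (fst x) + snd x * (r i / sqrt v))"] int2 by simp
  also have "\<dots> = (\<Sum>i\<in>I. r i * (LINT x|(M \<Otimes>\<^sub>M stdN). D' i (\<lambda>i\<in>I. W i (fst x) + snd x * (r i / sqrt v))))"
    using int2 by simp
  also have "\<dots> = (\<Sum>i\<in>I. r i * (LINT \<omega>|M. D' i (\<lambda>i\<in>I. Z i \<omega>)))"
    by (intro sum.cong refl arg_cong2[where f = times] transfer[of "\<lambda>u z. D' _ z", symmetric]) measurable
  finally show ?thesis .
qed

subsection \<open>Energies of block sums\<close>

text \<open>The mean value inequality bounds every difference quotient by \<open>w\<close>, so
  dominated convergence applies.\<close>

lemma has_real_derivative_integral: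
  fixes f f' :: "real \<Rightarrow> 'a \<Rightarrow> real"
  assumes f: "\<And>x. integrable M (f x)" and f' [measurable]: "\<And>x. f' x \<in> borel_measurable M"
    and d: "\<And>\<omega> x. ((\<lambda>x. f x \<omega>) has_real_derivative f' x \<omega>) (at x)"
    and w: "integrable M w" "\<And>x \<omega>. \<bar>f' x \<omega>\<bar> \<le> w \<omega>"
  shows "((\<lambda>x. LINT \<omega>|M. f x \<omega>) has_real_derivative (LINT \<omega>|M. f' x \<omega>)) (at x)"
  unfolding DERIV_def tendsto_at_iff_sequentially comp_def
proof (intro allI impI)
  fix h :: "nat \<Rightarrow> real" assume h: "\<forall>i. h i \<in> UNIV - {0}" "h \<longlonglongrightarrow> 0"
  have [measurable]: "f x \<in> borel_measurable M" for x using f by (rule borel_measurable_integrable)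
  have "(\<lambda>n. LINT \<omega>|M. (f (x + h n) \<omega> - f x \<omega>) / h n) \<longlonglongrightarrow> (LINT \<omega>|M. f' x \<omega>)"
  proof (rule integral_dominated_convergence[where w = w])
    show "AE \<omega> in M. (\<lambda>n. (f (x + h n) \<omega> - f x \<omega>) / h n) \<longlonglongrightarrow> f' x \<omega>"
    proof (intro AE_I2)
      fix \<omega>
      show "(\<lambda>n. (f (x + h n) \<omega> - f x \<omega>) / h n) \<longlonglongrightarrow> f' x \<omega>"
        using d[where \<omega>=\<omega> and x=x, unfolded DERIV_def tendsto_at_iff_sequentially comp_def, rule_format, OF h(1)[rule_format] h(2)] .
    qed
    show "AE \<omega> in M. norm ((f (x + h n) \<omega> - f x \<omega>) / h n) \<le> w \<omega>" for n
    proof (intro AE_I2)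
      fix \<omega>
      have hn: "h n \<noteq> 0" using h by auto
      have "norm (f (x + h n) \<omega> - f x \<omega>) \<le> w \<omega> * norm (x + h n - x)"
        by (rule field_differentiable_bound[of UNIV "\<lambda>x. f x \<omega>" "\<lambda>x. f' x \<omega>"]) (simp_all add: d w(2))
      then show "norm ((f (x + h n) \<omega> - f x \<omega>) / h n) \<le> w \<omega>"
        using hn by (simp add: field_simps)
    qed
  qed (use w(1) in simp_all)
  then show "(\<lambda>n. ((LINT \<omega>|M. f (x + h n) \<omega>) - (LINT \<omega>|M. f x \<omega>)) / h n) \<longlonglongrightarrow> (LINT \<omega>|M. f' x \<omega>)"
    using f by simp
qed

lemma sum_delta_mult:
  fixes f :: "'i \<Rightarrow> real"
  assumes "finite I" "i \<in> I"
  shows "(\<Sum>k\<in>I. (if k = i then u else 0) * f k) = u * f i"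
proof -
  have "(\<Sum>k\<in>I. (if k = i then u else 0) * f k) = (\<Sum>k\<in>I. if k = i then u * f k else 0)"
    by (rule sum.cong) auto
  then show ?thesis using assms by (simp only: sum.delta if_True)
qed

text \<open>Setting all coefficients but one to zero identifies the law of a single coordinate. Its
  first moment dominates the derivative of the interpolation below.\<close>

lemma gaussian_family_integrable:
  assumes M: "prob_space M" and I: "finite I" and G: "gaussian_family M I X K" and i: "i \<in> I" and K: "0 < K i i"
  shows "integrable M (X i)"
proof -
  interpret prob_space M by fact
  interpret N: prob_space stdN by (rule prob_space_stdN)
  have [measurable]: "X i \<in> borel_measurable M" using G i by (simp add: gaussian_family_def)
  have "distr M borel (X i) = distr stdN borel (\<lambda>x. sqrt (K i i) * x)"
  proof (rule Levy_uniqueness)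
    show "real_distribution (distr M borel (X i))" by (rule real_distribution_distr) simp
    show "real_distribution (distr stdN borel (\<lambda>x. sqrt (K i i) * x))"
      by (rule N.real_distribution_distr) simp
    show "char (distr M borel (X i)) = char (distr stdN borel (\<lambda>x. sqrt (K i i) * x))"
    proof
      fix u
      have e: "(\<Sum>k\<in>I. (if k = i then u else 0) * X k \<omega>) = u * X i \<omega>" for \<omega>
        by (rule sum_delta_mult[OF I i])
      have e2: "(\<Sum>j\<in>I. \<Sum>k\<in>I. (if j = i then u else 0) * (if k = i then u else 0) * K j k) = u\<^sup>2 * K i i"
        by (simp only: mult.assoc sum_distrib_left[symmetric] sum_delta_mult[OF I i] power2_eq_square)
      have "char (distr M borel (X i)) u = (CLINT \<omega>|M. iexp (u * X i \<omega>))"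
        unfolding char_def by (subst integral_distr) auto
      also have "\<dots> = complex_of_real (exp (- (u\<^sup>2 * K i i) / 2))"
        using G[unfolded gaussian_family_def, THEN conjunct2, rule_format, of "\<lambda>k. if k = i then u else 0"]
        by (simp only: e e2)
      also have "\<dots> = (CLINT x|stdN. iexp ((u * sqrt (K i i)) * x))"
        using K by (subst iexp_stdN) (simp add: power_mult_distrib)
      also have "\<dots> = char (distr stdN borel (\<lambda>x. sqrt (K i i) * x)) u"
        unfolding char_def by (subst integral_distr) (simp_all add: mult.assoc)
      finally show "char (distr M borel (X i)) u = char (distr stdN borel (\<lambda>x. sqrt (K i i) * x)) u" .
    qed
  qed
  moreover have "integrable (distr stdN borel (\<lambda>x. sqrt (K i i) * x)) (\<lambda>x. x)"
    using integrable_mult_right[OF integrable_std_normal_distribution_moment[of 1], of "sqrt (K i i)"]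
    by (subst integrable_distr_eq) (simp_all del: integrable_mult_right_iff)
  ultimately have "integrable (distr M borel (X i)) (\<lambda>x. x)" by simp
  then show ?thesis by (subst (asm) integrable_distr_eq) auto
qed

text \<open>An index is a pair of a block and a point in it. There are two uses: blocks of one point
  with \<open>\<beta> = 1\<close> for the mass of the unit cube, and one block for each grid cube
  with \<open>\<beta> > 1\<close> for the sum of powers.\<close>

locale block_functional =
  fixes J :: "'j set" and A :: "'a set" and p \<beta> :: real
  assumes fJ: "finite J" and fA: "finite A" and A0: "A \<noteq> {}" and p0: "0 < p" and b1: "1 \<le> \<beta>"
begin

definition S :: "('j \<times> 'a \<Rightarrow> real) \<Rightarrow> 'j \<Rightarrow> real" where
  "S z j = (\<Sum>a\<in>A. p * exp (z (j, a)))"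

definition G :: "('j \<times> 'a \<Rightarrow> real) \<Rightarrow> real" where
  "G z = (\<Sum>j\<in>J. S z j powr \<beta>)"

definition \<Phi> :: "('j \<times> 'a \<Rightarrow> real) \<Rightarrow> real" where
  "\<Phi> z = 1 - exp (- G z)"

text \<open>This is the gradient of \<open>G\<close>; the Hessian of \<open>G\<close> is
  \<open>b\<close> plus the diagonal matrix with entries \<open>g\<close>. Accordingly
  \<open>D1\<close> and \<open>D2\<close> are the gradient and the Hessian of
  \<open>\<Phi>\<close>.\<close>

definition g :: "('j \<times> 'a \<Rightarrow> real) \<Rightarrow> 'j \<times> 'a \<Rightarrow> real" where
  "g z i = \<beta> * S z (fst i) powr (\<beta> - 1) * (p * exp (z i))"

definition b :: "('j \<times> 'a \<Rightarrow> real) \<Rightarrow> 'j \<times> 'a \<Rightarrow> 'j \<times> 'a \<Rightarrow> real" where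
  "b z i k = (if fst i = fst k then \<beta> * (\<beta> - 1) * S z (fst i) powr (\<beta> - 2) * (p * exp (z i)) * (p * exp (z k)) else 0)"

definition D1 :: "('j \<times> 'a \<Rightarrow> real) \<Rightarrow> 'j \<times> 'a \<Rightarrow> real" where
  "D1 z i = exp (- G z) * g z i"

definition D2 :: "('j \<times> 'a \<Rightarrow> real) \<Rightarrow> 'j \<times> 'a \<Rightarrow> 'j \<times> 'a \<Rightarrow> real" where
  "D2 z i k = exp (- G z) * (b z i k + (if i = k then g z i else 0) - g z i * g z k)"

lemma sum_Times: "(\<Sum>i\<in>J \<times> A. f i) = (\<Sum>j\<in>J. \<Sum>a\<in>A. f (j, a))" for f :: "'j \<times> 'a \<Rightarrow> real"
  by (simp add: sum.cartesian_product split_beta)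

lemma S_pos: "0 < S z j"
  unfolding S_def using fA A0 p0 by (intro sum_pos) auto

lemma G_nonneg: "0 \<le> G z"
  unfolding G_def by (intro sum_nonneg) simp

lemma g_nonneg: "0 \<le> g z i"
  unfolding g_def using b1 p0 by simp

lemma b_nonneg: "0 \<le> b z i k"
  unfolding b_def using b1 p0 by simp

text \<open>Euler's identity: \<open>G\<close> is homogeneous of degree \<open>\<beta>\<close> in
  the variables \<open>exp (z i)\<close>. The lemma \<open>sum_b\<close> is the second-order
  version.\<close>

lemma sum_g: "(\<Sum>i\<in>J \<times> A. g z i) = \<beta> * G z"
proof -
  have "(\<Sum>i\<in>J \<times> A. g z i) = (\<Sum>j\<in>J. \<Sum>a\<in>A. \<beta> * S z j powr (\<beta> - 1) * (p * exp (z (j, a))))"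
    by (simp add: sum_Times g_def)
  also have "\<dots> = (\<Sum>j\<in>J. \<beta> * S z j powr (\<beta> - 1) * S z j)"
    by (simp add: S_def sum_distrib_left)
  also have "\<dots> = (\<Sum>j\<in>J. \<beta> * S z j powr \<beta>)"
  proof (intro sum.cong refl)
    fix j
    have "S z j powr (\<beta> - 1) * S z j = S z j powr \<beta>"
      using S_pos[of z j] powr_add[of "S z j" "\<beta> - 1" 1] by simp
    then show "\<beta> * S z j powr (\<beta> - 1) * S z j = \<beta> * S z j powr \<beta>" by (simp only: mult.assoc)
  qed
  finally show ?thesis by (simp add: G_def sum_distrib_left)
qed

lemma sum_b_row:
  assumes "j \<in> J" shows "(\<Sum>k\<in>J \<times> A. b z (j, a) k * f k)
    = \<beta> * (\<beta> - 1) * S z j powr (\<beta> - 2) * (p * exp (z (j, a))) * (\<Sum>a'\<in>A. p * exp (z (j, a')) * f (j, a'))"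
proof -
  have "(\<Sum>k\<in>J \<times> A. b z (j, a) k * f k) = (\<Sum>j'\<in>J. \<Sum>a'\<in>A. b z (j, a) (j', a') * f (j', a'))"
    by (simp add: sum_Times)
  also have "\<dots> = (\<Sum>j'\<in>J. if j' = j then (\<Sum>a'\<in>A. b z (j, a) (j, a') * f (j, a')) else 0)"
    by (intro sum.cong refl) (simp add: b_def)
  also have "\<dots> = (\<Sum>a'\<in>A. b z (j, a) (j, a') * f (j, a'))"
    using fJ assms by simp
  also have "\<dots> = (\<Sum>a'\<in>A. \<beta> * (\<beta> - 1) * S z j powr (\<beta> - 2) * (p * exp (z (j, a))) * (p * exp (z (j, a')) * f (j, a')))"
    by (simp only: b_def fst_conv if_True refl mult.assoc)
  finally show ?thesis by (simp only: sum_distrib_left)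
qed

lemma sum_b: "(\<Sum>i\<in>J \<times> A. \<Sum>k\<in>J \<times> A. b z i k) = \<beta> * (\<beta> - 1) * G z"
proof -
  have "(\<Sum>i\<in>J \<times> A. \<Sum>k\<in>J \<times> A. b z i k) = (\<Sum>j\<in>J. \<Sum>a\<in>A. \<Sum>k\<in>J \<times> A. b z (j, a) k * 1)"
    by (simp add: sum_Times[of "\<lambda>i. \<Sum>k\<in>J \<times> A. b z i k"])
  also have "\<dots> = (\<Sum>j\<in>J. \<Sum>a\<in>A. \<beta> * (\<beta> - 1) * S z j powr (\<beta> - 2) * (p * exp (z (j, a))) * S z j)"
    by (intro sum.cong refl, subst sum_b_row) (auto simp: S_def)
  also have "\<dots> = (\<Sum>j\<in>J. \<beta> * (\<beta> - 1) * S z j powr (\<beta> - 2) * S z j * S z j)"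
    by (simp only: sum_distrib_left[symmetric] sum_distrib_right[symmetric] S_def)
  also have "\<dots> = (\<Sum>j\<in>J. \<beta> * (\<beta> - 1) * S z j powr \<beta>)"
  proof (intro sum.cong refl)
    fix j
    have "S z j powr (\<beta> - 2) * S z j * S z j = S z j powr (\<beta> - 2) * S z j powr 2"
      using S_pos[of z j] by (simp add: power2_eq_square mult.assoc)
    also have "\<dots> = S z j powr \<beta>" by (simp add: powr_add[symmetric])
    finally show "\<beta> * (\<beta> - 1) * S z j powr (\<beta> - 2) * S z j * S z j = \<beta> * (\<beta> - 1) * S z j powr \<beta>"
      by (simp add: mult.assoc)
  qed
  finally show ?thesis by (simp add: G_def sum_distrib_left)
qed

lemma S_deriv:
  assumes "\<And>a. a \<in> A \<Longrightarrow> ((\<lambda>s. c s (j, a)) has_real_derivative c' (j, a)) (at s)"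
  shows "((\<lambda>s. S (c s) j) has_real_derivative (\<Sum>a\<in>A. p * exp (c s (j, a)) * c' (j, a))) (at s)"
  unfolding S_def by (auto intro!: derivative_eq_intros DERIV_sum assms)

lemma G_deriv:
  assumes c: "\<And>i. i \<in> J \<times> A \<Longrightarrow> ((\<lambda>s. c s i) has_real_derivative c' i) (at s)"
  shows "((\<lambda>s. G (c s)) has_real_derivative (\<Sum>i\<in>J \<times> A. g (c s) i * c' i)) (at s)"
proof -
  have "((\<lambda>s. G (c s)) has_real_derivative
     (\<Sum>j\<in>J. \<beta> * S (c s) j powr (\<beta> - of_nat 1) * (\<Sum>a\<in>A. p * exp (c s (j, a)) * c' (j, a)))) (at s)"
    unfolding G_def by (intro DERIV_sum DERIV_fun_powr S_deriv S_pos c) auto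
  also have "(\<Sum>j\<in>J. \<beta> * S (c s) j powr (\<beta> - of_nat 1) * (\<Sum>a\<in>A. p * exp (c s (j, a)) * c' (j, a)))
      = (\<Sum>i\<in>J \<times> A. g (c s) i * c' i)"
    by (simp add: sum_Times g_def sum_distrib_left mult.assoc)
  finally show ?thesis .
qed

lemma \<Phi>_deriv:
  assumes c: "\<And>i. i \<in> J \<times> A \<Longrightarrow> ((\<lambda>s. c s i) has_real_derivative c' i) (at s)"
  shows "((\<lambda>s. \<Phi> (c s)) has_real_derivative (\<Sum>i\<in>J \<times> A. D1 (c s) i * c' i)) (at s)"
  unfolding \<Phi>_def
  by (auto intro!: derivative_eq_intros G_deriv[OF c] simp: D1_def sum_distrib_left sum_distrib_right mult_ac)

lemma D1_deriv:
  assumes c: "\<And>i. i \<in> J \<times> A \<Longrightarrow> ((\<lambda>s. c s i) has_real_derivative c' i) (at s)" and i: "i \<in> J \<times> A"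
  shows "((\<lambda>s. D1 (c s) i) has_real_derivative (\<Sum>k\<in>J \<times> A. D2 (c s) i k * c' k)) (at s)"
proof -
  obtain j a where ja: "i = (j, a)" "j \<in> J" "a \<in> A" using i by auto
  have dS: "((\<lambda>s. S (c s) j) has_real_derivative (\<Sum>a\<in>A. p * exp (c s (j, a)) * c' (j, a))) (at s)"
    by (rule S_deriv) (use c ja in auto)
  have dg: "((\<lambda>s. g (c s) i) has_real_derivative
      (\<Sum>k\<in>J \<times> A. b (c s) i k * c' k) + g (c s) i * c' i) (at s)"
  proof -
    have d1: "((\<lambda>s. S (c s) j powr (\<beta> - 1)) has_real_derivative
        (\<beta> - 1) * S (c s) j powr (\<beta> - 1 - of_nat 1) * (\<Sum>a\<in>A. p * exp (c s (j, a)) * c' (j, a))) (at s)"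
      by (rule DERIV_fun_powr[OF dS S_pos])
    have d2: "((\<lambda>s. p * exp (c s (j, a))) has_real_derivative p * (exp (c s (j, a)) * c' (j, a))) (at s)"
      using c[OF i] unfolding ja by (intro DERIV_cmult DERIV_fun_exp)
    from DERIV_mult[OF DERIV_cmult[OF d1, of \<beta>] d2] show ?thesis
      unfolding ja sum_b_row[OF ja(2)] unfolding g_def fst_conv
      by (rule DERIV_cong) (simp add: diff_diff_eq algebra_simps)
  qed
  have dk: "g (c s) i * c' i = (\<Sum>k\<in>J \<times> A. (if i = k then g (c s) i else 0) * c' k)"
    using i fJ fA by (simp add: if_distrib[of "\<lambda>x. x * _"] cong: if_cong)
  have "((\<lambda>s. D1 (c s) i) has_real_derivative exp (- G (c s)) * (((\<Sum>k\<in>J \<times> A. b (c s) i k * c' k) + g (c s) i * c' i)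
       - g (c s) i * (\<Sum>k\<in>J \<times> A. g (c s) k * c' k))) (at s)"
    unfolding D1_def by (auto intro!: derivative_eq_intros G_deriv[OF c] dg simp: algebra_simps)
  also have "exp (- G (c s)) * (((\<Sum>k\<in>J \<times> A. b (c s) i k * c' k) + g (c s) i * c' i)
       - g (c s) i * (\<Sum>k\<in>J \<times> A. g (c s) k * c' k)) = (\<Sum>k\<in>J \<times> A. D2 (c s) i k * c' k)"
    unfolding dk D2_def
    by (simp add: sum_distrib_left sum.distrib[symmetric] sum_subtractf[symmetric] algebra_simps)
  finally show ?thesis .
qed

text \<open>The scalar fact behind the Gronwall argument. The second derivatives are of size
  \<open>exp (- x) * (x + x\<^sup>2)\<close> at \<open>x = G z\<close>, which is linear near 0 and
  tends to 0 at infinity, and is thus bounded by a multiple of the functional itself.\<close>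

lemma exp_energy_bound: "exp (- x) * (x + x\<^sup>2) \<le> 2 * (1 - exp (- x))" if "0 \<le> x" for x :: real
proof -
  have "1 + x + x\<^sup>2 / 2 \<le> exp x" using exp_lower_Taylor_quadratic[OF that] .
  then have "x + x\<^sup>2 \<le> 2 * (exp x - 1)" using that by simp
  from mult_left_mono[OF this, of "exp (- x)"] show ?thesis
    by (simp add: algebra_simps exp_minus field_simps)
qed

text \<open>The Hessian \<open>D2\<close> with the sign of its negative term reversed: an entrywise
  majorant of the modulus of \<open>D2\<close> whose total can still be computed exactly.\<close>

definition H :: "('j \<times> 'a \<Rightarrow> real) \<Rightarrow> 'j \<times> 'a \<Rightarrow> 'j \<times> 'a \<Rightarrow> real" where
  "H z i k = exp (- G z) * (b z i k + (if i = k then g z i else 0) + g z i * g z k)"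

lemma H_nonneg: "0 \<le> H z i k"
  unfolding H_def using b_nonneg[of z i k] g_nonneg[of z i] g_nonneg[of z k] by simp

lemma sum_H: "(\<Sum>i\<in>J \<times> A. \<Sum>k\<in>J \<times> A. H z i k) \<le> 2 * \<beta>\<^sup>2 * \<Phi> z"
proof -
  have "(\<Sum>i\<in>J \<times> A. \<Sum>k\<in>J \<times> A. H z i k)
     = exp (- G z) * ((\<Sum>i\<in>J \<times> A. \<Sum>k\<in>J \<times> A. b z i k) + (\<Sum>i\<in>J \<times> A. g z i) + (\<Sum>i\<in>J \<times> A. g z i) * (\<Sum>k\<in>J \<times> A. g z k))"
  proof -
    have "(\<Sum>k\<in>J \<times> A. H z i k) = exp (- G z) * ((\<Sum>k\<in>J \<times> A. b z i k) + g z i + g z i * (\<Sum>k\<in>J \<times> A. g z k))"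
      if "i \<in> J \<times> A" for i
      using that fJ fA
      by (simp only: H_def sum_distrib_left[symmetric] sum.distrib sum.delta' finite_cartesian_product if_True)
    then have "(\<Sum>i\<in>J \<times> A. \<Sum>k\<in>J \<times> A. H z i k)
      = (\<Sum>i\<in>J \<times> A. exp (- G z) * ((\<Sum>k\<in>J \<times> A. b z i k) + g z i + g z i * (\<Sum>k\<in>J \<times> A. g z k)))"
      by (intro sum.cong refl) blast
    then show ?thesis
      by (simp only: sum_distrib_left[symmetric] sum_distrib_right[symmetric] sum.distrib)
  qed
  \<comment> \<open>The linear terms combine by
    \<open>\<beta> * (\<beta> - 1) + \<beta> = \<beta>\<^sup>2\<close>.\<close>
  also have "\<dots> = \<beta>\<^sup>2 * (exp (- G z) * (G z + (G z)\<^sup>2))"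
    unfolding sum_b sum_g by (simp add: algebra_simps power2_eq_square)
  also have "\<dots> \<le> \<beta>\<^sup>2 * (2 * \<Phi> z)"
    unfolding \<Phi>_def by (intro mult_left_mono exp_energy_bound G_nonneg) simp
  finally show ?thesis by simp
qed

lemma \<Phi>_bounds: "0 \<le> \<Phi> z" "\<Phi> z \<le> 1"
  unfolding \<Phi>_def using G_nonneg[of z] by auto

lemma D2_bound: assumes "i \<in> J \<times> A" "k \<in> J \<times> A" shows "\<bar>D2 z i k\<bar> \<le> 2 * \<beta>\<^sup>2"
proof -
  have "\<bar>D2 z i k\<bar> \<le> H z i k"
    unfolding D2_def H_def abs_mult using b_nonneg[of z i k] g_nonneg[of z i] g_nonneg[of z k]
    by (auto intro!: mult_left_mono simp: abs_le_iff)
  also have "\<dots> \<le> (\<Sum>k\<in>J \<times> A. H z i k)"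
    using assms fJ fA by (intro member_le_sum) (auto simp: H_nonneg)
  also have "\<dots> \<le> (\<Sum>i\<in>J \<times> A. \<Sum>k\<in>J \<times> A. H z i k)"
    using assms fJ fA by (intro member_le_sum) (auto simp: H_nonneg sum_nonneg)
  also have "\<dots> \<le> 2 * \<beta>\<^sup>2 * \<Phi> z" by (rule sum_H)
  also have "\<dots> \<le> 2 * \<beta>\<^sup>2 * 1" by (intro mult_left_mono \<Phi>_bounds) simp
  finally show ?thesis by simp
qed

lemma D1_bound: assumes "i \<in> J \<times> A" shows "\<bar>D1 z i\<bar> \<le> 2 * \<beta>\<^sup>2"
proof -
  have "\<bar>D1 z i\<bar> = exp (- G z) * g z i" using g_nonneg by (simp add: D1_def abs_mult)
  also have "\<dots> \<le> H z i i"
    unfolding H_def using b_nonneg[of z i i] g_nonneg[of z i] by (intro mult_left_mono) auto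
  also have "\<dots> \<le> (\<Sum>k\<in>J \<times> A. H z i k)"
    using assms fJ fA by (intro member_le_sum) (auto simp: H_nonneg)
  also have "\<dots> \<le> (\<Sum>i\<in>J \<times> A. \<Sum>k\<in>J \<times> A. H z i k)"
    using assms fJ fA by (intro member_le_sum) (auto simp: H_nonneg sum_nonneg)
  also have "\<dots> \<le> 2 * \<beta>\<^sup>2 * \<Phi> z" by (rule sum_H)
  also have "\<dots> \<le> 2 * \<beta>\<^sup>2 * 1" by (intro mult_left_mono \<Phi>_bounds) simp
  finally show ?thesis by simp
qed

text \<open>The hypotheses are asymmetric because of the signs in \<open>D2\<close>. The positive
  terms \<open>b\<close> and the diagonal live inside a block and need the upper bound on
  \<open>\<Delta>\<close>; the term \<open>- g z i * g z k\<close> couples all pairs, but being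
  negative it needs only the lower bound.\<close>

lemma D2_sum_bound:
  assumes C: "0 \<le> C" and lo: "\<And>i k. i \<in> J \<times> A \<Longrightarrow> k \<in> J \<times> A \<Longrightarrow> - C \<le> \<Delta> i k"
    and hi: "\<And>i k. i \<in> J \<times> A \<Longrightarrow> k \<in> J \<times> A \<Longrightarrow> fst i = fst k \<Longrightarrow> \<Delta> i k \<le> C"
  shows "(\<Sum>i\<in>J \<times> A. \<Sum>k\<in>J \<times> A. \<Delta> i k * D2 z i k) \<le> 2 * C * \<beta>\<^sup>2 * \<Phi> z"
proof -
  have arith: "d * (x + y - w) \<le> C * (x + y + w)" if "d * x \<le> C * x" "d * y \<le> C * y" "(- C) * w \<le> d * w" for d x y w :: real
    using that by (simp add: algebra_simps)
  have "\<Delta> i k * D2 z i k \<le> C * H z i k" if ik: "i \<in> J \<times> A" "k \<in> J \<times> A" for i k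
  proof -
    have "\<Delta> i k * b z i k \<le> C * b z i k"
      using hi[OF ik] b_nonneg[of z i k] by (cases "fst i = fst k") (auto intro!: mult_right_mono simp: b_def)
    moreover have "\<Delta> i k * (if i = k then g z i else 0) \<le> C * (if i = k then g z i else 0)"
      using hi[OF ik] g_nonneg[of z i] by (auto intro!: mult_right_mono)
    moreover have "(- C) * (g z i * g z k) \<le> \<Delta> i k * (g z i * g z k)"
      using lo[OF ik] g_nonneg[of z i] g_nonneg[of z k] by (intro mult_right_mono) auto
    ultimately have "\<Delta> i k * (b z i k + (if i = k then g z i else 0) - g z i * g z k)
        \<le> C * (b z i k + (if i = k then g z i else 0) + g z i * g z k)"
      by (rule arith)
    from mult_left_mono[OF this exp_ge_zero, of "- G z"] show ?thesis
      unfolding D2_def H_def mult.left_commute[of "\<Delta> i k" "exp (- G z)"] mult.left_commute[of C "exp (- G z)"] .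
  qed
  then have "(\<Sum>i\<in>J \<times> A. \<Sum>k\<in>J \<times> A. \<Delta> i k * D2 z i k) \<le> (\<Sum>i\<in>J \<times> A. \<Sum>k\<in>J \<times> A. C * H z i k)"
    by (intro sum_mono) auto
  also have "\<dots> = C * (\<Sum>i\<in>J \<times> A. \<Sum>k\<in>J \<times> A. H z i k)" by (simp add: sum_distrib_left)
  also have "\<dots> \<le> C * (2 * \<beta>\<^sup>2 * \<Phi> z)" by (intro mult_left_mono sum_H C)
  finally show ?thesis by (simp add: mult_ac)
qed

lemma cong_restrict:
  "G (restrict z (J \<times> A)) = G z" "\<Phi> (restrict z (J \<times> A)) = \<Phi> z"
  "i \<in> J \<times> A \<Longrightarrow> g (restrict z (J \<times> A)) i = g z i" "i \<in> J \<times> A \<Longrightarrow> D1 (restrict z (J \<times> A)) i = D1 z i"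
  "i \<in> J \<times> A \<Longrightarrow> k \<in> J \<times> A \<Longrightarrow> D2 (restrict z (J \<times> A)) i k = D2 z i k"
proof -
  have S: "S (restrict z (J \<times> A)) j = S z j" if "j \<in> J" for j
    using that by (simp add: S_def)
  show G: "G (restrict z (J \<times> A)) = G z" by (simp add: G_def S)
  show "\<Phi> (restrict z (J \<times> A)) = \<Phi> z" by (simp add: \<Phi>_def G)
  show g: "i \<in> J \<times> A \<Longrightarrow> g (restrict z (J \<times> A)) i = g z i" for i by (auto simp: g_def S)
  show "i \<in> J \<times> A \<Longrightarrow> D1 (restrict z (J \<times> A)) i = D1 z i" by (simp add: D1_def G g)
  show "i \<in> J \<times> A \<Longrightarrow> k \<in> J \<times> A \<Longrightarrow> D2 (restrict z (J \<times> A)) i k = D2 z i k"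
    by (auto simp: D2_def G g b_def S)
qed

lemma measurable_restricted [measurable]:
  "G \<in> borel_measurable (PiM (J \<times> A) (\<lambda>_. borel))" "\<Phi> \<in> borel_measurable (PiM (J \<times> A) (\<lambda>_. borel))"
  "i \<in> J \<times> A \<Longrightarrow> (\<lambda>z. D1 z i) \<in> borel_measurable (PiM (J \<times> A) (\<lambda>_. borel))"
  "i \<in> J \<times> A \<Longrightarrow> k \<in> J \<times> A \<Longrightarrow> (\<lambda>z. D2 z i k) \<in> borel_measurable (PiM (J \<times> A) (\<lambda>_. borel))"
proof -
  have c [measurable]: "(\<lambda>z. z i) \<in> borel_measurable (PiM (J \<times> A) (\<lambda>_. borel))" if "i \<in> J \<times> A" for i
    using that by (rule measurable_component_singleton)
  have S [measurable]: "(\<lambda>z. S z j) \<in> borel_measurable (PiM (J \<times> A) (\<lambda>_. borel))" if "j \<in> J" for j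
    unfolding S_def using that by (intro borel_measurable_sum) (auto intro!: borel_measurable_times borel_measurable_exp c)
  show [measurable]: "G \<in> borel_measurable (PiM (J \<times> A) (\<lambda>_. borel))" unfolding G_def[abs_def] by measurable
  show "\<Phi> \<in> borel_measurable (PiM (J \<times> A) (\<lambda>_. borel))" unfolding \<Phi>_def[abs_def] by measurable
  have g [measurable]: "(\<lambda>z. g z i) \<in> borel_measurable (PiM (J \<times> A) (\<lambda>_. borel))" if "i \<in> J \<times> A" for i
    using that c[OF that] S[of "fst i"] unfolding g_def by (auto intro!: borel_measurable_times borel_measurable_exp powr_real_measurable)
  show "i \<in> J \<times> A \<Longrightarrow> (\<lambda>z. D1 z i) \<in> borel_measurable (PiM (J \<times> A) (\<lambda>_. borel))"
    unfolding D1_def by measurable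
  have b [measurable]: "(\<lambda>z. b z i k) \<in> borel_measurable (PiM (J \<times> A) (\<lambda>_. borel))" if "i \<in> J \<times> A" "k \<in> J \<times> A" for i k
    using that c[OF that(1)] c[OF that(2)] S[of "fst i"] unfolding b_def by (auto intro!: borel_measurable_times borel_measurable_exp powr_real_measurable)
  show "i \<in> J \<times> A \<Longrightarrow> k \<in> J \<times> A \<Longrightarrow> (\<lambda>z. D2 z i k) \<in> borel_measurable (PiM (J \<times> A) (\<lambda>_. borel))"
    unfolding D2_def by measurable
qed

end

subsection \<open>Kahane interpolation\<close>

lemma exp_growth_bound:
  fixes f f' :: "real \<Rightarrow> real"
  assumes d: "\<And>x. (f has_real_derivative f' x) (at x)" and ab: "a \<le> b"
    and le: "\<And>x. a \<le> x \<Longrightarrow> x \<le> b \<Longrightarrow> f' x \<le> L * f x"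
  shows "f b \<le> exp (L * (b - a)) * f a"
proof -
  have "exp (- L * b) * f b \<le> exp (- L * a) * f a"
  proof (rule DERIV_nonpos_imp_nonincreasing[OF ab])
    fix x assume x: "a \<le> x" "x \<le> b"
    have "((\<lambda>x. exp (- L * x) * f x) has_real_derivative (exp (- L * x) * (f' x - L * f x))) (at x)"
      by (auto intro!: derivative_eq_intros d simp: algebra_simps)
    moreover have "exp (- L * x) * (f' x - L * f x) \<le> 0"
      using le[OF x] by (simp add: mult_le_0_iff)
    ultimately show "\<exists>y. ((\<lambda>x. exp (- L * x) * f x) has_real_derivative y) (at x) \<and> y \<le> 0" by blast
  qed
  then have "exp (L * b) * (exp (- L * b) * f b) \<le> exp (L * b) * (exp (- L * a) * f a)"
    by (intro mult_left_mono) auto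
  moreover have "exp (L * b) * exp (- L * b) = 1" "exp (L * b) * exp (- L * a) = exp (L * (b - a))"
    by (simp_all add: mult_exp_exp right_diff_distrib)
  ultimately show ?thesis by (simp only: mult.assoc[symmetric] mult_1_left)
qed

context block_functional
begin

text \<open>
  Kahane's interpolation \<open>cos \<phi> Y + sin \<phi> X\<close>. Block energies are not concave, but the terms with the
  wrong sign are bounded by a multiple of the functional, so Gronwall's inequality applies.
\<close>

theorem kahane_comparison:
  fixes M :: "'m measure" and N :: "'n measure"
    and X :: "'j \<times> 'a \<Rightarrow> 'm \<Rightarrow> real" and Y :: "'j \<times> 'a \<Rightarrow> 'n \<Rightarrow> real"
  assumes M: "prob_space M" and N: "prob_space N"
    and GX: "gaussian_family M (J \<times> A) X KX" and GY: "gaussian_family N (J \<times> A) Y KY"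
    and symX: "\<And>i k. KX i k = KX k i" and symY: "\<And>i k. KY i k = KY k i"
    and posX: "\<And>i. i \<in> J \<times> A \<Longrightarrow> 0 < KX i i" and posY: "\<And>i. i \<in> J \<times> A \<Longrightarrow> 0 < KY i i"
    and C: "0 \<le> C" and lo: "\<And>i k. i \<in> J \<times> A \<Longrightarrow> k \<in> J \<times> A \<Longrightarrow> - C \<le> KX i k - KY i k"
    and hi: "\<And>i k. i \<in> J \<times> A \<Longrightarrow> k \<in> J \<times> A \<Longrightarrow> fst i = fst k \<Longrightarrow> KX i k - KY i k \<le> C"
  shows "(LINT \<omega>|M. \<Phi> (\<lambda>i. X i \<omega>)) \<le> exp (4 * C * \<beta>\<^sup>2) * (LINT \<omega>|N. \<Phi> (\<lambda>i. Y i \<omega>))"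
proof -
  interpret M: prob_space M by fact
  interpret N: prob_space N by fact
  interpret PF: pair_sigma_finite M N ..
  interpret P: pair_prob_space M N ..
  let ?I = "J \<times> A" and ?P = "M \<Otimes>\<^sub>M N"
  have fI: "finite ?I" using fJ fA by simp
  have [measurable]: "i \<in> ?I \<Longrightarrow> X i \<in> borel_measurable M" "i \<in> ?I \<Longrightarrow> Y i \<in> borel_measurable N" for i
    using GX GY by (auto simp: gaussian_family_def)
  have charX: "(CLINT \<omega>|M. iexp (\<Sum>i\<in>?I. c i * X i \<omega>)) = complex_of_real (exp (- (\<Sum>i\<in>?I. \<Sum>k\<in>?I. c i * c k * KX i k) / 2))" for c
    using GX unfolding gaussian_family_def by blast
  have charY: "(CLINT \<omega>|N. iexp (\<Sum>i\<in>?I. c i * Y i \<omega>)) = complex_of_real (exp (- (\<Sum>i\<in>?I. \<Sum>k\<in>?I. c i * c k * KY i k) / 2))" for c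
    using GY unfolding gaussian_family_def by blast
  \<comment> \<open>\<open>U\<close> is the derivative of \<open>Z\<close> in the angle. The
    trigonometric path has bounded speed, unlike the weights \<open>sqrt t\<close> and
    \<open>sqrt (1 - t)\<close>, whose derivatives blow up at the ends.\<close>
  define Z where "Z = (\<lambda>\<phi> i x. cos \<phi> * Y i (snd x) + sin \<phi> * X i (fst x))"
  define U where "U = (\<lambda>\<phi> i x. cos \<phi> * X i (fst x) - sin \<phi> * Y i (snd x))"
  have [measurable]: "i \<in> ?I \<Longrightarrow> Z \<phi> i \<in> borel_measurable ?P" "i \<in> ?I \<Longrightarrow> U \<phi> i \<in> borel_measurable ?P" for i \<phi>
    unfolding Z_def U_def by measurable
  have mr [measurable]: "(\<lambda>x. \<lambda>i\<in>?I. Z \<phi> i x) \<in> measurable ?P (PiM ?I (\<lambda>_. borel))" for \<phi>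
    by measurable
  have [measurable]: "(\<lambda>x. \<Phi> (\<lambda>i. Z \<phi> i x)) \<in> borel_measurable ?P" for \<phi>
    using measurable_compose[OF mr measurable_restricted(2)] by (simp add: cong_restrict)
  have mD1 [measurable]: "i \<in> ?I \<Longrightarrow> (\<lambda>x. D1 (\<lambda>i. Z \<phi> i x) i) \<in> borel_measurable ?P" for i \<phi>
    using measurable_compose[OF mr measurable_restricted(3)[of i]] by (simp add: cong_restrict)
  have mD2 [measurable]: "i \<in> ?I \<Longrightarrow> k \<in> ?I \<Longrightarrow> (\<lambda>x. D2 (\<lambda>i. Z \<phi> i x) i k) \<in> borel_measurable ?P" for i k \<phi>
    using measurable_compose[OF mr measurable_restricted(4)[of i k]] by (simp add: cong_restrict)
  have pairchar: "(CLINT x|?P. iexp ((\<Sum>i\<in>?I. c i * X i (fst x)) + (\<Sum>i\<in>?I. e i * Y i (snd x))))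
     = complex_of_real (exp (- ((\<Sum>i\<in>?I. \<Sum>k\<in>?I. c i * c k * KX i k) + (\<Sum>i\<in>?I. \<Sum>k\<in>?I. e i * e k * KY i k)) / 2))" for c e
  proof -
    have "(CLINT x|?P. iexp ((\<Sum>i\<in>?I. c i * X i (fst x)) + (\<Sum>i\<in>?I. e i * Y i (snd x))))
      = (CLINT \<omega>|M. CLINT \<omega>'|N. iexp ((\<Sum>i\<in>?I. c i * X i (fst (\<omega>, \<omega>'))) + (\<Sum>i\<in>?I. e i * Y i (snd (\<omega>, \<omega>')))))"
    proof (rule PF.integral_fst'[symmetric])
      show "integrable ?P (\<lambda>x. iexp ((\<Sum>i\<in>?I. c i * X i (fst x)) + (\<Sum>i\<in>?I. e i * Y i (snd x))))"
        by (rule P.integrable_iexp) simp_all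
    qed
    also have "\<dots> = (CLINT \<omega>|M. CLINT \<omega>'|N. iexp (\<Sum>i\<in>?I. c i * X i \<omega>) * iexp (\<Sum>i\<in>?I. e i * Y i \<omega>'))"
      by (simp only: fst_conv snd_conv of_real_add distrib_left exp_add)
    also have "\<dots> = (CLINT \<omega>|M. iexp (\<Sum>i\<in>?I. c i * X i \<omega>)) * (CLINT \<omega>'|N. iexp (\<Sum>i\<in>?I. e i * Y i \<omega>'))"
      by (simp only: integral_mult_right_zero integral_mult_left_zero)
    also have "\<dots> = complex_of_real (exp (- (\<Sum>i\<in>?I. \<Sum>k\<in>?I. c i * c k * KX i k) / 2) * exp (- (\<Sum>i\<in>?I. \<Sum>k\<in>?I. e i * e k * KY i k) / 2))"
      by (simp only: charX charY of_real_mult)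
    finally show ?thesis by (simp only: exp_add[symmetric] minus_add_distrib add_divide_distrib)
  qed
  define E where "E = (\<lambda>\<phi>. LINT x|?P. \<Phi> (\<lambda>i. Z \<phi> i x))"
  define E' where "E' = (\<lambda>\<phi>. LINT x|?P. (\<Sum>i\<in>?I. D1 (\<lambda>i. Z \<phi> i x) i * U \<phi> i x))"
  have intX: "integrable ?P (\<lambda>x. X i (fst x))" if "i \<in> ?I" for i
    using gaussian_family_integrable[OF M fI GX that posX[OF that]] that
    by (intro PF.Fubini_integrable) (auto simp: N.prob_space)
  have intY: "integrable ?P (\<lambda>x. Y i (snd x))" if "i \<in> ?I" for i
    using gaussian_family_integrable[OF N fI GY that posY[OF that]] that
    by (intro PF.Fubini_integrable) auto
  have Ub: "\<bar>U \<phi> i x\<bar> \<le> \<bar>X i (fst x)\<bar> + \<bar>Y i (snd x)\<bar>" for \<phi> i x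
  proof -
    have "\<bar>cos \<phi> * X i (fst x)\<bar> \<le> \<bar>X i (fst x)\<bar>" "\<bar>sin \<phi> * Y i (snd x)\<bar> \<le> \<bar>Y i (snd x)\<bar>"
      by (auto simp: abs_mult mult_left_le_one_le)
    then show ?thesis unfolding U_def by linarith
  qed
  have intDU: "integrable ?P (\<lambda>x. D1 (\<lambda>i. Z \<phi> i x) i * U \<phi> i x)" if i: "i \<in> ?I" for i \<phi>
  proof (rule Bochner_Integration.integrable_bound[where f = "\<lambda>x. 2 * \<beta>\<^sup>2 * (\<bar>X i (fst x)\<bar> + \<bar>Y i (snd x)\<bar>)"])
    show "integrable ?P (\<lambda>x. 2 * \<beta>\<^sup>2 * (\<bar>X i (fst x)\<bar> + \<bar>Y i (snd x)\<bar>))"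
      using intX[OF i] intY[OF i] by (intro integrable_mult_right Bochner_Integration.integrable_add integrable_abs)
    show "AE x in ?P. norm (D1 (\<lambda>i. Z \<phi> i x) i * U \<phi> i x) \<le> norm (2 * \<beta>\<^sup>2 * (\<bar>X i (fst x)\<bar> + \<bar>Y i (snd x)\<bar>))"
      using mult_mono[OF D1_bound[OF i] Ub] by (intro AE_I2) (simp add: abs_mult)
  qed (use i in measurable)
  have dE: "(E has_real_derivative E' \<phi>) (at \<phi>)" for \<phi>
    unfolding E_def E'_def
  proof (rule has_real_derivative_integral[where w = "\<lambda>x. \<Sum>i\<in>?I. 2 * \<beta>\<^sup>2 * (\<bar>X i (fst x)\<bar> + \<bar>Y i (snd x)\<bar>)"])
    show "integrable ?P (\<lambda>x. \<Phi> (\<lambda>i. Z \<phi> i x))" for \<phi>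
      by (rule P.integrable_const_bound[of _ 1]) (use \<Phi>_bounds in auto)
    show "(\<lambda>x. \<Sum>i\<in>?I. D1 (\<lambda>i. Z \<phi> i x) i * U \<phi> i x) \<in> borel_measurable ?P" for \<phi>
      by measurable
    show "((\<lambda>\<phi>. \<Phi> (\<lambda>i. Z \<phi> i x)) has_real_derivative (\<Sum>i\<in>?I. D1 (\<lambda>i. Z \<phi> i x) i * U \<phi> i x)) (at \<phi>)" for x \<phi>
    proof (rule \<Phi>_deriv)
      show "((\<lambda>s. Z s i x) has_real_derivative U \<phi> i x) (at \<phi>)" for i
        unfolding Z_def U_def by (auto intro!: derivative_eq_intros)
    qed
    show "integrable ?P (\<lambda>x. \<Sum>i\<in>?I. 2 * \<beta>\<^sup>2 * (\<bar>X i (fst x)\<bar> + \<bar>Y i (snd x)\<bar>))"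
      using intX intY by (intro Bochner_Integration.integrable_sum integrable_mult_right Bochner_Integration.integrable_add integrable_abs)
    show "\<bar>\<Sum>i\<in>?I. D1 (\<lambda>i. Z \<phi> i x) i * U \<phi> i x\<bar> \<le> (\<Sum>i\<in>?I. 2 * \<beta>\<^sup>2 * (\<bar>X i (fst x)\<bar> + \<bar>Y i (snd x)\<bar>))" for \<phi> x
      by (rule order_trans[OF sum_abs sum_mono]) (unfold abs_mult, intro mult_mono D1_bound Ub, auto)
  qed
  \<comment> \<open>The covariance of \<open>U \<phi> i\<close> with \<open>Z \<phi> k\<close> is
    \<open>sin \<phi> * cos \<phi> * (KX i k - KY i k)\<close>, so only the difference of the two
    covariances enters the derivative.\<close>
  have ibp: "(LINT x|?P. U \<phi> i x * D1 (\<lambda>i. Z \<phi> i x) i)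
      = (\<Sum>k\<in>?I. (sin \<phi> * cos \<phi> * (KX i k - KY i k)) * (LINT x|?P. D2 (\<lambda>i. Z \<phi> i x) i k))" if i: "i \<in> ?I" for i \<phi>
  proof -
    let ?K = "\<lambda>j k. (sin \<phi>)\<^sup>2 * KX j k + (cos \<phi>)\<^sup>2 * KY j k"
    have "(LINT x|?P. U \<phi> i x * D1 (\<lambda>i\<in>?I. Z \<phi> i x) i)
      = (\<Sum>k\<in>?I. (sin \<phi> * cos \<phi> * (KX i k - KY i k)) * (LINT x|?P. D2 (\<lambda>i\<in>?I. Z \<phi> i x) i k))"
    proof (rule gaussian_ibp[where v = "(cos \<phi>)\<^sup>2 * KX i i + (sin \<phi>)\<^sup>2 * KY i i"
          and Q = "\<lambda>c. \<Sum>j\<in>?I. \<Sum>k\<in>?I. c j * c k * ?K j k" and B = "2 * \<beta>\<^sup>2" and D = "\<lambda>z. D1 z i" and D' = "\<lambda>k z. D2 z i k"])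
      show "prob_space ?P" by (rule P.prob_space_axioms)
      show "finite ?I" by (rule fI)
      \<comment> \<open>Integration by parts divides by the variance of \<open>U\<close>. As both
        fields have positive variances, this one is positive also at the angles where sine or cosine
        vanishes.\<close>
      show "0 < (cos \<phi>)\<^sup>2 * KX i i + (sin \<phi>)\<^sup>2 * KY i i"
      proof (cases "cos \<phi> = 0")
        case True
        then have "(sin \<phi>)\<^sup>2 = 1" using sin_cos_squared_add[of \<phi>] by simp
        then show ?thesis using True posY[OF i] by simp
      next
        case False
        then show ?thesis using posX[OF i] posY[OF i] by (intro add_pos_nonneg) auto
      qed
      fix a :: real and c :: "'j \<times> 'a \<Rightarrow> real"
      let ?\<delta> = "\<lambda>k. if k = i then a else 0"
      let ?c = "\<lambda>k. cos \<phi> * ?\<delta> k + sin \<phi> * c k" and ?e = "\<lambda>k. - sin \<phi> * ?\<delta> k + cos \<phi> * c k"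
      have e1: "a * U \<phi> i x + (\<Sum>k\<in>?I. c k * Z \<phi> k x) = (\<Sum>k\<in>?I. ?c k * X k (fst x)) + (\<Sum>k\<in>?I. ?e k * Y k (snd x))" for x
      proof -
        have "a * U \<phi> i x = (\<Sum>k\<in>?I. ?\<delta> k * U \<phi> k x)" by (simp only: sum_delta_mult[OF fI i])
        then show ?thesis
          by (simp only: sum.distrib[symmetric]) (intro sum.cong refl, simp add: U_def Z_def algebra_simps)
      qed
      have quad: "(\<Sum>j\<in>?I. \<Sum>k\<in>?I. (s * ?\<delta> j + t * c j) * (s * ?\<delta> k + t * c k) * K j k)
          = s\<^sup>2 * a\<^sup>2 * K i i + 2 * s * t * a * (\<Sum>k\<in>?I. c k * K i k) + t\<^sup>2 * (\<Sum>j\<in>?I. \<Sum>k\<in>?I. c j * c k * K j k)"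
        if sym: "\<And>i k. K i k = K k i" for s t and K :: "'j \<times> 'a \<Rightarrow> 'j \<times> 'a \<Rightarrow> real"
      proof -
        have "(\<Sum>j\<in>?I. \<Sum>k\<in>?I. (s * ?\<delta> j + t * c j) * (s * ?\<delta> k + t * c k) * K j k)
          = (\<Sum>j\<in>?I. \<Sum>k\<in>?I. ?\<delta> j * (?\<delta> k * (s\<^sup>2 * K j k)) + ?\<delta> j * (s * t * (c k * K j k)) + ?\<delta> k * (s * t * (c j * K j k)) + t\<^sup>2 * (c j * c k * K j k))"
          by (intro sum.cong refl) (simp add: algebra_simps power2_eq_square)
        also have "\<dots> = (\<Sum>j\<in>?I. ?\<delta> j * (a * (s\<^sup>2 * K j i)) + ?\<delta> j * (\<Sum>k\<in>?I. s * t * (c k * K j k)) + a * (s * t * (c j * K j i)) + (\<Sum>k\<in>?I. t\<^sup>2 * (c j * c k * K j k)))"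
          by (simp only: sum.distrib sum_distrib_left[symmetric] sum_delta_mult[OF fI i])
        also have "\<dots> = a * (a * (s\<^sup>2 * K i i)) + a * (s * t * (\<Sum>k\<in>?I. c k * K i k)) + a * (s * t * (\<Sum>k\<in>?I. c k * K k i)) + t\<^sup>2 * (\<Sum>j\<in>?I. \<Sum>k\<in>?I. c j * c k * K j k)"
          by (simp only: sum.distrib sum_distrib_left[symmetric] sum_delta_mult[OF fI i])
        also have "(\<Sum>k\<in>?I. c k * K k i) = (\<Sum>k\<in>?I. c k * K i k)" by (intro sum.cong refl) (simp only: sym[of i])
        finally show ?thesis by (simp add: algebra_simps power2_eq_square)
      qed
      have e2: "(\<Sum>j\<in>?I. \<Sum>k\<in>?I. ?c j * ?c k * KX j k) + (\<Sum>j\<in>?I. \<Sum>k\<in>?I. ?e j * ?e k * KY j k)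
         = a\<^sup>2 * ((cos \<phi>)\<^sup>2 * KX i i + (sin \<phi>)\<^sup>2 * KY i i)
          + 2 * a * (\<Sum>k\<in>?I. c k * (sin \<phi> * cos \<phi> * (KX i k - KY i k))) + (\<Sum>j\<in>?I. \<Sum>k\<in>?I. c j * c k * ?K j k)"
      proof -
        have r: "(\<Sum>k\<in>?I. c k * (sin \<phi> * cos \<phi> * (KX i k - KY i k)))
           = sin \<phi> * cos \<phi> * ((\<Sum>k\<in>?I. c k * KX i k) - (\<Sum>k\<in>?I. c k * KY i k))"
          by (simp only: sum_subtractf[symmetric] sum_distrib_left) (simp add: algebra_simps)
        have q: "(\<Sum>j\<in>?I. \<Sum>k\<in>?I. c j * c k * ?K j k)
           = (sin \<phi>)\<^sup>2 * (\<Sum>j\<in>?I. \<Sum>k\<in>?I. c j * c k * KX j k) + (cos \<phi>)\<^sup>2 * (\<Sum>j\<in>?I. \<Sum>k\<in>?I. c j * c k * KY j k)"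
          by (simp only: sum_distrib_left sum.distrib[symmetric]) (simp add: algebra_simps)
        show ?thesis
          unfolding quad[OF symX] quad[OF symY] r q by (simp add: algebra_simps power2_eq_square)
      qed
      show "(CLINT x|?P. iexp (a * U \<phi> i x + (\<Sum>k\<in>?I. c k * Z \<phi> k x))) =
        complex_of_real (exp (- (a\<^sup>2 * ((cos \<phi>)\<^sup>2 * KX i i + (sin \<phi>)\<^sup>2 * KY i i)
          + 2 * a * (\<Sum>k\<in>?I. c k * (sin \<phi> * cos \<phi> * (KX i k - KY i k))) + (\<Sum>j\<in>?I. \<Sum>k\<in>?I. c j * c k * ?K j k)) / 2))"
        by (simp only: e1 pairchar e2)
    next
      fix z c :: "'j \<times> 'a \<Rightarrow> real" and s
      show "((\<lambda>s. D1 (\<lambda>i\<in>?I. z i + s * c i) i) has_real_derivative (\<Sum>k\<in>?I. D2 (\<lambda>i\<in>?I. z i + s * c i) i k * c k)) (at s)"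
        by (rule D1_deriv[OF _ i]) (auto intro!: derivative_eq_intros)
    next
      fix z c :: "'j \<times> 'a \<Rightarrow> real" and k assume k: "k \<in> ?I"
      have cS: "continuous_on UNIV (\<lambda>s. S (\<lambda>i. z i + s * c i) j)" for j
        unfolding S_def by (intro continuous_intros)
      have cG: "continuous_on UNIV (\<lambda>s. G (\<lambda>i. z i + s * c i))"
        unfolding G_def using S_pos by (intro continuous_intros cS) (auto simp: less_imp_neq[symmetric] less_imp_le)
      have cg: "continuous_on UNIV (\<lambda>s. g (\<lambda>i. z i + s * c i) j)" for j
        unfolding g_def using S_pos by (intro continuous_intros cS) (auto simp: less_imp_neq[symmetric])
      have cb: "continuous_on UNIV (\<lambda>s. b (\<lambda>i. z i + s * c i) i k)"
        unfolding b_def using S_pos by (cases "fst i = fst k") (auto intro!: continuous_intros cS simp: less_imp_neq[symmetric])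
      have cif: "continuous_on UNIV (\<lambda>s. if i = k then g (\<lambda>i. z i + s * c i) i else 0)"
        using cg[of i] by (cases "i = k") auto
      have "continuous_on UNIV (\<lambda>s. D2 (\<lambda>i. z i + s * c i) i k)"
        unfolding D2_def by (intro continuous_intros cG cg cb cif)
      then show "continuous_on UNIV (\<lambda>s. D2 (\<lambda>i\<in>?I. z i + s * c i) i k)"
        using i k by (simp add: cong_restrict)
    next
      show "\<bar>D1 z i\<bar> \<le> 2 * \<beta>\<^sup>2" for z by (rule D1_bound[OF i])
      show "k \<in> ?I \<Longrightarrow> \<bar>D2 z i k\<bar> \<le> 2 * \<beta>\<^sup>2" for z k by (rule D2_bound[OF i])
    qed (use i in measurable)
    then show ?thesis using i by (simp add: cong_restrict cong: sum.cong)
  qed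
  \<comment> \<open>On this range of angles \<open>sin \<phi> * cos \<phi>\<close> lies between 0
    and 1, so the rescaled difference of the covariances obeys the same bounds as the difference
    itself.\<close>
  have E'_le: "E' \<phi> \<le> 2 * C * \<beta>\<^sup>2 * E \<phi>" if \<phi>: "0 \<le> \<phi>" "\<phi> \<le> pi / 2" for \<phi>
  proof -
    have sc: "0 \<le> sin \<phi> * cos \<phi>" "sin \<phi> * cos \<phi> \<le> 1"
      using \<phi> by (auto intro!: mult_nonneg_nonneg sin_ge_zero cos_ge_zero mult_le_one)
    have iD2: "integrable ?P (\<lambda>x. D2 (\<lambda>i. Z \<phi> i x) i k)" if "i \<in> ?I" "k \<in> ?I" for i k
      by (rule P.integrable_const_bound[of _ "2 * \<beta>\<^sup>2"]) (use D2_bound that in \<open>auto intro: AE_I2\<close>)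
    have "E' \<phi> = (\<Sum>i\<in>?I. LINT x|?P. U \<phi> i x * D1 (\<lambda>i. Z \<phi> i x) i)"
      unfolding E'_def using intDU by (subst Bochner_Integration.integral_sum) (auto simp: mult.commute)
    also have "\<dots> = (\<Sum>i\<in>?I. \<Sum>k\<in>?I. (sin \<phi> * cos \<phi> * (KX i k - KY i k)) * (LINT x|?P. D2 (\<lambda>i. Z \<phi> i x) i k))"
      by (intro sum.cong refl ibp)
    also have "\<dots> = (LINT x|?P. (\<Sum>i\<in>?I. \<Sum>k\<in>?I. (sin \<phi> * cos \<phi> * (KX i k - KY i k)) * D2 (\<lambda>i. Z \<phi> i x) i k))"
      using iD2 by (subst Bochner_Integration.integral_sum, simp, intro sum.cong refl, subst Bochner_Integration.integral_sum) auto
    also have "\<dots> \<le> (LINT x|?P. 2 * C * \<beta>\<^sup>2 * \<Phi> (\<lambda>i. Z \<phi> i x))"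
    proof (rule integral_mono)
      show "integrable ?P (\<lambda>x. \<Sum>i\<in>?I. \<Sum>k\<in>?I. (sin \<phi> * cos \<phi> * (KX i k - KY i k)) * D2 (\<lambda>i. Z \<phi> i x) i k)"
        using iD2 by (intro Bochner_Integration.integrable_sum integrable_mult_right)
      show "integrable ?P (\<lambda>x. 2 * C * \<beta>\<^sup>2 * \<Phi> (\<lambda>i. Z \<phi> i x))"
        by (intro integrable_mult_right P.integrable_const_bound[of _ 1]) (use \<Phi>_bounds in auto)
      fix x
      show "(\<Sum>i\<in>?I. \<Sum>k\<in>?I. (sin \<phi> * cos \<phi> * (KX i k - KY i k)) * D2 (\<lambda>i. Z \<phi> i x) i k) \<le> 2 * C * \<beta>\<^sup>2 * \<Phi> (\<lambda>i. Z \<phi> i x)"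
      proof (rule D2_sum_bound[OF C])
        fix i k assume ik: "i \<in> ?I" "k \<in> ?I"
        have "- C \<le> sin \<phi> * cos \<phi> * (- C)" using mult_right_mono[OF sc(2) C] by simp
        also have "\<dots> \<le> sin \<phi> * cos \<phi> * (KX i k - KY i k)" by (intro mult_left_mono lo ik sc)
        finally show "- C \<le> sin \<phi> * cos \<phi> * (KX i k - KY i k)" .
        assume f: "fst i = fst k"
        have "sin \<phi> * cos \<phi> * (KX i k - KY i k) \<le> sin \<phi> * cos \<phi> * C" by (intro mult_left_mono hi ik f sc)
        also have "\<dots> \<le> C" using mult_right_mono[OF sc(2) C] by simp
        finally show "sin \<phi> * cos \<phi> * (KX i k - KY i k) \<le> C" .
      qed
    qed
    also have "\<dots> = 2 * C * \<beta>\<^sup>2 * E \<phi>" unfolding E_def by simp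
    finally show ?thesis .
  qed
  have E0: "E 0 = (LINT \<omega>|N. \<Phi> (\<lambda>i. Y i \<omega>))"
  proof -
    have "E 0 = (LINT x|?P. \<Phi> (\<lambda>i. Z 0 i x))" by (simp add: E_def)
    also have "\<dots> = (LINT \<omega>|M. LINT \<omega>'|N. \<Phi> (\<lambda>i. Z 0 i (\<omega>, \<omega>')))"
      by (rule PF.integral_fst'[symmetric], rule P.integrable_const_bound[of _ 1]) (use \<Phi>_bounds in auto)
    finally show ?thesis by (simp add: Z_def M.prob_space)
  qed
  have E1: "E (pi / 2) = (LINT \<omega>|M. \<Phi> (\<lambda>i. X i \<omega>))"
  proof -
    have "E (pi / 2) = (LINT x|?P. \<Phi> (\<lambda>i. Z (pi / 2) i x))" by (simp add: E_def)
    also have "\<dots> = (LINT \<omega>|M. LINT \<omega>'|N. \<Phi> (\<lambda>i. Z (pi / 2) i (\<omega>, \<omega>')))"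
      by (rule PF.integral_fst'[symmetric], rule P.integrable_const_bound[of _ 1]) (use \<Phi>_bounds in auto)
    finally show ?thesis by (simp add: Z_def N.prob_space)
  qed
  \<comment> \<open>An interval of length \<open>pi / 2\<close> gives the exponent
    \<open>C * \<beta>\<^sup>2 * pi\<close>, rounded up by \<open>pi < 4\<close>.\<close>
  have "E (pi / 2) \<le> exp (2 * C * \<beta>\<^sup>2 * (pi / 2 - 0)) * E 0"
    by (rule exp_growth_bound[OF dE]) (use E'_le in auto)
  also have "\<dots> \<le> exp (4 * C * \<beta>\<^sup>2) * E 0"
  proof (rule mult_right_mono)
    have "C * \<beta>\<^sup>2 * pi \<le> C * \<beta>\<^sup>2 * 4" using pi_less_4 C by (intro mult_left_mono) auto
    then show "exp (2 * C * \<beta>\<^sup>2 * (pi / 2 - 0)) \<le> exp (4 * C * \<beta>\<^sup>2)" by simp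
    show "0 \<le> E 0" unfolding E_def by (intro integral_nonneg_AE AE_I2 \<Phi>_bounds)
  qed
  finally show ?thesis unfolding E0 E1 .
qed

end

subsection \<open>The killed Gaussian walk\<close>

lemma nn_integral_stdN: "f \<in> borel_measurable borel \<Longrightarrow> (\<integral>\<^sup>+z. f z \<partial>stdN) = (\<integral>\<^sup>+z. ennreal (std_normal_density z) * f z \<partial>lborel)"
  by (subst nn_integral_density) auto

lemma std_normal_density_shift: "std_normal_density (z - t) = std_normal_density z * exp (z * t - t\<^sup>2 / 2)"
proof -
  have "- (z - t)\<^sup>2 / 2 = - z\<^sup>2 / 2 + (z * t - t\<^sup>2 / 2)"
    by (simp add: power2_eq_square field_simps)
  then show ?thesis unfolding std_normal_density_def by (simp only: exp_add mult.assoc)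
qed

text \<open>The Cameron-Martin formula on the line. It performs the change of measure at each
  generation of the cascade.\<close>

lemma nn_integral_stdN_shift:
  assumes [measurable]: "f \<in> borel_measurable borel"
  shows "(\<integral>\<^sup>+z. f (z + t) \<partial>stdN) = (\<integral>\<^sup>+z. ennreal (exp (z * t - t\<^sup>2 / 2)) * f z \<partial>stdN)"
proof -
  have "(\<integral>\<^sup>+z. f (z + t) \<partial>stdN) = (\<integral>\<^sup>+z. ennreal (std_normal_density z) * f (z + t) \<partial>lborel)"
    by (simp add: nn_integral_stdN)
  also have "\<dots> = (\<integral>\<^sup>+z. ennreal (std_normal_density (z - t)) * f z \<partial>lborel)"
    by (subst nn_integral_real_affine[of _ 1 "- t"]) (auto simp: algebra_simps)
  also have "\<dots> = (\<integral>\<^sup>+z. ennreal (exp (z * t - t\<^sup>2 / 2)) * f z \<partial>stdN)"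
    by (simp add: nn_integral_stdN std_normal_density_shift ennreal_mult' mult.assoc)
  finally show ?thesis .
qed

lemma nn_integral_stdN_uminus:
  assumes [measurable]: "f \<in> borel_measurable borel"
  shows "(\<integral>\<^sup>+z. f (- z) \<partial>stdN) = (\<integral>\<^sup>+z. f z \<partial>stdN)"
proof -
  have "(\<integral>\<^sup>+z. f z \<partial>stdN) = (\<integral>\<^sup>+z. ennreal (std_normal_density z) * f z \<partial>lborel)"
    by (simp add: nn_integral_stdN)
  also have "\<dots> = (\<integral>\<^sup>+z. ennreal (std_normal_density z) * f (- z) \<partial>lborel)"
    by (subst nn_integral_real_affine[of _ "-1" 0]) (auto simp: std_normal_density_def)
  finally show ?thesis by (simp add: nn_integral_stdN)
qed

lemma integral_stdN_shift:
  fixes f :: "real \<Rightarrow> real"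
  assumes [measurable]: "f \<in> borel_measurable borel"
  shows "(LINT z|stdN. f (z + t)) = (LINT z|stdN. exp (z * t - t\<^sup>2 / 2) * f z)"
proof -
  have "(LINT z|stdN. f (z + t)) = (LINT z|lborel. std_normal_density z * f (z + t))"
    by (simp add: integral_stdN)
  also have "\<dots> = (LINT z|lborel. std_normal_density (z - t) * f z)"
    by (subst lborel_integral_real_affine[of 1 _ "- t"]) (auto simp: algebra_simps)
  also have "\<dots> = (LINT z|stdN. exp (z * t - t\<^sup>2 / 2) * f z)"
    by (simp add: integral_stdN std_normal_density_shift mult.assoc)
  finally show ?thesis .
qed

lemma integrable_stdN_shift:
  fixes f :: "real \<Rightarrow> real"
  assumes [measurable]: "f \<in> borel_measurable borel"
  shows "integrable stdN (\<lambda>z. f (z + t)) \<longleftrightarrow> integrable stdN (\<lambda>z. exp (z * t - t\<^sup>2 / 2) * f z)"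
  unfolding integrable_iff_bounded
  using nn_integral_stdN_shift[of "\<lambda>z. ennreal (norm (f z))" t] by (simp add: abs_mult ennreal_mult')

lemma integrable_stdN_id: "integrable stdN (\<lambda>z. z)"
  using integrable_std_normal_distribution_moment[of 1] by simp

lemma integral_stdN_id: "(LINT z|stdN. z) = 0"
  using integral_std_normal_distribution_moment_odd[of 1] by simp

lemma integrable_stdN_exp: "integrable stdN (\<lambda>z. exp (z * t))"
proof -
  interpret prob_space stdN by (rule prob_space_stdN)
  have "integrable stdN (\<lambda>z. exp (z * t - t\<^sup>2 / 2) * 1)"
    by (subst integrable_stdN_shift[symmetric]) auto
  then have "integrable stdN (\<lambda>z. exp (t\<^sup>2 / 2) * (exp (z * t - t\<^sup>2 / 2) * 1))" by (rule integrable_mult_right)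
  then show ?thesis by (simp add: exp_add[symmetric])
qed

lemma integral_stdN_exp: "(LINT z|stdN. exp (z * t)) = exp (t\<^sup>2 / 2)"
proof -
  interpret prob_space stdN by (rule prob_space_stdN)
  have "(LINT z|stdN. exp (z * t - t\<^sup>2 / 2)) = 1"
    using integral_stdN_shift[of "\<lambda>_. 1" t] prob_space by simp
  moreover have "(LINT z|stdN. exp (z * t)) = (LINT z|stdN. exp (t\<^sup>2 / 2) * exp (z * t - t\<^sup>2 / 2))"
    by (simp add: exp_add[symmetric])
  ultimately show ?thesis by simp
qed

lemma measure_stdN_neg: "measure stdN {..<0} = 1 / 2"
proof -
  interpret prob_space stdN by (rule prob_space_stdN)
  have "emeasure stdN {0<..} = emeasure stdN {..<0}"
    using nn_integral_stdN_uminus[of "indicator {..<0}"]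
    by (simp add: indicator_def[abs_def] nn_integral_indicator[symmetric] del: nn_integral_indicator)
  then have 1: "measure stdN {0<..} = measure stdN {..<0}" by (simp add: measure_def)
  have ae: "AE z in stdN. z \<noteq> 0"
    using AE_lborel_singleton[of "0::real"] by (subst AE_density) (auto elim: eventually_mono)
  have "measure stdN {0<..} = measure stdN (space stdN - {..<0})"
    by (rule measure_eq_AE) (use ae in \<open>auto elim!: eventually_mono\<close>)
  also have "\<dots> = 1 - measure stdN {..<0}" by (rule prob_compl) simp
  finally show ?thesis using 1 by simp
qed

text \<open>
  After shifting, the weight \<open>exp (t w)\<close> on \<open>w < 0\<close> favours the region where \<open>f\<close> is positive, so the
  case \<open>h = 0\<close> implies all others.
\<close>

lemma negative_part_nonneg:
  fixes f :: "real \<Rightarrow> real"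
  assumes g: "0 < g" and [measurable]: "f \<in> borel_measurable borel"
    and pos: "\<And>y. - \<kappa> \<le> y \<Longrightarrow> 0 \<le> f y" and neg: "\<And>y. y \<le> - \<kappa> \<Longrightarrow> f y \<le> 0"
    and int: "\<And>h. integrable stdN (\<lambda>z. f (h + g * z))"
    and zero: "0 \<le> (LINT z|stdN. indicator {..<0} z * f (g * z))" and h: "0 \<le> h"
  shows "(LINT z|stdN. indicator {0..} (h + g * z) * f (h + g * z)) \<le> (LINT z|stdN. f (h + g * z))"
proof -
  define t where "t = h / g"
  have t: "0 \<le> t" "h = g * t" using g h by (auto simp: t_def)
  define F where "F = (\<lambda>w. indicator {..<0} w * f (g * w))"
  have [measurable]: "F \<in> borel_measurable borel" unfolding F_def by measurable
  have Fsh: "F (z + t) = indicator {..<0} (h + g * z) * f (h + g * z)" for z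
  proof -
    have "h + g * z = g * (z + t)" using t by (simp add: distrib_left)
    then show ?thesis using g by (auto simp: F_def indicator_def mult_less_0_iff)
  qed
  have i1: "integrable stdN (\<lambda>z. indicator A (h + g * z) * f (h + g * z))" if [measurable]: "A \<in> sets borel" for A h
    by (rule Bochner_Integration.integrable_bound[OF int[of h]]) (auto simp: indicator_def)
  have iF: "integrable stdN (\<lambda>z. exp (z * t - t\<^sup>2 / 2) * F z)"
    using i1[of "{..<0}" h] by (subst integrable_stdN_shift[symmetric]) (auto simp: Fsh)
  have iF0: "integrable stdN F"
  proof -
    have "F = (\<lambda>z. indicator {..<0} (0 + g * z) * f (0 + g * z))"
      using g by (auto simp: F_def indicator_def mult_less_0_iff fun_eq_iff)
    then show ?thesis using i1[of "{..<0}" 0] by simp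
  qed
  \<comment> \<open>The comparison constant is the weight \<open>exp (z * t - t\<^sup>2 / 2)\<close>
    at the point \<open>z = - \<kappa> / g\<close> where \<open>f (g * z)\<close> changes
    sign.\<close>
  have "0 \<le> exp (- \<kappa> / g * t - t\<^sup>2 / 2) * (LINT z|stdN. F z)"
    using zero by (simp add: F_def)
  also have "\<dots> = (LINT z|stdN. exp (- \<kappa> / g * t - t\<^sup>2 / 2) * F z)" by simp
  also have "\<dots> \<le> (LINT z|stdN. exp (z * t - t\<^sup>2 / 2) * F z)"
  proof (rule integral_mono[OF _ iF])
    show "integrable stdN (\<lambda>z. exp (- \<kappa> / g * t - t\<^sup>2 / 2) * F z)" using iF0 by (rule integrable_mult_right)
    fix z
    show "exp (- \<kappa> / g * t - t\<^sup>2 / 2) * F z \<le> exp (z * t - t\<^sup>2 / 2) * F z"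
    proof (cases "z < 0")
      case True
      show ?thesis
      proof (cases "- \<kappa> \<le> g * z")
        case le: True
        then have "- \<kappa> / g \<le> z" using g by (simp add: field_simps)
        then have "- \<kappa> / g * t \<le> z * t" using t(1) by (rule mult_right_mono)
        then show ?thesis using pos[OF le] True by (intro mult_right_mono) (auto simp: F_def)
      next
        case False
        then have "z \<le> - \<kappa> / g" using g by (simp add: field_simps)
        then have "z * t \<le> - \<kappa> / g * t" using t(1) by (rule mult_right_mono)
        then show ?thesis using neg[of "g * z"] False True by (intro mult_right_mono_neg) (auto simp: F_def)
      qed
    qed (simp add: F_def)
  qed
  also have "\<dots> = (LINT z|stdN. indicator {..<0} (h + g * z) * f (h + g * z))"
    by (subst integral_stdN_shift[symmetric]) (auto simp: Fsh)
  finally have n: "0 \<le> (LINT z|stdN. indicator {..<0} (h + g * z) * f (h + g * z))" .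
  have "(LINT z|stdN. f (h + g * z)) = (LINT z|stdN. indicator {0..} (h + g * z) * f (h + g * z) + indicator {..<0} (h + g * z) * f (h + g * z))"
    by (intro Bochner_Integration.integral_cong) (auto simp: indicator_def)
  also have "\<dots> = (LINT z|stdN. indicator {0..} (h + g * z) * f (h + g * z)) + (LINT z|stdN. indicator {..<0} (h + g * z) * f (h + g * z))"
    by (rule Bochner_Integration.integral_add) (auto intro: i1)
  finally show ?thesis using n by simp
qed

text \<open>The walk overshoots zero when it dies, so the identity function is not superharmonic for
  the killed walk; an offset repairs this. At \<open>h = 0\<close> an offset of
  \<open>sqrt (2 / pi) * g\<close> already balances the overshoot; the larger value
  \<open>3/2 * g\<close> is the one that also serves the exponential function of the next
  lemma.\<close>

lemma linear_negative_part:
  assumes g: "0 < g" and h: "0 \<le> h"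
  shows "(LINT z|stdN. indicator {0..} (h + g * z) * (h + g * z + 3/2 * g)) \<le> h + 3/2 * g"
proof -
  interpret prob_space stdN by (rule prob_space_stdN)
  have int: "integrable stdN (\<lambda>z. h + g * z + c)" for h c
    using integrable_stdN_id by (intro Bochner_Integration.integrable_add integrable_mult_right) auto
  have "(LINT z|stdN. indicator {0..} (h + g * z) * (h + g * z + 3/2 * g)) \<le> (LINT z|stdN. h + g * z + 3/2 * g)"
  proof (rule negative_part_nonneg[OF g, where f = "\<lambda>y. y + 3/2 * g" and \<kappa> = "3/2 * g"])
    have e: "indicator {..<0} z * (g * z + 3/2 * g) = g / 2 * (z - \<bar>z\<bar>) + 3/2 * g * indicator {..<0} z" for z :: real
      by (auto simp: indicator_def)
    have eq: "(LINT z|stdN. indicator {..<0} z * (g * z + 3/2 * g)) = g / 2 * (0 - sqrt (2 / pi)) + 3/2 * g * (1/2)"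
    proof -
      have "integrable stdN (indicat_real {..<0})" by (rule integrable_const_bound[of _ 1]) auto
      then have "(LINT z|stdN. g / 2 * (z - \<bar>z\<bar>) + 3/2 * g * indicator {..<0} z)
        = (LINT z|stdN. g / 2 * (z - \<bar>z\<bar>)) + (LINT z|stdN. 3/2 * g * indicator {..<0} z)"
        using integrable_stdN_abs integrable_stdN_id
        by (intro Bochner_Integration.integral_add integrable_mult_right Bochner_Integration.integrable_diff) auto
      also have "(LINT z|stdN. g / 2 * (z - \<bar>z\<bar>)) = g / 2 * (0 - sqrt (2 / pi))"
        using std_normal_distribution_odd_moments_abs[of 0] integrable_stdN_abs integrable_stdN_id integral_stdN_id
        by (simp only: integral_mult_right_zero Bochner_Integration.integral_diff) simp
      also have "(LINT z|stdN. 3/2 * g * indicator {..<0} z) = 3/2 * g * (1/2)"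
        using measure_stdN_neg by (simp only: integral_mult_right_zero) simp
      finally show ?thesis unfolding e .
    qed
    have "sqrt (2 / pi) \<le> 1" using pi_gt3 by (simp add: real_sqrt_le_1_iff)
    then have "0 \<le> g * (3/4 - sqrt (2 / pi) / 2)" using g by (intro mult_nonneg_nonneg) linarith+
    then show "0 \<le> (LINT z|stdN. indicator {..<0} z * (g * z + 3/2 * g))"
      unfolding eq by (simp add: algebra_simps)
  qed (use g h int in auto)
  also have "\<dots> = h + 3/2 * g"
    using integrable_stdN_id integral_stdN_id prob_space by simp
  finally show ?thesis .
qed

text \<open>With \<open>\<mu> = l * g\<close>, the case of starting point zero asks for
  \<open>exp (- 3/2 * \<mu>) * exp (\<mu>\<^sup>2 / 2)\<close> times the normal probability of
  \<open>{..<\<mu>}\<close> to be at most \<open>1/2\<close>. As the normal density is at most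
  \<open>1/2\<close>, that probability is at most \<open>(1 + \<mu>) / 2\<close>, hence at most
  \<open>exp \<mu> / 2\<close>; and \<open>\<mu>\<^sup>2 / 2 + \<mu> \<le> 3/2 * \<mu>\<close>
  because \<open>\<mu> \<le> 1\<close>. This fixes the offset \<open>3/2 * g\<close>.\<close>

lemma exponential_negative_part:
  assumes g: "0 < g" and h: "0 \<le> h" and l: "0 < l" "l * g \<le> 1"
  shows "(LINT z|stdN. indicator {0..} (h + g * z) * (1 - exp (- l * (h + g * z + 3/2 * g))))
     \<le> 1 - exp ((l * g)\<^sup>2 / 2) * exp (- l * (h + 3/2 * g))"
proof -
  interpret prob_space stdN by (rule prob_space_stdN)
  define \<mu> where "\<mu> = l * g"
  have \<mu>: "0 < \<mu>" "\<mu> \<le> 1" using g l by (auto simp: \<mu>_def)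
  have e: "exp (- l * (h + g * z + 3/2 * g)) = exp (- l * (h + 3/2 * g)) * exp (z * (- \<mu>))" for z h
    by (simp add: \<mu>_def exp_add[symmetric] algebra_simps)
  have int: "integrable stdN (\<lambda>z. 1 - exp (- l * (h + g * z + 3/2 * g)))" for h
    unfolding e by (intro Bochner_Integration.integrable_diff integrable_mult_right integrable_stdN_exp) auto
  have "(LINT z|stdN. indicator {0..} (h + g * z) * (1 - exp (- l * (h + g * z + 3/2 * g))))
      \<le> (LINT z|stdN. 1 - exp (- l * (h + g * z + 3/2 * g)))"
  proof (rule negative_part_nonneg[OF g, where f = "\<lambda>y. 1 - exp (- l * (y + 3/2 * g))" and \<kappa> = "3/2 * g"])
    have i: "integrable stdN (\<lambda>z. indicator {..<0} z * exp (z * (- \<mu>)))"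
      by (rule Bochner_Integration.integrable_bound[OF integrable_stdN_exp[of "- \<mu>"]]) (auto simp: indicator_def)
    have "(LINT z|stdN. indicator {..<0} z * exp (z * (- \<mu>))) = exp (\<mu>\<^sup>2 / 2) * (LINT z|stdN. exp (z * (- \<mu>) - (- \<mu>)\<^sup>2 / 2) * indicator {..<0} z)"
      by (simp add: exp_diff mult.commute)
    also have "\<dots> = exp (\<mu>\<^sup>2 / 2) * (LINT z|stdN. indicator {..<0} (z + (- \<mu>)))"
      by (subst integral_stdN_shift[symmetric]) auto
    also have "(LINT z|stdN. indicator {..<0} (z + (- \<mu>))) = (LINT z|stdN. indicat_real {..<\<mu>} z)"
      by (intro Bochner_Integration.integral_cong) (auto simp: indicator_def)
    also have "\<dots> = measure stdN {..<\<mu>}" by simp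
    also have "{..<\<mu>} = {..<0} \<union> {0..<\<mu>}" using \<mu> by auto
    also have "measure stdN ({..<0} \<union> {0..<\<mu>}) = measure stdN {..<0} + measure stdN {0..<\<mu>}"
      by (rule finite_measure_Union) auto
    also have "measure stdN {0..<\<mu>} \<le> \<mu> / 2"
    proof -
      have "emeasure stdN {0..<\<mu>} = (\<integral>\<^sup>+z. ennreal (std_normal_density z) * indicator {0..<\<mu>} z \<partial>lborel)"
        by (subst emeasure_density) auto
      also have "\<dots> \<le> (\<integral>\<^sup>+z. ennreal (1/2) * indicator {0..<\<mu>} z \<partial>lborel)"
      proof (intro nn_integral_mono mult_right_mono ennreal_leI)
        fix z :: real
        have "2 \<le> sqrt (2 * pi)" using pi_gt3 by (intro real_le_rsqrt) auto
        then have "1 / sqrt (2 * pi) \<le> 1/2" by (simp add: field_simps)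
        moreover have "exp (- z\<^sup>2 / 2) \<le> 1" by simp
        ultimately have "1 / sqrt (2 * pi) * exp (- z\<^sup>2 / 2) \<le> 1/2 * 1" by (intro mult_mono) auto
        then show "std_normal_density z \<le> 1/2" by (simp add: std_normal_density_def)
      qed auto
      also have "\<dots> = ennreal (1/2) * ennreal \<mu>"
        using \<mu> by (subst nn_integral_cmult_indicator) auto
      also have "\<dots> = ennreal (\<mu> / 2)" using \<mu> by (subst ennreal_mult[symmetric]) (simp_all del: ennreal_half)
      finally show ?thesis using \<mu> by (simp add: emeasure_eq_measure)
    qed
    finally have "(LINT z|stdN. indicator {..<0} z * exp (z * (- \<mu>))) \<le> exp (\<mu>\<^sup>2 / 2) * (1/2 + \<mu> / 2)"
      by (simp add: measure_stdN_neg)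
    also have "\<dots> \<le> exp (\<mu>\<^sup>2 / 2) * (exp \<mu> / 2)"
      using exp_ge_add_one_self[of \<mu>] by (intro mult_left_mono) auto
    finally have a: "exp (- l * (0 + 3/2 * g)) * (LINT z|stdN. indicator {..<0} z * exp (z * (- \<mu>))) \<le> exp (- l * (0 + 3/2 * g)) * (exp (\<mu>\<^sup>2 / 2) * (exp \<mu> / 2))"
      by (rule mult_left_mono) simp
    have "\<mu>\<^sup>2 / 2 + \<mu> \<le> 3/2 * \<mu>" using \<mu> by (simp add: power2_eq_square mult_left_le)
    then have "exp (- l * (0 + 3/2 * g)) * (exp (\<mu>\<^sup>2 / 2) * exp \<mu>) \<le> 1"
      by (simp add: exp_add[symmetric] \<mu>_def mult.commute mult.left_commute)
    with a have b: "exp (- l * (0 + 3/2 * g)) * (LINT z|stdN. indicator {..<0} z * exp (z * (- \<mu>))) \<le> 1/2" by linarith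
    have "(LINT z|stdN. indicator {..<0} z * (1 - exp (- l * (g * z + 3/2 * g))))
       = (LINT z|stdN. indicat_real {..<0} z - exp (- l * (0 + 3/2 * g)) * (indicator {..<0} z * exp (z * (- \<mu>))))"
      using e[of 0] by (intro Bochner_Integration.integral_cong) (auto simp: indicator_def)
    also have "\<dots> = 1/2 - exp (- l * (0 + 3/2 * g)) * (LINT z|stdN. indicator {..<0} z * exp (z * (- \<mu>)))"
      using i integrable_const_bound[of "indicat_real {..<0}" 1]
      by (subst Bochner_Integration.integral_diff) (auto simp: measure_stdN_neg)
    finally show "0 \<le> (LINT z|stdN. indicator {..<0} z * (1 - exp (- l * (g * z + 3/2 * g))))" using b by linarith
    fix y
    show "- (3/2 * g) \<le> y \<Longrightarrow> 0 \<le> 1 - exp (- l * (y + 3/2 * g))" using l by (simp add: mult_le_0_iff)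
    show "y \<le> - (3/2 * g) \<Longrightarrow> 1 - exp (- l * (y + 3/2 * g)) \<le> 0" using l by (simp add: mult_le_0_iff zero_le_mult_iff)
  qed (use g h int in auto)
  also have "\<dots> = (LINT z|stdN. 1 - exp (- l * (h + 3/2 * g)) * exp (z * (- \<mu>)))" by (simp only: e)
  also have "\<dots> = 1 - exp (- l * (h + 3/2 * g)) * exp (\<mu>\<^sup>2 / 2)"
    using integrable_stdN_exp[of "- \<mu>"] integral_stdN_exp[of "- \<mu>"] prob_space by (subst Bochner_Integration.integral_diff) auto
  finally show ?thesis by (simp add: \<mu>_def mult.commute)
qed

text \<open>One step with increment \<open>g\<close> times a standard normal variable. The killing
  tests the position before the step; killing at the final position is left to \<open>f\<close>,
  which is why the functions fed into the iteration vanish on the negative half-line where this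
  matters.\<close>

definition kwalk :: "real \<Rightarrow> (real \<Rightarrow> ennreal) \<Rightarrow> real \<Rightarrow> ennreal" where
  "kwalk g f h = (if 0 \<le> h then \<integral>\<^sup>+z. f (h + g * z) \<partial>stdN else 0)"

lemma measurable_nn_stdN [measurable]:
  assumes [measurable]: "f \<in> borel_measurable borel"
  shows "(\<lambda>h. \<integral>\<^sup>+z. f (h + g * z) \<partial>stdN) \<in> borel_measurable borel"
proof -
  interpret prob_space stdN by (rule prob_space_stdN)
  have "(\<lambda>(h, z). f (h + g * z)) \<in> borel_measurable (borel \<Otimes>\<^sub>M stdN)" by measurable
  from borel_measurable_nn_integral[OF this] show ?thesis by simp
qed

lemma kwalk_measurable [measurable]:
  assumes [measurable]: "f \<in> borel_measurable borel"
  shows "kwalk g f \<in> borel_measurable borel"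
  unfolding kwalk_def[abs_def] by measurable

lemma kwalk_pow_measurable [measurable]: "f \<in> borel_measurable borel \<Longrightarrow> (kwalk g ^^ m) f \<in> borel_measurable borel"
  by (induction m) auto

lemma kwalk_mono: "(\<And>x. f x \<le> f' x) \<Longrightarrow> kwalk g f h \<le> kwalk g f' h"
  by (auto simp: kwalk_def intro!: nn_integral_mono)

lemma kwalk_pow_mono: "(\<And>x. f x \<le> f' x) \<Longrightarrow> (kwalk g ^^ m) f h \<le> (kwalk g ^^ m) f' h"
  by (induction m arbitrary: h) (auto intro!: kwalk_mono)

lemma kwalk_cmult: "f \<in> borel_measurable borel \<Longrightarrow> kwalk g (\<lambda>x. c * f x) h = c * kwalk g f h"
  by (auto simp: kwalk_def intro!: nn_integral_cmult)

lemma kwalk_add: "f \<in> borel_measurable borel \<Longrightarrow> f' \<in> borel_measurable borel \<Longrightarrow> kwalk g (\<lambda>x. f x + f' x) h = kwalk g f h + kwalk g f' h"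
  by (auto simp: kwalk_def intro!: nn_integral_add)

lemma kwalk_pow_lincomb:
  assumes [measurable]: "f \<in> borel_measurable borel" "f' \<in> borel_measurable borel"
  shows "(kwalk g ^^ m) (\<lambda>x. c * f x + c' * f' x) h = c * (kwalk g ^^ m) f h + c' * (kwalk g ^^ m) f' h"
proof (induction m arbitrary: h)
  case (Suc m)
  have "(kwalk g ^^ m) (\<lambda>x. c * f x + c' * f' x) = (\<lambda>h. c * (kwalk g ^^ m) f h + c' * (kwalk g ^^ m) f' h)"
    using Suc by auto
  then show ?case by (simp add: kwalk_add kwalk_cmult)
qed simp

abbreviation "half_line \<equiv> (\<lambda>h::real. if 0 \<le> h then 1 else 0 :: ennreal)"

lemma kwalk_half_line_le: "(kwalk g ^^ m) half_line h \<le> half_line h"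
proof (induction m arbitrary: h)
  case (Suc m)
  interpret prob_space stdN by (rule prob_space_stdN)
  have "kwalk g ((kwalk g ^^ m) half_line) h \<le> kwalk g (\<lambda>_. 1) h"
    by (rule kwalk_mono) (use order_trans[OF Suc] in auto)
  also have "\<dots> \<le> half_line h" using emeasure_space_1 by (auto simp: kwalk_def)
  finally show ?case by simp
qed simp

lemma kwalk_linear:
  assumes g: "0 < g"
  shows "(kwalk g ^^ m) (\<lambda>h. half_line h * ennreal (h + 3/2 * g)) h \<le> half_line h * ennreal (h + 3/2 * g)"
proof (induction m arbitrary: h)
  case (Suc m)
  have "kwalk g ((kwalk g ^^ m) (\<lambda>h. half_line h * ennreal (h + 3/2 * g))) h \<le> kwalk g (\<lambda>h. half_line h * ennreal (h + 3/2 * g)) h"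
    by (rule kwalk_mono[OF Suc])
  also have "\<dots> \<le> half_line h * ennreal (h + 3/2 * g)"
  proof (cases "0 \<le> h")
    case True
    have int: "integrable stdN (\<lambda>z. indicator {0..} (h + g * z) * (h + g * z + 3/2 * g))"
    proof (rule Bochner_Integration.integrable_bound)
      interpret prob_space stdN by (rule prob_space_stdN)
      show "integrable stdN (\<lambda>z. h + g * z + 3/2 * g)"
        using integrable_stdN_id by (intro Bochner_Integration.integrable_add integrable_mult_right) auto
    qed (auto simp: indicator_def)
    have "kwalk g (\<lambda>h. half_line h * ennreal (h + 3/2 * g)) h = (\<integral>\<^sup>+z. ennreal (indicator {0..} (h + g * z) * (h + g * z + 3/2 * g)) \<partial>stdN)"
      using True by (auto simp: kwalk_def indicator_def intro!: nn_integral_cong)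
    also have "\<dots> = ennreal (LINT z|stdN. indicator {0..} (h + g * z) * (h + g * z + 3/2 * g))"
      by (rule nn_integral_eq_integral[OF int]) (use g in \<open>auto simp: indicator_def\<close>)
    also have "\<dots> \<le> ennreal (h + 3/2 * g)" by (intro ennreal_leI linear_negative_part g True)
    finally show ?thesis using True by simp
  qed (simp add: kwalk_def)
  finally show ?case by simp
qed simp

text \<open>A Tauberian argument: the discounted sum of the survival probabilities is bounded
  through a superharmonic function, and since these probabilities decrease in the number of steps,
  the sum also bounds the last of them.\<close>

lemma kwalk_stay:
  assumes g: "0 < g" and h: "0 \<le> h"
  shows "(kwalk g ^^ m) half_line h \<le> ennreal (3 * (h + 3/2 * g) / (g * sqrt (real (m + 1))))"
proof -
  interpret N: prob_space stdN by (rule prob_space_stdN)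
  \<comment> \<open>Chosen so that the discount \<open>q\<close> satisfies
    \<open>q ^ (m + 1) = exp (- 1/2)\<close>: the discounting becomes effective at the time scale
    \<open>m\<close> of interest.\<close>
  define \<mu> where "\<mu> = 1 / sqrt (real (m + 1))"
  define l where "l = \<mu> / g"
  define q where "q = exp (- (\<mu>\<^sup>2) / 2)"
  have \<mu>: "0 < \<mu>" "\<mu> \<le> 1" by (auto simp: \<mu>_def)
  have l: "0 < l" "l * g = \<mu>" using g \<mu> by (auto simp: l_def)
  have q: "0 < q" "q < 1" using \<mu> by (auto simp: q_def)
  \<comment> \<open>The exponential function of \<open>exponential_negative_part\<close>, normalised
    so that 1 plus \<open>q\<close> times its killed expectation is at most \<open>F\<close>. Hence
    \<open>F\<close> dominates every partial sum \<open>s i\<close>.\<close>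
  define F where "F = (\<lambda>h. (1 - exp (- l * (h + 3/2 * g))) / (1 - q))"
  have F0: "0 \<le> F h" if "0 \<le> h" for h using that g l q by (auto simp: F_def intro!: divide_nonneg_nonneg)
  have F1: "1 \<le> F h" if "0 \<le> h" for h
  proof -
    have "\<mu>\<^sup>2 / 2 \<le> \<mu> * (3/2)" using \<mu> by (simp add: power2_eq_square mult_left_le)
    also have "\<dots> = l * (3/2 * g)" by (simp flip: l(2))
    also have "\<dots> \<le> l * (h + 3/2 * g)" using that l by (intro mult_left_mono) auto
    finally have "exp (- (l * (h + 3/2 * g))) \<le> exp (- (\<mu>\<^sup>2 / 2))" by (simp only: exp_le_cancel_iff neg_le_iff_le)
    then have "1 - q \<le> 1 - exp (- l * (h + 3/2 * g))" by (simp add: q_def)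
    then show ?thesis using q by (simp add: F_def le_divide_eq_1_pos)
  qed
  \<comment> \<open>The partial sum of \<open>q ^ j\<close> times the probability of surviving
    \<open>j\<close> steps, over \<open>j \<le> i\<close>, written as a recursion in the first
    step.\<close>
  define s where "s = rec_nat half_line (\<lambda>_ f h. half_line h + ennreal q * kwalk g f h)"
  have s0: "s 0 = half_line" and sS: "s (Suc i) = (\<lambda>h. half_line h + ennreal q * kwalk g (s i) h)" for i
    by (auto simp: s_def)
  have sm [measurable]: "s i \<in> borel_measurable borel" for i by (induction i) (auto simp: s0 sS)
  have sF: "s i h \<le> half_line h * ennreal (F h)" for i h
  proof (induction i arbitrary: h)
    case 0
    show ?case
    proof (cases "0 \<le> h")
      case True
      have "ennreal 1 \<le> ennreal (F h)" by (intro ennreal_leI F1 True)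
      then show ?thesis using True by (simp add: s0)
    qed (simp add: s0)
  next
    case (Suc i)
    show ?case
    proof (cases "0 \<le> h")
      case True
      have int: "integrable stdN (\<lambda>z. indicator {0..} (h + g * z) * F (h + g * z))"
      proof (rule N.integrable_const_bound[of _ "1 / (1 - q)"])
        show "AE z in stdN. norm (indicator {0..} (h + g * z) * F (h + g * z)) \<le> 1 / (1 - q)"
        proof (rule AE_I2)
          fix z
          have "F y \<le> 1 / (1 - q)" for y unfolding F_def using q by (intro divide_right_mono) auto
          then show "norm (indicator {0..} (h + g * z) * F (h + g * z)) \<le> 1 / (1 - q)"
            using F0[of "h + g * z"] q by (auto simp: indicator_def)
        qed
      qed (auto simp: F_def)
      have "kwalk g (s i) h \<le> kwalk g (\<lambda>h. half_line h * ennreal (F h)) h"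
        by (rule kwalk_mono[OF Suc])
      also have "\<dots> = (\<integral>\<^sup>+z. ennreal (indicator {0..} (h + g * z) * F (h + g * z)) \<partial>stdN)"
        using True by (auto simp: kwalk_def indicator_def intro!: nn_integral_cong)
      also have "\<dots> = ennreal (LINT z|stdN. indicator {0..} (h + g * z) * F (h + g * z))"
        by (rule nn_integral_eq_integral[OF int]) (use F0 in \<open>auto simp: indicator_def\<close>)
      also have "(LINT z|stdN. indicator {0..} (h + g * z) * F (h + g * z))
         = (LINT z|stdN. indicator {0..} (h + g * z) * (1 - exp (- l * (h + g * z + 3/2 * g)))) / (1 - q)"
        by (simp add: F_def)
      also have "\<dots> \<le> (1 - exp (\<mu>\<^sup>2 / 2) * exp (- l * (h + 3/2 * g))) / (1 - q)"
        using exponential_negative_part[OF g True l(1)] l(2) \<mu> q by (intro divide_right_mono) auto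
      finally have "ennreal q * kwalk g (s i) h \<le> ennreal q * ennreal ((1 - exp (\<mu>\<^sup>2 / 2) * exp (- l * (h + 3/2 * g))) / (1 - q))"
        by (auto intro!: mult_left_mono ennreal_leI)
      also have "\<dots> = ennreal (q * ((1 - exp (\<mu>\<^sup>2 / 2) * exp (- l * (h + 3/2 * g))) / (1 - q)))"
        using q by (intro ennreal_mult'[symmetric]) simp
      \<comment> \<open>The discount \<open>q\<close> is the inverse of the factor
        \<open>exp (\<mu>\<^sup>2 / 2)\<close> that one step produces, so the exponential is
        reproduced exactly and only the constant changes, by 1.\<close>
      also have "q * ((1 - exp (\<mu>\<^sup>2 / 2) * exp (- l * (h + 3/2 * g))) / (1 - q)) = F h - 1"
      proof -
        have gen: "q * ((1 - E * x) / (1 - q)) = (1 - x) / (1 - q) - 1" if "q * E = 1" for E x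
        proof -
          have "q * (1 - E * x) = q - x" using that by (simp add: right_diff_distrib mult.assoc[symmetric])
          then show ?thesis using q by (simp add: field_simps)
        qed
        have "q * exp (\<mu>\<^sup>2 / 2) = 1" by (simp add: q_def exp_add[symmetric])
        then show ?thesis unfolding F_def by (rule gen)
      qed
      finally have "s (Suc i) h \<le> 1 + ennreal (F h - 1)" using True by (simp add: sS)
      also have "\<dots> = ennreal (F h)"
      proof -
        have "1 \<le> F h" using F1[OF True] .
        then show ?thesis by (simp add: ennreal_plus[symmetric] ennreal_1[symmetric] del: ennreal_plus ennreal_1)
      qed
      finally show ?thesis using True by simp
    qed (simp add: sS kwalk_def)
  qed
  \<comment> \<open>Monotonicity of survival in the number of steps enters here, through
    \<open>kwalk_half_line_le\<close> applied to the term with weight 1.\<close>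
  have su: "ennreal (\<Sum>j\<le>i. q ^ j) * (kwalk g ^^ i) half_line h \<le> s i h" for i h
  proof (induction i arbitrary: h)
    case (Suc i)
    have "(\<Sum>j\<le>Suc i. q ^ j) = 1 + q * (\<Sum>j\<le>i. q ^ j)"
      by (subst sum.atMost_Suc_shift) (simp add: sum_distrib_left)
    then have "ennreal (\<Sum>j\<le>Suc i. q ^ j) = 1 + ennreal q * ennreal (\<Sum>j\<le>i. q ^ j)"
      using q by (simp add: ennreal_mult'[symmetric] sum_nonneg)
    then have "ennreal (\<Sum>j\<le>Suc i. q ^ j) * (kwalk g ^^ Suc i) half_line h
      = (kwalk g ^^ Suc i) half_line h + ennreal q * (ennreal (\<Sum>j\<le>i. q ^ j) * kwalk g ((kwalk g ^^ i) half_line) h)"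
      by (simp add: distrib_right mult.assoc)
    also have "\<dots> = (kwalk g ^^ Suc i) half_line h + ennreal q * (kwalk g (\<lambda>h. ennreal (\<Sum>j\<le>i. q ^ j) * (kwalk g ^^ i) half_line h) h)"
      by (subst kwalk_cmult) auto
    also have "\<dots> \<le> half_line h + ennreal q * kwalk g (s i) h"
      by (intro add_mono kwalk_half_line_le mult_left_mono kwalk_mono Suc) simp
    finally show ?case by (simp add: sS)
  qed (simp add: s0)
  have gs: "(\<Sum>j\<le>m. q ^ j) = (1 - exp (- 1/2)) / (1 - q)"
  proof -
    have "q ^ Suc m = exp (real (Suc m) * (- (\<mu>\<^sup>2) / 2))" unfolding q_def by (rule exp_of_nat_mult[symmetric])
    also have "real (Suc m) * (- (\<mu>\<^sup>2) / 2) = - 1/2" by (simp add: \<mu>_def power_divide field_simps)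
    finally have "q ^ Suc m = exp (- 1/2)" .
    then show ?thesis using sum_gp_basic[of q m] q by (simp add: field_simps)
  qed
  \<comment> \<open>The reciprocal of this bound is the factor 3 in the statement.\<close>
  have e: "1/3 \<le> 1 - exp (- 1/2 :: real)"
  proof -
    have "1 + 1/2 + (1/2)\<^sup>2 / 2 \<le> exp (1/2 :: real)" by (rule exp_lower_Taylor_quadratic) simp
    then have "3/2 \<le> exp (1/2 :: real)" by (simp add: power2_eq_square)
    then have "inverse (exp (1/2 :: real)) \<le> inverse (3/2)" by (intro le_imp_inverse_le) auto
    then show ?thesis by (simp add: exp_minus)
  qed
  have gp: "0 < (\<Sum>j\<le>m. q ^ j)" unfolding gs using e q by simp
  have "ennreal (\<Sum>j\<le>m. q ^ j) * (kwalk g ^^ m) half_line h \<le> ennreal (F h)"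
    using order_trans[OF su[of m h] sF[of m h]] h by simp
  then have "ennreal (1 / (\<Sum>j\<le>m. q ^ j)) * (ennreal (\<Sum>j\<le>m. q ^ j) * (kwalk g ^^ m) half_line h) \<le> ennreal (1 / (\<Sum>j\<le>m. q ^ j)) * ennreal (F h)"
    by (rule mult_left_mono) simp
  then have "(kwalk g ^^ m) half_line h \<le> ennreal (1 / (\<Sum>j\<le>m. q ^ j) * F h)"
    using gp F0[OF h] by (simp add: mult.assoc[symmetric] ennreal_mult'[symmetric])
  also have "1 / (\<Sum>j\<le>m. q ^ j) * F h \<le> 3 * (h + 3/2 * g) / (g * sqrt (real (m + 1)))"
  proof -
    have "1 / (\<Sum>j\<le>m. q ^ j) * F h = (1 - exp (- l * (h + 3/2 * g))) / (1 - exp (- 1/2))"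
    proof -
      have gen: "1 / (b / c) * (a / c) = a / b" if "c \<noteq> 0" for a b c :: real using that by simp
      show ?thesis unfolding gs F_def by (rule gen) (use q in simp)
    qed
    also have "\<dots> \<le> (l * (h + 3/2 * g)) / (1/3)"
      using exp_ge_add_one_self[of "- l * (h + 3/2 * g)"] e g h l by (intro frac_le) auto
    also have "\<dots> = 3 * (h + 3/2 * g) / (g * sqrt (real (m + 1)))"
      by (simp add: l_def \<mu>_def field_simps)
    finally show ?thesis .
  qed
  finally show ?thesis by (simp add: ennreal_leI)
qed

subsection \<open>Gaussian cascades\<close>

lemma nn_integral_stdN_conv:
  assumes [measurable]: "f \<in> borel_measurable borel"
  shows "(\<integral>\<^sup>+z. (\<integral>\<^sup>+z'. f (h + a * z + b * z') \<partial>stdN) \<partial>stdN) = (\<integral>\<^sup>+z. f (h + sqrt (a\<^sup>2 + b\<^sup>2) * z) \<partial>stdN)"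
proof -
  interpret N: prob_space stdN by (rule prob_space_stdN)
  interpret PF: pair_sigma_finite stdN stdN ..
  interpret P: pair_prob_space stdN stdN ..
  let ?P = "stdN \<Otimes>\<^sub>M stdN" and ?c = "sqrt (a\<^sup>2 + b\<^sup>2)"
  have law: "distr ?P borel (\<lambda>x. a * fst x + b * snd x) = distr stdN borel (\<lambda>z. ?c * z)"
  proof (rule Levy_uniqueness)
    show "real_distribution (distr ?P borel (\<lambda>x. a * fst x + b * snd x))"
      by (rule P.real_distribution_distr) simp
    show "real_distribution (distr stdN borel (\<lambda>z. ?c * z))"
      by (rule N.real_distribution_distr) simp
    show "char (distr ?P borel (\<lambda>x. a * fst x + b * snd x)) = char (distr stdN borel (\<lambda>z. ?c * z))"
    proof
      fix u
      have "char (distr ?P borel (\<lambda>x. a * fst x + b * snd x)) u = (CLINT x|?P. iexp (u * (a * fst x + b * snd x)))"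
        unfolding char_def by (subst integral_distr) auto
      also have "\<dots> = (CLINT z|stdN. CLINT z'|stdN. iexp (u * (a * fst (z, z') + b * snd (z, z'))))"
        by (rule PF.integral_fst'[symmetric], rule P.integrable_iexp) simp_all
      also have "\<dots> = (CLINT z|stdN. CLINT z'|stdN. iexp ((u * a) * z) * iexp ((u * b) * z'))"
        by (simp only: fst_conv snd_conv distrib_left of_real_add exp_add mult.assoc)
      also have "\<dots> = (CLINT z|stdN. iexp ((u * a) * z)) * (CLINT z'|stdN. iexp ((u * b) * z'))"
        by (simp only: integral_mult_right_zero integral_mult_left_zero)
      also have "\<dots> = complex_of_real (exp (- ((u * a)\<^sup>2) / 2) * exp (- ((u * b)\<^sup>2) / 2))"
        unfolding iexp_stdN by (simp only: of_real_mult)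
      also have "exp (- ((u * a)\<^sup>2) / 2) * exp (- ((u * b)\<^sup>2) / 2) = exp (- ((u * ?c)\<^sup>2) / 2)"
        by (simp add: mult_exp_exp power_mult_distrib distrib_left add_divide_distrib)
      also have "complex_of_real \<dots> = (CLINT z|stdN. iexp ((u * ?c) * z))"
        by (simp only: iexp_stdN)
      also have "\<dots> = char (distr stdN borel (\<lambda>z. ?c * z)) u"
        unfolding char_def by (subst integral_distr) (simp_all add: mult.assoc)
      finally show "char (distr ?P borel (\<lambda>x. a * fst x + b * snd x)) u = char (distr stdN borel (\<lambda>z. ?c * z)) u" .
    qed
  qed
  have "(\<integral>\<^sup>+z. (\<integral>\<^sup>+z'. f (h + a * z + b * z') \<partial>stdN) \<partial>stdN) = (\<integral>\<^sup>+x. f (h + (a * fst x + b * snd x)) \<partial>?P)"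
    by (subst N.nn_integral_fst[symmetric]) (auto simp: add.assoc)
  also have "\<dots> = (\<integral>\<^sup>+y. f (h + y) \<partial>distr ?P borel (\<lambda>x. a * fst x + b * snd x))"
    by (subst nn_integral_distr) auto
  also have "\<dots> = (\<integral>\<^sup>+z. f (h + ?c * z) \<partial>stdN)"
    unfolding law by (subst nn_integral_distr) auto
  finally show ?thesis .
qed

lemma kwalk_pow_le_gaussian:
  assumes [measurable]: "f \<in> borel_measurable borel"
  shows "(kwalk g ^^ Suc m) f h \<le> (\<integral>\<^sup>+z. f (h + g * sqrt (Suc m) * z) \<partial>stdN)"
proof (induction m arbitrary: h)
  case 0
  then show ?case by (auto simp: kwalk_def)
next
  case (Suc m)
  have "(kwalk g ^^ Suc (Suc m)) f h \<le> (\<integral>\<^sup>+z. (kwalk g ^^ Suc m) f (h + g * z) \<partial>stdN)"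
    by (subst funpow.simps) (auto simp: kwalk_def)
  also have "\<dots> \<le> (\<integral>\<^sup>+z. (\<integral>\<^sup>+z'. f (h + g * z + g * sqrt (Suc m) * z') \<partial>stdN) \<partial>stdN)"
    by (intro nn_integral_mono Suc)
  also have "\<dots> = (\<integral>\<^sup>+z. f (h + sqrt (g\<^sup>2 + (g * sqrt (Suc m))\<^sup>2) * z) \<partial>stdN)"
    by (rule nn_integral_stdN_conv) simp
  also have "sqrt (g\<^sup>2 + (g * sqrt (Suc m))\<^sup>2) = \<bar>g\<bar> * sqrt (Suc (Suc m))"
    by (simp add: power_mult_distrib real_sqrt_mult[symmetric] flip: real_sqrt_abs) (simp add: algebra_simps)
  also have "(\<integral>\<^sup>+z. f (h + \<bar>g\<bar> * sqrt (Suc (Suc m)) * z) \<partial>stdN) = (\<integral>\<^sup>+z. f (h + g * sqrt (Suc (Suc m)) * z) \<partial>stdN)"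
    using nn_integral_stdN_uminus[of "\<lambda>z. f (h + g * sqrt (Suc (Suc m)) * z)"] by (simp add: abs_if)
  finally show ?case .
qed

text \<open>The bound is crude on the left, but it is the integral of \<open>exp (- s)\<close> over
  all \<open>s \<ge> max z 0\<close>. As a function of \<open>z\<close> it is therefore a mixture of
  indicators of the half-lines \<open>{..s}\<close> with \<open>s \<ge> 0\<close>, the sets on which
  \<open>gaussian_smoothing\<close> has information.\<close>

lemma std_normal_density_le_exp: "std_normal_density z \<le> exp (- max z 0)"
proof -
  have s: "2 \<le> sqrt (2 * pi)" using pi_gt3 by (intro real_le_rsqrt) auto
  have "std_normal_density z = exp (- (z\<^sup>2) / 2) / sqrt (2 * pi)" by (simp add: std_normal_density_def)
  also have "\<dots> \<le> exp (1/2 - max z 0) / 2"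
  proof (rule frac_le)
    have "0 \<le> (z - 1)\<^sup>2" by simp
    then have "- (z\<^sup>2) / 2 \<le> 1/2 - max z 0" by (auto simp: power2_eq_square algebra_simps max_def intro: order_trans[of _ 0])
    then show "exp (- (z\<^sup>2) / 2) \<le> exp (1/2 - max z 0)" by simp
  qed (use s in auto)
  also have "\<dots> = exp (1/2) / 2 * exp (- max z 0)" by (simp add: mult_exp_exp)
  also have "\<dots> \<le> 1 * exp (- max z 0)"
  proof (rule mult_right_mono)
    have "(exp (1/2 :: real))\<^sup>2 = exp 1" by (simp add: exp_double[symmetric])
    also have "\<dots> \<le> 2\<^sup>2" using exp_le by simp
    finally have "exp (1/2 :: real) \<le> 2" by (rule power2_le_imp_le) simp
    then show "exp (1/2) / 2 \<le> (1::real)" by simp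
  qed simp
  finally show ?thesis by simp
qed

lemma nn_integral_exp_atLeast: "(\<integral>\<^sup>+s. ennreal (exp (- s)) * indicator {a..} s \<partial>lborel) = ennreal (exp (- a))" for a :: real
proof -
  have "((\<lambda>s::real. - exp (- s)) \<longlongrightarrow> - 0) at_top"
    by (intro tendsto_minus filterlim_compose[OF exp_at_bot filterlim_uminus_at_bot_at_top])
  then have "(\<integral>\<^sup>+s. ennreal (exp (- s)) * indicator {a..} s \<partial>lborel) = ennreal (- 0 - (- exp (- a)))"
    by (intro nn_integral_FTC_atLeast) (auto intro!: derivative_eq_intros)
  then show ?thesis by simp
qed

lemma nn_integral_affine_exp: 
  assumes "0 \<le> a" "0 \<le> b"
  shows "(\<integral>\<^sup>+s. ennreal (exp (- s)) * indicator {0..} s * ennreal (a + b * s) \<partial>lborel) = ennreal (a + b)"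
proof -
  have "(\<integral>\<^sup>+s. ennreal (exp (- s)) * indicator {0..} s * ennreal (a + b * s) \<partial>lborel)
    = (\<integral>\<^sup>+s. ennreal a * (ennreal (s ^ 0 * exp (- s)) * indicator {0..} s) + ennreal b * (ennreal (s ^ 1 * exp (- s)) * indicator {0..} s) \<partial>lborel)"
    using assms by (intro nn_integral_cong) (auto simp: indicator_def ennreal_mult' distrib_left mult.commute mult.left_commute)
  also have "\<dots> = ennreal a * (\<integral>\<^sup>+s. ennreal (s ^ 0 * exp (- s)) * indicator {0..} s \<partial>lborel) + ennreal b * (\<integral>\<^sup>+s. ennreal (s ^ 1 * exp (- s)) * indicator {0..} s \<partial>lborel)"
    by (subst nn_integral_add) (auto simp: nn_integral_cmult)
  also have "\<dots> = ennreal a + ennreal b"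
    by (subst (1 2) nn_intergal_power_times_exp_Ici) simp
  finally show ?thesis using assms by (simp add: ennreal_plus)
qed

lemma ennreal_affine: "0 \<le> a \<Longrightarrow> 0 \<le> b \<Longrightarrow> 0 \<le> y \<Longrightarrow> ennreal (a + b * y) = ennreal a + ennreal b * ennreal y"
  by (simp add: ennreal_plus ennreal_mult')

text \<open>
  The normal density is dominated by a mixture of indicators of half-lines, so bounds for the integrals
  of \<open>f\<close> over half-lines suffice.
\<close>

lemma gaussian_smoothing:
  assumes [measurable]: "f \<in> borel_measurable borel" and C: "0 \<le> C" and \<sigma>: "0 < \<sigma>" and h: "0 \<le> h"
    and av: "\<And>L. 0 \<le> L \<Longrightarrow> (\<integral>\<^sup>+y. f y * indicator {..L} y \<partial>lborel) \<le> ennreal (C * (1 + L))"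
  shows "(\<integral>\<^sup>+z. f (h + \<sigma> * z) \<partial>stdN) \<le> ennreal (C * (1 + h + \<sigma>) / \<sigma>)"
proof -
  have "(\<integral>\<^sup>+z. f (h + \<sigma> * z) \<partial>stdN) \<le> (\<integral>\<^sup>+z. ennreal (exp (- max z 0)) * f (h + \<sigma> * z) \<partial>lborel)"
    by (simp add: nn_integral_stdN) (intro nn_integral_mono mult_right_mono ennreal_leI std_normal_density_le_exp zero_le)
  also have "\<dots> = (\<integral>\<^sup>+z. (\<integral>\<^sup>+s. ennreal (exp (- s)) * indicator {max z 0..} s * f (h + \<sigma> * z) \<partial>lborel) \<partial>lborel)"
    by (simp add: nn_integral_multc nn_integral_exp_atLeast)
  also have "\<dots> = (\<integral>\<^sup>+s. (\<integral>\<^sup>+z. ennreal (exp (- s)) * indicator {max z 0..} s * f (h + \<sigma> * z) \<partial>lborel) \<partial>lborel)"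
  proof (rule lborel_pair.Fubini'[symmetric])
    have "(\<lambda>x. ennreal (exp (- snd x)) * indicator {x. max (fst x) 0 \<le> snd x} x * f (h + \<sigma> * fst x)) \<in> borel_measurable (lborel \<Otimes>\<^sub>M lborel)"
      by measurable
    then show "(\<lambda>(z, s). ennreal (exp (- s)) * indicator {max z 0..} s * f (h + \<sigma> * z)) \<in> borel_measurable (lborel \<Otimes>\<^sub>M lborel)"
      by (rule measurable_cong[THEN iffD1, rotated]) (auto simp: indicator_def)
  qed
  also have "\<dots> \<le> (\<integral>\<^sup>+s. ennreal (exp (- s)) * indicator {0..} s * ennreal (C * (1 + h) / \<sigma> + C * s) \<partial>lborel)"
  proof (rule nn_integral_mono)
    fix s :: real
    show "(\<integral>\<^sup>+z. ennreal (exp (- s)) * indicator {max z 0..} s * f (h + \<sigma> * z) \<partial>lborel)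
        \<le> ennreal (exp (- s)) * indicator {0..} s * ennreal (C * (1 + h) / \<sigma> + C * s)"
    proof (cases "0 \<le> s")
      case True
      have "(\<integral>\<^sup>+z. ennreal (exp (- s)) * indicator {max z 0..} s * f (h + \<sigma> * z) \<partial>lborel)
        = ennreal (exp (- s)) * (\<integral>\<^sup>+z. f (h + \<sigma> * z) * indicator {..h + \<sigma> * s} (h + \<sigma> * z) \<partial>lborel)"
        using True \<sigma> by (subst nn_integral_cmult[symmetric]) (auto intro!: nn_integral_cong simp: indicator_def)
      also have "(\<integral>\<^sup>+z. f (h + \<sigma> * z) * indicator {..h + \<sigma> * s} (h + \<sigma> * z) \<partial>lborel)
         = ennreal (1 / \<sigma>) * (\<integral>\<^sup>+y. f y * indicator {..h + \<sigma> * s} y \<partial>lborel)"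
        using \<sigma> nn_integral_real_affine[of "\<lambda>y. f y * indicator {..h + \<sigma> * s} y" \<sigma> h]
        by (simp add: mult.assoc[symmetric] ennreal_mult'[symmetric])
      also have "\<dots> \<le> ennreal (1 / \<sigma>) * ennreal (C * (1 + (h + \<sigma> * s)))"
        using \<sigma> h True by (intro mult_left_mono av) auto
      also have "\<dots> = ennreal (C * (1 + h) / \<sigma> + C * s)"
        using \<sigma> by (subst ennreal_mult'[symmetric]) (auto simp: field_simps)
      finally show ?thesis using True by (simp add: mult_left_mono)
    qed (simp add: indicator_def)
  qed
  also have "\<dots> = ennreal (C * (1 + h) / \<sigma> + C)"
    using C h \<sigma> by (intro nn_integral_affine_exp) auto
  also have "C * (1 + h) / \<sigma> + C = C * (1 + h + \<sigma>) / \<sigma>" using \<sigma> by (simp add: field_simps)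
  finally show ?thesis .
qed

text \<open>The summand \<open>3 * (1 + 1 / g)\<close> comes from the survival probability and the
  summand 1 from the linear superharmonic function; the factor 2 pays for using only half of the
  steps for each.\<close>

definition walk_const :: "real \<Rightarrow> real" where
  "walk_const g = 2 * (3 * (1 + 1 / g) + 1) / g"

lemma walk_const_pos: "0 < g \<Longrightarrow> 0 < walk_const g"
  by (simp add: walk_const_def add_pos_pos)

text \<open>
  Half of the steps smooth \<open>f\<close>; staying positive during the other half costs a factor of order \<open>1 / sqrt k\<close>.
\<close>

lemma kwalk_average_bound:
  assumes [measurable]: "f \<in> borel_measurable borel" and C: "0 \<le> C" and g: "0 < g" and h: "0 \<le> h" and k: "1 \<le> k"
    and av: "\<And>L. 0 \<le> L \<Longrightarrow> (\<integral>\<^sup>+y. f y * indicator {..L} y \<partial>lborel) \<le> ennreal (C * (1 + L))"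
  shows "(kwalk g ^^ k) f h \<le> ennreal (C * walk_const g * (h + 3/2 * g) / sqrt (real k))"
proof -
  define m where "m = k div 2"
  obtain m' where m': "k - m = Suc m'" using k by (cases "k - m") (auto simp: m_def)
  \<comment> \<open>The first \<open>m\<close> steps are those of survival, the last
    \<open>Suc m'\<close> those of smoothing. As \<open>k \<ge> 1\<close>, at least one step remains
    for smoothing.\<close>
  have km: "k = m + Suc m'" using m' k by (auto simp: m_def)
  define \<sigma> where "\<sigma> = g * sqrt (Suc m')"
  have s2: "sqrt (real k) \<le> 2 * sqrt (Suc m')" "sqrt (real k) \<le> 2 * sqrt (real (m + 1))"
  proof -
    have "real k \<le> 4 * real (Suc m')" "real k \<le> 4 * real (m + 1)" using km by (auto simp: m_def)
    then have "sqrt (real k) \<le> sqrt (4 * real (Suc m'))" "sqrt (real k) \<le> sqrt (4 * real (m + 1))"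
      by (auto simp del: of_nat_Suc of_nat_add)
    then show "sqrt (real k) \<le> 2 * sqrt (Suc m')" "sqrt (real k) \<le> 2 * sqrt (real (m + 1))"
      by (auto simp: real_sqrt_mult simp del: of_nat_Suc of_nat_add)
  qed
  have sk: "0 < sqrt (real k)" using k by simp
  have \<sigma>: "0 < \<sigma>" "g \<le> \<sigma>" using g by (auto simp: \<sigma>_def)
  have c0: "0 \<le> C * (1 + 1 / g)" "0 \<le> C / \<sigma>" using C g \<sigma> by auto
  \<comment> \<open>The bound is a combination of two functions that the first \<open>m\<close>
    steps can handle: the indicator of the half-line, which yields the survival probability, and the
    superharmonic function, which is preserved but already carries the factor
    \<open>1 / \<sigma>\<close>.\<close>
  have step: "(kwalk g ^^ Suc m') f x \<le> ennreal (C * (1 + 1 / g)) * half_line x + ennreal (C / \<sigma>) * (half_line x * ennreal (x + 3/2 * g))" for x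
  proof (cases "0 \<le> x")
    case True
    have "(kwalk g ^^ Suc m') f x \<le> (\<integral>\<^sup>+z. f (x + \<sigma> * z) \<partial>stdN)"
      unfolding \<sigma>_def by (rule kwalk_pow_le_gaussian) simp
    also have "\<dots> \<le> ennreal (C * (1 + x + \<sigma>) / \<sigma>)" by (rule gaussian_smoothing) (use C \<sigma> True av in auto)
    also have "\<dots> \<le> ennreal (C * (1 + 1 / g) + C / \<sigma> * (x + 3/2 * g))"
    proof (rule ennreal_leI)
      have "C * (1 + x + \<sigma>) / \<sigma> = C * (1 + 1 / \<sigma>) + C / \<sigma> * x" using \<sigma> by (simp add: field_simps)
      also have "\<dots> \<le> C * (1 + 1 / g) + C / \<sigma> * (x + 3/2 * g)"
        using \<sigma> g C by (intro add_mono mult_left_mono) (auto simp: frac_le)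
      finally show "C * (1 + x + \<sigma>) / \<sigma> \<le> C * (1 + 1 / g) + C / \<sigma> * (x + 3/2 * g)" .
    qed
    also have "\<dots> = ennreal (C * (1 + 1 / g)) * half_line x + ennreal (C / \<sigma>) * (half_line x * ennreal (x + 3/2 * g))"
      using True c0 g by (subst ennreal_affine) auto
    finally show ?thesis .
  qed (simp add: kwalk_def)
  have "(kwalk g ^^ k) f h = (kwalk g ^^ m) ((kwalk g ^^ Suc m') f) h"
    unfolding km funpow_add by simp
  also have "\<dots> \<le> (kwalk g ^^ m) (\<lambda>x. ennreal (C * (1 + 1 / g)) * half_line x + ennreal (C / \<sigma>) * (half_line x * ennreal (x + 3/2 * g))) h"
    by (rule kwalk_pow_mono[OF step])
  also have "\<dots> = ennreal (C * (1 + 1 / g)) * (kwalk g ^^ m) half_line h + ennreal (C / \<sigma>) * (kwalk g ^^ m) (\<lambda>x. half_line x * ennreal (x + 3/2 * g)) h"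
    by (rule kwalk_pow_lincomb) auto
  also have "\<dots> \<le> ennreal (C * (1 + 1 / g)) * ennreal (3 * (h + 3/2 * g) / (g * sqrt (real (m + 1)))) + ennreal (C / \<sigma>) * ennreal (h + 3/2 * g)"
    using order_trans[OF kwalk_linear[OF g, of m h]] h
    by (intro add_mono mult_left_mono kwalk_stay g h) auto
  also have "\<dots> = ennreal (C * (1 + 1 / g) * (3 * (h + 3/2 * g) / (g * sqrt (real (m + 1)))) + C / \<sigma> * (h + 3/2 * g))"
  proof -
    have b0: "0 \<le> 3 * (h + 3/2 * g) / (g * sqrt (real (m + 1)))" "0 \<le> h + 3/2 * g" using g h by auto
    show ?thesis
      by (simp only: ennreal_mult'[OF c0(1), symmetric] ennreal_affine[OF mult_nonneg_nonneg[OF c0(1) b0(1)] c0(2) b0(2)])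
  qed
  also have "\<dots> \<le> ennreal (C * walk_const g * (h + 3/2 * g) / sqrt (real k))"
  proof (rule ennreal_leI)
    have a: "3 * (h + 3/2 * g) / (g * sqrt (real (m + 1))) \<le> 3 * (h + 3/2 * g) / (g * (sqrt (real k) / 2))"
      using s2(2) g h sk by (intro divide_left_mono mult_left_mono mult_pos_pos) auto
    have b: "C / \<sigma> \<le> C / (g * (sqrt (real k) / 2))"
      unfolding \<sigma>_def using s2(1) g C sk by (intro divide_left_mono mult_left_mono mult_pos_pos) auto
    have "C * (1 + 1 / g) * (3 * (h + 3/2 * g) / (g * sqrt (real (m + 1)))) + C / \<sigma> * (h + 3/2 * g)
      \<le> C * (1 + 1 / g) * (3 * (h + 3/2 * g) / (g * (sqrt (real k) / 2))) + C / (g * (sqrt (real k) / 2)) * (h + 3/2 * g)"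
      using c0 g h by (intro add_mono mult_left_mono[OF a] mult_right_mono[OF b]) auto
    also have "\<dots> = C * walk_const g * (h + 3/2 * g) / sqrt (real k)"
    proof -
      have gen: "C * P * (3 * H / (g * (s / 2))) + C / (g * (s / 2)) * H = C * (2 * (3 * P + 1) / g) * H / s" if "s \<noteq> 0" for P H s
        using g that by (simp add: field_simps)
      show ?thesis unfolding walk_const_def by (rule gen) (use sk in auto)
    qed
    finally show "C * (1 + 1 / g) * (3 * (h + 3/2 * g) / (g * sqrt (real (m + 1)))) + C / \<sigma> * (h + 3/2 * g)
      \<le> C * walk_const g * (h + 3/2 * g) / sqrt (real k)" .
  qed
  finally show ?thesis .
qed

text \<open>The recursion obeyed by the union bound on a branching random walk. A vertex has at most
  \<open>exp (g\<^sup>2 / 2)\<close> children, \<open>exp (- x)\<close> is the scale at the vertex,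
  and an edge contributes \<open>g * z - g\<^sup>2\<close> to its logarithm. The minimum with 1
  records that an expectation of \<open>1 - exp\<close> is at most 1; it later supplies the
  killing.\<close>

fun casc :: "real \<Rightarrow> (real \<Rightarrow> ennreal) \<Rightarrow> nat \<Rightarrow> real \<Rightarrow> ennreal" where
  "casc g H 0 x = H x"
| "casc g H (Suc i) x = min 1 (ennreal (exp (g\<^sup>2 / 2)) * (\<integral>\<^sup>+z. casc g H i (x - (g * z - g\<^sup>2)) \<partial>stdN))"

lemma casc_measurable [measurable]:
  assumes [measurable]: "H \<in> borel_measurable borel"
  shows "casc g H i \<in> borel_measurable borel"
proof (induction i)
  case 0
  have "casc g H 0 = H" by auto
  then show ?case by simp
next
  case (Suc i)
  note [measurable] = Suc
  have "(\<lambda>x. \<integral>\<^sup>+z. casc g H i ((x + g\<^sup>2) + (- g) * z) \<partial>stdN) \<in> borel_measurable borel"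
    by (rule measurable_compose[OF _ measurable_nn_stdN[OF Suc]]) simp
  then show ?case by (simp add: algebra_simps)
qed

lemma casc_le_1: "(\<And>x. H x \<le> 1) \<Longrightarrow> casc g H i x \<le> 1"
  by (cases i) auto

text \<open>Factoring out \<open>exp (- x)\<close> tilts the normal variable by \<open>g\<close>.
  The tilt absorbs the number of children and shifts the mean of the step by
  \<open>g\<^sup>2\<close>, which is exactly the drift, so the walk becomes centred. Once the walk
  is below \<open>- c\<close>, the trivial bound 1 is at most \<open>exp (- x) * exp (- c)\<close>;
  this is the constant term, which the recursion reproduces.\<close>

lemma casc_le_kwalk:
  assumes [measurable]: "H \<in> borel_measurable borel" and H1: "\<And>x. H x \<le> 1"
  shows "casc g H i x \<le> ennreal (exp (- x)) *
     (ennreal (exp (- c)) + (kwalk g ^^ i) (\<lambda>h. half_line h * (ennreal (exp (h - c)) * H (h - c))) (x + c))"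
proof (induction i arbitrary: x)
  case 0
  show ?case
  proof (cases "0 \<le> x + c")
    case True
    have "H x = ennreal (exp (- x)) * (ennreal (exp x) * H x)"
      by (simp add: mult.assoc[symmetric] ennreal_mult'[symmetric] exp_add[symmetric])
    also have "\<dots> \<le> ennreal (exp (- x)) * (ennreal (exp (- c)) + ennreal (exp x) * H x)"
      by (intro mult_left_mono) auto
    finally show ?thesis using True by simp
  next
    case False
    have "H x \<le> ennreal (exp (- x) * exp (- c))"
      using False order_trans[OF H1[of x], of "ennreal (exp (- x) * exp (- c))"]
      by (simp add: exp_add[symmetric] ennreal_1[symmetric] del: ennreal_1)
    then show ?thesis using False by (simp add: ennreal_mult')
  qed
next
  case (Suc i)
  let ?U = "(kwalk g ^^ i) (\<lambda>h. half_line h * (ennreal (exp (h - c)) * H (h - c)))"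
  let ?U' = "(kwalk g ^^ Suc i) (\<lambda>h. half_line h * (ennreal (exp (h - c)) * H (h - c)))"
  interpret N: prob_space stdN by (rule prob_space_stdN)
  show ?case
  proof (cases "0 \<le> x + c")
    case True
    let ?F = "\<lambda>z. ennreal (exp (- c)) + ?U (x + c - g * z + g\<^sup>2)"
    have "casc g H (Suc i) x \<le> ennreal (exp (g\<^sup>2 / 2)) * (\<integral>\<^sup>+z. casc g H i (x - (g * z - g\<^sup>2)) \<partial>stdN)"
      by simp
    also have "\<dots> \<le> ennreal (exp (g\<^sup>2 / 2)) * (\<integral>\<^sup>+z. ennreal (exp (- (x - (g * z - g\<^sup>2)))) * ?F z \<partial>stdN)"
    proof (intro mult_left_mono nn_integral_mono)
      fix z
      have "x - (g * z - g\<^sup>2) + c = x + c - g * z + g\<^sup>2" by simp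
      then show "casc g H i (x - (g * z - g\<^sup>2)) \<le> ennreal (exp (- (x - (g * z - g\<^sup>2)))) * ?F z"
        using Suc[of "x - (g * z - g\<^sup>2)"] by (simp only:)
    qed simp
    also have "\<dots> = (\<integral>\<^sup>+z. ennreal (exp (- x)) * (ennreal (exp (z * g - g\<^sup>2 / 2)) * ?F z) \<partial>stdN)"
    proof -
      have "ennreal (exp (g\<^sup>2 / 2)) * (ennreal (exp (- (x - (g * z - g\<^sup>2)))) * w) = ennreal (exp (- x)) * (ennreal (exp (z * g - g\<^sup>2 / 2)) * w)" for z w
      proof -
        have "exp (g\<^sup>2 / 2) * exp (- (x - (g * z - g\<^sup>2))) = exp (- x) * exp (z * g - g\<^sup>2 / 2)"
          by (simp add: mult_exp_exp algebra_simps)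
        then show ?thesis by (simp add: mult.assoc[symmetric] ennreal_mult'[symmetric])
      qed
      then show ?thesis by (subst nn_integral_cmult[symmetric]) (auto simp: mult.assoc)
    qed
    also have "\<dots> = ennreal (exp (- x)) * (\<integral>\<^sup>+z. ?F (z + g) \<partial>stdN)"
      by (subst nn_integral_cmult, simp, subst nn_integral_stdN_shift) auto
    also have "(\<integral>\<^sup>+z. ?F (z + g) \<partial>stdN) = (\<integral>\<^sup>+z. ?F (- z + g) \<partial>stdN)"
      by (rule nn_integral_stdN_uminus[symmetric]) measurable
    also have "\<dots> = ennreal (exp (- c)) + (\<integral>\<^sup>+z. ?U (x + c + g * z) \<partial>stdN)"
    proof -
      have "emeasure stdN UNIV = 1" using N.emeasure_space_1 by simp
      then show ?thesis by (subst nn_integral_add) (auto simp: algebra_simps power2_eq_square)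
    qed
    also have "(\<integral>\<^sup>+z. ?U (x + c + g * z) \<partial>stdN) = ?U' (x + c)"
      using True by (simp add: kwalk_def)
    finally show ?thesis .
  next
    case False
    have "casc g H (Suc i) x \<le> 1" by (rule casc_le_1) (rule H1)
    also have "(1::ennreal) \<le> ennreal (exp (- x) * exp (- c))"
      using False by (simp add: exp_add[symmetric] ennreal_1[symmetric] del: ennreal_1)
    finally show ?thesis using False by (simp add: ennreal_mult' kwalk_def)
  qed
qed

text \<open>The barrier \<open>c = ln k / 2 + a\<close> balances the two terms. Starting at
  \<open>L - c\<close>, the tilt costs \<open>exp (- L) * sqrt k * exp a\<close>. The barrier term
  \<open>exp (- c)\<close> turns this into \<open>exp (- L)\<close>, and the factor
  \<open>1 / sqrt k\<close> of the killed walk cancels the \<open>sqrt k\<close>. The term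
  \<open>ln k / 2\<close> thus stands for the normalisation by the square root of time;
  \<open>a\<close> is room for constant factors.\<close>

lemma casc_bound:
  assumes [measurable]: "H \<in> borel_measurable borel" and H1: "\<And>x. H x \<le> 1"
    and C: "0 \<le> C" and g: "0 < g" and k: "1 \<le> k" and a: "0 \<le> a" and L: "0 \<le> L"
    and av: "\<And>L. (\<integral>\<^sup>+y. ennreal (exp y) * H y * indicator {..L} y \<partial>lborel) \<le> ennreal (C * (1 + max 0 L))"
  shows "casc g H k (L - (ln (real k) / 2 + a)) \<le> ennreal (exp (- L) * (1 + exp a * (C * walk_const g * (L + 3/2 * g))))"
proof -
  define c where "c = ln (real k) / 2 + a"
  have c: "0 \<le> c" using k a by (simp add: c_def)
  let ?f = "\<lambda>h. half_line h * (ennreal (exp (h - c)) * H (h - c))"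
  have av': "(\<integral>\<^sup>+y. ?f y * indicator {..l} y \<partial>lborel) \<le> ennreal (C * (1 + l))" if l: "0 \<le> l" for l
  proof -
    have "(\<integral>\<^sup>+y. ?f y * indicator {..l} y \<partial>lborel) \<le> (\<integral>\<^sup>+y. ennreal (exp (y - c)) * H (y - c) * indicator {..l} y \<partial>lborel)"
      by (intro nn_integral_mono) (auto simp: indicator_def)
    also have "\<dots> = (\<integral>\<^sup>+y. ennreal (exp y) * H y * indicator {..l - c} y \<partial>lborel)"
      by (subst nn_integral_real_affine[of _ 1 c]) (auto simp: indicator_def intro!: nn_integral_cong)
    also have "\<dots> \<le> ennreal (C * (1 + max 0 (l - c)))" by (rule av)
    also have "\<dots> \<le> ennreal (C * (1 + l))" using C l c by (intro ennreal_leI mult_left_mono) auto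
    finally show ?thesis .
  qed
  have "casc g H k (L - c) \<le> ennreal (exp (- (L - c))) * (ennreal (exp (- c)) + (kwalk g ^^ k) ?f (L - c + c))"
    by (rule casc_le_kwalk) (use H1 in auto)
  also have "\<dots> \<le> ennreal (exp (- (L - c))) * (ennreal (exp (- c)) + ennreal (C * walk_const g * (L + 3/2 * g) / sqrt (real k)))"
  proof (intro mult_left_mono add_left_mono)
    have "(kwalk g ^^ k) ?f L \<le> ennreal (C * walk_const g * (L + 3/2 * g) / sqrt (real k))"
      by (rule kwalk_average_bound) (use C g L k av' in simp_all)
    then show "(kwalk g ^^ k) ?f (L - c + c) \<le> ennreal (C * walk_const g * (L + 3/2 * g) / sqrt (real k))" by simp
  qed simp
  also have "\<dots> = ennreal (exp (- (L - c)) * (exp (- c) + C * walk_const g * (L + 3/2 * g) / sqrt (real k)))"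
    using C g L walk_const_pos[OF g] by (simp add: ennreal_plus[symmetric] ennreal_mult'[symmetric] del: ennreal_plus)
  also have "exp (- (L - c)) * (exp (- c) + C * walk_const g * (L + 3/2 * g) / sqrt (real k))
      = exp (- L) * (1 + exp a * (C * walk_const g * (L + 3/2 * g)))"
  proof -
    have "exp c = sqrt (real k) * exp a"
      using k by (simp add: c_def exp_add ln_sqrt[symmetric])
    moreover have "exp (- (L - c)) * (exp (- c) + w) = exp (- L) * (1 + exp c * w)" for w
      by (simp add: algebra_simps exp_add[symmetric])
    ultimately show ?thesis using k by simp
  qed
  finally show ?thesis by (simp add: c_def)
qed

section \<open>The union bound along a tree with independent Gaussian edges\<close>

lemma one_minus_prod_le_sum:
  fixes f :: "'a \<Rightarrow> real"
  assumes "finite A" "\<And>a. a \<in> A \<Longrightarrow> 0 \<le> f a" "\<And>a. a \<in> A \<Longrightarrow> f a \<le> 1"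
  shows "1 - (\<Prod>a\<in>A. f a) \<le> (\<Sum>a\<in>A. 1 - f a)"
  using assms
proof (induction A)
  case (insert a A)
  have p: "0 \<le> (\<Prod>a\<in>A. f a)" "(\<Prod>a\<in>A. f a) \<le> 1" using insert by (auto intro!: prod_nonneg prod_le_1)
  have "1 - f a * (\<Prod>a\<in>A. f a) \<le> (1 - f a) + (1 - (\<Prod>a\<in>A. f a))"
    using mult_nonneg_nonneg[of "1 - f a" "1 - (\<Prod>a\<in>A. f a)"] p insert.prems by (simp add: algebra_simps)
  then show ?case using insert by simp
qed simp

text \<open>Induction on the number of levels below a common ancestor. The leaves in
  \<open>J'\<close> are grouped by their ancestor one level down, the union bound is applied to the
  groups, and in each group the variable of the edge they share is integrated out first. The set
  \<open>E\<close> is only required to contain the edges in question, so that the induction can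
  delete one edge at a time.\<close>

lemma tree_bound:
  fixes anc :: "nat \<Rightarrow> 'j \<Rightarrow> 'v" and F :: "real \<Rightarrow> real"
  assumes J: "finite J" and F [measurable]: "F \<in> borel_measurable borel" and F01: "\<And>x. 0 \<le> F x" "\<And>x. F x \<le> 1"
    and H [measurable]: "H \<in> borel_measurable borel"
    and leaf: "\<And>J' x. J' \<subseteq> J \<Longrightarrow> (\<And>j j'. j \<in> J' \<Longrightarrow> j' \<in> J' \<Longrightarrow> anc k j = anc k j') \<Longrightarrow> ennreal (1 - F x ^ card J') \<le> H x"
    and branch: "\<And>J' i. J' \<subseteq> J \<Longrightarrow> i < k \<Longrightarrow> (\<And>j j'. j \<in> J' \<Longrightarrow> j' \<in> J' \<Longrightarrow> anc i j = anc i j') \<Longrightarrow>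
       real (card (anc (Suc i) ` J')) \<le> exp (g\<^sup>2 / 2)"
    and J': "J' \<subseteq> J" "\<And>j j'. j \<in> J' \<Longrightarrow> j' \<in> J' \<Longrightarrow> anc i j = anc i j'" and i: "i + m = k"
    and E: "finite E" "\<And>l j. i < l \<Longrightarrow> l \<le> k \<Longrightarrow> j \<in> J' \<Longrightarrow> (l, anc l j) \<in> E"
  shows "(\<integral>\<^sup>+\<omega>. ennreal (1 - (\<Prod>j\<in>J'. F (x - (\<Sum>l\<in>{i<..k}. g * \<omega> (l, anc l j) - g\<^sup>2)))) \<partial>PiM E (\<lambda>_. stdN)) \<le> casc g H m x"
  using J' i E
proof (induction m arbitrary: i J' E x)
  case 0
  interpret product_prob_space "\<lambda>_. stdN" E
    by (simp add: product_prob_space_def product_sigma_finite_def product_prob_space_axioms_def prob_space_stdN prob_space_imp_sigma_finite)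
  have ik: "i = k" using "0.prems"(3) by simp
  have "ennreal (1 - F x ^ card J') \<le> H x" by (rule leaf[OF "0.prems"(1)]) (use "0.prems"(2) ik in blast)
  then show ?case using ik by (simp add: P.emeasure_space_1)
next
  case (Suc m)
  interpret product_prob_space "\<lambda>_. stdN" E
    by (simp add: product_prob_space_def product_sigma_finite_def product_prob_space_axioms_def prob_space_stdN prob_space_imp_sigma_finite)
  have fJ': "finite J'" using Suc.prems(1) J by (rule finite_subset)
  let ?V = "anc (Suc i) ` J'"
  let ?A = "\<lambda>i j \<omega>. F (x - (\<Sum>l\<in>{i<..k}. g * \<omega> (l, anc l j) - g\<^sup>2))"
  let ?J = "\<lambda>v. {j\<in>J'. anc (Suc i) j = v}"
  have mA [measurable]: "(\<lambda>\<omega>. ?A i j \<omega>) \<in> borel_measurable (PiM E (\<lambda>_. stdN))" if "j \<in> J'" for j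
    using Suc.prems(5) that by measurable
  have A01: "0 \<le> ?A i j \<omega>" "?A i j \<omega> \<le> 1" for j \<omega> by (rule F01)+
  have split: "(\<Prod>j\<in>J'. ?A i j \<omega>) = (\<Prod>v\<in>?V. \<Prod>j\<in>?J v. ?A i j \<omega>)" for \<omega>
    by (rule prod.group[symmetric]) (use fJ' in auto)
  have one: "(\<integral>\<^sup>+\<omega>. ennreal (1 - (\<Prod>j\<in>J'. ?A i j \<omega>)) \<partial>PiM E (\<lambda>_. stdN)) \<le> 1"
  proof -
    have "(\<integral>\<^sup>+\<omega>. ennreal (1 - (\<Prod>j\<in>J'. ?A i j \<omega>)) \<partial>PiM E (\<lambda>_. stdN)) \<le> (\<integral>\<^sup>+\<omega>. 1 \<partial>PiM E (\<lambda>_. stdN))"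
      by (intro nn_integral_mono) (auto simp: ennreal_le_1 intro!: prod_nonneg A01)
    then show ?thesis by (simp add: P.emeasure_space_1)
  qed
  \<comment> \<open>The variable of the edge into \<open>v\<close> enters all leaves below
    \<open>v\<close> in the same way and shifts \<open>x\<close>; the induction hypothesis then
    applies at the shifted point, with this edge removed.\<close>
  have child: "(\<integral>\<^sup>+\<omega>. ennreal (1 - (\<Prod>j\<in>?J v. ?A i j \<omega>)) \<partial>PiM E (\<lambda>_. stdN)) \<le> (\<integral>\<^sup>+z. casc g H m (x - (g * z - g\<^sup>2)) \<partial>stdN)"
    if v: "v \<in> ?V" for v
  proof -
    let ?e = "(Suc i, v)" and ?E = "E - {(Suc i, v)}"
    have e: "?e \<in> E" using v Suc.prems(5)[of "Suc i"] Suc.prems(3) by (auto simp del: add_Suc_right)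
    have mm: "(\<lambda>\<omega>. ennreal (1 - (\<Prod>j\<in>?J v. ?A i j \<omega>))) \<in> borel_measurable (PiM (insert ?e ?E) (\<lambda>_. stdN))"
      using e by (simp add: insert_absorb) measurable
    have "(\<integral>\<^sup>+\<omega>. ennreal (1 - (\<Prod>j\<in>?J v. ?A i j \<omega>)) \<partial>PiM E (\<lambda>_. stdN))
      = (\<integral>\<^sup>+\<omega>. ennreal (1 - (\<Prod>j\<in>?J v. ?A i j \<omega>)) \<partial>PiM (insert ?e ?E) (\<lambda>_. stdN))"
      using e by (simp add: insert_absorb)
    also have "\<dots> = (\<integral>\<^sup>+z. (\<integral>\<^sup>+\<omega>. ennreal (1 - (\<Prod>j\<in>?J v. ?A i j (fun_upd \<omega> ?e z))) \<partial>PiM ?E (\<lambda>_. stdN)) \<partial>stdN)"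
      by (rule product_nn_integral_insert_rev[OF _ _ mm]) (use Suc.prems(4) in auto)
    also have "\<dots> \<le> (\<integral>\<^sup>+z. casc g H m (x - (g * z - g\<^sup>2)) \<partial>stdN)"
    proof (rule nn_integral_mono)
      fix z
      have s: "(\<Sum>l\<in>{i<..k}. g * (fun_upd \<omega> ?e z) (l, anc l j) - g\<^sup>2)
          = (g * z - g\<^sup>2) + (\<Sum>l\<in>{Suc i<..k}. g * \<omega> (l, anc l j) - g\<^sup>2)" if "j \<in> ?J v" for j \<omega>
      proof -
        have "{i<..k} = insert (Suc i) {Suc i<..k}" using Suc.prems(3) by auto
        then show ?thesis using that by (auto intro!: sum.cong)
      qed
      have "(\<integral>\<^sup>+\<omega>. ennreal (1 - (\<Prod>j\<in>?J v. ?A i j (fun_upd \<omega> ?e z))) \<partial>PiM ?E (\<lambda>_. stdN))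
        = (\<integral>\<^sup>+\<omega>. ennreal (1 - (\<Prod>j\<in>?J v. F ((x - (g * z - g\<^sup>2)) - (\<Sum>l\<in>{Suc i<..k}. g * \<omega> (l, anc l j) - g\<^sup>2)))) \<partial>PiM ?E (\<lambda>_. stdN))"
        by (intro nn_integral_cong arg_cong[where f = ennreal] arg_cong2[where f = "(-)"] refl prod.cong)
           (simp only: s diff_diff_eq)
      also have "\<dots> \<le> casc g H m (x - (g * z - g\<^sup>2))"
      proof (rule Suc.IH)
        show "?J v \<subseteq> J" using Suc.prems(1) by blast
        show "anc (Suc i) j = anc (Suc i) j'" if "j \<in> ?J v" "j' \<in> ?J v" for j j' using that by simp
        show "Suc i + m = k" using Suc.prems(3) by simp
        show "finite ?E" using Suc.prems(4) by simp
        show "(l, anc l j) \<in> ?E" if "Suc i < l" "l \<le> k" "j \<in> ?J v" for l j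
          using Suc.prems(5)[of l j] that by auto
      qed
      finally show "(\<integral>\<^sup>+\<omega>. ennreal (1 - (\<Prod>j\<in>?J v. ?A i j (fun_upd \<omega> ?e z))) \<partial>PiM ?E (\<lambda>_. stdN)) \<le> casc g H m (x - (g * z - g\<^sup>2))" .
    qed
    finally show ?thesis .
  qed
  have "(\<integral>\<^sup>+\<omega>. ennreal (1 - (\<Prod>j\<in>J'. ?A i j \<omega>)) \<partial>PiM E (\<lambda>_. stdN))
     \<le> (\<integral>\<^sup>+\<omega>. (\<Sum>v\<in>?V. ennreal (1 - (\<Prod>j\<in>?J v. ?A i j \<omega>))) \<partial>PiM E (\<lambda>_. stdN))"
  proof (rule nn_integral_mono)
    fix \<omega>
    have "1 - (\<Prod>j\<in>J'. ?A i j \<omega>) \<le> (\<Sum>v\<in>?V. 1 - (\<Prod>j\<in>?J v. ?A i j \<omega>))"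
      unfolding split by (rule one_minus_prod_le_sum) (use fJ' A01 in \<open>auto intro!: prod_nonneg prod_le_1\<close>)
    then have "ennreal (1 - (\<Prod>j\<in>J'. ?A i j \<omega>)) \<le> ennreal (\<Sum>v\<in>?V. 1 - (\<Prod>j\<in>?J v. ?A i j \<omega>))"
      by (rule ennreal_leI)
    also have "\<dots> = (\<Sum>v\<in>?V. ennreal (1 - (\<Prod>j\<in>?J v. ?A i j \<omega>)))"
      by (rule sum_ennreal[symmetric]) (auto intro!: prod_le_1 A01)
    finally show "ennreal (1 - (\<Prod>j\<in>J'. ?A i j \<omega>)) \<le> (\<Sum>v\<in>?V. ennreal (1 - (\<Prod>j\<in>?J v. ?A i j \<omega>)))" .
  qed
  also have "\<dots> = (\<Sum>v\<in>?V. \<integral>\<^sup>+\<omega>. ennreal (1 - (\<Prod>j\<in>?J v. ?A i j \<omega>)) \<partial>PiM E (\<lambda>_. stdN))"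
    by (rule nn_integral_sum) measurable
  also have "\<dots> \<le> (\<Sum>v\<in>?V. \<integral>\<^sup>+z. casc g H m (x - (g * z - g\<^sup>2)) \<partial>stdN)"
    by (intro sum_mono child)
  also have "\<dots> = ennreal (real (card ?V)) * (\<integral>\<^sup>+z. casc g H m (x - (g * z - g\<^sup>2)) \<partial>stdN)"
    by (simp add: ennreal_of_nat_eq_real_of_nat)
  also have "\<dots> \<le> ennreal (exp (g\<^sup>2 / 2)) * (\<integral>\<^sup>+z. casc g H m (x - (g * z - g\<^sup>2)) \<partial>stdN)"
  proof (intro mult_right_mono ennreal_leI branch Suc.prems(1))
    show "i < k" using Suc.prems(3) by simp
  qed (use Suc.prems(2) in blast, simp)
  \<comment> \<open>The two bounds, by the sum over the children and by 1, form the minimum in the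
    definition of \<open>casc\<close>.\<close>
  finally show ?case using one by simp
qed

subsection \<open>Grids and Gaussian families\<close>

lemma card_vec_le:
  fixes S :: "'d::finite \<Rightarrow> nat set"
  assumes "\<And>c. finite (S c)"
  shows "finite {v :: nat ^ 'd. \<forall>c. v $ c \<in> S c}" "card {v :: nat ^ 'd. \<forall>c. v $ c \<in> S c} \<le> (\<Prod>c\<in>UNIV. card (S c))"
proof -
  have sub: "{v :: nat ^ 'd. \<forall>c. v $ c \<in> S c} \<subseteq> vec_lambda ` (Pi\<^sub>E UNIV S)"
  proof
    fix v :: "nat ^ 'd" assume "v \<in> {v. \<forall>c. v $ c \<in> S c}"
    then have "(\<lambda>c. v $ c) \<in> Pi\<^sub>E UNIV S" by auto
    then have "vec_lambda (\<lambda>c. v $ c) \<in> vec_lambda ` (Pi\<^sub>E UNIV S)" by (rule imageI)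
    then show "v \<in> vec_lambda ` (Pi\<^sub>E UNIV S)" by simp
  qed
  have fin: "finite (Pi\<^sub>E UNIV S)" using assms by (intro finite_PiE) auto
  show "finite {v :: nat ^ 'd. \<forall>c. v $ c \<in> S c}" by (rule finite_subset[OF sub]) (use fin in auto)
  have "card {v :: nat ^ 'd. \<forall>c. v $ c \<in> S c} \<le> card (vec_lambda ` (Pi\<^sub>E UNIV S))"
    by (rule card_mono[OF _ sub]) (use fin in auto)
  also have "\<dots> \<le> card (Pi\<^sub>E UNIV S)" by (rule card_image_le[OF fin])
  also have "\<dots> = (\<Prod>c\<in>UNIV. card (S c))" by (rule card_PiE) simp
  finally show "card {v :: nat ^ 'd. \<forall>c. v $ c \<in> S c} \<le> (\<Prod>c\<in>UNIV. card (S c))" .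
qed

lemma finite_grid_index [simp]: "finite (grid_index n :: (nat ^ 'd::finite) set)"
  using card_vec_le(1)[of "\<lambda>_. {..<n}"] by (simp add: grid_index_def)

text \<open>The index of the dyadic cube of side \<open>1 / 2 ^ l\<close> containing the corner
  \<open>j / n\<close>. Rounding allows an arbitrary \<open>n\<close> instead of a power of
  two.\<close>

definition anc :: "nat \<Rightarrow> nat \<Rightarrow> nat ^ 'd \<Rightarrow> nat ^ 'd" where
  "anc n l j = (\<chi> c. (j $ c * 2 ^ l) div n)"

lemma anc_in_grid: "j \<in> grid_index n \<Longrightarrow> anc n l j \<in> grid_index (2 ^ l)"
proof -
  assume j: "j \<in> grid_index n"
  have "(j $ c * 2 ^ l) div n < 2 ^ l" for c
  proof -
    have jn: "j $ c < n" using j by (simp add: grid_index_def)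
    then have "j $ c * 2 ^ l < 2 ^ l * n" by simp
    then show ?thesis by (rule less_mult_imp_div_less)
  qed
  then show ?thesis by (simp add: anc_def grid_index_def)
qed

lemma card_div_fibre_le:
  fixes n b v :: nat
  assumes b: "0 < b" and n: "0 < n"
  shows "finite {m. (m * b) div n = v}" "card {m. (m * b) div n = v} \<le> n div b + 1"
proof -
  let ?K = "{m. (m * b) div n = v}"
  have "finite ?K \<and> card ?K \<le> n div b + 1"
  proof (cases "?K = {}")
    case False
    define m0 where "m0 = (LEAST m. (m * b) div n = v)"
    obtain m1 where "(m1 * b) div n = v" using False by auto
    then have m0: "(m0 * b) div n = v" unfolding m0_def by (rule LeastI)
    have "?K \<subseteq> {m0..m0 + n div b}"
    proof
      fix m assume "m \<in> ?K"
      then have m: "(m * b) div n = v" by simp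
      then have le: "m0 \<le> m" unfolding m0_def by (rule Least_le)
      have "m * b < n * ((m * b) div n) + n" using dividend_less_times_div[OF n, of "m * b"] by linarith
      then have "m * b < (v + 1) * n" unfolding m by (simp add: mult.commute)
      moreover have "v * n \<le> m0 * b" unfolding m0[symmetric] by (rule div_times_less_eq_dividend)
      moreover have "(v + 1) * n = v * n + n" by simp
      ultimately have "m * b < n + m0 * b" by linarith
      moreover have "m0 * b \<le> m * b" using le by (rule mult_le_mono1)
      ultimately have "(m - m0) * b < n" by (simp only: diff_mult_distrib less_diff_conv2)
      then have "(m - m0) \<le> n div b" using b by (simp add: less_eq_div_iff_mult_less_eq)
      then show "m \<in> {m0..m0 + n div b}" using le by simp
    qed
    then show ?thesis using card_mono[of "{m0..m0 + n div b}" ?K] finite_subset[of ?K "{m0..m0 + n div b}"] by auto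
  qed auto
  then show "finite ?K" "card ?K \<le> n div b + 1" by auto
qed

text \<open>In each coordinate at most \<open>n div 2 ^ k + 1\<close> grid indices have the same
  ancestor, and the rounding costs a factor of at most 2 because
  \<open>2 ^ k \<le> n\<close>.\<close>

lemma card_anc_class_le:
  fixes J' :: "(nat ^ 'd::finite) set"
  assumes n: "2 ^ k \<le> n" and J': "\<And>j j'. j \<in> J' \<Longrightarrow> j' \<in> J' \<Longrightarrow> anc n k j = anc n k j'"
  shows "real (card J') \<le> (2 * real n / 2 ^ k) ^ CARD('d)"
proof (cases "J' = {}")
  case False
  have n0: "0 < n" using n by (metis gr0I le_zero_eq power_not_zero zero_neq_numeral)
  obtain j0 where j0: "j0 \<in> J'" using False by auto
  let ?S = "\<lambda>c. {m. (m * 2 ^ k) div n = anc n k j0 $ c}"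
  have fin: "finite (?S c)" for c by (rule card_div_fibre_le) (use n0 in auto)
  have "J' \<subseteq> {v. \<forall>c. v $ c \<in> ?S c}"
  proof
    fix j assume "j \<in> J'"
    from J'[OF this j0] show "j \<in> {v. \<forall>c. v $ c \<in> ?S c}" by (auto simp: anc_def vec_eq_iff)
  qed
  then have "card J' \<le> card {v :: nat ^ 'd. \<forall>c. v $ c \<in> ?S c}"
    by (intro card_mono card_vec_le fin)
  also have "\<dots> \<le> (\<Prod>c\<in>UNIV. card (?S c))" by (rule card_vec_le(2)[OF fin])
  also have "\<dots> \<le> (\<Prod>c::'d\<in>UNIV. n div 2 ^ k + 1)"
    by (intro prod_mono conjI card_div_fibre_le) (use n0 in auto)
  finally have "card J' \<le> (n div 2 ^ k + 1) ^ CARD('d)" by simp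
  then have "real (card J') \<le> real (n div 2 ^ k + 1) ^ CARD('d)" by (metis of_nat_le_iff of_nat_power)
  also have "\<dots> \<le> (2 * real n / 2 ^ k) ^ CARD('d)"
  proof (rule power_mono)
    have "real (n div 2 ^ k) \<le> real n / real (2 ^ k)" by (rule of_nat_div_le_of_nat)
    moreover have "1 \<le> real n / 2 ^ k" using n by (simp add: le_divide_eq)
    moreover have "2 * real n / 2 ^ k = real n / 2 ^ k + real n / 2 ^ k" by simp
    moreover have "real (2 ^ k) = (2::real) ^ k" by simp
    ultimately show "real (n div 2 ^ k + 1) \<le> 2 * real n / 2 ^ k" unfolding of_nat_add of_nat_1 by (simp only:)
  qed simp
  finally show ?thesis .
qed simp

text \<open>For arbitrary \<open>n\<close> the levels are still nested and binary in each
  coordinate, because \<open>(2 * m) div n\<close> is either \<open>2 * (m div n)\<close> or its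
  successor.\<close>

lemma card_anc_children_le:
  fixes J' :: "(nat ^ 'd::finite) set"
  assumes n: "0 < n" and J': "\<And>j j'. j \<in> J' \<Longrightarrow> j' \<in> J' \<Longrightarrow> anc n i j = anc n i j'"
  shows "card (anc n (Suc i) ` J') \<le> 2 ^ CARD('d)"
proof (cases "J' = {}")
  case False
  obtain j0 where j0: "j0 \<in> J'" using False by auto
  let ?S = "\<lambda>c. {2 * (anc n i j0 $ c), 2 * (anc n i j0 $ c) + 1}"
  have "anc n (Suc i) ` J' \<subseteq> {v. \<forall>c. v $ c \<in> ?S c}"
  proof
    fix v assume "v \<in> anc n (Suc i) ` J'"
    then obtain j where j: "j \<in> J'" "v = anc n (Suc i) j" by auto
    have "v $ c \<in> ?S c" for c
    proof -
      have a: "anc n i j0 $ c = (j $ c * 2 ^ i) div n" using J'[OF j(1) j0] by (simp add: anc_def vec_eq_iff)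
      define m where "m = j $ c * 2 ^ i"
      have "v $ c = (2 * m) div n" by (simp add: j(2) anc_def m_def mult.left_commute mult.commute)
      moreover have "(2 * m) div n \<in> {2 * (m div n), 2 * (m div n) + 1}"
      proof -
        have "2 * m = n * (2 * (m div n)) + 2 * (m mod n)" by (metis add_mult_distrib2 mult.left_commute mult_div_mod_eq)
        then have "(2 * m) div n = 2 * (m div n) + (2 * (m mod n)) div n" using n by (metis div_mult_self4 add.commute less_not_refl2)
        moreover have "(2 * (m mod n)) div n < 2" using n by (intro less_mult_imp_div_less) simp
        ultimately show ?thesis by auto
      qed
      ultimately show ?thesis using a by (simp add: m_def)
    qed
    then show "v \<in> {v. \<forall>c. v $ c \<in> ?S c}" by simp
  qed
  then have "card (anc n (Suc i) ` J') \<le> card {v :: nat ^ 'd. \<forall>c. v $ c \<in> ?S c}"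
    by (intro card_mono card_vec_le) auto
  also have "\<dots> \<le> (\<Prod>c\<in>UNIV. card (?S c))" by (rule card_vec_le(2)) auto
  also have "\<dots> = 2 ^ CARD('d)" by (simp add: numeral_2_eq_2)
  finally show ?thesis .
qed simp

text \<open>Counting the levels, rather than taking the deepest one, makes this literally the
  covariance of the tree field up to the factor \<open>g\<^sup>2\<close>. The root level carries no
  edge and is left out.\<close>

definition common_levels :: "nat \<Rightarrow> nat \<Rightarrow> nat ^ 'd \<Rightarrow> nat ^ 'd \<Rightarrow> nat" where
  "common_levels n k j j' = card {l\<in>{0<..k}. anc n l j = anc n l j'}"

lemma common_levels_le: "common_levels n k j j' \<le> k"
proof -
  have "common_levels n k j j' \<le> card {0<..k}" unfolding common_levels_def by (rule card_mono) auto
  then show ?thesis by simp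
qed

lemma common_levels_self: "common_levels n k j j = k"
proof -
  have "{l\<in>{0<..k}. anc n l j = anc n l j} = {0<..k}" by auto
  then show ?thesis unfolding common_levels_def by simp
qed

definition grid_point :: "nat \<Rightarrow> nat ^ 'd \<Rightarrow> real ^ 'd \<Rightarrow> real ^ 'd" where
  "grid_point n j y = (1 / real n) *\<^sub>R ((\<chi> i. real (j $ i)) + y)"

text \<open>Sharing many levels forces two points to be close; the converse fails at dyadic
  boundaries. In each coordinate, after scaling by \<open>2 ^ common_levels\<close>, the distance of
  the cells contributes at most 1, and so do the positions within the cells, as
  \<open>2 ^ k \<le> n\<close>. Bounding the norm by the sum of the coordinates gives
  \<open>2 * CARD('d)\<close>.\<close>

lemma common_levels_dist:
  fixes y y' :: "real ^ 'd::finite"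
  assumes n: "2 ^ k \<le> n" and j: "j \<in> grid_index n" "j' \<in> grid_index n"
    and y: "\<And>c. 0 \<le> y $ c" "\<And>c. y $ c \<le> 1" and y': "\<And>c. 0 \<le> y' $ c" "\<And>c. y' $ c \<le> 1"
  shows "2 ^ common_levels n k j j' * norm (grid_point n j y - grid_point n j' y') \<le> 2 * real CARD('d)"
proof -
  define L where "L = common_levels n k j j'"
  have n0: "0 < n" using n by (metis gr0I le_zero_eq power_not_zero zero_neq_numeral)
  have d: "\<bar>real (j $ c) - real (j' $ c)\<bar> * 2 ^ L \<le> real n" for c
  proof (cases "L = 0")
    case True
    have "j $ c < n" "j' $ c < n" using j by (auto simp: grid_index_def)
    then show ?thesis using True by (auto simp: abs_le_iff)
  next
    case False
    \<comment> \<open>Pigeonhole: there are only \<open>L - 1\<close> positive levels below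
      \<open>L\<close>, so one of the \<open>L\<close> common levels is at least
      \<open>L\<close>.\<close>
    have "\<not> {l\<in>{0<..k}. anc n l j = anc n l j'} \<subseteq> {0<..<L}"
    proof
      assume "{l\<in>{0<..k}. anc n l j = anc n l j'} \<subseteq> {0<..<L}"
      then have "L \<le> card {0<..<L}" unfolding L_def common_levels_def by (intro card_mono) (auto simp: L_def)
      then show False using False by simp
    qed
    then obtain l where l: "l \<in> {l\<in>{0<..k}. anc n l j = anc n l j'}" "l \<notin> {0<..<L}" by blast
    then have l: "L \<le> l" "anc n l j = anc n l j'" by auto
    have lt: "a * 2 ^ l < b * 2 ^ l + n" if "(a * 2 ^ l) div n = (b * 2 ^ l) div n" for a b
    proof -
      have "a * 2 ^ l < n * ((a * 2 ^ l) div n) + n" using dividend_less_times_div[OF n0, of "a * 2 ^ l"] by linarith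
      also have "n * ((a * 2 ^ l) div n) \<le> b * 2 ^ l" unfolding that by simp
      finally show ?thesis by simp
    qed
    have e: "(j $ c * 2 ^ l) div n = (j' $ c * 2 ^ l) div n" using l(2) by (simp add: anc_def vec_eq_iff)
    have "real (j $ c * 2 ^ l) < real (j' $ c * 2 ^ l + n)" "real (j' $ c * 2 ^ l) < real (j $ c * 2 ^ l + n)"
      using lt[OF e] lt[OF e[symmetric]] by (simp_all only: of_nat_less_iff)
    then have "\<bar>real (j $ c) - real (j' $ c)\<bar> * 2 ^ l \<le> real n"
      by (auto simp: abs_le_iff abs_if algebra_simps)
    moreover have "\<bar>real (j $ c) - real (j' $ c)\<bar> * 2 ^ L \<le> \<bar>real (j $ c) - real (j' $ c)\<bar> * 2 ^ l"
      using l(1) by (intro mult_left_mono power_increasing) auto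
    ultimately show ?thesis by linarith
  qed
  have Ln: "2 ^ L \<le> real n"
  proof -
    have "(2::nat) ^ L \<le> 2 ^ k" unfolding L_def by (intro power_increasing common_levels_le) simp
    then have "2 ^ L \<le> n" using n by linarith
    then show ?thesis by (metis of_nat_le_iff of_nat_numeral of_nat_power)
  qed
  have comp: "2 ^ L * \<bar>(grid_point n j y - grid_point n j' y') $ c\<bar> \<le> 2" for c
  proof -
    have "\<bar>y $ c - y' $ c\<bar> \<le> 1" using y[of c] y'[of c] by linarith
    then have "2 ^ L * \<bar>y $ c - y' $ c\<bar> \<le> 2 ^ L * 1" by (intro mult_left_mono) auto
    then have a: "2 ^ L * \<bar>y $ c - y' $ c\<bar> \<le> real n" using Ln by linarith
    have "(grid_point n j y - grid_point n j' y') $ c = ((real (j $ c) - real (j' $ c)) + (y $ c - y' $ c)) / real n"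
      using n0 by (simp add: grid_point_def field_simps)
    then have "\<bar>(grid_point n j y - grid_point n j' y') $ c\<bar> \<le> (\<bar>real (j $ c) - real (j' $ c)\<bar> + \<bar>y $ c - y' $ c\<bar>) / real n"
      using n0 by (simp add: divide_right_mono)
    then have "2 ^ L * \<bar>(grid_point n j y - grid_point n j' y') $ c\<bar> \<le> 2 ^ L * ((\<bar>real (j $ c) - real (j' $ c)\<bar> + \<bar>y $ c - y' $ c\<bar>) / real n)"
      by (intro mult_left_mono) auto
    also have "\<dots> = (\<bar>real (j $ c) - real (j' $ c)\<bar> * 2 ^ L + 2 ^ L * \<bar>y $ c - y' $ c\<bar>) / real n"
      by (simp add: field_simps)
    also have "\<dots> \<le> (real n + real n) / real n" using d[of c] a by (intro divide_right_mono) auto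
    also have "\<dots> = 2" using n0 by simp
    finally show ?thesis .
  qed
  have "2 ^ L * norm (grid_point n j y - grid_point n j' y') \<le> 2 ^ L * (\<Sum>c\<in>UNIV. \<bar>(grid_point n j y - grid_point n j' y') $ c\<bar>)"
    by (intro mult_left_mono norm_le_l1_cart) simp
  also have "\<dots> = (\<Sum>c\<in>UNIV. 2 ^ L * \<bar>(grid_point n j y - grid_point n j' y') $ c\<bar>)" by (simp add: sum_distrib_left)
  also have "\<dots> \<le> (\<Sum>c\<in>(UNIV::'d set). 2)" by (intro sum_mono comp)
  finally show ?thesis by (simp add: L_def)
qed

section \<open>Constructions of Gaussian families: independent sums, linear images, independent
  copies, and values of the field\<close>

lemma gaussian_family_pair:
  assumes M: "prob_space M" and N: "prob_space N" and I: "finite I"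
    and Z: "gaussian_family M I Z K" and W: "gaussian_family N I W L"
  shows "gaussian_family (M \<Otimes>\<^sub>M N) I (\<lambda>i x. Z i (fst x) + W i (snd x)) (\<lambda>i k. K i k + L i k)"
proof -
  interpret M: prob_space M by fact
  interpret N: prob_space N by fact
  interpret PF: pair_sigma_finite M N ..
  interpret P: pair_prob_space M N ..
  have [measurable]: "i \<in> I \<Longrightarrow> Z i \<in> borel_measurable M" "i \<in> I \<Longrightarrow> W i \<in> borel_measurable N" for i
    using Z W by (auto simp: gaussian_family_def)
  have charZ: "(CLINT \<omega>|M. iexp (\<Sum>i\<in>I. c i * Z i \<omega>)) = complex_of_real (exp (- (\<Sum>i\<in>I. \<Sum>k\<in>I. c i * c k * K i k) / 2))" for c
    using Z unfolding gaussian_family_def by blast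
  have charW: "(CLINT \<omega>|N. iexp (\<Sum>i\<in>I. c i * W i \<omega>)) = complex_of_real (exp (- (\<Sum>i\<in>I. \<Sum>k\<in>I. c i * c k * L i k) / 2))" for c
    using W unfolding gaussian_family_def by blast
  show ?thesis unfolding gaussian_family_def
  proof (intro conjI ballI allI)
    fix c
    have s: "(\<Sum>i\<in>I. c i * (Z i (fst x) + W i (snd x))) = (\<Sum>i\<in>I. c i * Z i (fst x)) + (\<Sum>i\<in>I. c i * W i (snd x))" for x
      by (simp add: distrib_left sum.distrib)
    have "(CLINT x|(M \<Otimes>\<^sub>M N). iexp (\<Sum>i\<in>I. c i * (Z i (fst x) + W i (snd x))))
      = (CLINT \<omega>|M. CLINT \<omega>'|N. iexp ((\<Sum>i\<in>I. c i * Z i (fst (\<omega>, \<omega>'))) + (\<Sum>i\<in>I. c i * W i (snd (\<omega>, \<omega>')))))"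
      unfolding s by (rule PF.integral_fst'[symmetric], rule P.integrable_iexp) simp_all
    also have "\<dots> = (CLINT \<omega>|M. CLINT \<omega>'|N. iexp (\<Sum>i\<in>I. c i * Z i \<omega>) * iexp (\<Sum>i\<in>I. c i * W i \<omega>'))"
      by (simp only: fst_conv snd_conv of_real_add distrib_left exp_add)
    also have "\<dots> = (CLINT \<omega>|M. iexp (\<Sum>i\<in>I. c i * Z i \<omega>)) * (CLINT \<omega>'|N. iexp (\<Sum>i\<in>I. c i * W i \<omega>'))"
      by (simp only: integral_mult_right_zero integral_mult_left_zero)
    also have "\<dots> = complex_of_real (exp (- (\<Sum>i\<in>I. \<Sum>k\<in>I. c i * c k * K i k) / 2) * exp (- (\<Sum>i\<in>I. \<Sum>k\<in>I. c i * c k * L i k) / 2))"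
      by (simp only: charZ charW of_real_mult)
    finally show "(CLINT x|(M \<Otimes>\<^sub>M N). iexp (\<Sum>i\<in>I. c i * (Z i (fst x) + W i (snd x))))
       = complex_of_real (exp (- (\<Sum>i\<in>I. \<Sum>k\<in>I. c i * c k * (K i k + L i k)) / 2))"
      by (simp only: exp_add[symmetric] minus_add_distrib add_divide_distrib distrib_left sum.distrib)
  qed measurable
qed

lemma prob_space_PiM_const: "prob_space M \<Longrightarrow> prob_space (PiM I (\<lambda>_. M))"
  by (intro prob_space_PiM)

lemma gaussian_family_linear:
  assumes E: "finite E" and I: "finite I"
  shows "gaussian_family (PiM E (\<lambda>_. stdN)) I (\<lambda>i \<omega>. \<Sum>e\<in>E. W i e * \<omega> e) (\<lambda>i k. \<Sum>e\<in>E. W i e * W k e)"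
proof -
  interpret product_prob_space "\<lambda>_. stdN" E
    by (simp add: product_prob_space_def product_sigma_finite_def product_prob_space_axioms_def prob_space_stdN prob_space_imp_sigma_finite)
  interpret N: prob_space stdN by (rule prob_space_stdN)
  show ?thesis unfolding gaussian_family_def
  proof (intro conjI ballI allI)
    fix i show "(\<lambda>\<omega>. \<Sum>e\<in>E. W i e * \<omega> e) \<in> borel_measurable (PiM E (\<lambda>_. stdN))" by measurable
  next
    fix c
    define w where "w = (\<lambda>e. \<Sum>i\<in>I. c i * W i e)"
    have s: "(\<Sum>i\<in>I. c i * (\<Sum>e\<in>E. W i e * \<omega> e)) = (\<Sum>e\<in>E. w e * \<omega> e)" for \<omega>
      unfolding w_def sum_distrib_left sum_distrib_right mult.assoc by (rule sum.swap)
    have q: "(\<Sum>i\<in>I. \<Sum>k\<in>I. c i * c k * (\<Sum>e\<in>E. W i e * W k e)) = (\<Sum>e\<in>E. (w e)\<^sup>2)"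
    proof -
      have "(\<Sum>e\<in>E. (w e)\<^sup>2) = (\<Sum>e\<in>E. \<Sum>i\<in>I. \<Sum>k\<in>I. c i * c k * (W i e * W k e))"
        by (simp add: w_def power2_eq_square sum_product mult_ac)
      also have "\<dots> = (\<Sum>i\<in>I. \<Sum>e\<in>E. \<Sum>k\<in>I. c i * c k * (W i e * W k e))" by (rule sum.swap)
      also have "\<dots> = (\<Sum>i\<in>I. \<Sum>k\<in>I. \<Sum>e\<in>E. c i * c k * (W i e * W k e))" by (intro sum.cong refl sum.swap)
      finally show ?thesis by (simp add: sum_distrib_left)
    qed
    have "(CLINT \<omega>|PiM E (\<lambda>_. stdN). iexp (\<Sum>e\<in>E. w e * \<omega> e)) = (CLINT \<omega>|PiM E (\<lambda>_. stdN). (\<Prod>e\<in>E. iexp (w e * \<omega> e)))"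
      by (simp only: of_real_sum sum_distrib_left exp_sum[OF E])
    also have "\<dots> = (\<Prod>e\<in>E. (CLINT x|stdN. iexp (w e * x)))"
      by (rule product_integral_prod[OF E]) (auto intro!: prob_space.integrable_iexp[OF prob_space_stdN])
    also have "\<dots> = (\<Prod>e\<in>E. complex_of_real (exp (- ((w e)\<^sup>2) / 2)))" by (simp only: iexp_stdN)
    also have "\<dots> = complex_of_real (exp (- (\<Sum>e\<in>E. (w e)\<^sup>2) / 2))"
      by (simp only: of_real_prod[symmetric] exp_sum[OF E, symmetric] sum_negf[symmetric] sum_divide_distrib)
    finally show "(CLINT \<omega>|PiM E (\<lambda>_. stdN). iexp (\<Sum>i\<in>I. c i * (\<Sum>e\<in>E. W i e * \<omega> e)))
       = complex_of_real (exp (- (\<Sum>i\<in>I. \<Sum>k\<in>I. c i * c k * (\<Sum>e\<in>E. W i e * W k e)) / 2))"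
      unfolding s q .
  qed
qed

lemma gaussian_family_copies:
  fixes Z :: "'a \<Rightarrow> 'w \<Rightarrow> real"
  assumes M: "prob_space M" and J: "finite J" and A: "finite A" and Z: "gaussian_family M A Z K"
  shows "gaussian_family (PiM J (\<lambda>_. M)) (J \<times> A) (\<lambda>i \<omega>. Z (snd i) (\<omega> (fst i))) (\<lambda>i k. if fst i = fst k then K (snd i) (snd k) else 0)"
proof -
  interpret M: prob_space M by fact
  interpret product_prob_space "\<lambda>_. M" J
    by (simp add: product_prob_space_def product_sigma_finite_def product_prob_space_axioms_def M prob_space_imp_sigma_finite)
  have mZ [measurable]: "a \<in> A \<Longrightarrow> Z a \<in> borel_measurable M" for a
    using Z by (auto simp: gaussian_family_def)
  have charZ: "(CLINT \<omega>|M. iexp (\<Sum>i\<in>A. c i * Z i \<omega>)) = complex_of_real (exp (- (\<Sum>i\<in>A. \<Sum>k\<in>A. c i * c k * K i k) / 2))" for c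
    using Z unfolding gaussian_family_def by blast
  have Tim: "(\<Sum>i\<in>J \<times> A. f i) = (\<Sum>j\<in>J. \<Sum>a\<in>A. f (j, a))" for f :: "_ \<Rightarrow> real"
    by (simp add: sum.cartesian_product split_beta)
  show ?thesis unfolding gaussian_family_def
  proof (intro conjI ballI allI)
    fix i assume "i \<in> J \<times> A"
    then have "fst i \<in> J" "snd i \<in> A" by auto
    then have "(\<lambda>\<omega>. \<omega> (fst i)) \<in> measurable (PiM J (\<lambda>_. M)) M" "Z (snd i) \<in> borel_measurable M"
      by (auto intro: measurable_component_singleton mZ)
    then show "(\<lambda>\<omega>. Z (snd i) (\<omega> (fst i))) \<in> borel_measurable (PiM J (\<lambda>_. M))"
      by (rule measurable_compose)
  next
    fix c
    have q: "(\<Sum>i\<in>J \<times> A. \<Sum>k\<in>J \<times> A. c i * c k * (if fst i = fst k then K (snd i) (snd k) else 0))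
        = (\<Sum>j\<in>J. \<Sum>a\<in>A. \<Sum>b\<in>A. c (j, a) * c (j, b) * K a b)"
    proof -
      have inner: "(\<Sum>k\<in>J \<times> A. c (j, a) * c k * (if j = fst k then K a (snd k) else 0)) = (\<Sum>b\<in>A. c (j, a) * c (j, b) * K a b)"
        if "j \<in> J" for j a
      proof -
        have "(\<Sum>k\<in>J \<times> A. c (j, a) * c k * (if j = fst k then K a (snd k) else 0))
          = (\<Sum>j'\<in>J. if j = j' then (\<Sum>b\<in>A. c (j, a) * c (j', b) * K a b) else 0)"
          unfolding Tim by (intro sum.cong refl) auto
        then show ?thesis using J that by simp
      qed
      show ?thesis
        unfolding Tim[of "\<lambda>i. \<Sum>k\<in>J \<times> A. c i * c k * (if fst i = fst k then K (snd i) (snd k) else 0)"]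
        by (intro sum.cong refl) (simp only: fst_conv snd_conv inner)
    qed
    have "(CLINT \<omega>|PiM J (\<lambda>_. M). iexp (\<Sum>i\<in>J \<times> A. c i * Z (snd i) (\<omega> (fst i))))
       = (CLINT \<omega>|PiM J (\<lambda>_. M). (\<Prod>j\<in>J. iexp (\<Sum>a\<in>A. c (j, a) * Z a (\<omega> j))))"
      unfolding Tim by (simp only: of_real_sum sum_distrib_left exp_sum[OF J] fst_conv snd_conv)
    also have "\<dots> = (\<Prod>j\<in>J. (CLINT \<omega>|M. iexp (\<Sum>a\<in>A. c (j, a) * Z a \<omega>)))"
      by (rule product_integral_prod[OF J]) (auto intro!: M.integrable_iexp)
    also have "\<dots> = (\<Prod>j\<in>J. complex_of_real (exp (- (\<Sum>a\<in>A. \<Sum>b\<in>A. c (j, a) * c (j, b) * K a b) / 2)))"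
      by (simp only: charZ)
    also have "\<dots> = complex_of_real (exp (- (\<Sum>j\<in>J. \<Sum>a\<in>A. \<Sum>b\<in>A. c (j, a) * c (j, b) * K a b) / 2))"
      by (simp only: of_real_prod[symmetric] exp_sum[OF J, symmetric] sum_negf[symmetric] sum_divide_distrib)
    finally show "(CLINT \<omega>|PiM J (\<lambda>_. M). iexp (\<Sum>i\<in>J \<times> A. c i * Z (snd i) (\<omega> (fst i))))
       = complex_of_real (exp (- (\<Sum>i\<in>J \<times> A. \<Sum>k\<in>J \<times> A. c i * c k * (if fst i = fst k then K (snd i) (snd k) else 0)) / 2))"
      unfolding q .
  qed
qed

lemma centred_gaussian_rv_char:
  assumes P: "prob_space P" and Y: "centred_gaussian_rv P Y"
  shows "integrable P (\<lambda>\<omega>. (Y \<omega>)\<^sup>2)"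
    and "(CLINT \<omega>|P. iexp (Y \<omega>)) = complex_of_real (exp (- (LINT \<omega>|P. (Y \<omega>)\<^sup>2) / 2))"
proof -
  interpret prob_space P by fact
  have [measurable]: "Y \<in> borel_measurable P" using Y by (simp add: centred_gaussian_rv_def)
  have "integrable P (\<lambda>\<omega>. (Y \<omega>)\<^sup>2) \<and> (CLINT \<omega>|P. iexp (Y \<omega>)) = complex_of_real (exp (- (LINT \<omega>|P. (Y \<omega>)\<^sup>2) / 2))"
  proof (cases "AE \<omega> in P. Y \<omega> = 0")
    case True
    have "integrable P (\<lambda>\<omega>. (Y \<omega>)\<^sup>2) \<longleftrightarrow> integrable P (\<lambda>\<omega>. 0 :: real)"
      by (rule integrable_cong_AE) (use True in auto)
    moreover have "(LINT \<omega>|P. (Y \<omega>)\<^sup>2) = (LINT \<omega>|P. 0)"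
      by (rule integral_cong_AE) (use True in auto)
    moreover have "(CLINT \<omega>|P. iexp (Y \<omega>)) = (CLINT \<omega>|P. 1)"
      by (rule integral_cong_AE) (use True in auto)
    ultimately show ?thesis by (simp add: prob_space)
  next
    case False
    then obtain \<sigma> where \<sigma>: "0 < \<sigma>" "distributed P lborel Y (normal_density 0 \<sigma>)"
      using Y by (auto simp: centred_gaussian_rv_def)
    define Z where "Z = (\<lambda>\<omega>. Y \<omega> / \<sigma>)"
    have "distributed P lborel Z std_normal_density"
      using normal_standard_normal_convert[OF \<sigma>(1), of Y 0] \<sigma>(2) by (simp add: Z_def)
    then have law: "distr P lborel Z = stdN" by (simp add: distributed_def)
    have [measurable]: "Z \<in> borel_measurable P" unfolding Z_def by measurable
    have YZ: "Y \<omega> = \<sigma> * Z \<omega>" for \<omega> using \<sigma> by (simp add: Z_def)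
    have i: "integrable P (\<lambda>\<omega>. (Z \<omega>)\<^sup>2)"
      using integrable_std_normal_distribution_moment[of 2] unfolding law[symmetric]
      by (subst (asm) integrable_distr_eq) auto
    have e: "(LINT \<omega>|P. (Z \<omega>)\<^sup>2) = 1"
    proof -
      have "(LINT \<omega>|P. (Z \<omega>)\<^sup>2) = (LINT x|distr P lborel Z. x\<^sup>2)" by (subst integral_distr) auto
      then show ?thesis using std_normal_distribution_even_moments(1)[of 1] unfolding law by simp
    qed
    have "(CLINT \<omega>|P. iexp (Y \<omega>)) = (CLINT x|distr P lborel Z. iexp (\<sigma> * x))"
      by (subst integral_distr) (auto simp: YZ)
    also have "\<dots> = complex_of_real (exp (- (\<sigma>\<^sup>2) / 2))" unfolding law by (rule iexp_stdN)
    finally show ?thesis using i e by (simp add: YZ power_mult_distrib)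
  qed
  then show "integrable P (\<lambda>\<omega>. (Y \<omega>)\<^sup>2)"
    "(CLINT \<omega>|P. iexp (Y \<omega>)) = complex_of_real (exp (- (LINT \<omega>|P. (Y \<omega>)\<^sup>2) / 2))" by auto
qed

definition cov_int :: "(real ^ 'd \<Rightarrow> real) \<Rightarrow> real \<Rightarrow> real ^ 'd \<Rightarrow> real" where
  "cov_int \<rho> T z = (LINT u:{0..T}|lborel. \<rho> (exp u *\<^sub>R z))"

lemma gaussian_family_field:
  fixes X :: "real \<Rightarrow> real ^ 'd \<Rightarrow> 'w \<Rightarrow> real" and pt :: "'i \<Rightarrow> real ^ 'd"
  assumes P: "prob_space P" and X: "martingale_decomposition P \<rho> X" and T: "0 \<le> T" and I: "finite I"
  shows "gaussian_family P I (\<lambda>i \<omega>. \<gamma> * X T (pt i) \<omega>) (\<lambda>i k. \<gamma>\<^sup>2 * cov_int \<rho> T (pt i - pt k))"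
proof -
  interpret prob_space P by fact
  have G: "centred_gaussian_rv P (\<lambda>\<omega>. \<Sum>i\<in>A. c i * (case i of (t, x) \<Rightarrow> X t x \<omega>))"
    if "finite A" "A \<subseteq> {0..} \<times> UNIV" for A c
    using X that unfolding martingale_decomposition_def centred_jointly_gaussian_def by (simp add: split_beta)
  have cov: "expectation (\<lambda>\<omega>. X T x \<omega> * X T y \<omega>) = cov_int \<rho> T (x - y)" for x y
    using X T unfolding martingale_decomposition_def cov_int_def by simp
  have g1: "centred_gaussian_rv P (X T x)" for x
    using G[of "{(T, x)}" "\<lambda>_. 1"] T by simp
  have [measurable]: "X T x \<in> borel_measurable P" for x using g1 by (simp add: centred_gaussian_rv_def)
  have sq: "integrable P (\<lambda>\<omega>. (X T x \<omega>)\<^sup>2)" for x by (rule centred_gaussian_rv_char[OF P g1])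
  have int: "integrable P (\<lambda>\<omega>. X T x \<omega> * X T y \<omega>)" for x y
  proof (rule Bochner_Integration.integrable_bound[OF Bochner_Integration.integrable_add[OF sq[of x] sq[of y]]])
    show "AE \<omega> in P. norm (X T x \<omega> * X T y \<omega>) \<le> norm ((X T x \<omega>)\<^sup>2 + (X T y \<omega>)\<^sup>2)"
    proof (rule AE_I2)
      fix \<omega>
      have "0 \<le> (\<bar>X T x \<omega>\<bar> - \<bar>X T y \<omega>\<bar>)\<^sup>2" by simp
      then have "2 * (\<bar>X T x \<omega>\<bar> * \<bar>X T y \<omega>\<bar>) \<le> (X T x \<omega>)\<^sup>2 + (X T y \<omega>)\<^sup>2" by (simp add: power2_diff)
      moreover have "0 \<le> \<bar>X T x \<omega>\<bar> * \<bar>X T y \<omega>\<bar>" by simp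
      ultimately show "norm (X T x \<omega> * X T y \<omega>) \<le> norm ((X T x \<omega>)\<^sup>2 + (X T y \<omega>)\<^sup>2)"
        by (simp only: real_norm_def abs_mult)
    qed
  qed measurable
  show ?thesis unfolding gaussian_family_def
  proof (intro conjI ballI allI)
    fix c
    have "centred_gaussian_rv P (\<lambda>\<omega>. \<Sum>i\<in>I. c i * (\<gamma> * X T (pt i) \<omega>))"
    proof -
      \<comment> \<open>Several indices may carry the same point, whereas joint Gaussianity of the
        field is a statement about sets of time-point pairs; the coefficients belonging to one point
        are added up first.\<close>
      let ?e = "\<lambda>p. \<Sum>i\<in>{i\<in>I. (T, pt i) = p}. c i * \<gamma>"
      have "centred_gaussian_rv P (\<lambda>\<omega>. \<Sum>p\<in>(\<lambda>i. (T, pt i)) ` I. ?e p * (case p of (t, x) \<Rightarrow> X t x \<omega>))"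
        by (rule G) (use I T in auto)
      moreover have "(\<Sum>p\<in>(\<lambda>i. (T, pt i)) ` I. ?e p * (case p of (t, x) \<Rightarrow> X t x \<omega>)) = (\<Sum>i\<in>I. c i * (\<gamma> * X T (pt i) \<omega>))" for \<omega>
      proof -
        have "(\<Sum>i\<in>I. c i * (\<gamma> * X T (pt i) \<omega>)) = (\<Sum>p\<in>(\<lambda>i. (T, pt i)) ` I. \<Sum>i\<in>{i\<in>I. (T, pt i) = p}. c i * (\<gamma> * X T (pt i) \<omega>))"
          by (rule sum.image_gen[OF I])
        also have "\<dots> = (\<Sum>p\<in>(\<lambda>i. (T, pt i)) ` I. ?e p * (case p of (t, x) \<Rightarrow> X t x \<omega>))"
          unfolding sum_distrib_right by (intro sum.cong refl) (auto simp: mult.assoc)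
        finally show ?thesis by simp
      qed
      ultimately show ?thesis by simp
    qed
    from centred_gaussian_rv_char(2)[OF P this]
    have "(CLINT \<omega>|P. iexp (\<Sum>i\<in>I. c i * (\<gamma> * X T (pt i) \<omega>))) = complex_of_real (exp (- (LINT \<omega>|P. (\<Sum>i\<in>I. c i * (\<gamma> * X T (pt i) \<omega>))\<^sup>2) / 2))" .
    also have "(LINT \<omega>|P. (\<Sum>i\<in>I. c i * (\<gamma> * X T (pt i) \<omega>))\<^sup>2)
      = (LINT \<omega>|P. (\<Sum>i\<in>I. \<Sum>k\<in>I. (c i * c k * \<gamma>\<^sup>2) * (X T (pt i) \<omega> * X T (pt k) \<omega>)))"
      by (intro Bochner_Integration.integral_cong refl) (simp add: power2_eq_square sum_product mult_ac)
    also have "\<dots> = (\<Sum>i\<in>I. \<Sum>k\<in>I. (c i * c k * \<gamma>\<^sup>2) * cov_int \<rho> T (pt i - pt k))"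
      using int by (simp add: cov)
    finally show "(CLINT \<omega>|P. iexp (\<Sum>i\<in>I. c i * (\<gamma> * X T (pt i) \<omega>)))
       = complex_of_real (exp (- (\<Sum>i\<in>I. \<Sum>k\<in>I. c i * c k * (\<gamma>\<^sup>2 * cov_int \<rho> T (pt i - pt k))) / 2))"
      by (simp only: mult.assoc)
  qed measurable
qed

subsection \<open>The dyadic comparison tree\<close>

lemma seed_continuous: "seed_covariance \<rho> \<Longrightarrow> continuous_on UNIV \<rho>"
  unfolding seed_covariance_def smooth_def by (metis Ck.simps(1))

lemma seed_even:
  assumes "seed_covariance \<rho>" shows "\<rho> (- x) = \<rho> x"
proof -
  have "orthogonal_transformation (\<lambda>x :: real ^ 'd. - x)"
    by (simp add: orthogonal_transformation_neg)
  then show ?thesis using assms unfolding seed_covariance_def rotationally_symmetric_def by blast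
qed

lemma seed_le_1:
  assumes s: "seed_covariance \<rho>" shows "\<rho> x \<le> 1"
proof (cases "x = 0")
  case True
  then show ?thesis using s by (simp add: seed_covariance_def)
next
  case False
  have pd: "0 \<le> (\<Sum>a\<in>A. \<Sum>b\<in>A. c a * c b * \<rho> (a - b))" if "finite A" for A c
    using s that by (simp add: seed_covariance_def positive_definite_fun_def)
  \<comment> \<open>Positive definiteness on the two points \<open>x\<close> and 0 with coefficients
    1 and -1.\<close>
  have "0 \<le> (\<Sum>a\<in>{x, 0}. \<Sum>b\<in>{x, 0}. (if a = 0 then - 1 else 1) * (if b = 0 then - 1 else 1) * \<rho> (a - b))"
    by (rule pd) simp
  also have "\<dots> = 2 - 2 * \<rho> x"
    using s False seed_even[OF s, of x] by (simp add: seed_covariance_def)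
  finally show ?thesis by simp
qed

text \<open>A linear bound at the origin is all that is used of smoothness: along the scales
  \<open>exp u\<close> it sums to a constant as long as the dilated distance stays bounded.\<close>

lemma seed_lower:
  assumes s: "seed_covariance \<rho>"
  obtains C where "0 < C" "\<And>z. 1 - C * norm z \<le> \<rho> z"
proof -
  have "Ck (Suc 0) \<rho>" using s by (simp add: seed_covariance_def smooth_def)
  then have "\<rho> differentiable (at 0)" by (auto simp: differentiable_on_def)
  then obtain D where D: "(\<rho> has_derivative D) (at 0)" by (auto simp: differentiable_def)
  then have bl: "bounded_linear D" by (rule has_derivative_bounded_linear)
  obtain K where K: "0 < K" "\<And>z. norm (D z) \<le> norm z * K" using bounded_linear.pos_bounded[OF bl] by blast
  obtain \<delta> where \<delta>: "0 < \<delta>" "\<And>z. norm (z - 0) < \<delta> \<Longrightarrow> norm (\<rho> z - \<rho> 0 - D (z - 0)) \<le> 1 * norm (z - 0)"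
    using D unfolding has_derivative_at_alt by (metis zero_less_one)
  \<comment> \<open>\<open>K + 1\<close> serves the neighbourhood where the derivative controls the
    seed; outside it \<open>1 / \<delta>\<close> makes the lower bound non-positive.\<close>
  define C where "C = max (K + 1) (1 / \<delta>)"
  have C: "0 < C" "K + 1 \<le> C" "1 / \<delta> \<le> C" using K by (auto simp: C_def)
  have "1 - C * norm z \<le> \<rho> z" for z
  proof (cases "norm z < \<delta>")
    case True
    have "\<rho> 0 = 1" using s by (simp add: seed_covariance_def)
    then have "norm (\<rho> z - 1 - D z) \<le> norm z" using \<delta>(2)[of z] True by simp
    then have "1 - norm z - norm (D z) \<le> \<rho> z" by (simp add: abs_le_iff abs_if split: if_splits)
    moreover have "norm z + norm (D z) \<le> (K + 1) * norm z" using K(2)[of z] by (simp add: algebra_simps)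
    moreover have "(K + 1) * norm z \<le> C * norm z" using C by (intro mult_right_mono) auto
    ultimately show ?thesis by linarith
  next
    case False
    have "1 = 1 / \<delta> * \<delta>" using \<delta> by simp
    also have "\<dots> \<le> C * norm z" using False C \<delta> by (intro mult_mono) auto
    finally show ?thesis using s by (simp add: seed_covariance_def) (smt (verit, best))
  qed
  then show thesis using that C by blast
qed

section \<open>Covariances of the field with cutoff\<close>

lemma scaled_seed_continuous: "seed_covariance \<rho> \<Longrightarrow> continuous_on S (\<lambda>u. \<rho> (exp u *\<^sub>R z))"
  by (rule continuous_on_compose2[OF seed_continuous]) (auto intro!: continuous_intros)

lemma cov_int_eq:
  assumes "seed_covariance \<rho>" shows "cov_int \<rho> T z = integral {0..T} (\<lambda>u. \<rho> (exp u *\<^sub>R z))"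
  unfolding cov_int_def
  by (rule set_borel_integral_eq_integral borel_integrable_atLeastAtMost' scaled_seed_continuous assms)+

lemma scaled_seed_integrable: "seed_covariance \<rho> \<Longrightarrow> (\<lambda>u. \<rho> (exp u *\<^sub>R z)) integrable_on {a..b}"
  by (intro integrable_continuous_interval scaled_seed_continuous)

lemma cov_int_le: assumes s: "seed_covariance \<rho>" and T: "0 \<le> T" shows "cov_int \<rho> T z \<le> T"
proof -
  have "integral {0..T} (\<lambda>u. \<rho> (exp u *\<^sub>R z)) \<le> integral {0..T} (\<lambda>u. 1)"
    by (rule integral_le) (auto intro: scaled_seed_integrable[OF s] seed_le_1[OF s])
  then show ?thesis using T by (simp add: cov_int_eq[OF s])
qed

lemma cov_int_0: assumes s: "seed_covariance \<rho>" and T: "0 \<le> T" shows "cov_int \<rho> T 0 = T"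
  using T s by (simp add: cov_int_eq[OF s] seed_covariance_def)

lemma cov_int_minus: assumes s: "seed_covariance \<rho>" shows "cov_int \<rho> T (x - y) = cov_int \<rho> T (y - x)"
proof -
  have "\<rho> (exp u *\<^sub>R (x - y)) = \<rho> (exp u *\<^sub>R (y - x))" for u
    using seed_even[OF s, of "exp u *\<^sub>R (y - x)"] by (simp add: scaleR_diff_right)
  then show ?thesis by (simp add: cov_int_def)
qed

text \<open>Star-scale invariance: substituting \<open>u + t\<close> for \<open>u\<close>, the
  scales beyond \<open>t\<close> see the displacement \<open>z\<close> as a fresh field sees
  \<open>exp t *\<^sub>R z\<close>. For \<open>t = ln n\<close> the fine part inside a cube of side
  \<open>1 / n\<close> has the covariance of a field on the unit cube.\<close>

lemma cov_int_split:
  assumes s: "seed_covariance \<rho>" and t: "0 \<le> t" "t \<le> T"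
  shows "cov_int \<rho> T z = cov_int \<rho> t z + cov_int \<rho> (T - t) (exp t *\<^sub>R z)"
proof -
  have "integral {0..T} (\<lambda>u. \<rho> (exp u *\<^sub>R z)) = integral {0..t} (\<lambda>u. \<rho> (exp u *\<^sub>R z)) + integral {t..T} (\<lambda>u. \<rho> (exp u *\<^sub>R z))"
    by (rule Henstock_Kurzweil_Integration.integral_combine[symmetric]) (use t scaled_seed_integrable[OF s] in auto)
  also have "integral {t..T} (\<lambda>u. \<rho> (exp u *\<^sub>R z)) = integral {t - t..T - t} (\<lambda>u. \<rho> (exp (u + t) *\<^sub>R z))"
    by (rule integral_shift_real_ivl[symmetric])
  finally show ?thesis by (simp add: cov_int_eq[OF s] exp_add)
qed

text \<open>The scales up to \<open>r\<close> hardly decorrelate at distances of order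
  \<open>exp (- r)\<close>: the losses \<open>C * norm z * exp u\<close> form a geometric series
  dominated by its last terms. The scales beyond \<open>r\<close> contribute non-negatively.\<close>

lemma cov_int_ge:
  assumes s: "seed_covariance \<rho>" and C: "0 < C" "\<And>z. 1 - C * norm z \<le> \<rho> z"
    and r: "0 \<le> r" "r \<le> T" and D: "exp r * norm z \<le> D"
  shows "r - C * D \<le> cov_int \<rho> T z"
proof -
  have i: "((\<lambda>u. 1 - C * norm z * exp u) has_integral ((r - C * norm z * exp r) - (0 - C * norm z * exp 0))) {0..r}"
    by (rule fundamental_theorem_of_calculus)
       (use r in \<open>auto intro!: derivative_eq_intros simp: has_real_derivative_iff_has_vector_derivative[symmetric]\<close>)
  have "r - C * D \<le> r - C * (exp r * norm z)" using D C by simp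
  also have "\<dots> \<le> (r - C * norm z * exp r) - (0 - C * norm z * exp 0)"
    using C by (simp add: mult.assoc mult.commute[of "exp r"])
  also have "\<dots> = integral {0..r} (\<lambda>u. 1 - C * norm z * exp u)" using i by (rule integral_unique[symmetric])
  also have "\<dots> \<le> integral {0..r} (\<lambda>u. \<rho> (exp u *\<^sub>R z))"
  proof (rule integral_le)
    show "(\<lambda>u. 1 - C * norm z * exp u) integrable_on {0..r}" using i by blast
    show "(\<lambda>u. \<rho> (exp u *\<^sub>R z)) integrable_on {0..r}" by (rule scaled_seed_integrable[OF s])
    show "1 - C * norm z * exp u \<le> \<rho> (exp u *\<^sub>R z)" for u
      using C(2)[of "exp u *\<^sub>R z"] by (simp add: mult.commute mult.left_commute)
  qed
  also have "\<dots> \<le> integral {0..T} (\<lambda>u. \<rho> (exp u *\<^sub>R z))"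
    by (rule integral_subset_le) (use r s scaled_seed_integrable[OF s] in \<open>auto simp: seed_covariance_def\<close>)
  finally show ?thesis by (simp add: cov_int_eq[OF s])
qed

section \<open>The Gaussian field on the dyadic tree and its parameters\<close>

lemma gaussian_family_cong:
  assumes "\<And>i \<omega>. i \<in> I \<Longrightarrow> Z i \<omega> = Z' i \<omega>" "\<And>i k. i \<in> I \<Longrightarrow> k \<in> I \<Longrightarrow> K i k = K' i k"
  shows "gaussian_family M I Z K \<longleftrightarrow> gaussian_family M I Z' K'"
proof -
  have m: "Z i \<in> borel_measurable M \<longleftrightarrow> Z' i \<in> borel_measurable M" if "i \<in> I" for i
    using assms(1)[OF that] by (intro measurable_cong) auto
  have e1: "(\<Sum>i\<in>I. c i * Z i \<omega>) = (\<Sum>i\<in>I. c i * Z' i \<omega>)" for c \<omega> using assms(1) by simp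
  have e2: "(\<Sum>i\<in>I. \<Sum>k\<in>I. c i * c k * K i k) = (\<Sum>i\<in>I. \<Sum>k\<in>I. c i * c k * K' i k)" for c using assms(2) by simp
  show ?thesis unfolding gaussian_family_def e1 e2 using m by auto
qed

text \<open>An edge is named by its level and its lower end. The index set of the finest level
  contains the vertices of all levels, so the edges form a product.\<close>

definition tree_edges :: "nat \<Rightarrow> (nat \<times> (nat ^ 'd::finite)) set" where
  "tree_edges k = {0<..k} \<times> grid_index (2 ^ k)"

lemma finite_tree_edges [simp]: "finite (tree_edges k)"
  by (simp add: tree_edges_def)

lemma anc_tree_edge:
  assumes "j \<in> grid_index n" "0 < l" "l \<le> k" shows "(l, anc n l j) \<in> tree_edges k"
proof -
  have "(2::nat) ^ l \<le> 2 ^ k" using assms by (intro power_increasing) auto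
  moreover have "anc n l j $ c < 2 ^ l" for c
    using anc_in_grid[OF assms(1), of l] by (simp add: grid_index_def)
  ultimately have "anc n l j $ c < 2 ^ k" for c by (meson less_le_trans)
  then have "anc n l j \<in> grid_index (2 ^ k)" by (simp add: grid_index_def)
  then show ?thesis using assms by (simp add: tree_edges_def)
qed

text \<open>The field depends on the block alone. The second component of the index is carried along
  so that the field can be added to one that varies inside the blocks.\<close>

lemma gaussian_family_tree:
  fixes I :: "((nat ^ 'd::finite) \<times> 'a) set"
  assumes I: "finite I" "\<And>i. i \<in> I \<Longrightarrow> fst i \<in> grid_index n"
  shows "gaussian_family (PiM (tree_edges k) (\<lambda>_. stdN)) I (\<lambda>i \<omega>. \<Sum>l\<in>{0<..k}. g * \<omega> (l, anc n l (fst i)))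
     (\<lambda>i i'. g\<^sup>2 * real (common_levels n k (fst i) (fst i')))"
proof -
  define W where "W = (\<lambda>(i :: (nat ^ 'd) \<times> 'a) e. if anc n (fst e) (fst i) = snd e then g else 0)"
  have gi: "anc n l (fst i) \<in> grid_index (2 ^ k)" if "i \<in> I" "l \<in> {0<..k}" for i l
    using anc_tree_edge[OF I(2)[OF that(1)], of l k] that by (simp add: tree_edges_def)
  have prod: "(\<Sum>e\<in>tree_edges k. F e) = (\<Sum>l\<in>{0<..k}. \<Sum>v\<in>grid_index (2 ^ k). F (l, v))" for F :: "nat \<times> (nat ^ 'd) \<Rightarrow> real"
    unfolding tree_edges_def by (simp add: sum.cartesian_product split_beta)
  have "gaussian_family (PiM (tree_edges k) (\<lambda>_. stdN)) I (\<lambda>i \<omega>. \<Sum>e\<in>tree_edges k. W i e * \<omega> e) (\<lambda>i i'. \<Sum>e\<in>tree_edges k. W i e * W i' e)"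
    by (rule gaussian_family_linear) (use I in auto)
  also have "?this \<longleftrightarrow> ?thesis"
  proof (rule gaussian_family_cong)
    fix i \<omega> assume i: "i \<in> I"
    have "(\<Sum>v\<in>grid_index (2 ^ k). W i (l, v) * \<omega> (l, v)) = g * \<omega> (l, anc n l (fst i))" if l: "l \<in> {0<..k}" for l
    proof -
      have "(\<Sum>v\<in>grid_index (2 ^ k). W i (l, v) * \<omega> (l, v))
        = (\<Sum>v\<in>grid_index (2 ^ k). if v = anc n l (fst i) then g * \<omega> (l, v) else 0)"
        by (intro sum.cong refl) (auto simp: W_def)
      then show ?thesis using gi[OF i l] by simp
    qed
    then show "(\<Sum>e\<in>tree_edges k. W i e * \<omega> e) = (\<Sum>l\<in>{0<..k}. g * \<omega> (l, anc n l (fst i)))"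
      unfolding prod by (intro sum.cong refl)
  next
    fix i i' assume i: "i \<in> I" "i' \<in> I"
    have "(\<Sum>v\<in>grid_index (2 ^ k). W i (l, v) * W i' (l, v)) = (if anc n l (fst i) = anc n l (fst i') then g\<^sup>2 else 0)" if l: "l \<in> {0<..k}" for l
    proof -
      have "(\<Sum>v\<in>grid_index (2 ^ k). W i (l, v) * W i' (l, v))
        = (\<Sum>v\<in>grid_index (2 ^ k). if v = anc n l (fst i) then (if anc n l (fst i) = anc n l (fst i') then g\<^sup>2 else 0) else 0)"
        by (intro sum.cong refl) (auto simp: W_def power2_eq_square)
      then show ?thesis using gi[OF i(1) l] by simp
    qed
    then have "(\<Sum>e\<in>tree_edges k. W i e * W i' e) = (\<Sum>l\<in>{0<..k}. if anc n l (fst i) = anc n l (fst i') then g\<^sup>2 else 0)"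
      unfolding prod by (intro sum.cong refl)
    also have "\<dots> = (\<Sum>l\<in>{l\<in>{0<..k}. anc n l (fst i) = anc n l (fst i')}. g\<^sup>2)"
      by (rule sum.inter_filter[symmetric]) simp
    finally show "(\<Sum>e\<in>tree_edges k. W i e * W i' e) = g\<^sup>2 * real (common_levels n k (fst i) (fst i'))"
      by (simp add: common_levels_def)
  qed
  finally show ?thesis .
qed

lemma nn_integral_exp_atMost: "(\<integral>\<^sup>+y. ennreal (exp y) * indicator {..a} y \<partial>lborel) = ennreal (exp a)" for a :: real
proof -
  have "(\<integral>\<^sup>+y. ennreal (exp y) * indicator {..a} y \<partial>lborel) = (\<integral>\<^sup>+y. ennreal (exp (- y)) * indicator {- a..} y \<partial>lborel)"
    by (subst nn_integral_real_affine[of _ "-1" 0]) (auto simp: indicator_def intro!: nn_integral_cong)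
  then show ?thesis by (simp add: nn_integral_exp_atLeast)
qed

text \<open>The integrand is bounded by \<open>D\<close>, and also by \<open>exp y\<close>, which
  makes the integral over the negative half-line converge.\<close>

lemma exponential_leaf_average:
  fixes D L :: real
  assumes D: "1 \<le> D"
  shows "(\<integral>\<^sup>+y. ennreal (exp y) * ennreal (1 - exp (- D * exp (- y))) * indicator {..L} y \<partial>lborel) \<le> ennreal (D * (1 + max 0 L))"
proof -
  have "(\<integral>\<^sup>+y. ennreal (exp y) * ennreal (1 - exp (- D * exp (- y))) * indicator {..L} y \<partial>lborel)
     \<le> (\<integral>\<^sup>+y. ennreal (exp y) * indicator {..0} y + ennreal D * indicator {0..max 0 L} y \<partial>lborel)"
  proof (rule nn_integral_mono)
    fix y
    have "1 - exp (- D * exp (- y)) \<le> D * exp (- y)" using exp_ge_add_one_self[of "- D * exp (- y)"] by simp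
    then have "exp y * (1 - exp (- D * exp (- y))) \<le> exp y * (D * exp (- y))" by (rule mult_left_mono) simp
    also have "\<dots> = D" by (simp add: exp_minus)
    finally have a: "ennreal (exp y) * ennreal (1 - exp (- D * exp (- y))) \<le> ennreal D"
      by (subst ennreal_mult'[symmetric]) (auto intro: ennreal_leI)
    have "exp y * (1 - exp (- D * exp (- y))) \<le> exp y * 1" by (intro mult_left_mono) auto
    then have b: "ennreal (exp y) * ennreal (1 - exp (- D * exp (- y))) \<le> ennreal (exp y)"
      by (subst ennreal_mult'[symmetric]) (auto intro: ennreal_leI)
    show "ennreal (exp y) * ennreal (1 - exp (- D * exp (- y))) * indicator {..L} y \<le> ennreal (exp y) * indicator {..0} y + ennreal D * indicator {0..max 0 L} y"
      using a b by (cases "y \<le> 0") (auto simp: indicator_def intro: order_trans)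
  qed
  also have "\<dots> = ennreal (exp 0) + ennreal D * ennreal (max 0 L)"
    by (subst nn_integral_add) (auto simp: nn_integral_exp_atMost nn_integral_cmult)
  also have "\<dots> \<le> ennreal (D * (1 + max 0 L))"
  proof -
    have "ennreal (exp 0) + ennreal D * ennreal (max 0 L) = ennreal (1 + D * max 0 L)"
    proof -
      have "ennreal (1 + D * max 0 L) = ennreal 1 + ennreal D * ennreal (max 0 L)"
        by (rule ennreal_affine) (use D in auto)
      then show ?thesis by (simp only: exp_zero)
    qed
    also have "\<dots> \<le> ennreal (D * (1 + max 0 L))" using D by (intro ennreal_leI) (simp add: algebra_simps)
    finally show ?thesis .
  qed
  finally show ?thesis .
qed

text \<open>The standard deviation of one edge. A dyadic level corresponds to time
  \<open>ln 2\<close>, and criticality makes \<open>exp (g\<^sup>2 / 2)\<close> equal to the number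
  \<open>2 ^ CARD('d)\<close> of children.\<close>

definition branching_step :: "'d::finite itself \<Rightarrow> real" where
  "branching_step _ = critical_gamma TYPE('d) * sqrt (ln 2)"

lemma critical_gamma_sq: "(critical_gamma TYPE('d::finite))\<^sup>2 = 2 * real CARD('d)"
  by (simp add: critical_gamma_def)

lemma critical_gamma_pos: "0 < critical_gamma TYPE('d::finite)"
  by (simp add: critical_gamma_def)

lemma branching_step_sq: "(branching_step TYPE('d::finite))\<^sup>2 = 2 * real CARD('d) * ln 2"
  by (simp add: branching_step_def power_mult_distrib critical_gamma_sq)

lemma branching_step_pos: "0 < branching_step TYPE('d::finite)"
  by (simp add: branching_step_def critical_gamma_pos)

lemma branching_step_exp: "exp ((branching_step TYPE('d::finite))\<^sup>2 / 2) = 2 ^ CARD('d)"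
proof -
  have "exp ((branching_step TYPE('d))\<^sup>2 / 2) = exp (real CARD('d) * ln 2)" by (simp add: branching_step_sq)
  also have "\<dots> = exp (ln 2) ^ CARD('d)" by (rule exp_of_nat_mult)
  finally show ?thesis by simp
qed

text \<open>The Riemann sum over lower grid corners for the mass that the approximation at time
  \<open>T\<close> gives to the unit cube.\<close>

definition unit_mass :: "(real \<Rightarrow> real ^ 'd \<Rightarrow> 'w \<Rightarrow> real) \<Rightarrow> nat \<Rightarrow> real \<Rightarrow> 'w \<Rightarrow> real" where
  "unit_mass X n T \<omega> = (\<Sum>a\<in>grid_index n. (1 / real n) ^ CARD('d) * sqrt T * exp (- (real CARD('d) * T)) *
      exp (critical_gamma TYPE('d) * X T (grid_point n a 0) \<omega>))"

text \<open>\<open>F\<close> is the Laplace functional attached to one grid point. When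
  \<open>n\<close> exceeds \<open>2 ^ k\<close>, several grid points end in the same leaf;
  \<open>H\<close> has to dominate \<open>1 - F x ^ m\<close> for every possible number
  \<open>m\<close> of them.\<close>

lemma tree_expectation_bound:
  fixes F :: "real \<Rightarrow> real"
  defines "g \<equiv> branching_step TYPE('d::finite)"
  assumes n: "2 ^ k \<le> n" and k: "1 \<le> k" and F [measurable]: "F \<in> borel_measurable borel" and F01: "\<And>x. 0 \<le> F x" "\<And>x. F x \<le> 1"
    and H [measurable]: "H \<in> borel_measurable borel" and H1: "\<And>x. H x \<le> 1"
    and leaf: "\<And>m x. real m \<le> (2 * real n / 2 ^ k) ^ CARD('d) \<Longrightarrow> ennreal (1 - F x ^ m) \<le> H x"
    and C: "0 \<le> C" and a: "0 \<le> a" and L: "0 \<le> L"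
    and av: "\<And>L. (\<integral>\<^sup>+y. ennreal (exp y) * H y * indicator {..L} y \<partial>lborel) \<le> ennreal (C * (1 + max 0 L))"
  shows "(\<integral>\<^sup>+\<omega>. ennreal (1 - (\<Prod>j\<in>(grid_index n :: (nat ^ 'd) set). F (L - (ln (real k) / 2 + a) - (\<Sum>l\<in>{0<..k}. g * \<omega> (l, anc n l j) - g\<^sup>2))))
       \<partial>PiM (tree_edges k) (\<lambda>_. stdN)) \<le> ennreal (exp (- L) * (1 + exp a * (C * walk_const g * (L + 3/2 * g))))"
proof -
  have n0: "0 < n" using n by (metis gr0I le_zero_eq power_not_zero zero_neq_numeral)
  have "(\<integral>\<^sup>+\<omega>. ennreal (1 - (\<Prod>j\<in>(grid_index n :: (nat ^ 'd) set). F (L - (ln (real k) / 2 + a) - (\<Sum>l\<in>{0<..k}. g * \<omega> (l, anc n l j) - g\<^sup>2))))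
       \<partial>PiM (tree_edges k) (\<lambda>_. stdN)) \<le> casc g H k (L - (ln (real k) / 2 + a))"
  proof (rule tree_bound[where k = k and J = "grid_index n"])
    show "ennreal (1 - F x ^ card J') \<le> H x"
      if "\<And>j j'. j \<in> J' \<Longrightarrow> j' \<in> J' \<Longrightarrow> anc n k j = anc n k j'" for J' :: "(nat ^ 'd) set" and x
      by (rule leaf, rule card_anc_class_le[OF n]) (rule that)
    show "real (card (anc n (Suc i) ` J')) \<le> exp (g\<^sup>2 / 2)"
      if "\<And>j j'. j \<in> J' \<Longrightarrow> j' \<in> J' \<Longrightarrow> anc n i j = anc n i j'" for J' :: "(nat ^ 'd) set" and i
    proof -
      have "card (anc n (Suc i) ` J') \<le> 2 ^ CARD('d)" by (rule card_anc_children_le[OF n0]) (rule that)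
      then have "real (card (anc n (Suc i) ` J')) \<le> real (2 ^ CARD('d))" by (simp only: of_nat_le_iff)
      then show ?thesis unfolding g_def branching_step_exp by simp
    qed
    show "anc n 0 j = anc n 0 j'" if "j \<in> grid_index n" "j' \<in> grid_index n" for j j' :: "nat ^ 'd"
      using that by (auto simp: anc_def grid_index_def vec_eq_iff)
    show "(l, anc n l j) \<in> tree_edges k" if "0 < l" "l \<le> k" "j \<in> grid_index n" for l and j :: "nat ^ 'd"
      using anc_tree_edge[OF that(3) that(1,2)] .
  qed (use F01 in auto)
  also have "\<dots> \<le> ennreal (exp (- L) * (1 + exp a * (C * walk_const g * (L + 3/2 * g))))"
    by (rule casc_bound[OF H H1 C _ k a L av]) (simp add: g_def branching_step_pos)
  finally show ?thesis .
qed

subsection \<open>Mass of the unit cube\<close>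

lemma exp_card_ln2: "exp (- (real CARD('d::finite) * (real k * ln 2))) = (1 / 2 ^ k) ^ CARD('d)"
proof -
  have "exp (- (real CARD('d) * (real k * ln 2))) = exp (real CARD('d) * (real k * (- ln 2)))" by simp
  also have "\<dots> = (exp (- ln 2) ^ k) ^ CARD('d)" by (simp only: exp_of_nat_mult)
  finally show ?thesis by (simp add: exp_minus power_divide inverse_eq_divide)
qed

lemma common_levels_commute: "common_levels n k j j' = common_levels n k j' j"
  unfolding common_levels_def by (rule arg_cong[where f = card]) auto

lemma gaussian_family_measurable: "gaussian_family M I Z K \<Longrightarrow> i \<in> I \<Longrightarrow> Z i \<in> borel_measurable M"
  by (simp add: gaussian_family_def)

lemma field_measurable:
  assumes "prob_space P" "martingale_decomposition P \<rho> X" "0 \<le> T"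
  shows "X T x \<in> borel_measurable P"
  using gaussian_family_measurable[OF gaussian_family_field[OF assms, of "{()}" 1 "\<lambda>_. x"]] by simp

lemma unit_mass_measurable:
  assumes "prob_space P" "martingale_decomposition P \<rho> X" "0 \<le> T"
  shows "unit_mass X n T \<in> borel_measurable P"
proof -
  note [measurable] = field_measurable[OF assms]
  show ?thesis unfolding unit_mass_def[abs_def] by measurable
qed

lemma unit_mass_nonneg: "0 \<le> T \<Longrightarrow> 0 \<le> unit_mass X n T \<omega>"
  unfolding unit_mass_def by (intro sum_nonneg) simp

text \<open>The first comparison: one-point blocks, exponent 1, and a tree of depth \<open>k\<close>
  with \<open>k * ln 2\<close> close to \<open>T\<close>. The constant depends neither on
  \<open>k\<close> nor on the resolution \<open>n \<ge> 2 ^ k\<close>, which is what later permits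
  taking these masses as leaves at arbitrary resolution.\<close>

theorem unit_mass_bound:
  fixes X :: "real \<Rightarrow> real ^ 'd \<Rightarrow> 'w \<Rightarrow> real"
  assumes P: "prob_space P" and s: "seed_covariance \<rho>" and X: "martingale_decomposition P \<rho> X"
  obtains C where "0 \<le> C" "\<And>T k n L. 1 \<le> k \<Longrightarrow> real k * ln 2 \<le> T \<Longrightarrow> T \<le> (real k + 1) * ln 2 \<Longrightarrow> 2 ^ k \<le> n \<Longrightarrow> 0 \<le> L \<Longrightarrow>
     (LINT \<omega>|P. 1 - exp (- (exp (- L) * unit_mass X n T \<omega>))) \<le> exp (- L) * (C * (1 + L))"
proof -
  interpret prob_space P by fact
  let ?d = "real CARD('d)" and ?\<gamma> = "critical_gamma TYPE('d)"
  define g where "g = branching_step TYPE('d)"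
  have g: "0 < g" unfolding g_def by (rule branching_step_pos)
  obtain c\<rho> where c\<rho>: "0 < c\<rho>" "\<And>z. 1 - c\<rho> * norm z \<le> \<rho> z" using seed_lower[OF s] by blast
  \<comment> \<open>\<open>c\<rho> * (2 * ?d)\<close> is the loss of correlation within the distance
    given by \<open>common_levels_dist\<close>; \<open>ln 2\<close> covers the difference between
    \<open>T\<close> and \<open>k * ln 2\<close>.\<close>
  define C0 where "C0 = ?\<gamma>\<^sup>2 * (c\<rho> * (2 * ?d) + ln 2)"
  have C0: "0 \<le> C0" unfolding C0_def using c\<rho> by simp
  have g2: "g\<^sup>2 = ?\<gamma>\<^sup>2 * ln 2" by (simp add: g_def branching_step_def power_mult_distrib)
  define K where "K = exp (4 * C0) * (1 + exp (ln 2 / 2) * (2 ^ CARD('d) * walk_const g * (1 + 3/2 * g)))"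
  have K: "0 \<le> K" unfolding K_def using g walk_const_pos[OF g] by (auto intro!: mult_nonneg_nonneg add_nonneg_nonneg)
  have "(LINT \<omega>|P. 1 - exp (- (exp (- L) * unit_mass X n T \<omega>))) \<le> exp (- L) * (K * (1 + L))"
    if k: "1 \<le> k" and T: "real k * ln 2 \<le> T" "T \<le> (real k + 1) * ln 2" and n: "2 ^ k \<le> n" and L: "0 \<le> L" for T k n L
  proof -
    have n0: "0 < n" using n by (metis gr0I le_zero_eq power_not_zero zero_neq_numeral)
    have T0: "0 < T" 
    proof -
      have "0 < real k * ln 2" using k by (intro mult_pos_pos) auto
      then show ?thesis using T(1) by linarith
    qed
    define p where "p = exp (- L) * ((1 / real n) ^ CARD('d) * sqrt T * exp (- (?d * T)))"
    have p: "0 < p" unfolding p_def using n0 T0 by simp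
    interpret B: block_functional "grid_index n :: (nat ^ 'd) set" "{()}" p 1
      by unfold_locales (use p in auto)
    have BG: "B.G z = (\<Sum>j\<in>grid_index n. p * exp (z (j, ())))" for z
    proof -
      have S: "B.S z j = p * exp (z (j, ()))" for j by (simp add: B.S_def)
      show ?thesis unfolding B.G_def S using p by simp
    qed
    let ?I = "(grid_index n :: (nat ^ 'd) set) \<times> {()}"
    let ?Y = "\<lambda>i \<omega>. \<Sum>l\<in>{0<..k}. g * \<omega> (l, anc n l (fst i))"
    let ?Q = "PiM (tree_edges k) (\<lambda>_. stdN) :: (nat \<times> (nat ^ 'd) \<Rightarrow> real) measure"
    interpret Q: prob_space ?Q by (rule prob_space_PiM_const[OF prob_space_stdN])
    have gX: "gaussian_family P ?I (\<lambda>i \<omega>. ?\<gamma> * X T (grid_point n (fst i) 0) \<omega>) (\<lambda>i k. ?\<gamma>\<^sup>2 * cov_int \<rho> T (grid_point n (fst i) 0 - grid_point n (fst k) 0))"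
      by (rule gaussian_family_field[OF P X]) (use T0 in auto)
    have gY: "gaussian_family ?Q ?I ?Y (\<lambda>i i'. g\<^sup>2 * real (common_levels n k (fst i) (fst i')))"
      by (rule gaussian_family_tree) auto
    have "(LINT \<omega>|P. B.\<Phi> (\<lambda>i. ?\<gamma> * X T (grid_point n (fst i) 0) \<omega>)) \<le> exp (4 * C0 * 1\<^sup>2) * (LINT \<omega>|?Q. B.\<Phi> (\<lambda>i. ?Y i \<omega>))"
    proof (rule B.kahane_comparison[OF P Q.prob_space_axioms gX gY _ _ _ _ C0])
      fix i k' :: "(nat ^ 'd) \<times> unit"
      show "?\<gamma>\<^sup>2 * cov_int \<rho> T (grid_point n (fst i) 0 - grid_point n (fst k') 0) = ?\<gamma>\<^sup>2 * cov_int \<rho> T (grid_point n (fst k') 0 - grid_point n (fst i) 0)"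
        by (simp add: cov_int_minus[OF s, of T "grid_point n (fst i) 0"])
      show "g\<^sup>2 * real (common_levels n k (fst i) (fst k')) = g\<^sup>2 * real (common_levels n k (fst k') (fst i))"
        by (simp only: common_levels_commute[of n k "fst i" "fst k'"])
      assume i: "i \<in> ?I"
      show "0 < ?\<gamma>\<^sup>2 * cov_int \<rho> T (grid_point n (fst i) 0 - grid_point n (fst i) 0)"
        using T0 critical_gamma_pos[where 'd = 'd] by (simp add: cov_int_0[OF s])
      show "0 < g\<^sup>2 * real (common_levels n k (fst i) (fst i))"
        using g k by (simp add: common_levels_self)
      assume k': "k' \<in> ?I"
      let ?z = "grid_point n (fst i) 0 - grid_point n (fst k') 0"
      let ?r = "real (common_levels n k (fst i) (fst k')) * ln 2"
      have "?r \<le> real k * ln 2" using common_levels_le by (intro mult_right_mono) auto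
      then have r: "0 \<le> ?r" "?r \<le> T" using T(1) by (simp, linarith)
      have "exp ?r = 2 ^ common_levels n k (fst i) (fst k')" by (simp add: exp_of_nat_mult)
      then have "exp ?r * norm ?z \<le> 2 * ?d"
        using common_levels_dist[OF n, of "fst i" "fst k'" 0 0] i k' by auto
      from cov_int_ge[OF s c\<rho> r this] have "?r - c\<rho> * (2 * ?d) \<le> cov_int \<rho> T ?z" .
      then have "?\<gamma>\<^sup>2 * (?r - c\<rho> * (2 * ?d)) \<le> ?\<gamma>\<^sup>2 * cov_int \<rho> T ?z" by (intro mult_left_mono) auto
      moreover have "?\<gamma>\<^sup>2 * (?r - c\<rho> * (2 * ?d)) = g\<^sup>2 * real (common_levels n k (fst i) (fst k')) - ?\<gamma>\<^sup>2 * (c\<rho> * (2 * ?d))"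
        unfolding g2 by (simp add: algebra_simps)
      moreover have "C0 = ?\<gamma>\<^sup>2 * (c\<rho> * (2 * ?d)) + ?\<gamma>\<^sup>2 * ln 2" "0 \<le> ?\<gamma>\<^sup>2 * ln 2"
        by (simp_all add: C0_def distrib_left)
      ultimately show "- C0 \<le> ?\<gamma>\<^sup>2 * cov_int \<rho> T ?z - g\<^sup>2 * real (common_levels n k (fst i) (fst k'))"
        by linarith
      assume f: "fst i = fst k'"
      have "?\<gamma>\<^sup>2 * (T - real k * ln 2) \<le> ?\<gamma>\<^sup>2 * (c\<rho> * (2 * ?d) + ln 2)"
      proof (rule mult_left_mono)
        have "0 \<le> c\<rho> * (2 * ?d)" using c\<rho> by simp
        then show "T - real k * ln 2 \<le> c\<rho> * (2 * ?d) + ln 2" using T by (simp add: algebra_simps)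
      qed simp
      then show "?\<gamma>\<^sup>2 * cov_int \<rho> T ?z - g\<^sup>2 * real (common_levels n k (fst i) (fst k')) \<le> C0"
        unfolding C0_def g2 using f T0 by (simp add: common_levels_self cov_int_0[OF s] algebra_simps)
    qed
    moreover have "B.\<Phi> (\<lambda>i. ?\<gamma> * X T (grid_point n (fst i) 0) \<omega>) = 1 - exp (- (exp (- L) * unit_mass X n T \<omega>))" for \<omega>
      unfolding B.\<Phi>_def BG by (simp add: p_def unit_mass_def sum_distrib_left mult.assoc)
    moreover have "(LINT \<omega>|?Q. B.\<Phi> (\<lambda>i. ?Y i \<omega>)) \<le> exp (- L) * (1 + exp (ln 2 / 2) * (2 ^ CARD('d) * walk_const g * (L + 3/2 * g)))"
    proof -
      \<comment> \<open>The share of one grid point in the volume of a dyadic cube of level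
        \<open>k\<close>.\<close>
      define \<eta> where "\<eta> = (2 ^ k / real n) ^ CARD('d)"
      have \<eta>: "0 \<le> \<eta>" by (simp add: \<eta>_def)
      \<comment> \<open>The room \<open>a = ln 2 / 2\<close> of \<open>casc_bound\<close> is spent
        on \<open>sqrt T \<le> sqrt (2 * k)\<close>, which holds since
        \<open>T \<le> (k + 1) * ln 2\<close>.\<close>
      define x0 where "x0 = L - (ln (real k) / 2 + ln 2 / 2)"
      let ?F = "\<lambda>x. exp (- (\<eta> * exp (- x)))" and ?H = "\<lambda>x. ennreal (1 - exp (- (2 ^ CARD('d)) * exp (- x)))"
      have pw: "B.\<Phi> (\<lambda>i. ?Y i \<omega>) \<le> 1 - (\<Prod>j\<in>(grid_index n :: (nat ^ 'd) set). ?F (x0 - (\<Sum>l\<in>{0<..k}. g * \<omega> (l, anc n l j) - g\<^sup>2)))" for \<omega>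
      proof -
        \<comment> \<open>The drift of the \<open>k\<close> edges adds up to
          \<open>k * g\<^sup>2 = 2 * ?d * k * ln 2\<close>. One half of it accounts for the
          normalisation \<open>exp (- (?d * T))\<close>, the other for the volume of a dyadic cube,
          which \<open>\<eta>\<close> reduces to that of a grid cell.\<close>
        have "p \<le> \<eta> * exp (- x0) * exp (- (real k * g\<^sup>2))"
        proof -
          have e1: "exp (- x0) = exp (- L) * (sqrt (real k) * sqrt 2)"
            using k by (simp add: x0_def exp_add exp_diff ln_sqrt[symmetric] exp_minus field_simps)
          have e2: "exp (- (real k * g\<^sup>2)) = (1 / 2 ^ k) ^ CARD('d) * (1 / 2 ^ k) ^ CARD('d)"
          proof -
            have "- (real k * g\<^sup>2) = - (?d * (real k * ln 2)) + - (?d * (real k * ln 2))"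
              unfolding g_def branching_step_sq by simp
            then show ?thesis by (simp only: exp_add exp_card_ln2)
          qed
          have e3: "\<eta> * ((1 / 2 ^ k) ^ CARD('d) * (1 / 2 ^ k) ^ CARD('d)) = (1 / real n) ^ CARD('d) * (1 / 2 ^ k) ^ CARD('d)"
          proof -
            have "a / m * (1 / a * (1 / a)) = 1 / m * (1 / a)" if "a \<noteq> 0" for a m :: real using that by simp
            from this[of "2 ^ k" "real n"] show ?thesis
              unfolding \<eta>_def by (simp only: power_mult_distrib[symmetric]) simp
          qed
          have "T \<le> real k * 2"
          proof -
            have "(real k + 1) * ln 2 \<le> (real k + 1) * 1" using ln_2_less_1 by (intro mult_left_mono) auto
            then have "T \<le> (real k + 1) * 1" using T(2) by linarith
            then show ?thesis using k by simp
          qed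
          then have "sqrt T \<le> sqrt (real k) * sqrt 2" by (simp add: real_sqrt_mult[symmetric])
          moreover have "exp (- (?d * T)) \<le> (1 / 2 ^ k) ^ CARD('d)"
            unfolding exp_card_ln2[symmetric] using T(1) by (simp add: mult_left_mono)
          ultimately have "sqrt T * exp (- (?d * T)) \<le> (sqrt (real k) * sqrt 2) * (1 / 2 ^ k) ^ CARD('d)"
            by (intro mult_mono) auto
          then have "exp (- L) * (1 / real n) ^ CARD('d) * (sqrt T * exp (- (?d * T))) \<le> exp (- L) * (1 / real n) ^ CARD('d) * ((sqrt (real k) * sqrt 2) * (1 / 2 ^ k) ^ CARD('d))"
            by (intro mult_left_mono) auto
          also have "\<dots> = exp (- L) * (sqrt (real k) * sqrt 2) * (\<eta> * ((1 / 2 ^ k) ^ CARD('d) * (1 / 2 ^ k) ^ CARD('d)))"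
            unfolding e3 by (simp only: mult_ac)
          finally show ?thesis unfolding p_def e1 e2 by (simp only: mult_ac)
        qed
        then have pe: "p * exp (\<Sum>l\<in>{0<..k}. g * \<omega> (l, anc n l j)) \<le> \<eta> * exp (- (x0 - (\<Sum>l\<in>{0<..k}. g * \<omega> (l, anc n l j) - g\<^sup>2)))" for j :: "nat ^ 'd"
        proof -
          assume a: "p \<le> \<eta> * exp (- x0) * exp (- (real k * g\<^sup>2))"
          have "p * exp (\<Sum>l\<in>{0<..k}. g * \<omega> (l, anc n l j)) \<le> \<eta> * exp (- x0) * exp (- (real k * g\<^sup>2)) * exp (\<Sum>l\<in>{0<..k}. g * \<omega> (l, anc n l j))"
            using a by (rule mult_right_mono) simp
          also have "\<dots> = \<eta> * exp (- (x0 - (\<Sum>l\<in>{0<..k}. g * \<omega> (l, anc n l j) - g\<^sup>2)))"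
            by (simp add: sum_subtractf mult.assoc exp_add[symmetric])
          finally show ?thesis .
        qed
        have "B.G (\<lambda>i. ?Y i \<omega>) = (\<Sum>j\<in>(grid_index n :: (nat ^ 'd) set). p * exp (\<Sum>l\<in>{0<..k}. g * \<omega> (l, anc n l j)))"
          unfolding BG by simp
        also have "\<dots> \<le> (\<Sum>j\<in>(grid_index n :: (nat ^ 'd) set). \<eta> * exp (- (x0 - (\<Sum>l\<in>{0<..k}. g * \<omega> (l, anc n l j) - g\<^sup>2))))"
          by (intro sum_mono pe)
        finally show ?thesis unfolding B.\<Phi>_def by (simp add: exp_sum[symmetric] sum_negf)
      qed
      have mY: "(\<lambda>\<omega>. \<lambda>i\<in>?I. ?Y i \<omega>) \<in> measurable ?Q (PiM ?I (\<lambda>_. borel))"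
        using gaussian_family_measurable[OF gY] by (intro measurable_restrict) auto
      have mPhi [measurable]: "(\<lambda>\<omega>. B.\<Phi> (\<lambda>i. ?Y i \<omega>)) \<in> borel_measurable ?Q"
        using measurable_compose[OF mY B.measurable_restricted(2)] by (simp add: B.cong_restrict)
      have "ennreal (LINT \<omega>|?Q. B.\<Phi> (\<lambda>i. ?Y i \<omega>)) = (\<integral>\<^sup>+\<omega>. ennreal (B.\<Phi> (\<lambda>i. ?Y i \<omega>)) \<partial>?Q)"
        by (rule nn_integral_eq_integral[symmetric], rule Q.integrable_const_bound[of _ 1]) (use B.\<Phi>_bounds in auto)
      also have "\<dots> \<le> (\<integral>\<^sup>+\<omega>. ennreal (1 - (\<Prod>j\<in>(grid_index n :: (nat ^ 'd) set). ?F (x0 - (\<Sum>l\<in>{0<..k}. g * \<omega> (l, anc n l j) - g\<^sup>2)))) \<partial>?Q)"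
        by (intro nn_integral_mono ennreal_leI pw)
      also have "\<dots> \<le> ennreal (exp (- L) * (1 + exp (ln 2 / 2) * (2 ^ CARD('d) * walk_const g * (L + 3/2 * g))))"
        unfolding x0_def g_def
      proof (rule tree_expectation_bound[OF n k, where H = ?H])
        fix m x assume m: "real m \<le> (2 * real n / 2 ^ k) ^ CARD('d)"
        \<comment> \<open>A leaf holds at most \<open>(2 * n / 2 ^ k) ^ CARD('d)\<close> grid points
          of share \<open>\<eta>\<close>, so its total share is at most \<open>2 ^ CARD('d)\<close>,
          uniformly in \<open>n\<close>.\<close>
        have "real m * \<eta> \<le> (2 * real n / 2 ^ k) ^ CARD('d) * \<eta>" using m \<eta> by (rule mult_right_mono)
        also have "\<dots> = 2 ^ CARD('d)" using n0 by (simp add: \<eta>_def power_mult_distrib[symmetric])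
        finally have "real m * \<eta> * exp (- x) \<le> 2 ^ CARD('d) * exp (- x)" by (rule mult_right_mono) simp
        moreover have "?F x ^ m = exp (- (real m * \<eta> * exp (- x)))"
          by (simp add: exp_of_nat_mult[symmetric] mult.assoc)
        ultimately show "ennreal (1 - ?F x ^ m) \<le> ?H x" by (intro ennreal_leI) simp
      next
        show "(\<integral>\<^sup>+y. ennreal (exp y) * ?H y * indicator {..L} y \<partial>lborel) \<le> ennreal (2 ^ CARD('d) * (1 + max 0 L))" for L
          by (rule exponential_leaf_average) simp
      qed (use \<eta> L in \<open>auto intro!: ennreal_le_1[THEN iffD2]\<close>)
      finally show ?thesis
        using L g walk_const_pos[OF g] by (subst (asm) ennreal_le_iff) (auto intro!: mult_nonneg_nonneg add_nonneg_nonneg)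
    qed
    ultimately have "(LINT \<omega>|P. 1 - exp (- (exp (- L) * unit_mass X n T \<omega>))) \<le> exp (4 * C0) * (exp (- L) * (1 + exp (ln 2 / 2) * (2 ^ CARD('d) * walk_const g * (L + 3/2 * g))))"
      by (simp add: order_trans[OF _ mult_left_mono])
    also have "\<dots> = exp (- L) * (exp (4 * C0) * (1 + exp (ln 2 / 2) * (2 ^ CARD('d) * walk_const g * (L + 3/2 * g))))" by simp
    also have "\<dots> \<le> exp (- L) * (K * (1 + L))"
    proof (rule mult_left_mono)
      define w where "w = exp (ln 2 / 2 :: real) * (2 ^ CARD('d) * walk_const g)"
      have w: "0 \<le> w" unfolding w_def using walk_const_pos[OF g] by simp
      have "1 + w * (L + 3/2 * g) \<le> (1 + w * (1 + 3/2 * g)) * (1 + L)"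
      proof -
        have "0 \<le> w * (1 + 3/2 * g * L)" "0 \<le> L" using w g L by auto
        moreover have "(1 + w * (1 + 3/2 * g)) * (1 + L) = (1 + w * (L + 3/2 * g)) + L + w * (1 + 3/2 * g * L)"
          by (simp add: algebra_simps)
        ultimately show ?thesis by linarith
      qed
      then have "exp (4 * C0) * (1 + w * (L + 3/2 * g)) \<le> exp (4 * C0) * ((1 + w * (1 + 3/2 * g)) * (1 + L))"
        by (rule mult_left_mono) simp
      then show "exp (4 * C0) * (1 + exp (ln 2 / 2) * (2 ^ CARD('d) * walk_const g * (L + 3/2 * g))) \<le> K * (1 + L)"
        unfolding K_def w_def by (simp only: mult.assoc)
    qed simp
    finally show ?thesis .
  qed
  then show thesis using K that by blast
qed

subsection \<open>Masses of the grid cubes\<close>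

lemma nn_integral_exp_atLeast_scaled:
  fixes a b :: real
  assumes b: "0 < b"
  shows "(\<integral>\<^sup>+y. ennreal (exp (- b * y)) * indicator {a..} y \<partial>lborel) = ennreal (exp (- b * a) / b)"
proof -
  have "(\<integral>\<^sup>+y. ennreal (exp (- b * y)) * indicator {a..} y \<partial>lborel)
      = ennreal \<bar>1 / b\<bar> * (\<integral>\<^sup>+s. ennreal (exp (- b * (0 + 1 / b * s))) * indicator {a..} (0 + 1 / b * s) \<partial>lborel)"
    by (rule nn_integral_real_affine) (use b in auto)
  also have "(\<integral>\<^sup>+s. ennreal (exp (- b * (0 + 1 / b * s))) * indicator {a..} (0 + 1 / b * s) \<partial>lborel)
      = (\<integral>\<^sup>+s. ennreal (exp (- s)) * indicator {b * a..} s \<partial>lborel)"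
    using b by (intro nn_integral_cong) (auto simp: indicator_def field_simps)
  also have "\<dots> = ennreal (exp (- (b * a)))" by (rule nn_integral_exp_atLeast)
  finally show ?thesis using b by (simp add: ennreal_mult'[symmetric])
qed

lemma one_minus_exp_le: "1 - exp (- x) \<le> x" for x :: real
  using exp_ge_add_one_self[of "- x"] by simp

text \<open>The bridge from a bound on a Laplace transform to a bound on a truncated mean.\<close>

lemma min_le_one_minus_exp:
  fixes u :: real assumes "0 \<le> u" shows "min u 1 \<le> 2 * (1 - exp (- u))"
proof -
  have q: "v \<le> 2 * (1 - exp (- v))" if v: "0 \<le> v" "v \<le> 1" for v :: real
  proof -
    have "1 + v \<le> exp v" by (rule exp_ge_add_one_self)
    then have "exp (- v) \<le> 1 / (1 + v)" using v by (simp add: exp_minus field_simps)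
    also have "\<dots> \<le> 1 - v / 2"
    proof -
      have "0 \<le> v * (1 - v)" using v by (intro mult_nonneg_nonneg) auto
      then have "1 \<le> (1 - v / 2) * (1 + v)" by (simp add: field_simps)
      then show ?thesis using v by (simp add: divide_le_eq)
    qed
    finally show ?thesis by simp
  qed
  show ?thesis
  proof (cases "u \<le> 1")
    case True then show ?thesis using q[of u] assms by simp
  next
    case False
    have "exp (- u) \<le> exp (- 1)" using False by simp
    moreover have "1 \<le> 2 * (1 - exp (- 1 :: real))" using q[of 1] by simp
    ultimately have "1 \<le> 2 * (1 - exp (- u))" by argo
    then show ?thesis using False by simp
  qed
qed

text \<open>Below \<open>ln m\<close> the integrand is at most \<open>exp y\<close>, which
  integrates to \<open>m\<close>; above, it is at most
  \<open>m powr \<beta> * exp (- (\<beta> - 1) * y)\<close>, which integrates to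
  \<open>m / (\<beta> - 1)\<close> because \<open>\<beta> > 1\<close>. If \<open>L\<close> lies
  below \<open>ln m\<close>, the first bound alone gives \<open>exp L\<close>.\<close>

lemma peak_integral:
  fixes m \<beta> L :: real
  assumes m: "0 \<le> m" and b: "1 < \<beta>"
  shows "(\<integral>\<^sup>+y. ennreal (exp y) * ennreal (1 - exp (- ((exp (- y) * m) powr \<beta>))) * indicator {..L} y \<partial>lborel)
     \<le> ennreal (\<beta> / (\<beta> - 1) * min m (exp L))"
proof (cases "m = 0")
  case True
  then show ?thesis by simp
next
  case False
  with m have m: "0 < m" by simp
  have le1: "ennreal (exp y) * ennreal (1 - exp (- ((exp (- y) * m) powr \<beta>))) \<le> ennreal (exp y)" for y
    by (subst ennreal_mult'[symmetric]) (auto intro!: ennreal_leI mult_left_le)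
  show ?thesis
  proof (cases "L \<le> ln m")
    case True
    then have mL: "min m (exp L) = exp L" using m by (metis exp_le_cancel_iff exp_ln min.absorb2)
    have "(\<integral>\<^sup>+y. ennreal (exp y) * ennreal (1 - exp (- ((exp (- y) * m) powr \<beta>))) * indicator {..L} y \<partial>lborel)
       \<le> (\<integral>\<^sup>+y. ennreal (exp y) * indicator {..L} y \<partial>lborel)"
      by (intro nn_integral_mono mult_right_mono le1) simp
    also have "\<dots> = ennreal (exp L)" by (rule nn_integral_exp_atMost)
    also have "\<dots> \<le> ennreal (\<beta> / (\<beta> - 1) * min m (exp L))"
    proof (rule ennreal_leI)
      have "1 \<le> \<beta> / (\<beta> - 1)" using b by (simp add: field_simps)
      then show "exp L \<le> \<beta> / (\<beta> - 1) * min m (exp L)" unfolding mL using mult_right_mono[of 1 "\<beta> / (\<beta> - 1)" "exp L"] by simp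
    qed
    finally show ?thesis .
  next
    case False
    then have mL: "min m (exp L) = m" using m by (metis exp_le_cancel_iff exp_ln linear min.absorb1)
    have pw: "ennreal (exp y) * ennreal (1 - exp (- ((exp (- y) * m) powr \<beta>))) \<le> ennreal (m powr \<beta>) * ennreal (exp (- (\<beta> - 1) * y))" for y
    proof -
      have "exp y * (1 - exp (- ((exp (- y) * m) powr \<beta>))) \<le> exp y * ((exp (- y) * m) powr \<beta>)"
        by (intro mult_left_mono one_minus_exp_le) simp
      also have "exp y * ((exp (- y) * m) powr \<beta>) = m powr \<beta> * exp (- (\<beta> - 1) * y)"
      proof -
        have "(exp (- y) * m) powr \<beta> = exp (- \<beta> * y) * m powr \<beta>"
          using m by (simp add: powr_mult exp_powr_real mult.commute)
        then show ?thesis by (simp add: mult.assoc[symmetric] exp_add[symmetric] algebra_simps)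
      qed
      finally have "ennreal (exp y * (1 - exp (- ((exp (- y) * m) powr \<beta>)))) \<le> ennreal (m powr \<beta> * exp (- (\<beta> - 1) * y))"
        by (rule ennreal_leI)
      then show ?thesis by (simp only: ennreal_mult'[OF exp_ge_zero] ennreal_mult'[OF powr_ge_zero])
    qed
    have "(\<integral>\<^sup>+y. ennreal (exp y) * ennreal (1 - exp (- ((exp (- y) * m) powr \<beta>))) * indicator {..L} y \<partial>lborel)
       \<le> (\<integral>\<^sup>+y. ennreal (exp y) * indicator {..ln m} y + ennreal (m powr \<beta>) * (ennreal (exp (- (\<beta> - 1) * y)) * indicator {ln m..} y) \<partial>lborel)"
    proof (rule nn_integral_mono)
      fix y
      show "ennreal (exp y) * ennreal (1 - exp (- ((exp (- y) * m) powr \<beta>))) * indicator {..L} y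
        \<le> ennreal (exp y) * indicator {..ln m} y + ennreal (m powr \<beta>) * (ennreal (exp (- (\<beta> - 1) * y)) * indicator {ln m..} y)"
        using le1[of y] pw[of y] by (cases "y \<le> ln m") (auto simp: indicator_def intro: order_trans)
    qed
    also have "\<dots> = (\<integral>\<^sup>+y. ennreal (exp y) * indicator {..ln m} y \<partial>lborel) + ennreal (m powr \<beta>) * (\<integral>\<^sup>+y. ennreal (exp (- (\<beta> - 1) * y)) * indicator {ln m..} y \<partial>lborel)"
      by (subst nn_integral_add, simp, simp, subst nn_integral_cmult) auto
    also have "\<dots> = ennreal (exp (ln m)) + ennreal (m powr \<beta>) * ennreal (exp (- (\<beta> - 1) * ln m) / (\<beta> - 1))"
      using b by (subst nn_integral_exp_atMost, subst nn_integral_exp_atLeast_scaled) auto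
    also have "\<dots> = ennreal (exp (ln m) + m powr \<beta> * (exp (- (\<beta> - 1) * ln m) / (\<beta> - 1)))"
      using b by (intro ennreal_affine[symmetric]) auto
    also have "exp (ln m) + m powr \<beta> * (exp (- (\<beta> - 1) * ln m) / (\<beta> - 1)) = \<beta> / (\<beta> - 1) * min m (exp L)"
    proof -
      have "m powr \<beta> * exp (- (\<beta> - 1) * ln m) = m"
        using m by (simp add: powr_def exp_add[symmetric] algebra_simps)
      then have "m powr \<beta> * (exp (- (\<beta> - 1) * ln m) / (\<beta> - 1)) = m / (\<beta> - 1)" by (simp only: times_divide_eq_right)
      then show ?thesis unfolding mL using m b by (simp add: field_simps)
    qed
    finally show ?thesis .
  qed
qed

text \<open>After exchanging the integrals, \<open>peak_integral\<close> leaves the expectation of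
  the mass truncated at \<open>exp L\<close>. The tail bound at \<open>exp (- L)\<close> makes this
  of order \<open>1 + L\<close>, the growth that the killed walk admits.\<close>

lemma leaf_average:
  fixes M' :: "'w \<Rightarrow> real"
  assumes P: "prob_space P" and [measurable]: "M' \<in> borel_measurable P" and M0: "\<And>\<omega>. 0 \<le> M' \<omega>" and b: "1 < \<beta>" and K: "0 \<le> K"
    and tail: "\<And>L. 0 \<le> L \<Longrightarrow> (LINT \<omega>|P. 1 - exp (- (exp (- L) * M' \<omega>))) \<le> exp (- L) * (K * (1 + L))"
  shows "(\<integral>\<^sup>+y. ennreal (exp y) * ennreal (1 - (LINT \<omega>|P. exp (- ((exp (- y) * M' \<omega>) powr \<beta>)))) * indicator {..L} y \<partial>lborel)
     \<le> ennreal (\<beta> / (\<beta> - 1) * (2 * (K + 1)) * (1 + max 0 L))"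
proof -
  interpret prob_space P by fact
  interpret PF: pair_sigma_finite lborel P ..
  let ?u = "\<lambda>y \<omega>. 1 - exp (- ((exp (- y) * M' \<omega>) powr \<beta>))"
  have "(\<integral>\<^sup>+y. ennreal (exp y) * ennreal (1 - (LINT \<omega>|P. exp (- ((exp (- y) * M' \<omega>) powr \<beta>)))) * indicator {..L} y \<partial>lborel)
    = (\<integral>\<^sup>+y. (\<integral>\<^sup>+\<omega>. ennreal (exp y) * ennreal (?u y \<omega>) * indicator {..L} y \<partial>P) \<partial>lborel)"
  proof (rule nn_integral_cong)
    fix y
    have int: "integrable P (\<lambda>\<omega>. exp (- ((exp (- y) * M' \<omega>) powr \<beta>)))"
      by (rule integrable_const_bound[of _ 1]) auto
    have "ennreal (1 - (LINT \<omega>|P. exp (- ((exp (- y) * M' \<omega>) powr \<beta>)))) = ennreal (LINT \<omega>|P. ?u y \<omega>)"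
      using int by (simp add: prob_space)
    also have "\<dots> = (\<integral>\<^sup>+\<omega>. ennreal (?u y \<omega>) \<partial>P)"
      using int by (intro nn_integral_eq_integral[symmetric]) auto
    finally show "ennreal (exp y) * ennreal (1 - (LINT \<omega>|P. exp (- ((exp (- y) * M' \<omega>) powr \<beta>)))) * indicator {..L} y
       = (\<integral>\<^sup>+\<omega>. ennreal (exp y) * ennreal (?u y \<omega>) * indicator {..L} y \<partial>P)"
      by (simp add: nn_integral_cmult nn_integral_multc)
  qed
  also have "\<dots> = (\<integral>\<^sup>+\<omega>. (\<integral>\<^sup>+y. ennreal (exp y) * ennreal (?u y \<omega>) * indicator {..L} y \<partial>lborel) \<partial>P)"
    by (rule PF.Fubini'[symmetric]) measurable
  also have "\<dots> \<le> (\<integral>\<^sup>+\<omega>. ennreal (\<beta> / (\<beta> - 1) * min (M' \<omega>) (exp L)) \<partial>P)"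
    by (intro nn_integral_mono peak_integral M0 b)
  also have "\<dots> = ennreal (\<beta> / (\<beta> - 1)) * (\<integral>\<^sup>+\<omega>. ennreal (min (M' \<omega>) (exp L)) \<partial>P)"
  proof -
    have "ennreal (\<beta> / (\<beta> - 1) * x) = ennreal (\<beta> / (\<beta> - 1)) * ennreal x" for x
      by (rule ennreal_mult') (use b in simp)
    then show ?thesis by (simp only:) (rule nn_integral_cmult, measurable)
  qed
  also have "(\<integral>\<^sup>+\<omega>. ennreal (min (M' \<omega>) (exp L)) \<partial>P) \<le> ennreal (2 * (K + 1) * (1 + max 0 L))"
  proof (cases "0 \<le> L")
    case True
    have int: "integrable P (\<lambda>\<omega>. 1 - exp (- (exp (- L) * M' \<omega>)))"
      by (rule integrable_const_bound[of _ 1]) (use M0 in auto)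
    have "(\<integral>\<^sup>+\<omega>. ennreal (min (M' \<omega>) (exp L)) \<partial>P) \<le> (\<integral>\<^sup>+\<omega>. ennreal (2 * exp L) * ennreal (1 - exp (- (exp (- L) * M' \<omega>))) \<partial>P)"
    proof (rule nn_integral_mono)
      fix \<omega>
      have "exp L * min (exp (- L) * M' \<omega>) 1 \<le> exp L * (2 * (1 - exp (- (exp (- L) * M' \<omega>))))"
        using M0 by (intro mult_left_mono min_le_one_minus_exp) auto
      moreover have "exp L * min (exp (- L) * M' \<omega>) 1 = min (M' \<omega>) (exp L)"
        by (simp add: mult_min_right mult.assoc[symmetric] exp_add[symmetric])
      ultimately have "min (M' \<omega>) (exp L) \<le> exp L * (2 * (1 - exp (- (exp (- L) * M' \<omega>))))"
        by (simp only:)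
      also have "\<dots> = 2 * exp L * (1 - exp (- (exp (- L) * M' \<omega>)))" by (simp only: mult_ac)
      finally have "ennreal (min (M' \<omega>) (exp L)) \<le> ennreal (2 * exp L * (1 - exp (- (exp (- L) * M' \<omega>))))"
        by (rule ennreal_leI)
      then show "ennreal (min (M' \<omega>) (exp L)) \<le> ennreal (2 * exp L) * ennreal (1 - exp (- (exp (- L) * M' \<omega>)))"
        by (subst (asm) ennreal_mult') auto
    qed
    also have "\<dots> = ennreal (2 * exp L) * ennreal (LINT \<omega>|P. 1 - exp (- (exp (- L) * M' \<omega>)))"
      using M0 int by (subst nn_integral_cmult, simp, subst nn_integral_eq_integral) auto
    also have "\<dots> \<le> ennreal (2 * exp L) * ennreal (exp (- L) * (K * (1 + L)))"
      by (intro mult_left_mono ennreal_leI tail True) simp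
    also have "\<dots> = ennreal (2 * K * (1 + L))"
    proof -
      have "2 * exp L * (exp (- L) * (K * (1 + L))) = 2 * K * (1 + L)"
        by (simp add: exp_minus)
      then show ?thesis by (subst ennreal_mult'[symmetric], simp, simp only:)
    qed
    also have "\<dots> \<le> ennreal (2 * (K + 1) * (1 + max 0 L))" using True by (intro ennreal_leI) simp
    finally show ?thesis .
  next
    case False
    have "(\<integral>\<^sup>+\<omega>. ennreal (min (M' \<omega>) (exp L)) \<partial>P) \<le> (\<integral>\<^sup>+\<omega>. 1 \<partial>P)"
    proof (intro nn_integral_mono)
      fix \<omega>
      have "min (M' \<omega>) (exp L) \<le> 1" using False by (simp add: min_le_iff_disj)
      then show "ennreal (min (M' \<omega>) (exp L)) \<le> 1" by (simp add: ennreal_le_1)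
    qed
    also have "\<dots> = ennreal 1" by (simp add: emeasure_space_1)
    also have "\<dots> \<le> ennreal (2 * (K + 1) * (1 + max 0 L))" using False K by (intro ennreal_leI) simp
    finally show ?thesis .
  qed
  finally show ?thesis using b by (simp add: ennreal_mult'[symmetric] mult_left_mono mult.assoc)
qed

definition cell_mass :: "(real \<Rightarrow> real ^ 'd \<Rightarrow> 'w \<Rightarrow> real) \<Rightarrow> nat \<Rightarrow> nat \<Rightarrow> real \<Rightarrow> nat ^ 'd \<Rightarrow> 'w \<Rightarrow> real" where
  "cell_mass X n N T j \<omega> = (\<Sum>a\<in>grid_index N. (1 / (real n * real N)) ^ CARD('d) * sqrt T * exp (- (real CARD('d) * T)) *
      exp (critical_gamma TYPE('d) * X T (grid_point n j (grid_point N a 0)) \<omega>))"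

text \<open>The second comparison. The new field is a tree over the cubes plus independent copies of
  the field at the remaining time \<open>T - ln n\<close>, one for each cube. Integrating out the
  copies leaves a tree whose leaf function is the Laplace functional of a power of the unit mass, to
  which \<open>unit_mass_bound\<close> applies.\<close>

theorem grid_mass_bound:
  fixes X :: "real \<Rightarrow> real ^ 'd \<Rightarrow> 'w \<Rightarrow> real"
  assumes P: "prob_space P" and s: "seed_covariance \<rho>" and X: "martingale_decomposition P \<rho> X" and b: "1 < \<beta>"
  obtains C where "0 \<le> C" "\<And>n T N k' L. 2 \<le> n \<Longrightarrow> 2 * ln (real n) \<le> T \<Longrightarrow> 1 \<le> k' \<Longrightarrow> real k' * ln 2 \<le> T - ln (real n) \<Longrightarrow>
     T - ln (real n) \<le> (real k' + 1) * ln 2 \<Longrightarrow> 2 ^ k' \<le> N \<Longrightarrow> 0 \<le> L \<Longrightarrow>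
     (LINT \<omega>|P. 1 - exp (- (\<Sum>j\<in>grid_index n. (exp (- L) * sqrt (ln (real n)) * cell_mass X n N T j \<omega>) powr \<beta>))) \<le> exp (- L) * (C * (1 + L))"
proof -
  interpret prob_space P by fact
  let ?d = "real CARD('d)" and ?\<gamma> = "critical_gamma TYPE('d)"
  define g where "g = branching_step TYPE('d)"
  have g: "0 < g" unfolding g_def by (rule branching_step_pos)
  obtain c\<rho> where c\<rho>: "0 < c\<rho>" "\<And>z. 1 - c\<rho> * norm z \<le> \<rho> z" using seed_lower[OF s] by blast
  obtain K1 where K1: "0 \<le> K1" "\<And>T k n L. 1 \<le> k \<Longrightarrow> real k * ln 2 \<le> T \<Longrightarrow> T \<le> (real k + 1) * ln 2 \<Longrightarrow> 2 ^ k \<le> n \<Longrightarrow> 0 \<le> L \<Longrightarrow>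
     (LINT \<omega>|P. 1 - exp (- (exp (- L) * unit_mass X n T \<omega>))) \<le> exp (- L) * (K1 * (1 + L))"
    using unit_mass_bound[OF P s X] by blast
  define C0 where "C0 = ?\<gamma>\<^sup>2 * (c\<rho> * (2 * ?d) + ln 2)"
  have C0: "0 \<le> C0" unfolding C0_def using c\<rho> by simp
  have C0': "C0 = ?\<gamma>\<^sup>2 * (c\<rho> * (2 * ?d)) + ?\<gamma>\<^sup>2 * ln 2" "0 \<le> ?\<gamma>\<^sup>2 * ln 2" "0 \<le> ?\<gamma>\<^sup>2 * (c\<rho> * (2 * ?d))"
    using c\<rho> by (simp_all add: C0_def distrib_left)
  have g2: "g\<^sup>2 = ?\<gamma>\<^sup>2 * ln 2" by (simp add: g_def branching_step_def power_mult_distrib)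
  \<comment> \<open>A leaf of the tree contains at most \<open>4 ^ CARD('d)\<close> cubes of side
    \<open>1 / n\<close>; the other factor is the constant of \<open>leaf_average\<close>.\<close>
  define A0 where "A0 = 4 ^ CARD('d) * (\<beta> / (\<beta> - 1) * (2 * (K1 + 1)))"
  have A0: "0 \<le> A0" unfolding A0_def using b K1 by simp
  define K where "K = exp (4 * C0 * \<beta>\<^sup>2) * (1 + exp (ln 2) * (A0 * walk_const g * (1 + 3/2 * g)))"
  have K: "0 \<le> K" unfolding K_def using g walk_const_pos[OF g] A0 by (auto intro!: mult_nonneg_nonneg add_nonneg_nonneg)
  have "(LINT \<omega>|P. 1 - exp (- (\<Sum>j\<in>grid_index n. (exp (- L) * sqrt (ln (real n)) * cell_mass X n N T j \<omega>) powr \<beta>))) \<le> exp (- L) * (K * (1 + L))"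
    if n: "2 \<le> n" and T: "2 * ln (real n) \<le> T" and k': "1 \<le> k'" "real k' * ln 2 \<le> T - ln (real n)" "T - ln (real n) \<le> (real k' + 1) * ln 2"
      and N: "2 ^ k' \<le> N" and L: "0 \<le> L" for n T N k' L
  proof -
    define t where "t = ln (real n)"
    have t0: "0 < t" unfolding t_def using n by simp
    define T' where "T' = T - t"
    have T': "t \<le> T'" "0 < T'" "T = t + T'" "0 < T" "t \<le> T" using T t0 by (auto simp: T'_def t_def)
    have N0: "0 < N" using N by (metis gr0I le_zero_eq power_not_zero zero_neq_numeral)
    \<comment> \<open>The depth of the tree is that of the largest power of two not exceeding
      \<open>n\<close>.\<close>
    obtain k where k2: "2 ^ k \<le> n" "n < 2 ^ (k + 1)" using ex_power_ivl1[of 2 n] n by auto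
    have k: "1 \<le> k" using k2 n by (cases k) auto
    have "ln (real (2 ^ k)) \<le> t" "t \<le> ln (real (2 ^ (k + 1)))"
      unfolding t_def using k2 n by (simp_all only: ln_le_cancel_iff of_nat_0_less_iff of_nat_le_iff zero_less_power pos2 less_imp_le)
    then have kt: "real k * ln 2 \<le> t" "t \<le> real k * ln 2 + ln 2" by (simp_all add: ln_realpow algebra_simps ln_mult)
    have expt: "exp t = real n" unfolding t_def using n by simp
    define p where "p = exp (- L) * sqrt t * ((1 / (real n * real N)) ^ CARD('d) * sqrt T * exp (- (?d * T)))"
    have p: "0 < p" unfolding p_def using n N0 T' t0 by simp
    let ?J = "grid_index n :: (nat ^ 'd) set" and ?A = "grid_index N :: (nat ^ 'd) set"
    have A0': "?A \<noteq> {}"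
    proof -
      have "0 \<in> ?A" using N0 by (simp add: grid_index_def)
      then show ?thesis by blast
    qed
    interpret B: block_functional ?J ?A p \<beta>
      by unfold_locales (use p b A0' in auto)
    let ?I = "?J \<times> ?A"
    let ?y = "\<lambda>i :: (nat ^ 'd) \<times> (nat ^ 'd). grid_point N (snd i) 0 :: real ^ 'd"
    let ?x = "\<lambda>i. grid_point n (fst i) (?y i)"
    let ?C = "\<lambda>j \<omega>. \<Sum>l\<in>{0<..k}. g * \<omega> (l, anc n l j)"
    let ?Q1 = "PiM (tree_edges k) (\<lambda>_. stdN) :: (nat \<times> (nat ^ 'd) \<Rightarrow> real) measure"
    let ?Q2 = "PiM ?J (\<lambda>_. P)"
    let ?Y = "\<lambda>i \<omega>. ?C (fst i) (fst \<omega>) + ?\<gamma> * X T' (?y i) (snd \<omega> (fst i))"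
    interpret Q1: prob_space ?Q1 by (rule prob_space_PiM_const[OF prob_space_stdN])
    interpret Q2: product_prob_space "\<lambda>_. P" ?J
      by (simp add: product_prob_space_def product_sigma_finite_def product_prob_space_axioms_def P prob_space_imp_sigma_finite)
    interpret Q: pair_prob_space ?Q1 ?Q2 ..
    have gX: "gaussian_family P ?I (\<lambda>i \<omega>. ?\<gamma> * X T (?x i) \<omega>) (\<lambda>i k. ?\<gamma>\<^sup>2 * cov_int \<rho> T (?x i - ?x k))"
      by (rule gaussian_family_field[OF P X]) (use T' in auto)
    have gC: "gaussian_family ?Q1 ?I (\<lambda>i. ?C (fst i)) (\<lambda>i i'. g\<^sup>2 * real (common_levels n k (fst i) (fst i')))"
      by (rule gaussian_family_tree) auto
    have gR: "gaussian_family ?Q2 ?I (\<lambda>i \<omega>. ?\<gamma> * X T' (grid_point N (snd i) 0) (\<omega> (fst i)))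
        (\<lambda>i i'. if fst i = fst i' then ?\<gamma>\<^sup>2 * cov_int \<rho> T' (grid_point N (snd i) 0 - grid_point N (snd i') 0) else 0)"
      by (rule gaussian_family_copies[OF P _ _ gaussian_family_field[OF P X]]) (use T' in auto)
    \<comment> \<open>Across cubes only the tree correlates; within a cube the tree part is constant
      and the independent copy is added.\<close>
    let ?KY = "\<lambda>i i'. g\<^sup>2 * real (common_levels n k (fst i) (fst i')) + (if fst i = fst i' then ?\<gamma>\<^sup>2 * cov_int \<rho> T' (?y i - ?y i') else 0)"
    have gY: "gaussian_family (?Q1 \<Otimes>\<^sub>M ?Q2) ?I ?Y ?KY"
      by (rule gaussian_family_pair[OF Q1.prob_space_axioms Q2.P.prob_space_axioms _ gC gR]) simp
    have ybox: "0 \<le> ?y i $ c" "?y i $ c \<le> 1" if "i \<in> ?I" for i c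
    proof -
      have "snd i $ c < N" using that by (auto simp: grid_index_def)
      then show "0 \<le> ?y i $ c" "?y i $ c \<le> 1" by (simp_all add: grid_point_def)
    qed
    have "(LINT \<omega>|P. B.\<Phi> (\<lambda>i. ?\<gamma> * X T (?x i) \<omega>)) \<le> exp (4 * C0 * \<beta>\<^sup>2) * (LINT \<omega>|(?Q1 \<Otimes>\<^sub>M ?Q2). B.\<Phi> (\<lambda>i. ?Y i \<omega>))"
    proof (rule B.kahane_comparison[OF P Q.prob_space_axioms gX gY _ _ _ _ C0])
      fix i i' :: "(nat ^ 'd) \<times> (nat ^ 'd)"
      show "?\<gamma>\<^sup>2 * cov_int \<rho> T (?x i - ?x i') = ?\<gamma>\<^sup>2 * cov_int \<rho> T (?x i' - ?x i)"
        by (simp only: cov_int_minus[OF s, of T "?x i" "?x i'"])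
      show "?KY i i' = ?KY i' i"
        by (simp only: common_levels_commute[of n k "fst i" "fst i'"] cov_int_minus[OF s, of T' "?y i" "?y i'"] eq_commute[of "fst i" "fst i'"])
      assume i: "i \<in> ?I"
      show "0 < ?\<gamma>\<^sup>2 * cov_int \<rho> T (?x i - ?x i)"
        using T' critical_gamma_pos[where 'd = 'd] by (simp add: cov_int_0[OF s])
      show "0 < ?KY i i"
        using g k T' critical_gamma_pos[where 'd = 'd] by (simp add: common_levels_self cov_int_0[OF s] add_pos_pos)
      assume i': "i' \<in> ?I"
      let ?z = "?x i - ?x i'"
      let ?r = "real (common_levels n k (fst i) (fst i')) * ln 2"
      have rk: "?r \<le> real k * ln 2" using common_levels_le by (intro mult_right_mono) auto
      have r: "0 \<le> ?r" "?r \<le> t" using rk kt(1) by (simp, linarith)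
      have "exp ?r = 2 ^ common_levels n k (fst i) (fst i')" by (simp add: exp_of_nat_mult)
      then have dist: "exp ?r * norm ?z \<le> 2 * ?d"
        using common_levels_dist[OF k2(1), of "fst i" "fst i'" "?y i" "?y i'"] i i' ybox[OF i] ybox[OF i'] by auto
      have expand: "?\<gamma>\<^sup>2 * (?r - c\<rho> * (2 * ?d)) = g\<^sup>2 * real (common_levels n k (fst i) (fst i')) - ?\<gamma>\<^sup>2 * (c\<rho> * (2 * ?d))"
        unfolding g2 by (simp add: algebra_simps)
      \<comment> \<open>Within a cube the fine parts of both covariances coincide by scale
        invariance. Only the coarse part, up to time \<open>t\<close>, has to be compared with the
        constant tree part.\<close>
      have same: "cov_int \<rho> T ?z = cov_int \<rho> t ?z + cov_int \<rho> T' (?y i - ?y i')" if "fst i = fst i'"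
      proof -
        have "exp t *\<^sub>R ?z = ?y i - ?y i'"
          unfolding expt using that n by (simp add: grid_point_def scaleR_diff_right)
        with cov_int_split[OF s less_imp_le[OF t0] T'(5), of ?z] show ?thesis by (simp only: T'_def)
      qed
      show "- C0 \<le> ?\<gamma>\<^sup>2 * cov_int \<rho> T ?z - ?KY i i'"
      proof (cases "fst i = fst i'")
        case True
        have "?r - c\<rho> * (2 * ?d) \<le> cov_int \<rho> t ?z" by (rule cov_int_ge[OF s c\<rho> r dist])
        then have "?\<gamma>\<^sup>2 * (?r - c\<rho> * (2 * ?d)) \<le> ?\<gamma>\<^sup>2 * cov_int \<rho> t ?z" by (intro mult_left_mono) auto
        moreover have "?KY i i' = g\<^sup>2 * real (common_levels n k (fst i) (fst i')) + ?\<gamma>\<^sup>2 * cov_int \<rho> T' (?y i - ?y i')"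
          using True by simp
        ultimately show ?thesis unfolding same[OF True] distrib_left using expand C0' by linarith
      next
        case False
        have "?r \<le> T" using r T' by linarith
        then have "?r - c\<rho> * (2 * ?d) \<le> cov_int \<rho> T ?z" by (rule cov_int_ge[OF s c\<rho> r(1) _ dist])
        then have "?\<gamma>\<^sup>2 * (?r - c\<rho> * (2 * ?d)) \<le> ?\<gamma>\<^sup>2 * cov_int \<rho> T ?z" by (intro mult_left_mono) auto
        moreover have "?KY i i' = g\<^sup>2 * real (common_levels n k (fst i) (fst i'))"
          using False by simp
        ultimately show ?thesis using expand C0' by linarith
      qed
      assume f: "fst i = fst i'"
      have "cov_int \<rho> t ?z \<le> real k * ln 2 + ln 2"
        using cov_int_le[OF s, of t ?z] t0 kt(2) by linarith
      then have "?\<gamma>\<^sup>2 * cov_int \<rho> t ?z \<le> ?\<gamma>\<^sup>2 * (real k * ln 2 + ln 2)" by (intro mult_left_mono) auto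
      also have "\<dots> = g\<^sup>2 * real k + ?\<gamma>\<^sup>2 * ln 2" unfolding g2 by (simp add: algebra_simps)
      finally show "?\<gamma>\<^sup>2 * cov_int \<rho> T ?z - ?KY i i' \<le> C0"
      proof -
        assume a: "?\<gamma>\<^sup>2 * cov_int \<rho> t ?z \<le> g\<^sup>2 * real k + ?\<gamma>\<^sup>2 * ln 2"
        have "?KY i i' = g\<^sup>2 * real k + ?\<gamma>\<^sup>2 * cov_int \<rho> T' (?y i - ?y i')"
          using f by (simp add: common_levels_self)
        then show ?thesis unfolding same[OF f] distrib_left using a C0' by linarith
      qed
    qed
    moreover have "B.\<Phi> (\<lambda>i. ?\<gamma> * X T (?x i) \<omega>) = 1 - exp (- (\<Sum>j\<in>?J. (exp (- L) * sqrt (ln (real n)) * cell_mass X n N T j \<omega>) powr \<beta>))" for \<omega>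
    proof -
      have "B.S (\<lambda>i. ?\<gamma> * X T (?x i) \<omega>) j = exp (- L) * sqrt (ln (real n)) * cell_mass X n N T j \<omega>" for j
        unfolding B.S_def by (simp only: cell_mass_def p_def t_def sum_distrib_left fst_conv snd_conv mult.assoc)
      then show ?thesis by (simp only: B.\<Phi>_def B.G_def)
    qed
    moreover have "(LINT \<omega>|(?Q1 \<Otimes>\<^sub>M ?Q2). B.\<Phi> (\<lambda>i. ?Y i \<omega>)) \<le> exp (- L) * (1 + exp (ln 2) * (A0 * walk_const g * (L + 3/2 * g)))"
    proof -
      let ?M = "unit_mass X N T'"
      have mM [measurable]: "?M \<in> borel_measurable P" by (rule unit_mass_measurable[OF P X]) (use T' in simp)
      have M0: "0 \<le> ?M \<omega>" for \<omega> using T' by (intro unit_mass_nonneg) simp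
      \<comment> \<open>The Laplace functional of the \<open>\<beta>\<close>-th power of the mass of
        one independent copy, at scale \<open>exp (- x)\<close>.\<close>
      define F where "F = (\<lambda>x. LINT \<omega>|P. exp (- ((exp (- x) * ?M \<omega>) powr \<beta>)))"
      have intF: "integrable P (\<lambda>\<omega>. exp (- ((exp (- x) * ?M \<omega>) powr \<beta>)))" for x
        by (rule integrable_const_bound[of _ 1]) auto
      have F [measurable]: "F \<in> borel_measurable borel" unfolding F_def by measurable
      have F01: "0 \<le> F x" "F x \<le> 1" for x
      proof -
        show "0 \<le> F x" unfolding F_def by (intro integral_nonneg_AE) auto
        have "F x \<le> (LINT \<omega>|P. 1)" unfolding F_def by (intro integral_mono intF) auto
        then show "F x \<le> 1" by (simp add: prob_space)
      qed
      \<comment> \<open>Here the room \<open>a\<close> is \<open>ln 2\<close>, for a factor 2 in the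
        estimate \<open>A\<close> below.\<close>
      define x0 where "x0 = L - (ln (real k) / 2 + ln 2)"
      let ?S = "\<lambda>j \<omega>. x0 - (\<Sum>l\<in>{0<..k}. g * \<omega> (l, anc n l j) - g\<^sup>2)"
      \<comment> \<open>The prefactor in \<open>unit_mass\<close> at time \<open>T'\<close>; the
        ratio \<open>p / m0\<close> is what the tree has to account for.\<close>
      define m0 where "m0 = (1 / real N) ^ CARD('d) * sqrt T' * exp (- (?d * T'))"
      have m0: "0 < m0" unfolding m0_def using N0 T' by simp
      have p_le: "p / m0 \<le> exp (- x0) * exp (- (real k * g\<^sup>2))"
      proof -
        have e1: "exp (- x0) = exp (- L) * (sqrt (real k) * 2)"
          using k by (simp add: x0_def exp_add exp_diff ln_sqrt[symmetric] exp_minus field_simps)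
        have e2: "exp (- (real k * g\<^sup>2)) = (1 / 2 ^ k) ^ CARD('d) * (1 / 2 ^ k) ^ CARD('d)"
        proof -
          have "- (real k * g\<^sup>2) = - (?d * (real k * ln 2)) + - (?d * (real k * ln 2))"
            unfolding g_def branching_step_sq by simp
          then show ?thesis by (simp only: exp_add exp_card_ln2)
        qed
        have e3: "p / m0 = exp (- L) * (sqrt t * (sqrt T / sqrt T')) * ((1 / real n) ^ CARD('d) * exp (- (?d * t)))"
        proof -
          have gen: "lo * st * ((q * r) * sT * (u * v)) / (r * sT' * v) = lo * (st * (sT / sT')) * (q * u)" if "r \<noteq> 0" "v \<noteq> 0" for lo st q r sT sT' u v :: real
            using that by (simp add: field_simps)
          have "(1 / (real n * real N)) ^ CARD('d) = (1 / real n) ^ CARD('d) * (1 / real N) ^ CARD('d)"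
            by (simp add: power_mult_distrib[symmetric])
          moreover have "exp (- (?d * T)) = exp (- (?d * t)) * exp (- (?d * T'))"
            using T'(3) by (simp add: exp_add[symmetric] algebra_simps)
          ultimately show ?thesis unfolding p_def m0_def using gen N0 by simp
        qed
        \<comment> \<open>The condition \<open>T \<ge> 2 * ln n\<close> gives
          \<open>T \<le> 2 * T'\<close>, so one factor \<open>sqrt 2\<close> pays for the change
          from time \<open>T\<close> to \<open>T'\<close>. The other comes from
          \<open>t \<le> 2 * k\<close>.\<close>
        have A: "sqrt t * (sqrt T / sqrt T') \<le> sqrt (real k) * 2"
        proof -
          have "T / T' \<le> 2" using T' by (simp add: divide_le_eq)
          then have a: "sqrt T / sqrt T' \<le> sqrt 2" by (simp add: real_sqrt_divide[symmetric])
          have "(real k + 1) * ln 2 \<le> (real k + 1) * 1" using ln_2_less_1 by (intro mult_left_mono) auto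
          then have "t \<le> real k * 2" using kt(2) k by (simp add: algebra_simps)
          then have "sqrt t \<le> sqrt (real k) * sqrt 2" by (simp add: real_sqrt_mult[symmetric])
          then have "sqrt t * (sqrt T / sqrt T') \<le> sqrt (real k) * sqrt 2 * sqrt 2"
            using a T' by (intro mult_mono) auto
          also have "sqrt (real k) * sqrt 2 * sqrt 2 = sqrt (real k) * 2" by (simp only: mult.assoc) simp
          finally show ?thesis .
        qed
        have B: "(1 / real n) ^ CARD('d) * exp (- (?d * t)) \<le> (1 / 2 ^ k) ^ CARD('d) * (1 / 2 ^ k) ^ CARD('d)"
        proof (rule mult_mono)
          have "2 ^ k \<le> real n" using k2(1) by (metis of_nat_le_iff of_nat_numeral of_nat_power)
          then have "1 / real n \<le> 1 / 2 ^ k" using n by (intro divide_left_mono) auto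
          then show "(1 / real n) ^ CARD('d) \<le> (1 / 2 ^ k) ^ CARD('d)" by (rule power_mono) simp
          show "exp (- (?d * t)) \<le> (1 / 2 ^ k) ^ CARD('d)"
            unfolding exp_card_ln2[symmetric] using kt(1) by (simp add: mult_left_mono)
        qed auto
        have "exp (- L) * (sqrt t * (sqrt T / sqrt T')) * ((1 / real n) ^ CARD('d) * exp (- (?d * t)))
          \<le> exp (- L) * (sqrt (real k) * 2) * ((1 / 2 ^ k) ^ CARD('d) * (1 / 2 ^ k) ^ CARD('d))"
          by (rule mult_mono[OF mult_left_mono[OF A exp_ge_zero] B]) auto
        then show ?thesis unfolding e1 e2 e3 .
      qed
      have S_le: "B.S (\<lambda>i. ?Y i \<omega>) j \<le> exp (- (?S j (fst \<omega>))) * ?M (snd \<omega> j)" for j \<omega>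
      proof -
        have "B.S (\<lambda>i. ?Y i \<omega>) j = p * exp (?C j (fst \<omega>)) * (\<Sum>a\<in>?A. exp (?\<gamma> * X T' (grid_point N a 0) (snd \<omega> j)))"
          by (simp only: B.S_def fst_conv snd_conv exp_add sum_distrib_left mult.assoc)
        also have "(\<Sum>a\<in>?A. exp (?\<gamma> * X T' (grid_point N a 0) (snd \<omega> j))) = ?M (snd \<omega> j) / m0"
          using m0 by (simp add: unit_mass_def m0_def[symmetric] sum_distrib_left[symmetric])
        also have "p * exp (?C j (fst \<omega>)) * (?M (snd \<omega> j) / m0) = (p / m0) * (exp (?C j (fst \<omega>)) * ?M (snd \<omega> j))" by simp
        also have "\<dots> \<le> (exp (- x0) * exp (- (real k * g\<^sup>2))) * (exp (?C j (fst \<omega>)) * ?M (snd \<omega> j))"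
          using M0 by (intro mult_right_mono p_le) simp
        also have "\<dots> = exp (- (?S j (fst \<omega>))) * ?M (snd \<omega> j)"
          by (simp add: sum_subtractf mult.assoc[symmetric] exp_add[symmetric])
        finally show ?thesis .
      qed
      let ?f = "\<lambda>x \<omega>. exp (- ((exp (- x) * ?M \<omega>) powr \<beta>))"
      have pw: "B.\<Phi> (\<lambda>i. ?Y i \<omega>) \<le> 1 - (\<Prod>j\<in>?J. ?f (?S j (fst \<omega>)) (snd \<omega> j))" for \<omega>
      proof -
        have "B.G (\<lambda>i. ?Y i \<omega>) \<le> (\<Sum>j\<in>?J. (exp (- (?S j (fst \<omega>))) * ?M (snd \<omega> j)) powr \<beta>)"
          unfolding B.G_def using b B.S_pos by (intro sum_mono powr_mono2 S_le) (auto intro: less_imp_le)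
        then show ?thesis unfolding B.\<Phi>_def by (simp add: exp_sum[symmetric] sum_negf)
      qed
      have mY: "(\<lambda>\<omega>. \<lambda>i\<in>?I. ?Y i \<omega>) \<in> measurable (?Q1 \<Otimes>\<^sub>M ?Q2) (PiM ?I (\<lambda>_. borel))"
        using gaussian_family_measurable[OF gY] by (intro measurable_restrict) auto
      have mPhi [measurable]: "(\<lambda>\<omega>. B.\<Phi> (\<lambda>i. ?Y i \<omega>)) \<in> borel_measurable (?Q1 \<Otimes>\<^sub>M ?Q2)"
        using measurable_compose[OF mY B.measurable_restricted(2)] by (simp add: B.cong_restrict)
      have mS [measurable]: "(\<lambda>\<omega>. ?S j \<omega>) \<in> borel_measurable ?Q1" if "j \<in> ?J" for j
        using anc_tree_edge[OF that] by measurable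
      have mprod [measurable]: "(\<lambda>\<omega>. ennreal (1 - (\<Prod>j\<in>?J. ?f (?S j (fst \<omega>)) (snd \<omega> j)))) \<in> borel_measurable (?Q1 \<Otimes>\<^sub>M ?Q2)"
        by measurable
      have "ennreal (LINT \<omega>|(?Q1 \<Otimes>\<^sub>M ?Q2). B.\<Phi> (\<lambda>i. ?Y i \<omega>)) = (\<integral>\<^sup>+\<omega>. ennreal (B.\<Phi> (\<lambda>i. ?Y i \<omega>)) \<partial>(?Q1 \<Otimes>\<^sub>M ?Q2))"
        by (rule nn_integral_eq_integral[symmetric], rule Q.integrable_const_bound[of _ 1]) (use B.\<Phi>_bounds in auto)
      also have "\<dots> \<le> (\<integral>\<^sup>+\<omega>. ennreal (1 - (\<Prod>j\<in>?J. ?f (?S j (fst \<omega>)) (snd \<omega> j))) \<partial>(?Q1 \<Otimes>\<^sub>M ?Q2))"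
        by (intro nn_integral_mono ennreal_leI pw)
      also have "\<dots> = (\<integral>\<^sup>+\<omega>. (\<integral>\<^sup>+\<omega>'. ennreal (1 - (\<Prod>j\<in>?J. ?f (?S j \<omega>) (\<omega>' j))) \<partial>?Q2) \<partial>?Q1)"
        by (subst Q2.P.nn_integral_fst[symmetric, OF mprod]) simp
      \<comment> \<open>For a fixed tree field the copies are independent, so the expectation of the
        product over the cubes is the product of the values of \<open>F\<close>.\<close>
      also have "\<dots> = (\<integral>\<^sup>+\<omega>. ennreal (1 - (\<Prod>j\<in>?J. F (?S j \<omega>))) \<partial>?Q1)"
      proof (rule nn_integral_cong)
        fix \<omega>
        have mp [measurable]: "(\<lambda>\<omega>'. \<Prod>j\<in>?J. ?f (?S j \<omega>) (\<omega>' j)) \<in> borel_measurable ?Q2" by measurable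
        have p1: "0 \<le> (\<Prod>j\<in>?J. ?f (?S j \<omega>) (\<omega>' j))" "(\<Prod>j\<in>?J. ?f (?S j \<omega>) (\<omega>' j)) \<le> 1" for \<omega>'
          by (auto intro!: prod_nonneg prod_le_1)
        have ip: "integrable ?Q2 (\<lambda>\<omega>'. \<Prod>j\<in>?J. ?f (?S j \<omega>) (\<omega>' j))"
          by (rule Q2.P.integrable_const_bound[of _ 1]) (use p1 in auto)
        have "(\<integral>\<^sup>+\<omega>'. ennreal (1 - (\<Prod>j\<in>?J. ?f (?S j \<omega>) (\<omega>' j))) \<partial>?Q2) = ennreal (LINT \<omega>'|?Q2. 1 - (\<Prod>j\<in>?J. ?f (?S j \<omega>) (\<omega>' j)))"
          by (rule nn_integral_eq_integral) (use ip p1 in auto)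
        also have "(LINT \<omega>'|?Q2. 1 - (\<Prod>j\<in>?J. ?f (?S j \<omega>) (\<omega>' j))) = 1 - (LINT \<omega>'|?Q2. (\<Prod>j\<in>?J. ?f (?S j \<omega>) (\<omega>' j)))"
          using ip by (simp add: Q2.P.prob_space)
        also have "(LINT \<omega>'|?Q2. (\<Prod>j\<in>?J. ?f (?S j \<omega>) (\<omega>' j))) = (\<Prod>j\<in>?J. F (?S j \<omega>))"
          unfolding F_def by (rule Q2.product_integral_prod) (simp, rule intF)
        finally show "(\<integral>\<^sup>+\<omega>'. ennreal (1 - (\<Prod>j\<in>?J. ?f (?S j \<omega>) (\<omega>' j))) \<partial>?Q2) = ennreal (1 - (\<Prod>j\<in>?J. F (?S j \<omega>)))" .
      qed
      also have "\<dots> \<le> ennreal (exp (- L) * (1 + exp (ln 2) * (A0 * walk_const g * (L + 3/2 * g))))"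
        unfolding x0_def g_def
      \<comment> \<open>The union bound over the cubes in one leaf gives
        \<open>1 - F x ^ m \<le> m * (1 - F x)\<close>; the minimum with 1 keeps the leaf function
        admissible.\<close>
      proof (rule tree_expectation_bound[OF k2(1) k F F01, where H = "\<lambda>x. ennreal (min 1 (4 ^ CARD('d) * (1 - F x)))"])
        fix m x assume m: "real m \<le> (2 * real n / 2 ^ k) ^ CARD('d)"
        have "real n \<le> 2 * 2 ^ k"
        proof -
          have "n \<le> 2 * 2 ^ k" using k2(2) by simp
          then have "real n \<le> real (2 * 2 ^ k)" by (simp only: of_nat_le_iff)
          then show ?thesis by simp
        qed
        then have "(2 * real n / 2 ^ k) ^ CARD('d) \<le> 4 ^ CARD('d)" by (intro power_mono) (auto simp: field_simps)
        then have m4: "real m \<le> 4 ^ CARD('d)" using m by linarith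
        have "1 - F x ^ m \<le> real m * (1 - F x)"
          using one_minus_prod_le_sum[of "{..<m}" "\<lambda>_. F x"] F01 by simp
        also have "\<dots> \<le> 4 ^ CARD('d) * (1 - F x)" using m4 F01 by (intro mult_right_mono) auto
        finally show "ennreal (1 - F x ^ m) \<le> ennreal (min 1 (4 ^ CARD('d) * (1 - F x)))"
          using F01 by (intro ennreal_leI) simp
      next
        fix L' :: real
        have "(\<integral>\<^sup>+y. ennreal (exp y) * ennreal (min 1 (4 ^ CARD('d) * (1 - F y))) * indicator {..L'} y \<partial>lborel)
          \<le> (\<integral>\<^sup>+y. ennreal (4 ^ CARD('d)) * (ennreal (exp y) * ennreal (1 - F y) * indicator {..L'} y) \<partial>lborel)"
        proof (rule nn_integral_mono)
          fix y
          have "ennreal (min 1 (4 ^ CARD('d) * (1 - F y))) \<le> ennreal (4 ^ CARD('d)) * ennreal (1 - F y)"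
            by (subst ennreal_mult'[symmetric]) (auto intro: ennreal_leI)
          then have "ennreal (exp y) * ennreal (min 1 (4 ^ CARD('d) * (1 - F y))) * indicator {..L'} y
             \<le> ennreal (exp y) * (ennreal (4 ^ CARD('d)) * ennreal (1 - F y)) * indicator {..L'} y"
            by (intro mult_right_mono mult_left_mono) auto
          then show "ennreal (exp y) * ennreal (min 1 (4 ^ CARD('d) * (1 - F y))) * indicator {..L'} y
             \<le> ennreal (4 ^ CARD('d)) * (ennreal (exp y) * ennreal (1 - F y) * indicator {..L'} y)"
            by (simp only: mult_ac)
        qed
        also have "\<dots> = ennreal (4 ^ CARD('d)) * (\<integral>\<^sup>+y. ennreal (exp y) * ennreal (1 - F y) * indicator {..L'} y \<partial>lborel)"
          by (rule nn_integral_cmult) measurable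
        also have "\<dots> \<le> ennreal (4 ^ CARD('d)) * ennreal (\<beta> / (\<beta> - 1) * (2 * (K1 + 1)) * (1 + max 0 L'))"
          unfolding F_def
          by (intro mult_left_mono leaf_average[OF P mM M0 b K1(1)] K1(2)[OF k'(1)]) (use k' N in \<open>auto simp: T'_def t_def\<close>)
        also have "\<dots> = ennreal (A0 * (1 + max 0 L'))"
          by (subst ennreal_mult'[symmetric]) (auto simp: A0_def mult.assoc)
        finally show "(\<integral>\<^sup>+y. ennreal (exp y) * ennreal (min 1 (4 ^ CARD('d) * (1 - F y))) * indicator {..L'} y \<partial>lborel) \<le> ennreal (A0 * (1 + max 0 L'))" .
      qed (use A0 L in \<open>auto simp: ennreal_le_1\<close>)
      finally show ?thesis
        using L g walk_const_pos[OF g] A0 by (subst (asm) ennreal_le_iff) (auto intro!: mult_nonneg_nonneg add_nonneg_nonneg)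
    qed
    ultimately have "(LINT \<omega>|P. 1 - exp (- (\<Sum>j\<in>?J. (exp (- L) * sqrt (ln (real n)) * cell_mass X n N T j \<omega>) powr \<beta>)))
       \<le> exp (4 * C0 * \<beta>\<^sup>2) * (exp (- L) * (1 + exp (ln 2) * (A0 * walk_const g * (L + 3/2 * g))))"
      by (simp only:) (erule order_trans, rule mult_left_mono, assumption, simp)
    also have "\<dots> = exp (- L) * (exp (4 * C0 * \<beta>\<^sup>2) * (1 + exp (ln 2) * (A0 * walk_const g * (L + 3/2 * g))))" by simp
    also have "\<dots> \<le> exp (- L) * (K * (1 + L))"
    proof (rule mult_left_mono)
      define w where "w = exp (ln 2 :: real) * (A0 * walk_const g)"
      have w: "0 \<le> w" unfolding w_def using walk_const_pos[OF g] A0 by simp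
      have "1 + w * (L + 3/2 * g) \<le> (1 + w * (1 + 3/2 * g)) * (1 + L)"
      proof -
        have "0 \<le> w * (1 + 3/2 * g * L)" "0 \<le> L" using w g L by auto
        moreover have "(1 + w * (1 + 3/2 * g)) * (1 + L) = (1 + w * (L + 3/2 * g)) + L + w * (1 + 3/2 * g * L)"
          by (simp add: algebra_simps)
        ultimately show ?thesis by linarith
      qed
      then have "exp (4 * C0 * \<beta>\<^sup>2) * (1 + w * (L + 3/2 * g)) \<le> exp (4 * C0 * \<beta>\<^sup>2) * ((1 + w * (1 + 3/2 * g)) * (1 + L))"
        by (rule mult_left_mono) simp
      then show "exp (4 * C0 * \<beta>\<^sup>2) * (1 + exp (ln 2) * (A0 * walk_const g * (L + 3/2 * g))) \<le> K * (1 + L)"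
        unfolding K_def w_def by (simp only: mult.assoc)
    qed simp
    finally show ?thesis .
  qed
  then show thesis using K that by blast
qed

subsection \<open>Riemann sums and test functions\<close>

text \<open>Half-open boxes, so that the small cells tile a cube exactly and every point has a
  unique cell.\<close>

definition hbox :: "real ^ 'd \<Rightarrow> real ^ 'd \<Rightarrow> (real ^ 'd::finite) set" where
  "hbox l u = {x. \<forall>c. l $ c \<le> x $ c \<and> x $ c < u $ c}"

lemma hbox_sets [measurable, simp]:
  fixes l u :: "real ^ 'd::finite"
  shows "hbox l u \<in> sets borel"
proof -
  have "{x \<in> space borel. \<forall>c. l $ c \<le> x $ c \<and> x $ c < u $ c} \<in> sets borel" by measurable
  then show ?thesis by (simp add: hbox_def)
qed

lemma emeasure_hbox:
  fixes l u :: "real ^ 'd::finite"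
  assumes s: "0 < s" and u: "\<And>c. u $ c = l $ c + s"
  shows "emeasure lborel (hbox l u) = ennreal (s ^ CARD('d))"
proof -
  have ne: "cbox l u \<noteq> {}" using s u by (auto simp: interval_ne_empty_cart less_imp_le)
  have "measure lborel (cbox l u) = (\<Prod>c\<in>UNIV. u $ c - l $ c)" by (rule content_cbox_cart[OF ne])
  then have "measure lborel (cbox l u) = s ^ CARD('d)" by (simp add: u)
  then have c: "emeasure lborel (cbox l u) = ennreal (s ^ CARD('d))"
    by (subst emeasure_eq_ennreal_measure) (auto simp: emeasure_lborel_cbox_eq)
  have "emeasure lborel (box l u) = emeasure lborel (cbox l u)"
    by (simp add: emeasure_lborel_box_eq emeasure_lborel_cbox_eq)
  moreover have "emeasure lborel (box l u) \<le> emeasure lborel (hbox l u)"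
    by (intro emeasure_mono) (auto simp: hbox_def mem_box_cart less_imp_le)
  moreover have "emeasure lborel (hbox l u) \<le> emeasure lborel (cbox l u)"
    by (intro emeasure_mono) (auto simp: hbox_def mem_box_cart less_imp_le)
  ultimately show ?thesis using c by simp
qed

definition hcube :: "nat \<Rightarrow> nat ^ 'd \<Rightarrow> (real ^ 'd::finite) set" where
  "hcube n j = hbox (grid_point n j 0) (grid_point n j 1)"

lemma hcube_sets [measurable, simp]: "hcube n j \<in> sets borel"
  by (simp add: hcube_def)

lemma mem_hcube: "0 < n \<Longrightarrow> x \<in> hcube n j \<longleftrightarrow> (\<forall>c. 0 \<le> real n * x $ c - real (j $ c) \<and> real n * x $ c - real (j $ c) < 1)"
  by (auto simp: hcube_def hbox_def grid_point_def field_simps)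

lemma hcube_subset_cbox: "hcube n j \<subseteq> cbox (grid_point n j 0) (grid_point n j 1)"
  by (auto simp: hcube_def hbox_def mem_box_cart less_imp_le)

text \<open>The sum is the integral of a step function, equal on each cell to the value of
  \<open>h\<close> at the lower corner. The corners converge to the point, and continuity on the
  closed cube provides the dominating constant.\<close>

theorem riemann_sum_cube:
  fixes h :: "real ^ 'd::finite \<Rightarrow> real"
  assumes h: "continuous_on UNIV h" and n: "0 < n"
  shows "(\<lambda>N. \<Sum>a\<in>grid_index (Suc N). (1 / (real n * real (Suc N))) ^ CARD('d) * h (grid_point n j (grid_point (Suc N) a 0)))
     \<longlonglongrightarrow> (LINT x|lborel. indicator (hcube n j) x * h x)"
proof -
  have [measurable]: "h \<in> borel_measurable borel" using h by (rule borel_measurable_continuous_onI)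
  let ?pt = "\<lambda>K a. grid_point n j (grid_point K a 0) :: real ^ 'd"
  define cell where "cell = (\<lambda>K a. hbox (?pt K a) (?pt K a + (\<chi> c. 1 / (real n * real K))))"
  \<comment> \<open>The cell containing a given point, obtained by rounding down the rescaled
    coordinates.\<close>
  define idx where "idx = (\<lambda>K (x :: real ^ 'd). \<chi> c :: 'd. nat \<lfloor>(real n * x $ c - real (j $ c)) * real K\<rfloor>)"
  have ptc: "?pt K a $ c = (real (j $ c) + real (a $ c) / real K) / real n" for K a c
    by (simp add: grid_point_def add_divide_distrib)
  have mem_cell: "x \<in> cell K a \<longleftrightarrow> (\<forall>c. real (a $ c) \<le> (real n * x $ c - real (j $ c)) * real K \<and> (real n * x $ c - real (j $ c)) * real K < real (a $ c) + 1)"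
    if K: "0 < K" for K a x
  proof -
    have "(?pt K a $ c \<le> x $ c \<and> x $ c < ?pt K a $ c + 1 / (real n * real K)) \<longleftrightarrow>
      (real (a $ c) \<le> (real n * x $ c - real (j $ c)) * real K \<and> (real n * x $ c - real (j $ c)) * real K < real (a $ c) + 1)" for c
    proof -
      have e: "?pt K a $ c = (real (j $ c) * real K + real (a $ c)) / (real n * real K)"
        unfolding ptc using n K by (simp add: field_simps)
      have nK: "0 < real n * real K" using n K by simp
      have "?pt K a $ c \<le> x $ c \<longleftrightarrow> real (j $ c) * real K + real (a $ c) \<le> x $ c * (real n * real K)"
        unfolding e using nK by (rule pos_divide_le_eq)
      moreover have "x $ c < ?pt K a $ c + 1 / (real n * real K) \<longleftrightarrow> x $ c * (real n * real K) < real (j $ c) * real K + real (a $ c) + 1"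
        unfolding e add_divide_distrib[symmetric] using nK by (rule pos_less_divide_eq)
      ultimately show ?thesis by (auto simp: algebra_simps)
    qed
    then show ?thesis by (auto simp: cell_def hbox_def)
  qed
  have cell_idx: "x \<in> cell K a \<longleftrightarrow> a = idx K x" if K: "0 < K" and x: "x \<in> hcube n j" for K a x
  proof -
    have eq: "(real m \<le> y \<and> y < real m + 1) \<longleftrightarrow> m = nat \<lfloor>y\<rfloor>" if "0 \<le> y" for m :: nat and y :: real
    proof -
      have "(real m \<le> y \<and> y < real m + 1) \<longleftrightarrow> \<lfloor>y\<rfloor> = int m" by (simp add: floor_eq_iff)
      then show ?thesis using that by auto
    qed
    have nn: "0 \<le> (real n * x $ c - real (j $ c)) * real K" for c using x n by (simp add: mem_hcube)
    show ?thesis unfolding mem_cell[OF K] by (simp add: idx_def vec_eq_iff eq[OF nn])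
  qed
  have idx_grid: "idx K x \<in> grid_index K" if K: "0 < K" and x: "x \<in> hcube n j" for K x
  proof -
    have "idx K x $ c < K" for c
    proof -
      have "(real n * x $ c - real (j $ c)) * real K < 1 * real K"
        using x n K by (intro mult_strict_right_mono) (auto simp: mem_hcube)
      then have "\<lfloor>(real n * x $ c - real (j $ c)) * real K\<rfloor> < int K" by (simp add: floor_less_iff)
      then show ?thesis using K by (simp add: idx_def nat_less_iff)
    qed
    then show ?thesis by (simp add: grid_index_def)
  qed
  have cell_sub: "cell K a \<subseteq> hcube n j" if K: "0 < K" and a: "a \<in> grid_index K" for K a
  proof
    fix x assume x: "x \<in> cell K a"
    have "0 \<le> real n * x $ c - real (j $ c) \<and> real n * x $ c - real (j $ c) < 1" for c
    proof -
      have b: "real (a $ c) \<le> (real n * x $ c - real (j $ c)) * real K" "(real n * x $ c - real (j $ c)) * real K < real (a $ c) + 1"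
        using x mem_cell[OF K] by auto
      have "a $ c < K" using a by (simp add: grid_index_def)
      then have aK: "real (a $ c) + 1 \<le> real K" by linarith
      have "(real n * x $ c - real (j $ c)) * real K < 1 * real K"
        using less_le_trans[OF b(2) aK] by (simp only: mult_1_left)
      moreover have "0 * real K \<le> (real n * x $ c - real (j $ c)) * real K"
        using order_trans[OF of_nat_0_le_iff b(1)] by (simp only: mult_zero_left)
      ultimately show ?thesis using K by (simp only: mult_less_cancel_right_pos mult_le_cancel_right_pos of_nat_0_less_iff)
    qed
    then show "x \<in> hcube n j" using n by (simp add: mem_hcube)
  qed
  have step: "indicator (hcube n j) x * h (?pt K (idx K x)) = (\<Sum>a\<in>grid_index K. h (?pt K a) * indicator (cell K a) x)" if K: "0 < K" for K x
  proof (cases "x \<in> hcube n j")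
    case True
    have "(\<Sum>a\<in>grid_index K. h (?pt K a) * indicator (cell K a) x) = (\<Sum>a\<in>grid_index K. if a = idx K x then h (?pt K a) else 0)"
      by (intro sum.cong refl) (auto simp: indicator_def cell_idx[OF K True])
    then show ?thesis using True idx_grid[OF K True] by simp
  next
    case False
    then have "x \<notin> cell K a" if "a \<in> grid_index K" for a using cell_sub[OF K that] by auto
    then show ?thesis using False by simp
  qed
  have cell_meas: "emeasure lborel (cell K a) = ennreal ((1 / (real n * real K)) ^ CARD('d))" if K: "0 < K" for K a
    unfolding cell_def by (rule emeasure_hbox) (use K n in auto)
  have cm [measurable]: "cell K a \<in> sets borel" for K a by (simp add: cell_def)
  have int: "(LINT x|lborel. (\<Sum>a\<in>grid_index K. h (?pt K a) * indicator (cell K a) x)) = (\<Sum>a\<in>grid_index K. (1 / (real n * real K)) ^ CARD('d) * h (?pt K a))" if K: "0 < K" for K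
  proof -
    have i: "integrable lborel (\<lambda>x. h (?pt K a) * indicator (cell K a) x)" for a
      by (intro integrable_mult_right integrable_real_indicator) (auto simp: cell_meas[OF K])
    have m: "(LINT x|lborel. indicat_real (cell K a) x) = (1 / (real n * real K)) ^ CARD('d)" for a
    proof -
      have "(LINT x|lborel. indicat_real (cell K a) x) = measure lborel (cell K a)" by simp
      also have "\<dots> = (1 / (real n * real K)) ^ CARD('d)" unfolding measure_def cell_meas[OF K] by simp
      finally show ?thesis .
    qed
    have "(LINT x|lborel. (\<Sum>a\<in>grid_index K. h (?pt K a) * indicator (cell K a) x))
       = (\<Sum>a\<in>grid_index K. LINT x|lborel. h (?pt K a) * indicator (cell K a) x)"
      by (rule Bochner_Integration.integral_sum) (rule i)
    also have "\<dots> = (\<Sum>a\<in>grid_index K. h (?pt K a) * (1 / (real n * real K)) ^ CARD('d))"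
      by (simp only: integral_mult_right_zero m)
    finally show ?thesis by (simp only: mult.commute)
  qed
  have lim: "(\<lambda>N. indicator (hcube n j) x * h (?pt (Suc N) (idx (Suc N) x))) \<longlonglongrightarrow> indicator (hcube n j) x * h x" for x
  proof (cases "x \<in> hcube n j")
    case True
    have "(\<lambda>N. ?pt (Suc N) (idx (Suc N) x)) \<longlonglongrightarrow> x"
    proof (rule vec_tendstoI)
      fix c
      have c: "?pt (Suc N) (idx (Suc N) x) $ c \<le> x $ c \<and> x $ c < ?pt (Suc N) (idx (Suc N) x) $ c + 1 / (real n * real (Suc N))" for N
        using cell_idx[of "Suc N" x "idx (Suc N) x"] True by (simp add: cell_def hbox_def)
      show "(\<lambda>N. ?pt (Suc N) (idx (Suc N) x) $ c) \<longlonglongrightarrow> x $ c"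
      proof (rule tendsto_sandwich)
        show "\<forall>\<^sub>F N in sequentially. x $ c - 1 / real n * (1 / real (Suc N)) \<le> ?pt (Suc N) (idx (Suc N) x) $ c"
        proof (rule always_eventually, rule allI)
          fix N
          have "1 / real n * (1 / real (Suc N)) = 1 / (real n * real (Suc N))" by simp
          then show "x $ c - 1 / real n * (1 / real (Suc N)) \<le> ?pt (Suc N) (idx (Suc N) x) $ c" using c[of N] by linarith
        qed
        show "\<forall>\<^sub>F N in sequentially. ?pt (Suc N) (idx (Suc N) x) $ c \<le> x $ c" using c by simp
        have "(\<lambda>N. x $ c - 1 / real n * (1 / real (Suc N))) \<longlonglongrightarrow> x $ c - 1 / real n * 0"
          by (intro tendsto_intros LIMSEQ_Suc[OF lim_1_over_n])
        then show "(\<lambda>N. x $ c - 1 / real n * (1 / real (Suc N))) \<longlonglongrightarrow> x $ c" by simp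
      qed simp
    qed
    moreover have "isCont h x" using h by (simp add: continuous_on_eq_continuous_at)
    ultimately have "(\<lambda>N. h (?pt (Suc N) (idx (Suc N) x))) \<longlonglongrightarrow> h x" by (rule isCont_tendsto_compose[rotated])
    then show ?thesis by (intro tendsto_mult tendsto_const)
  qed simp
  have "compact (h ` cbox (grid_point n j 0) (grid_point n j 1))"
    by (rule compact_continuous_image[OF continuous_on_subset[OF h]]) auto
  then obtain B where B: "\<And>x. x \<in> cbox (grid_point n j 0) (grid_point n j 1) \<Longrightarrow> norm (h x) \<le> B"
    using compact_imp_bounded bounded_iff by (metis image_eqI)
  have "(\<lambda>N. LINT x|lborel. (\<Sum>a\<in>grid_index (Suc N). h (?pt (Suc N) a) * indicator (cell (Suc N) a) x)) \<longlonglongrightarrow> (LINT x|lborel. indicator (hcube n j) x * h x)"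
  proof (rule integral_dominated_convergence[where w = "\<lambda>x. indicator (hcube n j) x * B"])
    have "emeasure lborel (hcube n j) < \<infinity>"
      using emeasure_mono[OF hcube_subset_cbox, of n j lborel] by (auto simp: emeasure_lborel_cbox_eq intro: le_less_trans)
    then show "integrable lborel (\<lambda>x. indicator (hcube n j) x * B)"
      by (intro integrable_mult_left integrable_real_indicator) auto
    show "AE x in lborel. (\<lambda>N. \<Sum>a\<in>grid_index (Suc N). h (?pt (Suc N) a) * indicator (cell (Suc N) a) x) \<longlonglongrightarrow> indicator (hcube n j) x * h x"
      by (intro AE_I2) (simp only: step[OF zero_less_Suc, symmetric] lim)
    fix N
    show "AE x in lborel. norm (\<Sum>a\<in>grid_index (Suc N). h (?pt (Suc N) a) * indicator (cell (Suc N) a) x) \<le> indicator (hcube n j) x * B"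
    proof (rule AE_I2)
      fix x
      have "norm (h (?pt (Suc N) (idx (Suc N) x))) \<le> B" if x: "x \<in> hcube n j"
      proof (rule B)
        have "?pt (Suc N) (idx (Suc N) x) \<in> cell (Suc N) (idx (Suc N) x)"
          using n by (simp add: cell_def hbox_def)
        then have "?pt (Suc N) (idx (Suc N) x) \<in> hcube n j" using cell_sub[OF _ idx_grid[OF _ x], of "Suc N"] by auto
        then show "?pt (Suc N) (idx (Suc N) x) \<in> cbox (grid_point n j 0) (grid_point n j 1)" using hcube_subset_cbox by blast
      qed
      then show "norm (\<Sum>a\<in>grid_index (Suc N). h (?pt (Suc N) a) * indicator (cell (Suc N) a) x) \<le> indicator (hcube n j) x * B"
        unfolding step[of "Suc N", OF zero_less_Suc, symmetric] by (auto simp: indicator_def)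
    qed
  qed measurable
  then show ?thesis by (simp only: int[OF zero_less_Suc])
qed

section \<open>Continuous test functions exhausting an open grid cube\<close>

lemma grid_cube_eq_box:
  fixes j :: "nat ^ 'd::finite"
  assumes n: "0 < n" shows "grid_cube n j = box (grid_point n j 0) (grid_point n j 1)"
proof -
  have "x \<in> grid_cube n j \<longleftrightarrow> x \<in> box (grid_point n j 0) (grid_point n j 1)" for x :: "real ^ 'd"
  proof
    assume "x \<in> grid_cube n j"
    then obtain y where y: "y \<in> box 0 1" "x = (1 / real n) *\<^sub>R ((\<chi> i. real (j $ i)) + y)" by (auto simp: grid_cube_def)
    then show "x \<in> box (grid_point n j 0) (grid_point n j 1)"
      using n by (auto simp: mem_box_cart grid_point_def divide_strict_right_mono)
  next
    assume x: "x \<in> box (grid_point n j 0) (grid_point n j 1)"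
    let ?y = "real n *\<^sub>R x - (\<chi> i. real (j $ i))"
    have "?y \<in> box 0 1" using x n by (auto simp: mem_box_cart grid_point_def field_simps)
    moreover have "x = (1 / real n) *\<^sub>R ((\<chi> i. real (j $ i)) + ?y)" using n by simp
    ultimately show "x \<in> grid_cube n j" unfolding grid_cube_def by blast
  qed
  then show ?thesis by blast
qed

lemma grid_cube_subset_hcube: "0 < n \<Longrightarrow> grid_cube n j \<subseteq> hcube n j"
  by (auto simp: grid_cube_eq_box hcube_def hbox_def mem_box_cart less_imp_le)

text \<open>Multiples of the distance to the complement, capped at 1. They increase to the indicator
  of the open cube from below, so weak* convergence can be used without any statement about mass on
  the boundary.\<close>

definition cube_test :: "nat \<Rightarrow> nat ^ 'd \<Rightarrow> nat \<Rightarrow> real ^ 'd::finite \<Rightarrow> real" where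
  "cube_test n j m x = min 1 (real m * infdist x (- grid_cube n j))"

lemma cube_test_continuous: "continuous_on UNIV (cube_test n j m)"
  unfolding cube_test_def[abs_def] by (intro continuous_intros)

lemma cube_test_bounds: "0 \<le> cube_test n j m x" "cube_test n j m x \<le> indicator (grid_cube n j) x"
  unfolding cube_test_def by (auto simp: infdist_nonneg indicator_def)

lemma cube_test_supp:
  assumes n: "0 < n" shows "compact (supp (cube_test n j m))"
proof -
  have "support_on UNIV (cube_test n j m) \<subseteq> grid_cube n j"
  proof
    fix x assume "x \<in> support_on UNIV (cube_test n j m)"
    then have "cube_test n j m x \<noteq> 0" by (simp add: support_on_def)
    then show "x \<in> grid_cube n j"
      using cube_test_bounds[of n j m x] by (cases "x \<in> grid_cube n j") auto
  qed
  then have "bounded (support_on UNIV (cube_test n j m))"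
    using bounded_subset[OF bounded_box] n by (simp add: grid_cube_eq_box)
  then show ?thesis unfolding supp_def by (simp add: compact_closure)
qed

lemma cube_test_lim:
  fixes j :: "nat ^ 'd::finite"
  assumes n: "0 < n" shows "(\<lambda>m. cube_test n j m x) \<longlonglongrightarrow> indicator (grid_cube n j) x"
proof (cases "x \<in> grid_cube n j")
  case True
  let ?B = "- grid_cube n j :: (real ^ 'd) set"
  have cl: "closed ?B" using n by (simp add: grid_cube_eq_box closed_def open_box)
  have ne: "?B \<noteq> {}"
  proof -
    have "grid_point n j 0 \<notin> grid_cube n j" using n by (auto simp: grid_cube_eq_box mem_box_cart)
    then show ?thesis by blast
  qed
  have pos: "0 < infdist x ?B" by (rule infdist_pos_not_in_closed[OF cl ne]) (use True in simp)
  obtain m0 :: nat where m0: "1 / infdist x ?B \<le> real m0" using real_arch_simple by blast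
  have "cube_test n j m x = 1" if "m0 \<le> m" for m
  proof -
    have "1 / infdist x ?B \<le> real m" using m0 that by linarith
    then have "1 \<le> real m * infdist x ?B" using pos by (simp add: divide_le_eq)
    then show ?thesis by (simp add: cube_test_def)
  qed
  then have "\<forall>\<^sub>F m in sequentially. cube_test n j m x = 1" by (auto simp: eventually_sequentially)
  then show ?thesis using True by (simp add: tendsto_eventually)
next
  case False
  then show ?thesis by (simp add: cube_test_def)
qed

lemma random_measure_nn_integral_measurable:
  fixes M :: "'w \<Rightarrow> 'a::topological_space measure"
  assumes M: "locally_finite_random_measure P M" and f: "f \<in> borel_measurable borel"
  shows "(\<lambda>\<omega>. \<integral>\<^sup>+x. f x \<partial>M \<omega>) \<in> borel_measurable P"
  using f
proof (induction f rule: borel_measurable_induct)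
  case (cong f g)
  have "(\<integral>\<^sup>+x. f x \<partial>M \<omega>) = (\<integral>\<^sup>+x. g x \<partial>M \<omega>)" for \<omega>
    using cong by (intro nn_integral_cong) auto
  then show ?case using cong by simp
next
  case (set A)
  have "(\<lambda>\<omega>. emeasure (M \<omega>) A) \<in> borel_measurable P" using M set by (simp add: locally_finite_random_measure_def)
  moreover have "(\<integral>\<^sup>+x. indicator A x \<partial>M \<omega>) = emeasure (M \<omega>) A" if "\<omega> \<in> space P" for \<omega>
    using M set that by (simp add: locally_finite_random_measure_def)
  ultimately show ?case by (simp cong: measurable_cong)
next
  case (mult u c)
  have "(\<integral>\<^sup>+x. c * u x \<partial>M \<omega>) = c * (\<integral>\<^sup>+x. u x \<partial>M \<omega>)" if "\<omega> \<in> space P" for \<omega>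
    using M mult that by (intro nn_integral_cmult) (simp add: locally_finite_random_measure_def cong: measurable_cong_sets)
  then show ?case using mult by (simp cong: measurable_cong)
next
  case (add u v)
  have "(\<integral>\<^sup>+x. v x + u x \<partial>M \<omega>) = (\<integral>\<^sup>+x. v x \<partial>M \<omega>) + (\<integral>\<^sup>+x. u x \<partial>M \<omega>)" if "\<omega> \<in> space P" for \<omega>
    using M add that by (intro nn_integral_add) (simp_all add: locally_finite_random_measure_def cong: measurable_cong_sets)
  then show ?case using add by (simp cong: measurable_cong)
next
  case (seq U)
  have "(\<integral>\<^sup>+x. (SUP i. U i) x \<partial>M \<omega>) = (SUP i. \<integral>\<^sup>+x. U i x \<partial>M \<omega>)" if "\<omega> \<in> space P" for \<omega>
    using M seq that by (simp add: image_comp, intro nn_integral_monotone_convergence_SUP)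
      (simp_all add: locally_finite_random_measure_def cong: measurable_cong_sets)
  then show ?case using seq by (simp cong: measurable_cong)
qed

subsection \<open>Passage to the limit\<close>

definition crit_density :: "(real \<Rightarrow> real ^ 'd \<Rightarrow> 'w \<Rightarrow> real) \<Rightarrow> real \<Rightarrow> 'w \<Rightarrow> real ^ 'd::finite \<Rightarrow> real" where
  "crit_density X T \<omega> x = sqrt T * exp (critical_gamma TYPE('d) * X T x \<omega> - real CARD('d) * T)"

text \<open>Taken over the half-open cube, which suits the Riemann sums. For the measures tested
  with \<open>cube_test\<close> it serves as an upper bound.\<close>

definition cube_mass :: "(real \<Rightarrow> real ^ 'd \<Rightarrow> 'w \<Rightarrow> real) \<Rightarrow> nat \<Rightarrow> real \<Rightarrow> nat ^ 'd \<Rightarrow> 'w \<Rightarrow> real" where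
  "cube_mass X n T j \<omega> = (LINT x|lborel. indicator (hcube n j) x * crit_density X T \<omega> x)"

lemma crit_density_continuous:
  fixes X :: "real \<Rightarrow> real ^ 'd::finite \<Rightarrow> 'w \<Rightarrow> real"
  assumes "martingale_decomposition P \<rho> X" "0 \<le> T" "\<omega> \<in> space P"
  shows "continuous_on UNIV (crit_density X T \<omega>)"
proof -
  have "continuous_on UNIV (\<lambda>x. X T x \<omega>)" using assms by (simp add: martingale_decomposition_def)
  then show ?thesis unfolding crit_density_def[abs_def] by (intro continuous_intros)
qed

lemma crit_density_nonneg: "0 \<le> T \<Longrightarrow> 0 \<le> crit_density X T \<omega> x"
  by (simp add: crit_density_def)

lemma cell_mass_tendsto:
  fixes X :: "real \<Rightarrow> real ^ 'd::finite \<Rightarrow> 'w \<Rightarrow> real"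
  assumes X: "martingale_decomposition P \<rho> X" and T: "0 \<le> T" and w: "\<omega> \<in> space P" and n: "0 < n"
  shows "(\<lambda>N. cell_mass X n (Suc N) T j \<omega>) \<longlonglongrightarrow> cube_mass X n T j \<omega>"
proof -
  have "cell_mass X n (Suc N) T j \<omega> = (\<Sum>a\<in>grid_index (Suc N). (1 / (real n * real (Suc N))) ^ CARD('d) *
      crit_density X T \<omega> (grid_point n j (grid_point (Suc N) a 0)))" for N
    unfolding cell_mass_def crit_density_def
    by (intro sum.cong refl) (simp only: exp_diff exp_minus divide_inverse mult.assoc mult.left_commute mult.commute)
  then show ?thesis
    using riemann_sum_cube[OF crit_density_continuous[OF X T w] n, of j] by (simp only: cube_mass_def)
qed

lemma crit_integral_measurable:
  fixes X :: "real \<Rightarrow> real ^ 'd::finite \<Rightarrow> 'w \<Rightarrow> real"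
  assumes P: "prob_space P" and X: "martingale_decomposition P \<rho> X" and T: "0 \<le> T" and n: "0 < n"
    and f: "continuous_on UNIV f"
  shows "(\<lambda>\<omega>. LINT x|lborel. indicator (hcube n j) x * (f x * crit_density X T \<omega> x)) \<in> borel_measurable P"
proof (rule borel_measurable_LIMSEQ_real)
  fix \<omega> assume "\<omega> \<in> space P"
  then show "(\<lambda>N. \<Sum>a\<in>grid_index (Suc N). (1 / (real n * real (Suc N))) ^ CARD('d) *
      (f (grid_point n j (grid_point (Suc N) a 0)) * crit_density X T \<omega> (grid_point n j (grid_point (Suc N) a 0))))
      \<longlonglongrightarrow> (LINT x|lborel. indicator (hcube n j) x * (f x * crit_density X T \<omega> x))"
    by (intro riemann_sum_cube[OF _ n] continuous_on_mult f crit_density_continuous[OF X T])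
next
  fix N
  have [measurable]: "(\<lambda>\<omega>. crit_density X T \<omega> x) \<in> borel_measurable P" for x
    using field_measurable[OF P X T, of x] unfolding crit_density_def by measurable
  show "(\<lambda>\<omega>. \<Sum>a\<in>grid_index (Suc N). (1 / (real n * real (Suc N))) ^ CARD('d) *
      (f (grid_point n j (grid_point (Suc N) a 0)) * crit_density X T \<omega> (grid_point n j (grid_point (Suc N) a 0))))
      \<in> borel_measurable P" by measurable
qed

lemma cube_mass_measurable:
  assumes "prob_space P" "martingale_decomposition P \<rho> X" "0 \<le> T" "0 < n"
  shows "cube_mass X n T j \<in> borel_measurable P"
  using crit_integral_measurable[OF assms, of "\<lambda>_. 1" j] by (simp add: cube_mass_def[abs_def])

lemma cell_mass_measurable:
  assumes "prob_space P" "martingale_decomposition P \<rho> X" "0 \<le> T"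
  shows "cell_mass X n N T j \<in> borel_measurable P"
proof -
  have [measurable]: "X T x \<in> borel_measurable P" for x by (rule field_measurable[OF assms])
  show ?thesis unfolding cell_mass_def[abs_def] by measurable
qed

lemma cell_mass_nonneg: "0 \<le> T \<Longrightarrow> 0 \<le> cell_mass X n N T j \<omega>"
  by (simp add: cell_mass_def sum_nonneg)

lemma powr_tendsto_nonneg:
  fixes f :: "'a \<Rightarrow> real"
  assumes "(f \<longlongrightarrow> a) F" "0 < b" "\<And>x. 0 \<le> f x"
  shows "((\<lambda>x. f x powr b) \<longlongrightarrow> a powr b) F"
  by (rule tendsto_powr'[OF assms(1) tendsto_const]) (use assms in auto)

lemma expectation_one_minus_exp_tendsto:
  fixes f :: "nat \<Rightarrow> 'j \<Rightarrow> 'w \<Rightarrow> real" and g :: "'j \<Rightarrow> 'w \<Rightarrow> real"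
  assumes P: "prob_space P" and J: "finite J" and b: "0 < b" and c: "0 \<le> c"
    and nn: "\<And>i j \<omega>. 0 \<le> f i j \<omega>"
    and m: "\<And>i j. j \<in> J \<Longrightarrow> f i j \<in> borel_measurable P"
    and lim: "\<And>j \<omega>. j \<in> J \<Longrightarrow> \<omega> \<in> space P \<Longrightarrow> (\<lambda>i. f i j \<omega>) \<longlonglongrightarrow> g j \<omega>"
  shows "(\<lambda>i. LINT \<omega>|P. 1 - exp (- (\<Sum>j\<in>J. (c * f i j \<omega>) powr b))) \<longlonglongrightarrow>
    (LINT \<omega>|P. 1 - exp (- (\<Sum>j\<in>J. (c * g j \<omega>) powr b)))"
proof (rule integral_dominated_convergence[where w = "\<lambda>_. 1"])
  interpret prob_space P by fact
  have [measurable]: "g j \<in> borel_measurable P" if "j \<in> J" for j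
    by (rule borel_measurable_LIMSEQ_real[OF lim[OF that] m[OF that]])
  have s: "(\<lambda>\<omega>. \<Sum>j\<in>J. (c * g j \<omega>) powr b) \<in> borel_measurable P" "(\<lambda>\<omega>. \<Sum>j\<in>J. (c * f i j \<omega>) powr b) \<in> borel_measurable P" for i
    using m[of _ i] by (intro borel_measurable_sum; measurable)+
  show "(\<lambda>\<omega>. 1 - exp (- (\<Sum>j\<in>J. (c * g j \<omega>) powr b))) \<in> borel_measurable P"
    using s(1) by measurable
  show "(\<lambda>\<omega>. 1 - exp (- (\<Sum>j\<in>J. (c * f i j \<omega>) powr b))) \<in> borel_measurable P" for i
    using s(2)[of i] by measurable
  show "integrable P (\<lambda>_. 1 :: real)" by simp
  show "AE \<omega> in P. (\<lambda>i. 1 - exp (- (\<Sum>j\<in>J. (c * f i j \<omega>) powr b))) \<longlonglongrightarrow> 1 - exp (- (\<Sum>j\<in>J. (c * g j \<omega>) powr b))"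
    by (intro AE_I2 tendsto_intros powr_tendsto_nonneg lim) (use b c nn in auto)
  show "AE \<omega> in P. norm (1 - exp (- (\<Sum>j\<in>J. (c * f i j \<omega>) powr b))) \<le> 1" for i
    by (intro AE_I2) (auto simp: sum_nonneg)
qed

text \<open>The bound of \<open>grid_mass_bound\<close> does not depend on the resolution
  \<open>N\<close>, so the Riemann sums can be sent to the integral while \<open>T\<close> is
  fixed.\<close>

theorem cube_mass_bound:
  fixes P :: "'w measure" and \<rho> :: "real ^ 'd::finite \<Rightarrow> real" and X :: "real \<Rightarrow> real ^ 'd \<Rightarrow> 'w \<Rightarrow> real"
  assumes P: "prob_space P" and s: "seed_covariance \<rho>" and X: "martingale_decomposition P \<rho> X" and b: "1 < \<beta>"
  obtains C where "0 \<le> C"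
    "\<And>n T L. 2 \<le> n \<Longrightarrow> 2 * ln (real n) \<le> T \<Longrightarrow> ln (real n) + ln 2 \<le> T \<Longrightarrow> 0 \<le> L \<Longrightarrow>
      (LINT \<omega>|P. 1 - exp (- (\<Sum>j\<in>grid_index n. ((exp (- L) * sqrt (ln (real n))) * cube_mass X n T j \<omega>) powr \<beta>))) \<le> exp (- L) * (C * (1 + L))"
proof -
  obtain C where C: "0 \<le> C"
    "\<And>n T N k' L. 2 \<le> n \<Longrightarrow> 2 * ln (real n) \<le> T \<Longrightarrow> 1 \<le> k' \<Longrightarrow> real k' * ln 2 \<le> T - ln (real n) \<Longrightarrow>
      T - ln (real n) \<le> (real k' + 1) * ln 2 \<Longrightarrow> 2 ^ k' \<le> N \<Longrightarrow> 0 \<le> L \<Longrightarrow>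
      (LINT \<omega>|P. 1 - exp (- (\<Sum>j\<in>grid_index n. (exp (- L) * sqrt (ln (real n)) * cell_mass X n N T j \<omega>) powr \<beta>))) \<le> exp (- L) * (C * (1 + L))"
    using grid_mass_bound[OF assms] by metis
  have "(LINT \<omega>|P. 1 - exp (- (\<Sum>j\<in>grid_index n. ((exp (- L) * sqrt (ln (real n))) * cube_mass X n T j \<omega>) powr \<beta>))) \<le> exp (- L) * (C * (1 + L))"
    if n: "2 \<le> n" and T: "2 * ln (real n) \<le> T" and T': "ln (real n) + ln 2 \<le> T" and L: "0 \<le> L" for n T L
  proof -
    have n0: "0 < n" "0 \<le> ln (real n)" using n by auto
    have T0: "0 \<le> T" using n0 T by linarith
    \<comment> \<open>The depth belonging to the remaining time \<open>T - ln n\<close>; it is at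
      least 1 because \<open>T \<ge> ln n + ln 2\<close>.\<close>
    define k where "k = nat \<lfloor>(T - ln (real n)) / ln 2\<rfloor>"
    have q: "1 \<le> (T - ln (real n)) / ln 2" using T' by (simp add: le_divide_eq)
    have k: "1 \<le> k" "real k \<le> (T - ln (real n)) / ln 2" "(T - ln (real n)) / ln 2 \<le> real k + 1"
      using q unfolding k_def by linarith+
    have k': "real k * ln 2 \<le> T - ln (real n)" "T - ln (real n) \<le> (real k + 1) * ln 2"
      using k(2,3) by (simp_all add: field_simps)
    have "(\<lambda>N. LINT \<omega>|P. 1 - exp (- (\<Sum>j\<in>grid_index n. ((exp (- L) * sqrt (ln (real n))) * cell_mass X n (Suc N) T j \<omega>) powr \<beta>))) \<longlonglongrightarrow>
      (LINT \<omega>|P. 1 - exp (- (\<Sum>j\<in>grid_index n. ((exp (- L) * sqrt (ln (real n))) * cube_mass X n T j \<omega>) powr \<beta>)))"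
      by (rule expectation_one_minus_exp_tendsto[OF P])
        (use b n0 T0 in \<open>auto intro!: cell_mass_measurable[OF P X] cell_mass_tendsto[OF X] cell_mass_nonneg simp del: of_nat_Suc\<close>)
    then show ?thesis
    proof (rule LIMSEQ_le_const2)
      show "\<exists>N. \<forall>i\<ge>N. (LINT \<omega>|P. 1 - exp (- (\<Sum>j\<in>grid_index n. ((exp (- L) * sqrt (ln (real n))) * cell_mass X n (Suc i) T j \<omega>) powr \<beta>))) \<le> exp (- L) * (C * (1 + L))"
        using C(2)[OF n T k(1) k' _ L] by (intro exI[of _ "2 ^ k"]) auto
    qed
  qed
  then show thesis using that C(1) by blast
qed

text \<open>Outside a small event \<open>B\<close> is at most \<open>A + \<epsilon>\<close>, hence
  at most \<open>2 * max (A, \<epsilon>)\<close>, and the power of the maximum is bounded by the sum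
  of the powers. The factor 2 is given away in the scale \<open>c\<close>, and no almost surely
  convergent subsequence is extracted.\<close>

lemma one_minus_exp_limit_in_probability:
  fixes A :: "real \<Rightarrow> 'j \<Rightarrow> 'w \<Rightarrow> real" and B :: "'j \<Rightarrow> 'w \<Rightarrow> real"
  assumes P: "prob_space P" and J: "finite J" and b: "1 < b" and c: "0 \<le> c"
    and Am: "\<And>T j. Tmin \<le> T \<Longrightarrow> j \<in> J \<Longrightarrow> A T j \<in> borel_measurable P" and Bm: "\<And>j. j \<in> J \<Longrightarrow> B j \<in> borel_measurable P"
    and A0: "\<And>T j \<omega>. Tmin \<le> T \<Longrightarrow> 0 \<le> A T j \<omega>" and B0: "\<And>j \<omega>. 0 \<le> B j \<omega>"
    and lim: "\<And>\<epsilon>. 0 < \<epsilon> \<Longrightarrow> ((\<lambda>T. measure P {\<omega> \<in> space P. \<exists>j\<in>J. \<epsilon> \<le> \<bar>A T j \<omega> - B j \<omega>\<bar>}) \<longlongrightarrow> 0) at_top"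
    and bound: "\<And>T. Tmin \<le> T \<Longrightarrow> (LINT \<omega>|P. 1 - exp (- (\<Sum>j\<in>J. (2 * c * A T j \<omega>) powr b))) \<le> K"
  shows "(LINT \<omega>|P. 1 - exp (- (\<Sum>j\<in>J. (c * B j \<omega>) powr b))) \<le> K"
proof -
  interpret prob_space P by fact
  let ?E = "LINT \<omega>|P. 1 - exp (- (\<Sum>j\<in>J. (c * B j \<omega>) powr b))"
  have Bs [measurable]: "(\<lambda>\<omega>. \<Sum>j\<in>J. (c * B j \<omega>) powr b) \<in> borel_measurable P"
    using Bm by (intro borel_measurable_sum; measurable)
  have main: "?E \<le> measure P {\<omega> \<in> space P. \<exists>j\<in>J. \<epsilon> \<le> \<bar>A T j \<omega> - B j \<omega>\<bar>} + real (card J) * (2 * c * \<epsilon>) powr b + K"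
    if e: "0 < \<epsilon>" and T: "Tmin \<le> T" for \<epsilon> T
  proof -
    let ?D = "{\<omega> \<in> space P. \<exists>j\<in>J. \<epsilon> \<le> \<bar>A T j \<omega> - B j \<omega>\<bar>}"
    let ?r = "real (card J) * (2 * c * \<epsilon>) powr b"
    have As [measurable]: "(\<lambda>\<omega>. \<Sum>j\<in>J. (2 * c * A T j \<omega>) powr b) \<in> borel_measurable P"
      using Am[OF T] by (intro borel_measurable_sum; measurable)
    have D: "?D \<in> sets P"
    proof -
      have "{\<omega> \<in> space P. \<epsilon> \<le> \<bar>A T j \<omega> - B j \<omega>\<bar>} \<in> sets P" if "j \<in> J" for j
        using Am[OF T that] Bm[OF that] by measurable
      then have "(\<Union>j\<in>J. {\<omega> \<in> space P. \<epsilon> \<le> \<bar>A T j \<omega> - B j \<omega>\<bar>}) \<in> sets P" using J by (intro sets.finite_UN) auto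
      also have "(\<Union>j\<in>J. {\<omega> \<in> space P. \<epsilon> \<le> \<bar>A T j \<omega> - B j \<omega>\<bar>}) = ?D" by auto
      finally show ?thesis .
    qed
    have iA: "integrable P (\<lambda>\<omega>. 1 - exp (- (\<Sum>j\<in>J. (2 * c * A T j \<omega>) powr b)))"
      by (rule integrable_const_bound[where B = 1]) (auto simp: sum_nonneg)
    have iB: "integrable P (\<lambda>\<omega>. 1 - exp (- (\<Sum>j\<in>J. (c * B j \<omega>) powr b)))"
      by (rule integrable_const_bound[where B = 1]) (auto simp: sum_nonneg)
    have iD: "integrable P (indicat_real ?D)" using D by (simp add: emeasure_eq_measure)
    have "?E \<le> (LINT \<omega>|P. indicat_real ?D \<omega> + (?r + (1 - exp (- (\<Sum>j\<in>J. (2 * c * A T j \<omega>) powr b)))))"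
    proof (rule integral_mono_AE[OF iB])
      show "integrable P (\<lambda>\<omega>. indicat_real ?D \<omega> + (?r + (1 - exp (- (\<Sum>j\<in>J. (2 * c * A T j \<omega>) powr b)))))"
        by (intro Bochner_Integration.integrable_add iD iA integrable_const)
      show "AE \<omega> in P. 1 - exp (- (\<Sum>j\<in>J. (c * B j \<omega>) powr b)) \<le> indicat_real ?D \<omega> + (?r + (1 - exp (- (\<Sum>j\<in>J. (2 * c * A T j \<omega>) powr b))))"
      proof (rule AE_I2)
        fix \<omega> assume w: "\<omega> \<in> space P"
        let ?a = "\<Sum>j\<in>J. (2 * c * A T j \<omega>) powr b"
        have a0: "0 \<le> ?a" by (simp add: sum_nonneg)
        have r0: "0 \<le> ?r" by simp
        show "1 - exp (- (\<Sum>j\<in>J. (c * B j \<omega>) powr b)) \<le> indicat_real ?D \<omega> + (?r + (1 - exp (- ?a)))"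
        proof (cases "\<omega> \<in> ?D")
          case True
          have "exp (- ?a) \<le> 1" using a0 by simp
          moreover have "0 < exp (- (\<Sum>j\<in>J. (c * B j \<omega>) powr b))" by simp
          ultimately show ?thesis using True r0 by (simp only: indicator_simps)
        next
          case False
          have "(c * B j \<omega>) powr b \<le> (2 * c * A T j \<omega>) powr b + (2 * c * \<epsilon>) powr b" if j: "j \<in> J" for j
          proof -
            have "\<bar>A T j \<omega> - B j \<omega>\<bar> < \<epsilon>" using False w j by force
            then have B: "B j \<omega> \<le> A T j \<omega> + \<epsilon>" by linarith
            have m: "c * B j \<omega> \<le> 2 * c * max (A T j \<omega>) \<epsilon>"
            proof -
              have "B j \<omega> \<le> 2 * max (A T j \<omega>) \<epsilon>" using B by linarith
              from mult_left_mono[OF this c] show ?thesis by (simp only: mult.assoc mult.left_commute)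
            qed
            have "(c * B j \<omega>) powr b \<le> (2 * c * max (A T j \<omega>) \<epsilon>) powr b"
              using b c B0 by (intro powr_mono2 m) auto
            also have "\<dots> \<le> (2 * c * A T j \<omega>) powr b + (2 * c * \<epsilon>) powr b" by (simp add: max_def)
            finally show ?thesis .
          qed
          then have "(\<Sum>j\<in>J. (c * B j \<omega>) powr b) \<le> (\<Sum>j\<in>J. (2 * c * A T j \<omega>) powr b + (2 * c * \<epsilon>) powr b)" by (rule sum_mono)
          also have "\<dots> = ?a + ?r" by (simp add: sum.distrib)
          finally have le: "exp (- (?a + ?r)) \<le> exp (- (\<Sum>j\<in>J. (c * B j \<omega>) powr b))" by simp
          have "exp (- ?a) * 1 - exp (- ?a) * exp (- ?r) \<le> ?r"
          proof -
            have "1 - ?r \<le> exp (- ?r)" using exp_ge_add_one_self[of "- ?r"] by simp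
            then have "exp (- ?a) * (1 - exp (- ?r)) \<le> 1 * ?r" using a0 r0 by (intro mult_mono) auto
            then show ?thesis by (simp only: right_diff_distrib mult_1_left)
          qed
          then have "exp (- ?a) - ?r \<le> exp (- (?a + ?r))" by (simp only: minus_add_distrib exp_add mult_1_right)
          moreover have "indicat_real ?D \<omega> = 0" using False by (rule indicator_simps(2))
          ultimately show ?thesis using le by linarith
        qed
      qed
    qed
    also have "\<dots> = measure P ?D + (?r + (LINT \<omega>|P. 1 - exp (- (\<Sum>j\<in>J. (2 * c * A T j \<omega>) powr b))))"
    proof -
      have "(LINT \<omega>|P. indicat_real ?D \<omega> + (?r + (1 - exp (- (\<Sum>j\<in>J. (2 * c * A T j \<omega>) powr b)))))
        = (LINT \<omega>|P. indicat_real ?D \<omega>) + (LINT \<omega>|P. ?r + (1 - exp (- (\<Sum>j\<in>J. (2 * c * A T j \<omega>) powr b))))"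
        by (intro Bochner_Integration.integral_add Bochner_Integration.integrable_add iD iA integrable_const)
      also have "(LINT \<omega>|P. ?r + (1 - exp (- (\<Sum>j\<in>J. (2 * c * A T j \<omega>) powr b)))) = (LINT \<omega>|P. ?r) + (LINT \<omega>|P. 1 - exp (- (\<Sum>j\<in>J. (2 * c * A T j \<omega>) powr b)))"
        by (intro Bochner_Integration.integral_add iA integrable_const)
      also have "(LINT \<omega>|P. indicat_real ?D \<omega>) = measure P ?D" using D by simp
      also have "(LINT \<omega>|P. ?r) = ?r" by (simp add: prob_space)
      finally show ?thesis .
    qed
    finally show ?thesis using bound[OF T] by linarith
  qed
  \<comment> \<open>First \<open>T\<close> tends to infinity for fixed \<open>\<epsilon>\<close>,
    which removes the exceptional event; only then does \<open>\<epsilon>\<close> tend to 0.\<close>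
  have e: "?E \<le> real (card J) * (2 * c * \<epsilon>) powr b + K" if "0 < \<epsilon>" for \<epsilon>
  proof (rule tendsto_lowerbound[where F = at_top])
    have "((\<lambda>T. measure P {\<omega> \<in> space P. \<exists>j\<in>J. \<epsilon> \<le> \<bar>A T j \<omega> - B j \<omega>\<bar>} + real (card J) * (2 * c * \<epsilon>) powr b + K)
      \<longlongrightarrow> 0 + real (card J) * (2 * c * \<epsilon>) powr b + K) at_top"
      by (intro tendsto_add tendsto_const lim that)
    then show "((\<lambda>T. measure P {\<omega> \<in> space P. \<exists>j\<in>J. \<epsilon> \<le> \<bar>A T j \<omega> - B j \<omega>\<bar>} + real (card J) * (2 * c * \<epsilon>) powr b + K)
      \<longlongrightarrow> real (card J) * (2 * c * \<epsilon>) powr b + K) at_top" by simp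
    show "\<forall>\<^sub>F T in at_top. ?E \<le> measure P {\<omega> \<in> space P. \<exists>j\<in>J. \<epsilon> \<le> \<bar>A T j \<omega> - B j \<omega>\<bar>} + real (card J) * (2 * c * \<epsilon>) powr b + K"
      using eventually_ge_at_top[of Tmin] by (rule eventually_mono) (rule main[OF that])
  qed simp
  show ?thesis
  proof (rule tendsto_lowerbound)
    have "((\<lambda>i. real (card J) * (2 * c * (1 / real (Suc i))) powr b + K) \<longlongrightarrow> real (card J) * (2 * c * 0) powr b + K) sequentially"
      by (intro tendsto_intros powr_tendsto_nonneg LIMSEQ_Suc[OF lim_1_over_n]) (use b c in auto)
    then show "((\<lambda>i. real (card J) * (2 * c * (1 / real (Suc i))) powr b + K) \<longlongrightarrow> K) sequentially" by simp
    show "\<forall>\<^sub>F i in sequentially. ?E \<le> real (card J) * (2 * c * (1 / real (Suc i))) powr b + K"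
      by (intro always_eventually allI e) simp
  qed simp
qed

lemma hcube_integrable:
  fixes h :: "real ^ 'd::finite \<Rightarrow> real"
  assumes h: "continuous_on UNIV h"
  shows "integrable lborel (\<lambda>x. indicator (hcube n j) x * h x)"
proof -
  let ?K = "cbox (grid_point n j 0) (grid_point n j 1)"
  have "integrable lborel (\<lambda>x. indicator ?K x *\<^sub>R h x)"
    by (rule borel_integrable_compact[OF compact_cbox continuous_on_subset[OF h]]) simp
  then have "integrable lborel (\<lambda>x. indicator (hcube n j) x *\<^sub>R (indicator ?K x *\<^sub>R h x))"
    by (rule integrable_mult_indicator[rotated]) simp
  moreover have "indicat_real (hcube n j) x *\<^sub>R (indicator ?K x *\<^sub>R h x) = indicator (hcube n j) x * h x" for x
    using hcube_subset_cbox[of n j] by (auto simp: indicator_def)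
  ultimately show ?thesis by (simp only:)
qed

lemma critical_approx_integral:
  fixes X :: "real \<Rightarrow> real ^ 'd::finite \<Rightarrow> 'w \<Rightarrow> real"
  assumes X: "martingale_decomposition P \<rho> X" and T: "0 \<le> T" and w: "\<omega> \<in> space P" and n: "0 < n"
  shows "(LINT x|critical_approx X T \<omega>. cube_test n j m x) =
      (LINT x|lborel. indicator (hcube n j) x * (cube_test n j m x * crit_density X T \<omega> x))" (is "?l = ?r")
    and "(LINT x|critical_approx X T \<omega>. cube_test n j m x) \<le> cube_mass X n T j \<omega>"
proof -
  have c: "continuous_on UNIV (crit_density X T \<omega>)" by (rule crit_density_continuous[OF X T w])
  have ct: "cube_test n j m \<in> borel_measurable lborel"
    using borel_measurable_continuous_onI[OF cube_test_continuous] by simp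
  have cd: "crit_density X T \<omega> \<in> borel_measurable lborel"
    using borel_measurable_continuous_onI[OF c] by simp
  have "critical_approx X T \<omega> = density lborel (\<lambda>x. ennreal (crit_density X T \<omega> x))"
    by (simp only: critical_approx_def crit_density_def)
  then have "?l = (LINT x|lborel. crit_density X T \<omega> x *\<^sub>R cube_test n j m x)"
    using integral_density[OF ct cd AE_I2[OF crit_density_nonneg[OF T]]] by (simp only:)
  moreover have "crit_density X T \<omega> x *\<^sub>R cube_test n j m x = indicator (hcube n j) x * (cube_test n j m x * crit_density X T \<omega> x)" for x
  proof (cases "x \<in> grid_cube n j")
    case True
    then show ?thesis using grid_cube_subset_hcube[OF n, of j] by (auto simp: indicator_def)
  next
    case False
    then have "cube_test n j m x = 0" using cube_test_bounds[of n j m x] by simp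
    then show ?thesis by simp
  qed
  ultimately show eq: "?l = ?r" by (simp only:)
  have "?r \<le> cube_mass X n T j \<omega>"
    unfolding cube_mass_def
  proof (rule integral_mono)
    show "integrable lborel (\<lambda>x. indicator (hcube n j) x * (cube_test n j m x * crit_density X T \<omega> x))"
      by (intro hcube_integrable continuous_on_mult c cube_test_continuous)
    show "integrable lborel (\<lambda>x. indicator (hcube n j) x * crit_density X T \<omega> x)"
      by (rule hcube_integrable[OF c])
    fix x
    have "cube_test n j m x \<le> 1" by (simp add: cube_test_def)
    then have "cube_test n j m x * crit_density X T \<omega> x \<le> 1 * crit_density X T \<omega> x"
      by (rule mult_right_mono) (rule crit_density_nonneg[OF T])
    then show "indicator (hcube n j) x * (cube_test n j m x * crit_density X T \<omega> x) \<le> indicator (hcube n j) x * crit_density X T \<omega> x"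
      by (simp add: indicator_def)
  qed
  then show "?l \<le> cube_mass X n T j \<omega>" using eq by simp
qed

lemma random_measure_test_measurable:
  fixes f :: "'a::topological_space \<Rightarrow> real"
  assumes M: "locally_finite_random_measure P M" and f: "continuous_on UNIV f" and f0: "\<And>x. 0 \<le> f x"
  shows "(\<lambda>\<omega>. LINT x|M \<omega>. f x) \<in> borel_measurable P"
proof -
  have fm: "f \<in> borel_measurable borel" using f by (rule borel_measurable_continuous_onI)
  have "(LINT x|M \<omega>. f x) = enn2real (\<integral>\<^sup>+x. ennreal (f x) \<partial>M \<omega>)" if "\<omega> \<in> space P" for \<omega>
  proof (rule integral_eq_nn_integral)
    have "sets (M \<omega>) = sets borel" using M that by (simp add: locally_finite_random_measure_def)
    then show "f \<in> borel_measurable (M \<omega>)" using fm by (simp cong: measurable_cong_sets)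
  qed (simp add: f0)
  moreover have "(\<lambda>\<omega>. enn2real (\<integral>\<^sup>+x. ennreal (f x) \<partial>M \<omega>)) \<in> borel_measurable P"
    using random_measure_nn_integral_measurable[OF M, of "\<lambda>x. ennreal (f x)"] fm by measurable
  ultimately show ?thesis by (simp cong: measurable_cong)
qed

lemma cube_test_integral_tendsto:
  fixes M :: "'w \<Rightarrow> (real ^ 'd::finite) measure"
  assumes M: "locally_finite_random_measure P M" and w: "\<omega> \<in> space P" and n: "0 < n"
  shows "(\<lambda>m. LINT x|M \<omega>. cube_test n j m x) \<longlonglongrightarrow> measure (M \<omega>) (grid_cube n j)"
proof -
  have st: "sets (M \<omega>) = sets borel" and lf: "\<And>K. compact K \<Longrightarrow> emeasure (M \<omega>) K < \<infinity>"
    using M w by (auto simp: locally_finite_random_measure_def)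
  have G: "grid_cube n j \<in> sets (M \<omega>)" using n by (simp add: st grid_cube_eq_box)
  have "emeasure (M \<omega>) (grid_cube n j) \<le> emeasure (M \<omega>) (cbox (grid_point n j 0) (grid_point n j 1))"
    using n box_subset_cbox by (intro emeasure_mono) (auto simp: st grid_cube_eq_box)
  then have fin: "emeasure (M \<omega>) (grid_cube n j) < \<infinity>" using lf[OF compact_cbox] by (rule le_less_trans)
  have "(\<lambda>m. LINT x|M \<omega>. cube_test n j m x) \<longlonglongrightarrow> (LINT x|M \<omega>. indicat_real (grid_cube n j) x)"
  proof (rule integral_dominated_convergence[where w = "indicat_real (grid_cube n j)"])
    show i: "integrable (M \<omega>) (indicat_real (grid_cube n j))" using G fin by simp
    show "indicat_real (grid_cube n j) \<in> borel_measurable (M \<omega>)" using G by simp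
    show "cube_test n j m \<in> borel_measurable (M \<omega>)" for m
      using borel_measurable_continuous_onI[OF cube_test_continuous] st by (simp cong: measurable_cong_sets)
    show "AE x in M \<omega>. (\<lambda>m. cube_test n j m x) \<longlonglongrightarrow> indicat_real (grid_cube n j) x"
      by (intro AE_I2 cube_test_lim n)
    show "AE x in M \<omega>. norm (cube_test n j m x) \<le> indicat_real (grid_cube n j) x" for m
      using cube_test_bounds[of n j m] by (intro AE_I2) simp
  qed
  then show ?thesis using G by simp
qed

text \<open>For a fixed test function the cutoff is removed by convergence in probability; then the
  test functions increase to the indicators of the cubes. The factor \<open>1 / 2\<close> in the
  scale is the loss in \<open>one_minus_exp_limit_in_probability\<close>.\<close>

theorem critical_gmc_cube_bound:
  fixes P :: "'w measure" and \<rho> :: "real ^ 'd::finite \<Rightarrow> real" and X :: "real \<Rightarrow> real ^ 'd \<Rightarrow> 'w \<Rightarrow> real"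
  assumes P: "prob_space P" and s: "seed_covariance \<rho>" and X: "martingale_decomposition P \<rho> X"
    and M: "critical_gmc P X M" and b: "1 < \<beta>"
  obtains C where "0 \<le> C"
    "\<And>n L. 2 \<le> n \<Longrightarrow> 0 \<le> L \<Longrightarrow>
      (LINT \<omega>|P. 1 - exp (- (\<Sum>j\<in>grid_index n. (exp (- L) / 2 * sqrt (ln (real n)) * measure (M \<omega>) (grid_cube n j)) powr \<beta>))) \<le> exp (- L) * (C * (1 + L))"
proof -
  interpret prob_space P by fact
  have lf: "locally_finite_random_measure P M" and conv: "tendsto_in_prob_weak_star P at_top (critical_approx X) M"
    using M by (auto simp: critical_gmc_def)
  obtain C where C: "0 \<le> C"
    "\<And>n T L. 2 \<le> n \<Longrightarrow> 2 * ln (real n) \<le> T \<Longrightarrow> ln (real n) + ln 2 \<le> T \<Longrightarrow> 0 \<le> L \<Longrightarrow>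
      (LINT \<omega>|P. 1 - exp (- (\<Sum>j\<in>grid_index n. ((exp (- L) * sqrt (ln (real n))) * cube_mass X n T j \<omega>) powr \<beta>))) \<le> exp (- L) * (C * (1 + L))"
    using cube_mass_bound[OF P s X b] by metis
  have "(LINT \<omega>|P. 1 - exp (- (\<Sum>j\<in>grid_index n. (exp (- L) / 2 * sqrt (ln (real n)) * measure (M \<omega>) (grid_cube n j)) powr \<beta>))) \<le> exp (- L) * (C * (1 + L))"
    if n: "2 \<le> n" and L: "0 \<le> L" for n L
  proof -
    let ?c = "exp (- L) / 2 * sqrt (ln (real n))"
    define T0 where "T0 = max (2 * ln (real n)) (ln (real n) + ln 2)"
    have n0: "0 < n" "0 \<le> ln (real n)" using n by auto
    have T0: "0 \<le> T" "2 * ln (real n) \<le> T" "ln (real n) + ln 2 \<le> T" if "T0 \<le> T" for T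
      using that n0(2) unfolding T0_def by linarith+
    \<comment> \<open>All cubes share the same index \<open>m\<close>, so the test functions form
      one finite family, as convergence in the weak* topology requires.\<close>
    have test: "(LINT \<omega>|P. 1 - exp (- (\<Sum>j\<in>grid_index n. (?c * (LINT x|M \<omega>. cube_test n j m x)) powr \<beta>))) \<le> exp (- L) * (C * (1 + L))" for m
    proof (rule one_minus_exp_limit_in_probability[OF P finite_grid_index b, where Tmin = T0 and A = "\<lambda>T j \<omega>. LINT x|critical_approx X T \<omega>. cube_test n j m x"])
      show "0 \<le> ?c" using n0 by simp
      show Am: "(\<lambda>\<omega>. LINT x|critical_approx X T \<omega>. cube_test n j m x) \<in> borel_measurable P" if "T0 \<le> T" for T j
        using crit_integral_measurable[OF P X T0(1)[OF that] n0(1) cube_test_continuous, of j n j m]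
        by (simp only: critical_approx_integral(1)[OF X T0(1)[OF that] _ n0(1)] cong: measurable_cong)
      show "(\<lambda>\<omega>. LINT x|M \<omega>. cube_test n j m x) \<in> borel_measurable P" for j
        by (intro random_measure_test_measurable[OF lf] cube_test_continuous cube_test_bounds)
      show "0 \<le> (LINT x|critical_approx X T \<omega>. cube_test n j m x)" for T j \<omega>
        by (intro Bochner_Integration.integral_nonneg cube_test_bounds)
      show "0 \<le> (LINT x|M \<omega>. cube_test n j m x)" for j \<omega>
        by (intro Bochner_Integration.integral_nonneg cube_test_bounds)
      show "((\<lambda>T. measure P {\<omega> \<in> space P. \<exists>j\<in>grid_index n. \<epsilon> \<le> \<bar>(LINT x|critical_approx X T \<omega>. cube_test n j m x) - (LINT x|M \<omega>. cube_test n j m x)\<bar>}) \<longlongrightarrow> 0) at_top" if "0 < \<epsilon>" for \<epsilon>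
      proof -
        have "finite ((\<lambda>j. cube_test n j m) ` grid_index n) \<and> (\<forall>f\<in>(\<lambda>j. cube_test n j m) ` grid_index n. continuous_on UNIV f \<and> compact (supp f)) \<and> 0 < \<epsilon>"
          by (simp add: that cube_test_continuous cube_test_supp[OF n0(1)])
        from conv[unfolded tendsto_in_prob_weak_star_def, rule_format, OF this] show ?thesis by simp
      qed
      show "(LINT \<omega>|P. 1 - exp (- (\<Sum>j\<in>grid_index n. (2 * ?c * (LINT x|critical_approx X T \<omega>. cube_test n j m x)) powr \<beta>))) \<le> exp (- L) * (C * (1 + L))" if T: "T0 \<le> T" for T
      proof -
        have As [measurable]: "(\<lambda>\<omega>. \<Sum>j\<in>grid_index n. (2 * ?c * (LINT x|critical_approx X T \<omega>. cube_test n j m x)) powr \<beta>) \<in> borel_measurable P"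
          using Am[OF T] by (intro borel_measurable_sum; measurable)
        have Bs [measurable]: "(\<lambda>\<omega>. \<Sum>j\<in>grid_index n. ((exp (- L) * sqrt (ln (real n))) * cube_mass X n T j \<omega>) powr \<beta>) \<in> borel_measurable P"
          using cube_mass_measurable[OF P X T0(1)[OF T] n0(1)] by (intro borel_measurable_sum; measurable)
        have "(LINT \<omega>|P. 1 - exp (- (\<Sum>j\<in>grid_index n. (2 * ?c * (LINT x|critical_approx X T \<omega>. cube_test n j m x)) powr \<beta>)))
          \<le> (LINT \<omega>|P. 1 - exp (- (\<Sum>j\<in>grid_index n. ((exp (- L) * sqrt (ln (real n))) * cube_mass X n T j \<omega>) powr \<beta>)))"
        proof (rule integral_mono)
          show "integrable P (\<lambda>\<omega>. 1 - exp (- (\<Sum>j\<in>grid_index n. (2 * ?c * (LINT x|critical_approx X T \<omega>. cube_test n j m x)) powr \<beta>)))"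
            by (rule integrable_const_bound[where B = 1], simp add: sum_nonneg, measurable)
          show "integrable P (\<lambda>\<omega>. 1 - exp (- (\<Sum>j\<in>grid_index n. ((exp (- L) * sqrt (ln (real n))) * cube_mass X n T j \<omega>) powr \<beta>)))"
            by (rule integrable_const_bound[where B = 1], simp add: sum_nonneg, measurable)
          fix \<omega> assume w: "\<omega> \<in> space P"
          have "(2 * ?c * (LINT x|critical_approx X T \<omega>. cube_test n j m x)) powr \<beta> \<le> ((exp (- L) * sqrt (ln (real n))) * cube_mass X n T j \<omega>) powr \<beta>" for j
          proof (rule powr_mono2)
            have A0: "0 \<le> (LINT x|critical_approx X T \<omega>. cube_test n j m x)"
              by (intro Bochner_Integration.integral_nonneg cube_test_bounds)
            have e: "2 * ?c = exp (- L) * sqrt (ln (real n))" by simp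
            show "0 \<le> 2 * ?c * (LINT x|critical_approx X T \<omega>. cube_test n j m x)"
              unfolding e using n0 by (intro mult_nonneg_nonneg A0) auto
            show "2 * ?c * (LINT x|critical_approx X T \<omega>. cube_test n j m x) \<le> (exp (- L) * sqrt (ln (real n))) * cube_mass X n T j \<omega>"
              unfolding e using n0 by (intro mult_left_mono critical_approx_integral(2)[OF X T0(1)[OF T] w n0(1)]) auto
          qed (use b in simp)
          then have "(\<Sum>j\<in>grid_index n. (2 * ?c * (LINT x|critical_approx X T \<omega>. cube_test n j m x)) powr \<beta>) \<le> (\<Sum>j\<in>grid_index n. ((exp (- L) * sqrt (ln (real n))) * cube_mass X n T j \<omega>) powr \<beta>)"
            by (rule sum_mono)
          then show "1 - exp (- (\<Sum>j\<in>grid_index n. (2 * ?c * (LINT x|critical_approx X T \<omega>. cube_test n j m x)) powr \<beta>)) \<le> 1 - exp (- (\<Sum>j\<in>grid_index n. ((exp (- L) * sqrt (ln (real n))) * cube_mass X n T j \<omega>) powr \<beta>))"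
            by simp
        qed
        also have "\<dots> \<le> exp (- L) * (C * (1 + L))" by (rule C(2)[OF n T0(2,3)[OF T] L])
        finally show ?thesis .
      qed
    qed
    have "(\<lambda>m. LINT \<omega>|P. 1 - exp (- (\<Sum>j\<in>grid_index n. (?c * (LINT x|M \<omega>. cube_test n j m x)) powr \<beta>))) \<longlonglongrightarrow>
      (LINT \<omega>|P. 1 - exp (- (\<Sum>j\<in>grid_index n. (?c * measure (M \<omega>) (grid_cube n j)) powr \<beta>)))"
    proof (rule expectation_one_minus_exp_tendsto[OF P finite_grid_index])
      show "0 < \<beta>" "0 \<le> ?c" using b n0 by auto
      show "0 \<le> (LINT x|M \<omega>. cube_test n j m x)" for m j \<omega>
        by (intro Bochner_Integration.integral_nonneg cube_test_bounds)
      show "(\<lambda>\<omega>. LINT x|M \<omega>. cube_test n j m x) \<in> borel_measurable P" for m j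
        by (intro random_measure_test_measurable[OF lf] cube_test_continuous cube_test_bounds)
      show "(\<lambda>m. LINT x|M \<omega>. cube_test n j m x) \<longlonglongrightarrow> measure (M \<omega>) (grid_cube n j)" if "\<omega> \<in> space P" for j \<omega>
        by (rule cube_test_integral_tendsto[OF lf that n0(1)])
    qed
    then show ?thesis by (rule LIMSEQ_le_const2) (use test in blast)
  qed
  then show thesis using that C(1) by blast
qed

theorem theorem1p1:
  fixes P :: "'w measure"
    and \<rho> :: "real ^ 'd \<Rightarrow> real"
    and X :: "real \<Rightarrow> real ^ 'd \<Rightarrow> 'w \<Rightarrow> real"
    and M :: "'w \<Rightarrow> (real ^ 'd) measure"
    and \<beta> r :: real
  assumes "prob_space P"
    and "seed_covariance \<rho>"
    and "martingale_decomposition P \<rho> X"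
    and "critical_gmc P X M"
    and "\<beta> > 1"
    and "r \<in> {0<..<1 / \<beta>}"
  shows "\<exists>C>0. \<forall>q\<in>{0..1/2}.
           (SUP n\<in>{1..}. prob_space.expectation P (\<lambda>\<omega>. 1 - exp (- q * V_tilde \<beta> (M \<omega>) n)))
           \<le> C * q powr r"
proof -
  interpret prob_space P by fact
  obtain C where C: "0 \<le> C"
    "\<And>n L. 2 \<le> n \<Longrightarrow> 0 \<le> L \<Longrightarrow>
      (LINT \<omega>|P. 1 - exp (- (\<Sum>j\<in>grid_index n. (exp (- L) / 2 * sqrt (ln (real n)) * measure (M \<omega>) (grid_cube n j)) powr \<beta>))) \<le> exp (- L) * (C * (1 + L))"
    using critical_gmc_cube_bound[OF assms(1-5)] by metis
  \<comment> \<open>The exponent for which \<open>(q powr (1 / \<beta>)) powr s = q powr r\<close>;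
    the assumption \<open>r < 1 / \<beta>\<close> is \<open>s < 1\<close>.\<close>
  define s where "s = r * \<beta>"
  have s: "0 < s" "s < 1" using assms(5,6) by (auto simp: s_def less_divide_eq)
  \<comment> \<open>The first summand serves small \<open>q\<close>. The summand 2 serves the
    remaining \<open>q\<close>, where the expectation is bounded by 1, and makes the constant
    positive when \<open>C = 0\<close>.\<close>
  define K where "K = 2 * (C * (1 + 1 / (1 - s))) + 2"
  have K: "2 \<le> K" "2 * (C * (1 + 1 / (1 - s))) \<le> K" using C(1) s by (simp_all add: K_def)
  have two: "(2 * q powr (1 / \<beta>)) powr s \<le> 2 * q powr r" if q: "0 < q" for q :: real
  proof -
    have "(2 * q powr (1 / \<beta>)) powr s = 2 powr s * q powr r"
      using assms(5) by (simp add: powr_mult powr_powr s_def)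
    also have "\<dots> \<le> 2 powr 1 * q powr r" using s by (intro mult_right_mono powr_mono) auto
    finally show ?thesis by simp
  qed
  have main: "(LINT \<omega>|P. 1 - exp (- q * V_tilde \<beta> (M \<omega>) n)) \<le> K * q powr r" if q: "0 < q" and n: "2 \<le> n" for q n
  \<comment> \<open>Only in the first case is the \<open>L\<close> with
    \<open>exp (- L) = 2 * q powr (1 / \<beta>)\<close> non-negative; otherwise \<open>q\<close> is
    bounded away from 0 and the trivial bound suffices.\<close>
  proof (cases "2 * q powr (1 / \<beta>) \<le> 1")
    case True
    define L where "L = - ln (2 * q powr (1 / \<beta>))"
    have p: "0 < 2 * q powr (1 / \<beta>)" using q by simp
    have L: "0 \<le> L" "exp (- L) = 2 * q powr (1 / \<beta>)" using True p by (simp_all add: L_def)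
    have n0: "0 \<le> ln (real n)" using n by simp
    have "- q * V_tilde \<beta> (M \<omega>) n = - (\<Sum>j\<in>grid_index n. (exp (- L) / 2 * sqrt (ln (real n)) * measure (M \<omega>) (grid_cube n j)) powr \<beta>)" for \<omega>
    proof -
      have "(exp (- L) / 2 * sqrt (ln (real n)) * y) powr \<beta> = q * (ln (real n) powr (\<beta> / 2) * y powr \<beta>)" if "0 \<le> y" for y
      proof -
        have "(exp (- L) / 2 * sqrt (ln (real n)) * y) powr \<beta> = (q powr (1 / \<beta>)) powr \<beta> * (ln (real n) powr (1 / 2)) powr \<beta> * y powr \<beta>"
          using that n0 by (simp add: L(2) powr_mult powr_half_sqrt)
        also have "\<dots> = q * ln (real n) powr (\<beta> / 2) * y powr \<beta>"
          using q assms(5) by (simp add: powr_powr)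
        finally show ?thesis by simp
      qed
      then have "(\<Sum>j\<in>grid_index n. (exp (- L) / 2 * sqrt (ln (real n)) * measure (M \<omega>) (grid_cube n j)) powr \<beta>) = q * V_tilde \<beta> (M \<omega>) n"
        unfolding V_tilde_def sum_distrib_left by (intro sum.cong refl) (simp only: measure_nonneg)
      then show ?thesis by simp
    qed
    then have "(LINT \<omega>|P. 1 - exp (- q * V_tilde \<beta> (M \<omega>) n)) \<le> exp (- L) * (C * (1 + L))"
      using C(2)[OF n L(1)] by simp
    also have "\<dots> \<le> C * (1 + 1 / (1 - s)) * (2 * q powr (1 / \<beta>)) powr s"
    proof -
      \<comment> \<open>The logarithmic factor is absorbed by giving up the power
        \<open>1 - s\<close> of \<open>exp (- L)\<close>.\<close>
      have "(1 - s) * L \<le> exp ((1 - s) * L)" using exp_ge_add_one_self[of "(1 - s) * L"] by linarith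
      then have "L \<le> 1 / (1 - s) * exp ((1 - s) * L)" using s by (simp add: field_simps)
      moreover have "1 \<le> exp ((1 - s) * L)" using s L by simp
      ultimately have "1 + L \<le> (1 + 1 / (1 - s)) * exp ((1 - s) * L)" by (simp only: distrib_right mult_1_left)
      then have "exp (- L) * (C * (1 + L)) \<le> exp (- L) * (C * ((1 + 1 / (1 - s)) * exp ((1 - s) * L)))"
        using C(1) by (intro mult_left_mono) auto
      also have "\<dots> = C * (1 + 1 / (1 - s)) * (exp (- L) * exp ((1 - s) * L))" by (simp only: mult.assoc mult.left_commute)
      also have "exp (- L) * exp ((1 - s) * L) = exp (- (s * L))" by (simp add: exp_add[symmetric] algebra_simps)
      also have "exp (- (s * L)) = (2 * q powr (1 / \<beta>)) powr s" using p by (simp add: powr_def L_def)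
      finally show ?thesis .
    qed
    also have "\<dots> \<le> C * (1 + 1 / (1 - s)) * (2 * q powr r)"
      using C(1) s by (intro mult_left_mono two q) auto
    also have "\<dots> = 2 * (C * (1 + 1 / (1 - s))) * q powr r" by simp
    also have "\<dots> \<le> K * q powr r" using K by (intro mult_right_mono) auto
    finally show ?thesis .
  next
    case False
    have V0: "0 \<le> V_tilde \<beta> (M \<omega>) n" for \<omega> by (simp add: V_tilde_def sum_nonneg)
    have "(LINT \<omega>|P. 1 - exp (- q * V_tilde \<beta> (M \<omega>) n)) \<le> (LINT \<omega>|P. (1::real))"
      by (rule Bochner_Integration.integral_mono') auto
    also have "\<dots> = 1" by (simp add: prob_space)
    also have "\<dots> \<le> (2 * q powr (1 / \<beta>)) powr s" using False s by (intro ge_one_powr_ge_zero) auto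
    also have "\<dots> \<le> 2 * q powr r" by (rule two[OF q])
    also have "\<dots> \<le> K * q powr r" using K by (intro mult_right_mono) auto
    finally show ?thesis .
  qed
  have "(SUP n\<in>{1..}. (LINT \<omega>|P. 1 - exp (- q * V_tilde \<beta> (M \<omega>) n))) \<le> K * q powr r" if q: "q \<in> {0..1/2}" for q
  proof (rule cSUP_least)
    fix n :: nat assume n: "n \<in> {1..}"
    show "(LINT \<omega>|P. 1 - exp (- q * V_tilde \<beta> (M \<omega>) n)) \<le> K * q powr r"
    \<comment> \<open>For \<open>n = 1\<close> the normalisation is
      \<open>0 powr (\<beta> / 2) = 0\<close>, so this term of the supremum vanishes, as do all
      terms for \<open>q = 0\<close>.\<close>
    proof (cases "0 < q \<and> 2 \<le> n")
      case True
      then show ?thesis using main by blast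
    next
      case False
      then have "q = 0 \<or> n = 1" using q n by auto
      then have z: "- q * V_tilde \<beta> (M \<omega>) n = 0" for \<omega> by (auto simp: V_tilde_def)
      have "0 \<le> K * q powr r" using K by (intro mult_nonneg_nonneg) auto
      then show ?thesis by (simp only: z exp_zero diff_self Bochner_Integration.integral_zero)
    qed
  qed simp
  then show ?thesis using K by (intro exI[of _ K]) auto
qed

end
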